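(* Let $\Gamma$ be a tropical curve and let $D$ be a divisor on $\Gamma$ with $r(D)\ge 0$, and put $d=\deg(D)$. Then the map $\mathrm{Red}:\Gamma\to |D|\hookrightarrow \Gamma^{(d)}$, which sends a point $P\in\Gamma$ to the point of $\Gamma^{(d)}$ given by the unique $P$-reduced divisor $D_P$ linearly equivalent to $D$, is integral affine, and hence continuous.
   Context: A tropical curve $\Gamma$ is a compact connected metric graph: the metric space obtained from a finite connected graph $G=(V,E)$ (a model of $\Gamma$; loops and multiple edges allowed) by replacing each edge $e$ by a closed interval of positive length $\ell(e)$. The degree $\deg(v)$ of a point $v$ is the number of connected components of $U\setminus\{v\}$ for a sufficiently small connected neighbourhood $U$ of $v$. A divisor is a finite formal sum $D=\sum_v D(v)(v)$ with $D(v)\in\mathbb Z$; $\deg(D)=\sum_v D(v)$; $D$ is effective ($D\ge 0$) if all $D(v)\ge 0$. A rational function is a continuous piecewise linear $f:\Gamma\to\mathbb R$ with integer slopes and finitely many linear pieces on each edge; $\mathrm{ord}_v(f)$ is the sum of the outgoing slopes of $f$ at $v$, and $\mathrm{div}(f)=\sum_v\mathrm{ord}_v(f)(v)$. Divisors $D,D'$ are linearly equivalent ($D\sim D'$) if $D-D'=\mathrm{div}(f)$ for some rational $f$. The linear system is $|D|=\{E\ge 0: E\sim D\}$. The rank is $r(D)=\min\{\deg(E): E\ge 0,\ |D-E|=\emptyset\}-1$. For a closed connected $X\subseteq\Gamma$ and $v\in\partial X$, $\deg^{\mathrm{out}}_X(v)$ is the maximum number of internally disjoint segments in $\Gamma\setminus(X\setminus\{v\})$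 having an endpoint at $v$. For a point $P$, a divisor $D'$ is $P$-reduced if $D'(v)\ge0$ for all $v\ne P$ and every closed connected $X\subseteq \Gamma$ with $P\notin X$ has a boundary point $v$ with $D'(v)<\deg^{\mathrm{out}}_X(v)$. Every divisor $D$ is linearly equivalent to a unique $P$-reduced divisor, denoted $D_P$; if $r(D)\ge 0$ then $D_P\in |D|$. Integral affine structure on symmetric products: $\Gamma^{(N)}=\Gamma^N/\mathfrak S_N$ is the set of unordered $N$-tuples of points; $|D|$ embeds in $\Gamma^{(\deg D)}$ by sending $E$ to the multiset of points where each $v$ appears $E(v)$ times. Fix a model without loops or multiple edges, enumerate the vertices, orient each edge $e$ and identify it with $[0,\ell(e)]$. For edges $e_1<\dots<e_k$ (lexicographic order) with multiplicities $s_1,\dots,s_k$, $\sum s_i=N$, the subset $e_1^{(s_1)}\times\dots\times e_k^{(s_k)}\subseteq\Gamma^{(N)}$ is identified with the rational polytope $\prod_i\{0\le x_1\le\dots\le x_{s_i}\le\ell(e_i)\}\subseteq\mathbb R^N$; the faces of these polytopes give the cells $\tau$ of a rational polyhedral complex structure on $\Gamma^{(N)}$, each cell $\tau$ carrying the lattice $N_\tau$ of integer points of the linear space parallel to it (the resulting structure is independent of the model up to subdivision). A map $\phi:\Gamma\to\Gamma^{(N)}$ is integral affine if for every point $v$ of $\Gamma$ and every sufficiently small segment $I$ on an edge adjacent to $v$ whose image lies in a single cell $\tau$, the image of $I$ in the polytope of $\tau$ is a straight segment with slope (direction) in $N_{\tau}\otimes\mathbb Q$. *)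

theory Defs
  imports "HOL-Analysis.Analysis" "HOL-Analysis.Finite_Function_Topology" "HOL-Library.Multiset"
begin

text \<open>A model consists of vertices, which are points of the curve, and of edges \<open>e\<close> of length
  \<open>elen e\<close> with a parametrization \<open>epar e\<close> on the interval from \<open>0\<close> to \<open>elen e\<close>, which
  also orients \<open>e\<close>. Values of \<open>epar e\<close> outside this interval are irrelevant.\<close>

record ('p, 'e) graph_model =
  verts :: "'p set"
  edges :: "'e set"
  elen :: "'e \<Rightarrow> real"
  epar :: "'e \<Rightarrow> real \<Rightarrow> 'p"

text \<open>Lengths of chains of points in which consecutive points are joined by a
  subinterval of one edge.\<close>

inductive chain_length :: "('p, 'e) graph_model \<Rightarrow> 'p \<Rightarrow> real \<Rightarrow> 'p \<Rightarrow> bool"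
  for G :: "('p, 'e) graph_model" where
  refl: "chain_length G x 0 x"
| step: "\<lbrakk>e \<in> edges G; s \<in> {0..elen G e}; t \<in> {0..elen G e}; chain_length G (epar G e t) c y\<rbrakk>
    \<Longrightarrow> chain_length G (epar G e s) (\<bar>s - t\<bar> + c) y"

text \<open>\<open>\<Gamma>\<close> is the metric space obtained from a finite connected graph (loops and multiple edges
  allowed) by replacing edges by intervals. The last condition says that the
  graph is connected and that the distance on \<open>\<Gamma>\<close> is the path metric.\<close>

definition model_of :: "'p::metric_space set \<Rightarrow> ('p, 'e) graph_model \<Rightarrow> bool" where
  "model_of \<Gamma> G \<longleftrightarrow>
     finite (verts G) \<and> verts G \<noteq> {} \<and> finite (edges G) \<and>
     (\<forall>e\<in>edges G. 0 < elen G e \<and> epar G e 0 \<in> verts G \<and> epar G e (elen G e) \<in> verts G \<and>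
        inj_on (epar G e) {0<..<elen G e} \<and> epar G e ` {0<..<elen G e} \<inter> verts G = {}) \<and>
     (\<forall>e\<in>edges G. \<forall>e'\<in>edges G. e \<noteq> e' \<longrightarrow>
        epar G e ` {0<..<elen G e} \<inter> epar G e' ` {0<..<elen G e'} = {}) \<and>
     \<Gamma> = verts G \<union> (\<Union>e\<in>edges G. epar G e ` {0..elen G e}) \<and>
     (\<forall>x\<in>\<Gamma>. \<forall>y\<in>\<Gamma>. {c. chain_length G x c y} \<noteq> {} \<and> dist x y = Inf {c. chain_length G x c y})"

definition simple_model :: "('p, 'e) graph_model \<Rightarrow> bool" where
  "simple_model G \<longleftrightarrow>
     (\<forall>e\<in>edges G. epar G e 0 \<noteq> epar G e (elen G e)) \<and>
     (\<forall>e\<in>edges G. \<forall>e'\<in>edges G. e \<noteq> e' \<longrightarrow>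
        {epar G e 0, epar G e (elen G e)} \<noteq> {epar G e' 0, epar G e' (elen G e')})"

text \<open>The outgoing directions at \<open>v\<close>: triples \<open>(e, t, \<sigma>)\<close> such that \<open>v\<close> is the point with
  parameter \<open>t\<close> on \<open>e\<close> and one can leave it along \<open>e\<close> with increasing (\<open>\<sigma> = 1\<close>) or
  decreasing (\<open>\<sigma> = - 1\<close>) parameter. A loop at \<open>v\<close> yields two directions.\<close>

definition directions :: "('p, 'e) graph_model \<Rightarrow> 'p \<Rightarrow> ('e \<times> real \<times> real) set" where
  "directions G v = {(e, t, \<sigma>). e \<in> edges G \<and> t \<in> {0..elen G e} \<and> epar G e t = v \<and>
     (\<sigma> = 1 \<and> t < elen G e \<or> \<sigma> = - 1 \<and> 0 < t)}"


definition divisor :: "'p set \<Rightarrow> ('p \<Rightarrow>\<^sub>0 int) \<Rightarrow> bool" where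
  "divisor \<Gamma> D \<longleftrightarrow> Poly_Mapping.keys D \<subseteq> \<Gamma>"

definition effective :: "('p \<Rightarrow>\<^sub>0 int) \<Rightarrow> bool" where
  "effective D \<longleftrightarrow> (\<forall>v. 0 \<le> Poly_Mapping.lookup D v)"

definition div_degree :: "('p \<Rightarrow>\<^sub>0 int) \<Rightarrow> int" where
  "div_degree D = (\<Sum>v\<in>Poly_Mapping.keys D. Poly_Mapping.lookup D v)"

definition rational_function ::
  "'p::metric_space set \<Rightarrow> ('p, 'e) graph_model \<Rightarrow> ('p \<Rightarrow> real) \<Rightarrow> bool" where
  "rational_function \<Gamma> G f \<longleftrightarrow> continuous_on \<Gamma> f \<and>
     (\<forall>e\<in>edges G. \<exists>S. finite S \<and>
        (\<forall>a b. 0 \<le> a \<and> a < b \<and> b \<le> elen G e \<and> {a<..<b} \<inter> S = {} \<longrightarrow>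
           (\<exists>k::int. \<forall>t\<in>{a..b}. f (epar G e t) = f (epar G e a) + of_int k * (t - a))))"

definition outgoing_slope ::
  "('p, 'e) graph_model \<Rightarrow> ('p \<Rightarrow> real) \<Rightarrow> 'e \<times> real \<times> real \<Rightarrow> int" where
  "outgoing_slope G f = (\<lambda>(e, t, \<sigma>).
     THE k::int. \<forall>\<^sub>F h in at_right 0. f (epar G e (t + \<sigma> * h)) = f (epar G e t) + of_int k * h)"

definition ord_at :: "('p, 'e) graph_model \<Rightarrow> ('p \<Rightarrow> real) \<Rightarrow> 'p \<Rightarrow> int" where
  "ord_at G f v = (\<Sum>\<delta>\<in>directions G v. outgoing_slope G f \<delta>)"

definition lin_equiv ::
  "'p::metric_space set \<Rightarrow> ('p, 'e) graph_model \<Rightarrow> ('p \<Rightarrow>\<^sub>0 int) \<Rightarrow> ('p \<Rightarrow>\<^sub>0 int) \<Rightarrow> bool" where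
  "lin_equiv \<Gamma> G D D' \<longleftrightarrow>
     (\<exists>f. rational_function \<Gamma> G f \<and> (\<forall>v\<in>\<Gamma>. Poly_Mapping.lookup (D - D') v = ord_at G f v))"

definition linear_system ::
  "'p::metric_space set \<Rightarrow> ('p, 'e) graph_model \<Rightarrow> ('p \<Rightarrow>\<^sub>0 int) \<Rightarrow> ('p \<Rightarrow>\<^sub>0 int) set" where
  "linear_system \<Gamma> G D = {E. divisor \<Gamma> E \<and> effective E \<and> lin_equiv \<Gamma> G E D}"

definition div_rank ::
  "'p::metric_space set \<Rightarrow> ('p, 'e) graph_model \<Rightarrow> ('p \<Rightarrow>\<^sub>0 int) \<Rightarrow> int" where
  "div_rank \<Gamma> G D =
     int (LEAST n. \<exists>E. divisor \<Gamma> E \<and> effective E \<and> div_degree E = int n \<and>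
       linear_system \<Gamma> G (D - E) = {}) - 1"


definition deg_out :: "'p::metric_space set \<Rightarrow> 'p set \<Rightarrow> 'p \<Rightarrow> nat" where
  "deg_out \<Gamma> X v = Max {card A | A. finite A \<and>
     (\<forall>g\<in>A. arc g \<and> pathstart g = v \<and> path_image g \<subseteq> \<Gamma> - (X - {v})) \<and>
     (\<forall>g\<in>A. \<forall>h\<in>A. g \<noteq> h \<longrightarrow> g ` {0<..<1} \<inter> path_image h = {})}"

text \<open>The empty set, which has no boundary point, counts as \<open>connected\<close> in the library and has
  to be excluded.\<close>

definition reduced :: "'p::metric_space set \<Rightarrow> 'p \<Rightarrow> ('p \<Rightarrow>\<^sub>0 int) \<Rightarrow> bool" where
  "reduced \<Gamma> P D \<longleftrightarrow>
     (\<forall>v\<in>\<Gamma> - {P}. 0 \<le> Poly_Mapping.lookup D v) \<and>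
     (\<forall>X. closedin (top_of_set \<Gamma>) X \<and> connected X \<and> X \<noteq> {} \<and> P \<notin> X \<longrightarrow>
        (\<exists>v \<in> top_of_set \<Gamma> frontier_of X. Poly_Mapping.lookup D v < int (deg_out \<Gamma> X v)))"

definition reduced_divisor ::
  "'p::metric_space set \<Rightarrow> ('p, 'e) graph_model \<Rightarrow> ('p \<Rightarrow>\<^sub>0 int) \<Rightarrow> 'p \<Rightarrow> ('p \<Rightarrow>\<^sub>0 int)" where
  "reduced_divisor \<Gamma> G D P = (THE D'. divisor \<Gamma> D' \<and> lin_equiv \<Gamma> G D' D \<and> reduced \<Gamma> P D')"


definition sym_product :: "'p set \<Rightarrow> nat \<Rightarrow> 'p multiset set" where
  "sym_product \<Gamma> N = {m. set_mset m \<subseteq> \<Gamma> \<and> size m = N}"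

definition unordered_tuple :: "nat \<Rightarrow> (nat \<Rightarrow> 'p) \<Rightarrow> 'p multiset" where
  "unordered_tuple N x = image_mset x (mset_set {..<N})"

definition sym_product_topology :: "'p::metric_space set \<Rightarrow> nat \<Rightarrow> 'p multiset topology" where
  "sym_product_topology \<Gamma> N = topology (\<lambda>U. U \<subseteq> sym_product \<Gamma> N \<and>
     openin (product_topology (\<lambda>_. top_of_set \<Gamma>) {..<N})
       {x \<in> {..<N} \<rightarrow>\<^sub>E \<Gamma>. unordered_tuple N x \<in> U})"

lemma openin_sym_product_topology:
  "openin (sym_product_topology \<Gamma> N) U \<longleftrightarrow> U \<subseteq> sym_product \<Gamma> N \<and>
     openin (product_topology (\<lambda>_. top_of_set \<Gamma>) {..<N})
       {x \<in> {..<N} \<rightarrow>\<^sub>E \<Gamma>. unordered_tuple N x \<in> U}" (is "_ \<longleftrightarrow> ?Q U")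
proof -
  let ?T = "product_topology (\<lambda>_. top_of_set \<Gamma>) {..<N}"
  let ?pre = "\<lambda>U. {x \<in> {..<N} \<rightarrow>\<^sub>E \<Gamma>. unordered_tuple N x \<in> U}"
  have int: "?Q (S \<inter> T)" if "?Q S" "?Q T" for S T
  proof -
    have "?pre (S \<inter> T) = ?pre S \<inter> ?pre T" by auto
    with that show ?thesis by (metis (lifting) le_infI1 openin_Int)
  qed
  have union: "?Q (\<Union>K)" if "\<forall>S\<in>K. ?Q S" for K
  proof -
    have "?pre (\<Union>K) = \<Union>(?pre ` K)" by auto
    moreover have "openin ?T (\<Union>(?pre ` K))" using that by (intro openin_Union) blast
    ultimately show ?thesis using that by (simp add: Sup_le_iff)
  qed
  have "istopology ?Q"
    unfolding istopology_def using int union by blast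
  then show ?thesis
    unfolding sym_product_topology_def by (simp add: topology_inverse')
qed

definition mset_of_divisor :: "('p \<Rightarrow>\<^sub>0 int) \<Rightarrow> 'p multiset" where
  "mset_of_divisor E =
     (\<Sum>v\<in>Poly_Mapping.keys E. replicate_mset (nat (Poly_Mapping.lookup E v)) v)"

definition Red ::
  "'p::metric_space set \<Rightarrow> ('p, 'e) graph_model \<Rightarrow> ('p \<Rightarrow>\<^sub>0 int) \<Rightarrow> 'p \<Rightarrow> 'p multiset" where
  "Red \<Gamma> G D P = mset_of_divisor (reduced_divisor \<Gamma> G D P)"


text \<open>A function \<open>s\<close> records how often each edge is used. The coordinates of the polytope
  attached to \<open>s\<close> are indexed by the pairs \<open>(e, i)\<close> with \<open>i < s e\<close> instead of an initial segment of
  the natural numbers, so that no enumeration of the edges is needed.\<close>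

definition cell_polytope ::
  "('p, 'e) graph_model \<Rightarrow> ('e \<Rightarrow> nat) \<Rightarrow> ('e \<times> nat \<Rightarrow>\<^sub>0 real) set" where
  "cell_polytope M s =
     {x. Poly_Mapping.keys x \<subseteq> {(e, i). e \<in> edges M \<and> i < s e} \<and>
         (\<forall>e\<in>edges M.
            (\<forall>i<s e. Poly_Mapping.lookup x (e, i) \<in> {0..elen M e}) \<and>
            (\<forall>j<s e. \<forall>i\<le>j. Poly_Mapping.lookup x (e, i) \<le> Poly_Mapping.lookup x (e, j)))}"

definition cell_point ::
  "('p, 'e) graph_model \<Rightarrow> ('e \<Rightarrow> nat) \<Rightarrow> ('e \<times> nat \<Rightarrow>\<^sub>0 real) \<Rightarrow> 'p multiset" where
  "cell_point M s x =
     (\<Sum>e\<in>edges M. image_mset (\<lambda>i. epar M e (Poly_Mapping.lookup x (e, i))) (mset_set {..<s e}))"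

definition cells ::
  "('p, 'e) graph_model \<Rightarrow> nat \<Rightarrow> (('e \<Rightarrow> nat) \<times> ('e \<times> nat \<Rightarrow>\<^sub>0 real) set) set" where
  "cells M N = {(s, F). (\<forall>e. e \<notin> edges M \<longrightarrow> s e = 0) \<and> (\<Sum>e\<in>edges M. s e) = N \<and>
     F face_of cell_polytope M s \<and> F \<noteq> {}}"

definition cell_lattice :: "('e \<times> nat \<Rightarrow>\<^sub>0 real) set \<Rightarrow> ('e \<times> nat \<Rightarrow>\<^sub>0 real) set" where
  "cell_lattice F =
     {z \<in> span {x - y | x y. x \<in> F \<and> y \<in> F}. \<forall>k. Poly_Mapping.lookup z k \<in> \<int>}"

text \<open>The tensor product of the lattice of a cell with the rationals, as a subset of the linear space parallel to the cell.\<close>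

definition rational_slopes :: "('e \<times> nat \<Rightarrow>\<^sub>0 real) set \<Rightarrow> ('e \<times> nat \<Rightarrow>\<^sub>0 real) set" where
  "rational_slopes F = {w. \<exists>n::nat. 0 < n \<and> real n *\<^sub>R w \<in> cell_lattice F}"

text \<open>The path \<open>\<gamma>\<close> on the interval from \<open>0\<close> to \<open>h\<close> is, in the polytope of the cell, a straight
  segment with rational slope. The slope may be \<open>0\<close>, in which case \<open>\<gamma>\<close> is constant. The polytope
  of a cell need not embed into the symmetric product (on a triangle, the multiset of the three
  vertices is the image of two vertices of the polytope of the three edges), hence the
  segment is required to exist as a lift to the polytope.\<close>

definition straight_in_cell ::
  "('p, 'e) graph_model \<Rightarrow> ('e \<Rightarrow> nat) \<Rightarrow> ('e \<times> nat \<Rightarrow>\<^sub>0 real) set \<Rightarrow> real \<Rightarrow> (real \<Rightarrow> 'p multiset) \<Rightarrow> bool"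
  where
  "straight_in_cell M s F h \<gamma> \<longleftrightarrow>
     (\<exists>x. \<exists>w \<in> rational_slopes F. \<forall>r\<in>{0..h}. x + r *\<^sub>R w \<in> F \<and> \<gamma> r = cell_point M s (x + r *\<^sub>R w))"

text \<open>Small segments starting at \<open>v\<close> in a given direction are parametrized by arc length. They are
  mapped into a single cell, and to a straight segment in every cell into which they
  are mapped.\<close>

definition integral_affine ::
  "'p set \<Rightarrow> ('p, 'e) graph_model \<Rightarrow> nat \<Rightarrow> ('p \<Rightarrow> 'p multiset) \<Rightarrow> bool" where
  "integral_affine \<Gamma> M N \<phi> \<longleftrightarrow> \<phi> \<in> \<Gamma> \<rightarrow> sym_product \<Gamma> N \<and>
     (\<forall>v\<in>\<Gamma>. \<forall>(e, t, \<sigma>)\<in>directions M v. \<exists>\<epsilon>>0. t + \<sigma> * \<epsilon> \<in> {0..elen M e} \<and>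
        (let \<gamma> = (\<lambda>r. \<phi> (epar M e (t + \<sigma> * r))) in
          (\<exists>(s, F)\<in>cells M N. \<gamma> ` {0..\<epsilon>} \<subseteq> cell_point M s ` F) \<and>
          (\<forall>h\<in>{0<..\<epsilon>}. \<forall>(s, F)\<in>cells M N. \<gamma> ` {0..h} \<subseteq> cell_point M s ` F \<longrightarrow>
             straight_in_cell M s F h \<gamma>)))"

end

theory Submission
  imports Defs
begin

text \<open>Let \<open>E\<close> be an effective divisor equivalent to \<open>D\<close>. The functions \<open>f\<close> with \<open>E + div f\<close> effective have
  slopes bounded by \<open>d\<close> and are stable under maxima, so among those vanishing at \<open>w\<close> there is a largest
  one, \<open>F\<close>; then \<open>E + div F\<close> is the \<open>w\<close>-reduced divisor, since firing a set that violates reducedness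
  would enlarge \<open>F\<close>.

  To study the reduced divisor near \<open>v\<close>, subdivide so that \<open>v\<close> is a vertex and \<open>E = D\<^sub>v\<close> is supported on
  vertices, and let \<open>w\<close> lie at distance \<open>r\<close> from \<open>v\<close> on a given edge. Then \<open>0 \<le> F \<le> d r\<close>, so \<open>F\<close> bends only
  near the vertices. On each half edge \<open>F\<close> is a maximum of lines of slopes \<open>0, - 1, \<dots>, - d\<close>. Rounding
  their heights up to multiples of \<open>r\<close> gives another admissible function vanishing at \<open>w\<close>, so by
  maximality the heights are multiples of \<open>r\<close> to begin with. They form the greatest element of a finite
  set of integer vectors that does not depend on \<open>r\<close>. Hence every chip of the reduced divisor sits at
  \<open>a + q r\<close> on some edge, with \<open>q\<close> rational and independent of \<open>r\<close>.\<close>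

section \<open>The metric near a point\<close>

text \<open>The bound \<open>F \<le> d r\<close> comes from reducedness of \<open>E\<close> at
  \<open>v\<close>: every admissible function is largest at \<open>v\<close>, and \<open>F\<close>
  reaches 0 at distance \<open>r\<close> from \<open>v\<close> with slopes at most \<open>d\<close>.
  Rounding is harmless because all conditions on the heights are comparisons, which monotone
  rounding respects: at a vertex one height on every half edge equals the common vertex value and no
  other exceeds it, and \<open>F w = 0\<close> says that the height of slope \<open>- m\<close> is
  at most \<open>m r\<close>, with equality for some \<open>m\<close>. In units of \<open>r\<close>
  these conditions speak of integers only, so the scale disappears. The remaining work is forced by
  the definitions. Outgoing degrees count arcs, so the metric near a point has to be computed before
  reducedness can be read off slopes. Vertices have to be added at the support of \<open>E\<close>,
  so directions and slopes are transported between models, again by means of the metric. The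
  polytope of a cell need not embed into the symmetric product, so straightness is shown starting
  from an arbitrary lift at a single positive time, by following each chip from there.\<close>

definition along :: "('p, 'e) graph_model \<Rightarrow> 'e \<times> real \<times> real \<Rightarrow> real \<Rightarrow> 'p" where
  "along G = (\<lambda>(e, t, \<sigma>) h. epar G e (t + \<sigma> * h))"

lemma along_simp [simp]: "along G (e, t, \<sigma>) h = epar G e (t + \<sigma> * h)"
  by (simp add: along_def)

lemma along_0: "\<delta> \<in> directions G v \<Longrightarrow> along G \<delta> 0 = v"
  by (auto simp: along_def directions_def)

lemma chain_length_nonneg: "chain_length G x c y \<Longrightarrow> 0 \<le> c"
  by (induction rule: chain_length.induct) auto

lemma chain_length_Lipschitz:
  assumes "chain_length G x c y"
    and "\<And>e s t. e \<in> edges G \<Longrightarrow> s \<in> {0..elen G e} \<Longrightarrow> t \<in> {0..elen G e} \<Longrightarrow>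
      \<bar>f (epar G e s) - f (epar G e t)\<bar> \<le> C * \<bar>s - t\<bar>"
  shows "\<bar>f x - f y\<bar> \<le> C * c"
  using assms(1)
proof (induction rule: chain_length.induct)
  case (step e s t c y)
  then show ?case using assms(2)[of e s t] by (simp add: distrib_left)
qed auto

locale tropical_curve =
  fixes \<Gamma> :: "'p::metric_space set" and G :: "('p, 'e) graph_model"
  assumes model: "model_of \<Gamma> G"
begin

lemma finite_verts: "finite (verts G)" and finite_edges: "finite (edges G)"
  and verts_nonempty: "verts G \<noteq> {}"
  using model by (auto simp: model_of_def)

lemma
  assumes "e \<in> edges G"
  shows elen_pos: "0 < elen G e"
    and epar_0: "epar G e 0 \<in> verts G"
    and epar_elen: "epar G e (elen G e) \<in> verts G"
    and inj_epar: "inj_on (epar G e) {0<..<elen G e}"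
    and epar_interior: "t \<in> {0<..<elen G e} \<Longrightarrow> epar G e t \<notin> verts G"
proof -
  have "0 < elen G e \<and> epar G e 0 \<in> verts G \<and> epar G e (elen G e) \<in> verts G \<and>
      inj_on (epar G e) {0<..<elen G e} \<and> epar G e ` {0<..<elen G e} \<inter> verts G = {}"
    using model assms by (simp add: model_of_def)
  then show "0 < elen G e" "epar G e 0 \<in> verts G" "epar G e (elen G e) \<in> verts G"
    "inj_on (epar G e) {0<..<elen G e}" "t \<in> {0<..<elen G e} \<Longrightarrow> epar G e t \<notin> verts G"
    by blast+
qed

lemma interiors_disjoint:
  assumes "e \<in> edges G" "e' \<in> edges G" "e \<noteq> e'"
  shows "epar G e ` {0<..<elen G e} \<inter> epar G e' ` {0<..<elen G e'} = {}"
  using model assms by (simp add: model_of_def)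

lemma \<Gamma>_eq: "\<Gamma> = verts G \<union> (\<Union>e\<in>edges G. epar G e ` {0..elen G e})"
  using model by (simp add: model_of_def)

lemma verts_subset: "verts G \<subseteq> \<Gamma>"
  using \<Gamma>_eq by auto

lemma epar_in: "e \<in> edges G \<Longrightarrow> t \<in> {0..elen G e} \<Longrightarrow> epar G e t \<in> \<Gamma>"
  using \<Gamma>_eq by blast

text \<open>An end of \<open>e'\<close> is a vertex and an interior point of \<open>e\<close> is
  not, so the second parameter is interior too, and disjointness and injectivity of open edges
  apply.\<close>

lemma interior_eq:
  assumes "e \<in> edges G" "e' \<in> edges G" "t \<in> {0<..<elen G e}" "s \<in> {0..elen G e'}"
    "epar G e t = epar G e' s"
  shows "e = e'" "t = s"
proof -
  have s: "s \<in> {0<..<elen G e'}"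
    using assms epar_interior[of e t] epar_0[of e'] epar_elen[of e']
    by (cases "s = 0 \<or> s = elen G e'") auto
  then show e: "e = e'"
    using interiors_disjoint[OF assms(1,2)] assms by blast
  show "t = s"
    using inj_onD[OF inj_epar[of e'] assms(5)[unfolded e]] s assms e by auto
qed

lemma point_cases:
  assumes "x \<in> \<Gamma>"
  obtains "x \<in> verts G"
  | e t where "e \<in> edges G" "t \<in> {0<..<elen G e}" "x = epar G e t"
proof -
  consider "x \<in> verts G" | e t where "e \<in> edges G" "t \<in> {0..elen G e}" "x = epar G e t"
    using assms \<Gamma>_eq by blast
  then show ?thesis
  proof cases
    case (2 e t)
    then show ?thesis using that epar_0[of e] epar_elen[of e]
      by (cases "t = 0 \<or> t = elen G e") (auto simp: less_eq_real_def)
  qed (use that in blast)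
qed

lemma vertex_param:
  "e \<in> edges G \<Longrightarrow> t \<in> {0..elen G e} \<Longrightarrow> epar G e t \<in> verts G \<Longrightarrow> t = 0 \<or> t = elen G e"
  using epar_interior[of e t] by (auto simp: less_eq_real_def)

lemma dist_Inf:
  assumes "x \<in> \<Gamma>" "y \<in> \<Gamma>"
  shows "{c. chain_length G x c y} \<noteq> {}" "dist x y = Inf {c. chain_length G x c y}"
proof -
  have "\<forall>x\<in>\<Gamma>. \<forall>y\<in>\<Gamma>. {c. chain_length G x c y} \<noteq> {} \<and> dist x y = Inf {c. chain_length G x c y}"
    using model unfolding model_of_def by (elim conjE)
  then show "{c. chain_length G x c y} \<noteq> {}" "dist x y = Inf {c. chain_length G x c y}"
    using assms by blast+
qed

text \<open>Lower bounds for distances come from here: a function of slope at most \<open>C\<close>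
  on every edge changes by at most \<open>C\<close> times the length of any chain, hence also of the
  infimum.\<close>

lemma Lipschitz_dist:
  assumes L: "\<And>e s t. e \<in> edges G \<Longrightarrow> s \<in> {0..elen G e} \<Longrightarrow> t \<in> {0..elen G e} \<Longrightarrow>
      \<bar>f (epar G e s) - f (epar G e t)\<bar> \<le> C * \<bar>s - t\<bar>"
    and "0 \<le> C" "x \<in> \<Gamma>" "y \<in> \<Gamma>"
  shows "\<bar>f x - f y\<bar> \<le> C * dist x y"
proof -
  have *: "\<bar>f x - f y\<bar> \<le> C * c" if "chain_length G x c y" for c
    using chain_length_Lipschitz[OF that L] by blast
  note ne = dist_Inf[OF assms(3,4)]
  show ?thesis
  proof (cases "C = 0")
    case True
    then show ?thesis using * ne(1) by fastforce
  next
    case False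
    then have "\<bar>f x - f y\<bar> / C \<le> Inf {c. chain_length G x c y}"
      using * \<open>0 \<le> C\<close> ne(1) by (intro cInf_greatest) (auto simp: field_simps)
    then show ?thesis using False \<open>0 \<le> C\<close> ne(2) by (simp add: field_simps)
  qed
qed

lemma dist_epar_le:
  assumes "e \<in> edges G" "s \<in> {0..elen G e}" "t \<in> {0..elen G e}"
  shows "dist (epar G e s) (epar G e t) \<le> \<bar>s - t\<bar>"
proof -
  have "chain_length G (epar G e s) (\<bar>s - t\<bar> + 0) (epar G e t)"
    using assms by (intro chain_length.intros) auto
  then have "Inf {c. chain_length G (epar G e s) c (epar G e t)} \<le> \<bar>s - t\<bar>"
    by (intro cInf_lower bdd_belowI[of _ 0]) (auto dest: chain_length_nonneg)
  then show ?thesis using dist_Inf epar_in assms by metis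
qed

lemma continuous_epar: "e \<in> edges G \<Longrightarrow> continuous_on {0..elen G e} (epar G e)"
  unfolding continuous_on_iff
proof (intro ballI allI impI)
  fix x \<epsilon> :: real assume a: "e \<in> edges G" "x \<in> {0..elen G e}" "0 < \<epsilon>"
  show "\<exists>d>0. \<forall>x'\<in>{0..elen G e}. dist x' x < d \<longrightarrow> dist (epar G e x') (epar G e x) < \<epsilon>"
    using a dist_epar_le[OF a(1) _ a(2)] by (intro exI[of _ \<epsilon>]) (force simp: dist_real_def)
qed

lemma compact_epar: "e \<in> edges G \<Longrightarrow> closed S \<Longrightarrow> compact (epar G e ` ({0..elen G e} \<inter> S))"
  by (intro compact_continuous_image continuous_on_subset[OF continuous_epar] compact_Int_closed) auto

lemma compact_\<Gamma>: "compact \<Gamma>"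
  unfolding \<Gamma>_eq using finite_verts finite_edges compact_epar[of _ UNIV]
  by (intro compact_Un compact_UN) (auto intro: finite_imp_compact)

text \<open>Functions on the curve are prescribed edge by edge. Interior points have a unique
  parameter, so the only compatibility is between end values and values at vertices, which also
  covers loops and multiple edges.\<close>

lemma glue:
  assumes "\<And>e. e \<in> edges G \<Longrightarrow> \<phi> e 0 = val (epar G e 0)"
    and "\<And>e. e \<in> edges G \<Longrightarrow> \<phi> e (elen G e) = val (epar G e (elen G e))"
  shows "\<exists>f. (\<forall>u\<in>verts G. f u = val u) \<and> (\<forall>e\<in>edges G. \<forall>s\<in>{0..elen G e}. f (epar G e s) = \<phi> e s)"
proof -
  define f where "f x = (if x \<in> verts G then val x else
    (let (e, s) = SOME (e, s). e \<in> edges G \<and> s \<in> {0<..<elen G e} \<and> x = epar G e s in \<phi> e s))" for x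
  have "f (epar G e s) = \<phi> e s" if e: "e \<in> edges G" and s: "s \<in> {0..elen G e}" for e s
  proof (cases "s \<in> {0<..<elen G e}")
    case True
    have "(SOME (e', s'). e' \<in> edges G \<and> s' \<in> {0<..<elen G e'} \<and> epar G e s = epar G e' s') = (e, s)"
    proof (rule some_equality)
      show "case (e, s) of (e', s') \<Rightarrow> e' \<in> edges G \<and> s' \<in> {0<..<elen G e'} \<and> epar G e s = epar G e' s'"
        using True e by simp
      show "p = (e, s)" if "case p of (e', s') \<Rightarrow> e' \<in> edges G \<and> s' \<in> {0<..<elen G e'} \<and> epar G e s = epar G e' s'" for p
      proof -
        obtain e' s' where p: "p = (e', s')" by (cases p)
        then have "e' \<in> edges G" "s' \<in> {0..elen G e'}" "epar G e s = epar G e' s'" using that by auto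
        then show ?thesis using interior_eq[OF e _ True, of e' s'] p by simp
      qed
    qed
    then show ?thesis using True e epar_interior[of e s] by (simp add: f_def)
  next
    case False
    then have "s = 0 \<or> s = elen G e" using s by auto
    then show ?thesis using assms[OF e] epar_0[OF e] epar_elen[OF e] by (auto simp: f_def)
  qed
  then show ?thesis by (intro exI[of _ f]) (auto simp: f_def)
qed

lemma finite_params:
  assumes "e \<in> edges G" "finite W"
  shows "finite {t \<in> {0..elen G e}. epar G e t \<in> W}"
proof (rule finite_subset)
  show "{t \<in> {0..elen G e}. epar G e t \<in> W} \<subseteq> {0, elen G e} \<union> (epar G e -` W \<inter> {0<..<elen G e})"
    by auto
  show "finite ({0, elen G e} \<union> (epar G e -` W \<inter> {0<..<elen G e}))"
    using finite_vimage_IntI[OF assms(2) inj_epar[OF assms(1)]] by simp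
qed

lemma directions_subset:
  "directions G v \<subseteq> (SIGMA e:edges G. {t \<in> {0..elen G e}. epar G e t \<in> {v}} \<times> {1, -1})"
  by (auto simp: directions_def)

lemma finite_directions: "finite (directions G v)"
  by (rule finite_subset[OF directions_subset]) (auto intro!: finite_SigmaI finite_edges finite_params[of _ "{v}", simplified])

lemma directions_interior:
  assumes "e \<in> edges G" "t \<in> {0<..<elen G e}"
  shows "directions G (epar G e t) = {(e, t, 1), (e, t, -1)}"
proof (intro equalityI subsetI)
  fix \<delta> assume "\<delta> \<in> directions G (epar G e t)"
  then obtain e' t' \<sigma> where \<delta>: "\<delta> = (e', t', \<sigma>)" "e' \<in> edges G" "t' \<in> {0..elen G e'}"
    "epar G e' t' = epar G e t" "\<sigma> = 1 \<or> \<sigma> = - 1"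
    by (auto simp: directions_def)
  then have "e = e'" "t = t'" using interior_eq[OF assms(1) \<delta>(2) assms(2) \<delta>(3)] by simp_all
  then show "\<delta> \<in> {(e, t, 1), (e, t, -1)}" using \<delta> by auto
qed (use assms in \<open>auto simp: directions_def\<close>)

lemma directions_vertex:
  assumes "u \<in> verts G"
  shows "directions G u = {(e, 0, 1) | e. e \<in> edges G \<and> epar G e 0 = u} \<union>
    {(e, elen G e, -1) | e. e \<in> edges G \<and> epar G e (elen G e) = u}"
proof (intro equalityI subsetI)
  fix \<delta> assume "\<delta> \<in> directions G u"
  then obtain e t \<sigma> where \<delta>: "\<delta> = (e, t, \<sigma>)" "e \<in> edges G" "t \<in> {0..elen G e}" "epar G e t = u"
    "\<sigma> = 1 \<and> t < elen G e \<or> \<sigma> = - 1 \<and> 0 < t"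
    by (auto simp: directions_def)
  then show "\<delta> \<in> {(e, 0, 1) | e. e \<in> edges G \<and> epar G e 0 = u} \<union>
      {(e, elen G e, -1) | e. e \<in> edges G \<and> epar G e (elen G e) = u}"
    using vertex_param[of e t] assms by auto
qed (use elen_pos in \<open>auto simp: directions_def less_imp_le\<close>)

text \<open>The radius of the star at \<open>v\<close> is a quarter of the smallest gap between
  parameters that are endpoints or belong to \<open>v\<close>.\<close>

lemma param_gap:
  obtains \<epsilon> where "0 < \<epsilon>"
    "\<And>e s t. e \<in> edges G \<Longrightarrow> s \<in> {0..elen G e} \<Longrightarrow> t \<in> {0..elen G e} \<Longrightarrow> epar G e s \<in> insert v (verts G) \<Longrightarrow>
      epar G e t \<in> insert v (verts G) \<Longrightarrow> s \<noteq> t \<Longrightarrow> 4 * \<epsilon> \<le> \<bar>s - t\<bar>"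
proof -
  define T where "T e = {t \<in> {0..elen G e}. epar G e t \<in> insert v (verts G)}" for e
  define Q where "Q = (\<Union>e\<in>edges G. (\<lambda>(s, t). \<bar>s - t\<bar>) ` (T e \<times> T e)) - {0}"
  have "finite (T e)" if "e \<in> edges G" for e
    unfolding T_def using that finite_verts by (intro finite_params) auto
  then have fin: "finite Q"
    unfolding Q_def using finite_edges by (intro finite_Diff finite_UN_I finite_imageI finite_cartesian_product) auto
  have Q_pos: "0 < q" if "q \<in> Q" for q using that by (auto simp: Q_def)
  have "\<exists>\<epsilon>>0. \<forall>q\<in>Q. \<epsilon> \<le> q"
  proof (cases "Q = {}")
    case False
    then show ?thesis using fin Q_pos Min_in[OF fin False] Min_le[OF fin] by blast
  next
    case True
    then show ?thesis by (intro exI[of _ 1]) simp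
  qed
  then obtain \<epsilon> where \<epsilon>: "0 < \<epsilon>" "\<And>q. q \<in> Q \<Longrightarrow> \<epsilon> \<le> q" by blast
  show ?thesis
  proof (rule that[of "\<epsilon> / 4"])
    fix e s t assume *: "e \<in> edges G" "s \<in> {0..elen G e}" "t \<in> {0..elen G e}" "epar G e s \<in> insert v (verts G)"
      "epar G e t \<in> insert v (verts G)" "s \<noteq> t"
    then have "(s, t) \<in> T e \<times> T e" by (simp add: T_def)
    then have "\<bar>s - t\<bar> \<in> (\<lambda>(s, t). \<bar>s - t\<bar>) ` (T e \<times> T e)" by (rule rev_image_eqI) simp
    then have "\<bar>s - t\<bar> \<in> Q" unfolding Q_def using *(1,6) by (intro DiffI UN_I[OF *(1)]) auto
    then show "4 * (\<epsilon> / 4) \<le> \<bar>s - t\<bar>" using \<epsilon>(2) by fastforce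
  qed (use \<epsilon> in simp)
qed

text \<open>The tent of direction \<open>\<sigma>\<close> at \<open>t\<close> rises with slope 1 up
  to distance \<open>\<epsilon>\<close> and vanishes again from distance
  \<open>2 * \<epsilon>\<close> on. Two tents that leave one point in opposite directions, or whose
  base points are \<open>4 * \<epsilon>\<close> apart, are never positive at the same place, so
  their difference has no slope larger than 1.\<close>

lemma tents_Lipschitz:
  fixes \<epsilon> :: real
  assumes "\<sigma> \<in> {1, -1}" "\<sigma>' \<in> {1, -1}" "0 < \<epsilon>" "t = t' \<and> \<sigma> \<noteq> \<sigma>' \<or> 4 * \<epsilon> \<le> \<bar>t - t'\<bar>"
  shows "\<bar>(max 0 (\<epsilon> - \<bar>\<sigma> * (s - t) - \<epsilon>\<bar>) - max 0 (\<epsilon> - \<bar>\<sigma>' * (s - t') - \<epsilon>\<bar>)) -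
    (max 0 (\<epsilon> - \<bar>\<sigma> * (s' - t) - \<epsilon>\<bar>) - max 0 (\<epsilon> - \<bar>\<sigma>' * (s' - t') - \<epsilon>\<bar>))\<bar> \<le> \<bar>s - s'\<bar>"
proof -
  define T where "T \<sigma> t s = max 0 (\<epsilon> - \<bar>\<sigma> * (s - t) - \<epsilon>\<bar>)" for \<sigma> t s :: real
  have T1: "T 1 t s = (if s \<le> t \<or> t + 2 * \<epsilon> \<le> s then 0 else if s \<le> t + \<epsilon> then s - t else t + 2 * \<epsilon> - s)" for t s
    using \<open>0 < \<epsilon>\<close> by (auto simp: T_def max_def abs_if)
  have T2: "T (-1) t s = (if t \<le> s \<or> s \<le> t - 2 * \<epsilon> then 0 else if t - \<epsilon> \<le> s then t - s else s - t + 2 * \<epsilon>)" for t s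
    using \<open>0 < \<epsilon>\<close> by (auto simp: T_def max_def abs_if)
  have *: "\<bar>(T \<sigma> t s - T \<sigma>' t' s) - (T \<sigma> t s' - T \<sigma>' t' s')\<bar> \<le> \<bar>s - s'\<bar>"
    using assms(1,2)
  proof (elim insertE emptyE)
    assume [simp]: "\<sigma> = 1" "\<sigma>' = 1"
    then show ?thesis using assms(3,4) unfolding \<open>\<sigma> = 1\<close> \<open>\<sigma>' = 1\<close> T1 by (smt (verit))
  next
    assume "\<sigma> = 1" "\<sigma>' = -1"
    then show ?thesis using assms(3,4) unfolding \<open>\<sigma> = 1\<close> \<open>\<sigma>' = -1\<close> T1 T2 by (smt (verit))
  next
    assume "\<sigma> = -1" "\<sigma>' = 1"
    then show ?thesis using assms(3,4) unfolding \<open>\<sigma> = -1\<close> \<open>\<sigma>' = 1\<close> T1 T2 by (smt (verit))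
  next
    assume "\<sigma> = -1" "\<sigma>' = -1"
    then show ?thesis using assms(3,4) unfolding \<open>\<sigma> = -1\<close> \<open>\<sigma>' = -1\<close> T2 by (smt (verit))
  qed
  then show ?thesis unfolding T_def .
qed

lemma tent_Lipschitz:
  fixes \<epsilon> :: real
  assumes "\<sigma> \<in> {1, -1}"
  shows "\<bar>max 0 (\<epsilon> - \<bar>\<sigma> * (s - t) - \<epsilon>\<bar>) - max 0 (\<epsilon> - \<bar>\<sigma> * (s' - t) - \<epsilon>\<bar>)\<bar> \<le> \<bar>s - s'\<bar>"
proof -
  have "\<bar>max 0 (\<epsilon> - \<bar>x - \<epsilon>\<bar>) - max 0 (\<epsilon> - \<bar>y - \<epsilon>\<bar>)\<bar> \<le> \<bar>x - y\<bar>" for x y :: real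
    by (simp add: max_def abs_if)
  from this[of "\<sigma> * (s - t)" "\<sigma> * (s' - t)"] show ?thesis
    using assms by (auto simp: abs_minus_commute)
qed

text \<open>Distances in the star are bounded below by tent functions supported on the branches.\<close>

lemma star:
  assumes v: "v \<in> \<Gamma>"
  obtains \<epsilon> where "0 < \<epsilon>"
    "\<And>e t \<sigma> h. (e, t, \<sigma>) \<in> directions G v \<Longrightarrow> h \<in> {0..\<epsilon>} \<Longrightarrow> t + \<sigma> * h \<in> {0..elen G e}"
    "\<And>\<delta> \<delta>' h h'. \<delta> \<in> directions G v \<Longrightarrow> \<delta>' \<in> directions G v \<Longrightarrow> h \<in> {0..\<epsilon>} \<Longrightarrow> h' \<in> {0..\<epsilon>} \<Longrightarrow>
      dist (along G \<delta> h) (along G \<delta>' h') = (if \<delta> = \<delta>' then \<bar>h - h'\<bar> else h + h')"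
    "\<And>y. y \<in> \<Gamma> \<Longrightarrow> dist v y < \<epsilon> \<Longrightarrow> y \<noteq> v \<Longrightarrow> \<exists>\<delta>\<in>directions G v. y = along G \<delta> (dist v y)"
proof -
  obtain \<epsilon>0 where \<epsilon>0: "0 < \<epsilon>0" and gap: "\<And>e s t. e \<in> edges G \<Longrightarrow> s \<in> {0..elen G e} \<Longrightarrow> t \<in> {0..elen G e} \<Longrightarrow>
      epar G e s \<in> insert v (verts G) \<Longrightarrow> epar G e t \<in> insert v (verts G) \<Longrightarrow> s \<noteq> t \<Longrightarrow> 4 * \<epsilon>0 \<le> \<bar>s - t\<bar>"
    using param_gap[of v] by blast
  have dir: "e \<in> edges G" "t \<in> {0..elen G e}" "epar G e t = v" "\<sigma> \<in> {1, -1}" "\<sigma> = 1 \<Longrightarrow> t + 4 * \<epsilon>0 \<le> elen G e"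
    "\<sigma> = -1 \<Longrightarrow> 4 * \<epsilon>0 \<le> t" if "(e, t, \<sigma>) \<in> directions G v" for e t \<sigma>
    using that gap[of e 0 t] gap[of e "elen G e" t] epar_0[of e] epar_elen[of e] elen_pos[of e]
    by (auto simp: directions_def)
  have range: "t + \<sigma> * h \<in> {0..elen G e}" if "(e, t, \<sigma>) \<in> directions G v" "h \<in> {0..\<epsilon>0}" for e t \<sigma> h
    using dir(2,4,5,6)[OF that(1)] that(2) by auto
  define T where "T \<sigma> t s = max 0 (\<epsilon>0 - \<bar>\<sigma> * (s - t) - \<epsilon>0\<bar>)" for \<sigma> t s :: real
  have T_end: "T \<sigma> t 0 = 0" "T \<sigma> t (elen G e) = 0" if "(e, t, \<sigma>) \<in> directions G v" for e t \<sigma>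
    using dir[OF that] gap[of e 0 t] gap[of e "elen G e" t] epar_0[of e] epar_elen[of e] elen_pos[of e] \<epsilon>0
    by (auto simp: T_def max_def abs_if)
  have T_at: "T \<sigma> t (t + \<sigma> * h) = h" if "\<sigma> \<in> {1, -1}" "h \<in> {0..\<epsilon>0}" for \<sigma> t h
    using that by (auto simp: T_def max_def)
  have T_off: "T \<sigma>' t' (t + \<sigma> * h) = 0" if "(e, t, \<sigma>) \<in> directions G v" "(e, t', \<sigma>') \<in> directions G v"
    "(t, \<sigma>) \<noteq> (t', \<sigma>')" "h \<in> {0..\<epsilon>0}" for e t t' \<sigma> \<sigma>' h
  proof (cases "t = t'")
    case True
    then have "\<sigma>' = - \<sigma>" using dir(4)[OF that(1)] dir(4)[OF that(2)] that(3) by auto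
    then show ?thesis using True that(4) dir(4)[OF that(1)] by (auto simp: T_def max_def)
  next
    case False
    then have "4 * \<epsilon>0 \<le> \<bar>t - t'\<bar>" using gap[of e t t'] dir(1-3)[OF that(1)] dir(1-3)[OF that(2)] by simp
    moreover have "\<sigma> = 1 \<or> \<sigma> = -1" "\<sigma>' = 1 \<or> \<sigma>' = -1" using dir(4)[OF that(1)] dir(4)[OF that(2)] by auto
    ultimately show ?thesis using that(4) \<epsilon>0 unfolding T_def
      by (elim disjE; clarsimp simp: max_def; linarith)
  qed
  have le: "dist (along G \<delta> h) (along G \<delta> h') \<le> \<bar>h - h'\<bar>"
    if "\<delta> \<in> directions G v" "h \<in> {0..\<epsilon>0}" "h' \<in> {0..\<epsilon>0}" for \<delta> h h'
  proof -
    obtain e t \<sigma> where \<delta>: "\<delta> = (e, t, \<sigma>)" by (cases \<delta>)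
    note d = dir[OF that(1)[unfolded \<delta>]]
    have "dist (epar G e (t + \<sigma> * h)) (epar G e (t + \<sigma> * h')) \<le> \<bar>(t + \<sigma> * h) - (t + \<sigma> * h')\<bar>"
      using that by (intro dist_epar_le d(1) range) (simp_all add: \<delta>)
    also have "\<dots> = \<bar>h - h'\<bar>" using d(4) by auto
    finally show ?thesis by (simp add: \<delta>)
  qed
  have dist_same: "dist (along G \<delta> h) (along G \<delta> h') = \<bar>h - h'\<bar>"
    if "\<delta> \<in> directions G v" "h \<in> {0..\<epsilon>0}" "h' \<in> {0..\<epsilon>0}" for \<delta> h h'
  proof -
    obtain e t \<sigma> where \<delta>: "\<delta> = (e, t, \<sigma>)" by (cases \<delta>)
    note d = dir[OF that(1)[unfolded \<delta>]] and ends = T_end[OF that(1)[unfolded \<delta>]]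
    define \<phi> where "\<phi> e' s = (if e' = e then T \<sigma> t s else 0)" for e' s
    have "\<exists>f. (\<forall>u\<in>verts G. f u = 0) \<and> (\<forall>e'\<in>edges G. \<forall>s\<in>{0..elen G e'}. f (epar G e' s) = \<phi> e' s)"
      using ends by (intro glue) (auto simp: \<phi>_def)
    then obtain f where f: "\<And>e' s. e' \<in> edges G \<Longrightarrow> s \<in> {0..elen G e'} \<Longrightarrow> f (epar G e' s) = \<phi> e' s"
      by blast
    have in_range: "t + \<sigma> * h \<in> {0..elen G e}" "t + \<sigma> * h' \<in> {0..elen G e}"
      using range[of e t \<sigma> h] range[of e t \<sigma> h'] that by (simp_all add: \<delta>)
    have "\<bar>f (epar G e (t + \<sigma> * h)) - f (epar G e (t + \<sigma> * h'))\<bar>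
        \<le> 1 * dist (epar G e (t + \<sigma> * h)) (epar G e (t + \<sigma> * h'))"
      by (rule Lipschitz_dist)
        (use d in_range in \<open>auto simp: f \<phi>_def T_def intro!: tent_Lipschitz epar_in\<close>)
    then have "\<bar>h - h'\<bar> \<le> dist (along G \<delta> h) (along G \<delta> h')"
      using f[OF d(1) in_range(1)] f[OF d(1) in_range(2)] T_at[OF d(4)] that(2,3) by (simp add: \<phi>_def \<delta>)
    then show ?thesis using le[OF that] by simp
  qed
  \<comment> \<open>The tent of \<open>\<delta>\<close> minus that of \<open>\<delta>'\<close> has
    slope at most 1 and takes the values \<open>h\<close> and \<open>- h'\<close> at the two points,
    which gives the lower bound.\<close>
  have dist_diff: "dist (along G \<delta> h) (along G \<delta>' h') = h + h'"
    if "\<delta> \<in> directions G v" "\<delta>' \<in> directions G v" "\<delta> \<noteq> \<delta>'" "h \<in> {0..\<epsilon>0}" "h' \<in> {0..\<epsilon>0}" for \<delta> \<delta>' h h'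
  proof -
    obtain e t \<sigma> where \<delta>: "\<delta> = (e, t, \<sigma>)" by (cases \<delta>)
    obtain e' t' \<sigma>' where \<delta>': "\<delta>' = (e', t', \<sigma>')" by (cases \<delta>')
    note d = dir[OF that(1)[unfolded \<delta>]] and d' = dir[OF that(2)[unfolded \<delta>']]
      and ends = T_end[OF that(1)[unfolded \<delta>]] T_end[OF that(2)[unfolded \<delta>']]
    define \<phi> where "\<phi> a s = (if a = e then T \<sigma> t s else 0) - (if a = e' then T \<sigma>' t' s else 0)" for a s
    have "\<exists>f. (\<forall>u\<in>verts G. f u = 0) \<and> (\<forall>a\<in>edges G. \<forall>s\<in>{0..elen G a}. f (epar G a s) = \<phi> a s)"
      using ends by (intro glue) (auto simp: \<phi>_def)
    then obtain f where f: "\<And>a s. a \<in> edges G \<Longrightarrow> s \<in> {0..elen G a} \<Longrightarrow> f (epar G a s) = \<phi> a s"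
      by blast
    have in_range: "t + \<sigma> * h \<in> {0..elen G e}" "t' + \<sigma>' * h' \<in> {0..elen G e'}"
      using range[of e t \<sigma> h] range[of e' t' \<sigma>' h'] that by (simp_all add: \<delta> \<delta>')
    have L: "\<bar>\<phi> a s - \<phi> a s'\<bar> \<le> \<bar>s - s'\<bar>" for a s s'
    proof (cases "e = e'")
      case True
      then have "t = t' \<and> \<sigma> \<noteq> \<sigma>' \<or> 4 * \<epsilon>0 \<le> \<bar>t - t'\<bar>"
        using gap[of e t t'] d d' that(3) \<delta> \<delta>' by auto
      from tents_Lipschitz[OF d(4) d'(4) \<epsilon>0 this, of s s']
      have "\<bar>(T \<sigma> t s - T \<sigma>' t' s) - (T \<sigma> t s' - T \<sigma>' t' s')\<bar> \<le> \<bar>s - s'\<bar>"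
        unfolding T_def .
      then show ?thesis using True by (simp add: \<phi>_def)
    next
      case False
      have "\<bar>T \<sigma> t s - T \<sigma> t s'\<bar> \<le> \<bar>s - s'\<bar>" "\<bar>T \<sigma>' t' s - T \<sigma>' t' s'\<bar> \<le> \<bar>s - s'\<bar>"
        unfolding T_def by (intro tent_Lipschitz d d')+
      then show ?thesis using False by (simp add: \<phi>_def abs_minus_commute)
    qed
    have "\<bar>f (epar G e (t + \<sigma> * h)) - f (epar G e' (t' + \<sigma>' * h'))\<bar>
        \<le> 1 * dist (epar G e (t + \<sigma> * h)) (epar G e' (t' + \<sigma>' * h'))"
      by (rule Lipschitz_dist) (use d d' in_range in \<open>auto simp: f L intro!: epar_in\<close>)
    moreover have "f (epar G e (t + \<sigma> * h)) = h"
      using f[OF d(1) in_range(1)] T_at[OF d(4) that(4)] T_off[of e t \<sigma> t' \<sigma>' h] that \<delta> \<delta>'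
      by (auto simp: \<phi>_def)
    moreover have "f (epar G e' (t' + \<sigma>' * h')) = - h'"
      using f[OF d'(1) in_range(2)] T_at[OF d'(4) that(5)] T_off[of e' t' \<sigma>' t \<sigma> h'] that \<delta> \<delta>'
      by (auto simp: \<phi>_def)
    ultimately have ge: "h + h' \<le> dist (along G \<delta> h) (along G \<delta>' h')"
      using that(4,5) by (simp add: \<delta> \<delta>')
    have "dist (along G \<delta> h) (along G \<delta>' h') \<le> dist (along G \<delta> h) v + dist (along G \<delta>' h') v"
      by (rule dist_triangle2)
    also have "\<dots> \<le> h + h'"
      using le[OF that(1,4), of 0] le[OF that(2,5), of 0] that(4,5) \<epsilon>0 along_0[OF that(1)] along_0[OF that(2)] by simp
    finally show ?thesis using ge by simp
  qed
  \<comment> \<open>\<open>Y\<close> collects the other vertices and all points at parameter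
    distance at least \<open>\<epsilon>0\<close> from every occurrence of \<open>v\<close> on their
    edge. It is closed and misses \<open>v\<close>, so a whole ball around \<open>v\<close> consists
    of points on the branches.\<close>
  define S where "S e = (\<Inter>t\<in>{t \<in> {0..elen G e}. epar G e t = v}. {s. \<epsilon>0 \<le> \<bar>s - t\<bar>})" for e
  define Y where "Y = (verts G - {v}) \<union> (\<Union>e\<in>edges G. epar G e ` ({0..elen G e} \<inter> S e))"
  have "closed (S e)" for e unfolding S_def
    by (intro closed_INT ballI closed_Collect_le continuous_intros)
  then have "closed Y" unfolding Y_def using finite_verts finite_edges compact_epar
    by (intro closed_Un closed_UN compact_imp_closed) (auto intro: finite_imp_compact)
  moreover have "v \<notin> Y"
  proof
    assume "v \<in> Y"
    then obtain e s where "s \<in> {0..elen G e}" "s \<in> S e" "v = epar G e s" unfolding Y_def by blast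
    then have "\<epsilon>0 \<le> \<bar>s - s\<bar>" unfolding S_def by blast
    then show False using \<epsilon>0 by simp
  qed
  ultimately obtain \<epsilon>1 where "0 < \<epsilon>1" "ball v \<epsilon>1 \<subseteq> - Y"
    using openE[of "- Y" v] by auto
  then have \<epsilon>1: "0 < \<epsilon>1" "\<And>y. y \<in> Y \<Longrightarrow> \<epsilon>1 \<le> dist v y"
    by (auto simp: subset_iff not_less[symmetric])
  show ?thesis
  proof (rule that[of "min \<epsilon>0 \<epsilon>1"])
    show "0 < min \<epsilon>0 \<epsilon>1" using \<epsilon>0 \<epsilon>1 by simp
    show "t + \<sigma> * h \<in> {0..elen G e}" if "(e, t, \<sigma>) \<in> directions G v" "h \<in> {0..min \<epsilon>0 \<epsilon>1}" for e t \<sigma> h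
      using range[OF that(1)] that(2) by simp
    show "dist (along G \<delta> h) (along G \<delta>' h') = (if \<delta> = \<delta>' then \<bar>h - h'\<bar> else h + h')"
      if "\<delta> \<in> directions G v" "\<delta>' \<in> directions G v" "h \<in> {0..min \<epsilon>0 \<epsilon>1}" "h' \<in> {0..min \<epsilon>0 \<epsilon>1}" for \<delta> \<delta>' h h'
      using dist_same dist_diff that by auto
    fix y assume y: "y \<in> \<Gamma>" "dist v y < min \<epsilon>0 \<epsilon>1" "y \<noteq> v"
    then have "y \<notin> Y" using \<epsilon>1(2) by force
    then obtain e s where e: "e \<in> edges G" "s \<in> {0..elen G e}" "y = epar G e s"
      using y(1,3) \<Gamma>_eq unfolding Y_def by blast
    then have "s \<notin> S e" using \<open>y \<notin> Y\<close> unfolding Y_def by blast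
    then obtain t where t: "t \<in> {0..elen G e}" "epar G e t = v" "\<bar>s - t\<bar> < \<epsilon>0"
      unfolding S_def by force
    define \<sigma> where "\<sigma> = (if t \<le> s then 1 else -1::real)"
    have "s \<noteq> t" using t e y(3) by auto
    then have \<delta>: "(e, t, \<sigma>) \<in> directions G v" using t e by (auto simp: directions_def \<sigma>_def)
    have y_eq: "y = along G (e, t, \<sigma>) \<bar>s - t\<bar>" using e by (auto simp: \<sigma>_def)
    moreover have "dist v y = \<bar>s - t\<bar>"
      using dist_same[OF \<delta>, of 0 "\<bar>s - t\<bar>"] t \<epsilon>0 along_0[OF \<delta>] y_eq by simp
    ultimately have "y = along G (e, t, \<sigma>) (dist v y)" by (simp only:)
    then show "\<exists>\<delta>\<in>directions G v. y = along G \<delta> (dist v y)" using \<delta> by (rule bexI)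
  qed
qed

end

section \<open>Piecewise linear functions of one real variable\<close>

lemma eventually_at_right_0:
  "(\<forall>\<^sub>F h in at_right (0::real). P h) \<longleftrightarrow> (\<exists>\<epsilon>>0. \<forall>h\<in>{0<..\<epsilon>}. P h)"
proof
  assume "\<forall>\<^sub>F h in at_right (0::real). P h"
  then obtain b where "b > 0" "\<And>h. 0 < h \<Longrightarrow> h < b \<Longrightarrow> P h"
    unfolding eventually_at_right_field by blast
  then show "\<exists>\<epsilon>>0. \<forall>h\<in>{0<..\<epsilon>}. P h" by (intro exI[of _ "b / 2"]) auto
next
  assume "\<exists>\<epsilon>>0. \<forall>h\<in>{0<..\<epsilon>}. P h"
  then show "\<forall>\<^sub>F h in at_right (0::real). P h"
    unfolding eventually_at_right_field by (metis greaterThanAtMost_iff less_imp_le)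
qed

lemma eventually_at_right_0_le: "0 < c \<Longrightarrow> \<forall>\<^sub>F h in at_right (0::real). 0 < h \<and> h \<le> c"
  unfolding eventually_at_right_0 by (intro exI[of _ c]) auto

lemma eventually_affine_less:
  fixes a b p q :: real
  assumes "a < b"
  shows "\<forall>\<^sub>F h in at_right 0. a + p * h < b + q * h"
proof -
  have "((\<lambda>h. (b + q * h) - (a + p * h)) \<longlongrightarrow> (b + q * 0) - (a + p * 0)) (at_right 0)"
    by (intro tendsto_intros)
  from order_tendstoD(1)[OF this, of 0] show ?thesis using assms
    by (auto elim: eventually_mono)
qed

text \<open>A line that starts strictly below \<open>\<psi> 0\<close> stays below for a short time,
  so near 0 only the lines through \<open>\<psi> 0\<close> compete, and the steepest of them
  wins.\<close>

lemma max_lines_slope: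
  fixes \<alpha> :: "'i \<Rightarrow> real" and \<beta> :: "'i \<Rightarrow> int"
  assumes A: "finite A" "\<And>i. i \<in> A \<Longrightarrow> \<alpha> i \<le> \<psi> 0" "\<exists>i\<in>A. \<alpha> i = \<psi> 0"
    and ev: "\<forall>\<^sub>F h in at_right 0. (\<forall>i\<in>A. \<alpha> i + of_int (\<beta> i) * h \<le> \<psi> h) \<and> (\<exists>i\<in>A. \<psi> h = \<alpha> i + of_int (\<beta> i) * h)"
  shows "\<forall>\<^sub>F h in at_right 0. \<psi> h = \<psi> 0 + of_int (Max (\<beta> ` {i \<in> A. \<alpha> i = \<psi> 0})) * h"
proof -
  define k where "k = Max (\<beta> ` {i \<in> A. \<alpha> i = \<psi> 0})"
  have fin: "finite (\<beta> ` {i \<in> A. \<alpha> i = \<psi> 0})" "\<beta> ` {i \<in> A. \<alpha> i = \<psi> 0} \<noteq> {}"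
    using A by auto
  then have "k \<in> \<beta> ` {i \<in> A. \<alpha> i = \<psi> 0}" unfolding k_def by (rule Max_in)
  then obtain i0 where i0: "i0 \<in> A" "\<alpha> i0 = \<psi> 0" "\<beta> i0 = k" by blast
  have "\<forall>\<^sub>F h in at_right 0. \<alpha> i + of_int (\<beta> i) * h \<le> \<psi> 0 + of_int k * h" if "i \<in> A" for i
  proof (cases "\<alpha> i = \<psi> 0")
    case True
    then have "\<beta> i \<le> k" unfolding k_def using fin that by (intro Max_ge) auto
    then have "of_int (\<beta> i) * h \<le> of_int k * h" if "0 < h" for h :: real
      using that by (intro mult_right_mono) auto
    then show ?thesis using True eventually_at_right_less[of 0]
      by (auto elim!: eventually_mono)
  next
    case False
    then have "\<alpha> i < \<psi> 0" using A(2)[OF that] by simp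
    from eventually_affine_less[OF this, of "of_int (\<beta> i)" "of_int k"] show ?thesis
      by (auto elim: eventually_mono)
  qed
  then have "\<forall>\<^sub>F h in at_right 0. \<forall>i\<in>A. \<alpha> i + of_int (\<beta> i) * h \<le> \<psi> 0 + of_int k * h"
    using A(1) by (intro eventually_ball_finite) auto
  with ev have "\<forall>\<^sub>F h in at_right 0. \<psi> h = \<psi> 0 + of_int k * h"
  proof eventually_elim
    case (elim h)
    then show ?case using i0 by (metis order_antisym)
  qed
  then show ?thesis by (simp add: k_def)
qed

text \<open>Both \<open>\<rho>\<close> and \<open>\<mu>\<close> are outgoing slopes, so their
  nonnegative sum is convexity at an interior point. The tangent inequalities hold on short
  intervals and can be joined at a common end, which is the form of argument that
  \<open>Bolzano\<close> supports.\<close>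

lemma convex_pl_support:
  fixes \<phi> \<rho> \<mu> :: "real \<Rightarrow> real"
  assumes right: "\<And>t. t \<in> {a..<b} \<Longrightarrow> \<forall>\<^sub>F h in at_right 0. \<phi> (t + h) = \<phi> t + \<rho> t * h"
    and left: "\<And>t. t \<in> {a<..b} \<Longrightarrow> \<forall>\<^sub>F h in at_right 0. \<phi> (t - h) = \<phi> t + \<mu> t * h"
    and conv: "\<And>t. t \<in> {a<..<b} \<Longrightarrow> 0 \<le> \<rho> t + \<mu> t"
    and st: "a \<le> s" "s < t" "t \<le> b"
  shows "\<phi> s + \<rho> s * (t - s) \<le> \<phi> t" "\<phi> t + \<mu> t * (t - s) \<le> \<phi> s"
proof -
  define P where "P x y \<longleftrightarrow> a \<le> x \<and> x < y \<and> y \<le> b \<longrightarrow>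
    \<phi> x + \<rho> x * (y - x) \<le> \<phi> y \<and> \<phi> y + \<mu> y * (y - x) \<le> \<phi> x" for x y
  have "P s t"
  proof (rule Bolzano[of s t P])
    fix x y z assume P: "P x y" "P y z" and xyz: "x \<le> y" "y \<le> z"
    show "P x z"
    proof (cases "x = y \<or> y = z \<or> \<not> (a \<le> x \<and> z \<le> b)")
      case True
      then show ?thesis using P xyz by (auto simp: P_def)
    next
      case False
      then have xy: "x < y" "y < z" "a \<le> x" "z \<le> b" using xyz by auto
      with P have 1: "\<phi> x + \<rho> x * (y - x) \<le> \<phi> y" "\<phi> y + \<mu> y * (y - x) \<le> \<phi> x"
        "\<phi> y + \<rho> y * (z - y) \<le> \<phi> z" "\<phi> z + \<mu> z * (z - y) \<le> \<phi> y" by (auto simp: P_def)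
      have c: "0 \<le> \<rho> y + \<mu> y" using xy by (intro conv) auto
      \<comment> \<open>The two inequalities across the left interval give
        \<open>\<rho> x \<le> - \<mu> y\<close>, and convexity at \<open>y\<close> gives
        \<open>- \<mu> y \<le> \<rho> y\<close>: slopes increase across the common point.\<close>
      have "(\<rho> x + \<mu> y) * (y - x) \<le> 0" using 1(1,2) by (simp add: algebra_simps)
      then have "\<rho> x + \<mu> y \<le> 0" using xy by (simp add: mult_le_0_iff)
      then have "\<rho> x * (z - y) \<le> \<rho> y * (z - y)" using xy c by (intro mult_right_mono) auto
      then have a: "\<phi> x + \<rho> x * (z - x) \<le> \<phi> z" using 1 by (simp add: algebra_simps)
      have "(\<rho> y + \<mu> z) * (z - y) \<le> 0" using 1(3,4) by (simp add: algebra_simps)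
      then have "\<rho> y + \<mu> z \<le> 0" using xy by (simp add: mult_le_0_iff)
      then have "\<mu> z * (y - x) \<le> \<mu> y * (y - x)" using xy c by (intro mult_right_mono) auto
      then have "\<phi> z + \<mu> z * (z - x) \<le> \<phi> x" using 1 by (simp add: algebra_simps)
      with a show ?thesis by (simp add: P_def)
    qed
  next
    fix x assume x: "s \<le> x" "x \<le> t"
    have "\<exists>d>0. x < b \<longrightarrow> (\<forall>h\<in>{0<..d}. \<phi> (x + h) = \<phi> x + \<rho> x * h)"
    proof (cases "x < b")
      case True
      then show ?thesis using right[of x] x st unfolding eventually_at_right_0 by auto
    qed (auto intro: exI[of _ 1])
    then obtain d1 where d1: "d1 > 0" "x < b \<Longrightarrow> h \<in> {0<..d1} \<Longrightarrow> \<phi> (x + h) = \<phi> x + \<rho> x * h" for h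
      by blast
    have "\<exists>d>0. a < x \<longrightarrow> (\<forall>h\<in>{0<..d}. \<phi> (x - h) = \<phi> x + \<mu> x * h)"
    proof (cases "a < x")
      case True
      then show ?thesis using left[of x] x st unfolding eventually_at_right_0 by auto
    qed (auto intro: exI[of _ 1])
    then obtain d2 where d2: "d2 > 0" "a < x \<Longrightarrow> h \<in> {0<..d2} \<Longrightarrow> \<phi> (x - h) = \<phi> x + \<mu> x * h" for h
      by blast
    have r: "P x y" if "x \<le> y" "y - x < min d1 d2" for y
      unfolding P_def
    proof (intro impI, elim conjE)
      assume y: "a \<le> x" "x < y" "y \<le> b"
      have "\<phi> (x + (y - x)) = \<phi> x + \<rho> x * (y - x)" using y that by (intro d1) auto
      then have y1: "\<phi> y = \<phi> x + \<rho> x * (y - x)" by simp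
      have "\<forall>\<^sub>F h in at_right 0. \<phi> (y - h) = \<phi> y + \<mu> y * h" using y by (intro left) auto
      with eventually_at_right_0_le[of "y - x"] y
      have "\<forall>\<^sub>F h in at_right 0. 0 < h \<and> h \<le> y - x \<and> \<phi> (y - h) = \<phi> y + \<mu> y * h"
        by (auto elim: eventually_elim2)
      \<comment> \<open>The function is linear between \<open>x\<close> and \<open>y\<close>, so the
        left germ at \<open>y\<close> lies on the line leaving \<open>x\<close>. Hence
        \<open>\<mu> y = - \<rho> x\<close>, and both inequalities are equalities.\<close>
      then obtain h where h: "0 < h" "h \<le> y - x" "\<phi> (y - h) = \<phi> y + \<mu> y * h"
        using eventually_happens[of _ "at_right (0::real)"] by auto
      have "\<phi> (y - h) = \<phi> x + \<rho> x * (y - h - x)"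
      proof (cases "y - h = x")
        case False
        have "\<phi> (x + (y - h - x)) = \<phi> x + \<rho> x * (y - h - x)"
          using h y that False by (intro d1) auto
        then show ?thesis by simp
      qed simp
      then have "(\<mu> y + \<rho> x) * h = 0" using h(3) y1 by (simp add: algebra_simps)
      then have "\<mu> y = - \<rho> x" using h(1) by (simp add: eq_neg_iff_add_eq_0)
      then show "\<phi> x + \<rho> x * (y - x) \<le> \<phi> y \<and> \<phi> y + \<mu> y * (y - x) \<le> \<phi> x" using y1 by simp
    qed
    have l: "P y x" if "y \<le> x" "x - y < min d1 d2" for y
      unfolding P_def
    proof (intro impI, elim conjE)
      assume y: "a \<le> y" "y < x" "x \<le> b"
      have "\<phi> (x - (x - y)) = \<phi> x + \<mu> x * (x - y)" using y that by (intro d2) auto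
      then have y1: "\<phi> y = \<phi> x + \<mu> x * (x - y)" by simp
      have "\<forall>\<^sub>F h in at_right 0. \<phi> (y + h) = \<phi> y + \<rho> y * h" using y by (intro right) auto
      with eventually_at_right_0_le[of "x - y"] y
      have "\<forall>\<^sub>F h in at_right 0. 0 < h \<and> h \<le> x - y \<and> \<phi> (y + h) = \<phi> y + \<rho> y * h"
        by (auto elim: eventually_elim2)
      then obtain h where h: "0 < h" "h \<le> x - y" "\<phi> (y + h) = \<phi> y + \<rho> y * h"
        using eventually_happens[of _ "at_right (0::real)"] by auto
      have "\<phi> (y + h) = \<phi> x + \<mu> x * (x - y - h)"
      proof (cases "x - y - h = 0")
        case False
        have "\<phi> (x - (x - y - h)) = \<phi> x + \<mu> x * (x - y - h)"
          using h y that False by (intro d2) auto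
        then show ?thesis by (simp add: algebra_simps)
      next
        case True
        then have "y + h = x" by simp
        then show ?thesis using True by (simp only: mult_zero_right add_0_right)
      qed
      then have "(\<rho> y + \<mu> x) * h = 0" using h(3) y1 by (simp add: algebra_simps)
      then have "\<rho> y = - \<mu> x" using h(1) by (simp add: eq_neg_iff_add_eq_0)
      then show "\<phi> y + \<rho> y * (x - y) \<le> \<phi> x \<and> \<phi> x + \<mu> x * (x - y) \<le> \<phi> y" using y1 by simp
    qed
    show "\<exists>d>0. \<forall>x' y. x' \<le> x \<and> x \<le> y \<and> y - x' < d \<longrightarrow> P x' y"
    proof (intro exI[of _ "min d1 d2"] conjI allI impI)
      fix x' y assume *: "x' \<le> x \<and> x \<le> y \<and> y - x' < min d1 d2"
      have 1: "P x' x" "P x y" using * by (auto intro!: l r)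
      show "P x' y"
      proof (cases "x' = x \<or> x = y \<or> \<not> (a \<le> x' \<and> y \<le> b)")
        case True
        then show ?thesis using 1 * by (auto simp: P_def)
      next
        case False
        then have xy: "x' < x" "x < y" "a \<le> x'" "y \<le> b" using * by auto
        with 1 have 2: "\<phi> x' + \<rho> x' * (x - x') \<le> \<phi> x" "\<phi> x + \<mu> x * (x - x') \<le> \<phi> x'"
          "\<phi> x + \<rho> x * (y - x) \<le> \<phi> y" "\<phi> y + \<mu> y * (y - x) \<le> \<phi> x" by (auto simp: P_def)
        have c: "0 \<le> \<rho> x + \<mu> x" using xy by (intro conv) auto
        have "(\<rho> x' + \<mu> x) * (x - x') \<le> 0" using 2(1,2) by (simp add: algebra_simps)
        then have "\<rho> x' + \<mu> x \<le> 0" using xy by (simp add: mult_le_0_iff)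
        then have "\<rho> x' * (y - x) \<le> \<rho> x * (y - x)" using xy c by (intro mult_right_mono) auto
        then have a: "\<phi> x' + \<rho> x' * (y - x') \<le> \<phi> y" using 2 by (simp add: algebra_simps)
        have "(\<rho> x + \<mu> y) * (y - x) \<le> 0" using 2(3,4) by (simp add: algebra_simps)
        then have "\<rho> x + \<mu> y \<le> 0" using xy by (simp add: mult_le_0_iff)
        then have "\<mu> y * (x - x') \<le> \<mu> x * (x - x')" using xy c by (intro mult_right_mono) auto
        then have "\<phi> y + \<mu> y * (y - x') \<le> \<phi> x'" using 2 by (simp add: algebra_simps)
        with a show ?thesis by (simp add: P_def)
      qed
    qed (use d1 d2 in simp)
  qed (use st in simp)
  then show "\<phi> s + \<rho> s * (t - s) \<le> \<phi> t" "\<phi> t + \<mu> t * (t - s) \<le> \<phi> s"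
    using st by (auto simp: P_def)
qed

text \<open>Compactness in the form of \<open>Bolzano\<close>: around each point its two germs leave
  the point itself as the only breakpoint, and breakpoint sets of adjacent intervals are united
  together with the common end.\<close>

lemma pl_pieces:
  fixes \<phi> :: "real \<Rightarrow> real"
  assumes right: "\<And>t. t \<in> {a..<b} \<Longrightarrow> \<exists>k::int. \<forall>\<^sub>F h in at_right 0. \<phi> (t + h) = \<phi> t + of_int k * h"
    and left: "\<And>t. t \<in> {a<..b} \<Longrightarrow> \<exists>k::int. \<forall>\<^sub>F h in at_right 0. \<phi> (t - h) = \<phi> t + of_int k * h"
    and ab: "a \<le> b"
  shows "\<exists>S. finite S \<and> (\<forall>x y. a \<le> x \<and> x < y \<and> y \<le> b \<and> {x<..<y} \<inter> S = {} \<longrightarrow>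
    (\<exists>k::int. \<forall>t\<in>{x..y}. \<phi> t = \<phi> x + of_int k * (t - x)))"
proof -
  define P where "P a' b' \<longleftrightarrow> (\<exists>S. finite S \<and> (\<forall>x y. a \<le> x \<and> y \<le> b \<and> a' \<le> x \<and> x < y \<and> y \<le> b' \<and> {x<..<y} \<inter> S = {} \<longrightarrow>
    (\<exists>k::int. \<forall>t\<in>{x..y}. \<phi> t = \<phi> x + of_int k * (t - x))))" for a' b'
  have "P a b"
  proof (rule Bolzano[of a b P])
    fix x y z assume P: "P x y" "P y z" and "x \<le> y" "y \<le> z"
    from P(1) obtain S1 where S1: "finite S1" "\<forall>x' y'. a \<le> x' \<and> y' \<le> b \<and> x \<le> x' \<and> x' < y' \<and> y' \<le> y \<and>
        {x'<..<y'} \<inter> S1 = {} \<longrightarrow> (\<exists>k::int. \<forall>t\<in>{x'..y'}. \<phi> t = \<phi> x' + of_int k * (t - x'))"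
      unfolding P_def by blast
    from P(2) obtain S2 where S2: "finite S2" "\<forall>x' y'. a \<le> x' \<and> y' \<le> b \<and> y \<le> x' \<and> x' < y' \<and> y' \<le> z \<and>
        {x'<..<y'} \<inter> S2 = {} \<longrightarrow> (\<exists>k::int. \<forall>t\<in>{x'..y'}. \<phi> t = \<phi> x' + of_int k * (t - x'))"
      unfolding P_def by blast
    show "P x z" unfolding P_def
    proof (intro exI[of _ "insert y (S1 \<union> S2)"] conjI allI impI)
      fix x' y' assume *: "a \<le> x' \<and> y' \<le> b \<and> x \<le> x' \<and> x' < y' \<and> y' \<le> z \<and> {x'<..<y'} \<inter> insert y (S1 \<union> S2) = {}"
      then have "y' \<le> y \<or> y \<le> x'" by force
      then show "\<exists>k::int. \<forall>t\<in>{x'..y'}. \<phi> t = \<phi> x' + of_int k * (t - x')"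
      proof
        assume "y' \<le> y" then show ?thesis using * by (intro S1(2)[rule_format]) auto
      next
        assume "y \<le> x'" then show ?thesis using * by (intro S2(2)[rule_format]) auto
      qed
    qed (use S1 S2 in auto)
  next
    fix x assume x: "a \<le> x" "x \<le> b"
    have "\<exists>(k::int). \<exists>d>0. x < b \<longrightarrow> (\<forall>h\<in>{0<..d}. \<phi> (x + h) = \<phi> x + of_int k * h)"
    proof (cases "x < b")
      case True
      then show ?thesis using right[of x] x unfolding eventually_at_right_0 by auto
    qed (auto intro: exI[of _ 1])
    then obtain d1 and k1 :: int where d1: "d1 > 0" "x < b \<Longrightarrow> h \<in> {0<..d1} \<Longrightarrow> \<phi> (x + h) = \<phi> x + of_int k1 * h" for h
      by blast
    have "\<exists>(k::int). \<exists>d>0. a < x \<longrightarrow> (\<forall>h\<in>{0<..d}. \<phi> (x - h) = \<phi> x + of_int k * h)"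
    proof (cases "a < x")
      case True
      then show ?thesis using left[of x] x unfolding eventually_at_right_0 by auto
    qed (auto intro: exI[of _ 1])
    then obtain d2 and k2 :: int where d2: "d2 > 0" "a < x \<Longrightarrow> h \<in> {0<..d2} \<Longrightarrow> \<phi> (x - h) = \<phi> x + of_int k2 * h" for h
      by blast
    have r: "\<phi> t = \<phi> x + of_int k1 * (t - x)" if "x \<le> t" "t - x < d1" "x < b" for t
      using d1(2)[of "t - x"] that by (cases "t = x") auto
    have l: "\<phi> t = \<phi> x - of_int k2 * (t - x)" if "t \<le> x" "x - t < d2" "a < x" for t
      using d2(2)[of "x - t"] that by (cases "t = x") (auto simp: algebra_simps)
    show "\<exists>d>0. \<forall>a' b'. a' \<le> x \<and> x \<le> b' \<and> b' - a' < d \<longrightarrow> P a' b'"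
    proof (intro exI[of _ "min d1 d2"] conjI allI impI)
      fix a' b' assume *: "a' \<le> x \<and> x \<le> b' \<and> b' - a' < min d1 d2"
      show "P a' b'" unfolding P_def
      proof (intro exI[of _ "{x}"] conjI allI impI)
        fix x' y' assume **: "a \<le> x' \<and> y' \<le> b \<and> a' \<le> x' \<and> x' < y' \<and> y' \<le> b' \<and> {x'<..<y'} \<inter> {x} = {}"
        then have "y' \<le> x \<or> x \<le> x'" by force
        then show "\<exists>k::int. \<forall>t\<in>{x'..y'}. \<phi> t = \<phi> x' + of_int k * (t - x')"
        proof
          assume y': "y' \<le> x"
          have "\<phi> t = \<phi> x' + of_int (- k2) * (t - x')" if "t \<in> {x'..y'}" for t
            using l[of t] l[of x'] y' that * ** by (simp add: algebra_simps)
          then show ?thesis by blast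
        next
          assume y': "x \<le> x'"
          have "\<phi> t = \<phi> x' + of_int k1 * (t - x')" if "t \<in> {x'..y'}" for t
            using r[of t] r[of x'] y' that * ** by (simp add: algebra_simps)
          then show ?thesis by blast
        qed
      qed simp
    qed (use d1 d2 in simp)
  qed (rule ab)
  then show ?thesis unfolding P_def by meson
qed

text \<open>The outgoing slopes at the two ends of a linear piece are opposite, so summing over the
  breakpoints telescopes. This serves both the degree of a principal divisor and the bends of a
  \<open>pencil\<close>.\<close>

lemma sum_consecutive:
  fixes R L :: "'a::linorder \<Rightarrow> 'b::ab_group_add"
  assumes "finite A" "A \<noteq> {}" "\<And>x y. x \<in> A \<Longrightarrow> y \<in> A \<Longrightarrow> x < y \<Longrightarrow> {x<..<y} \<inter> A = {} \<Longrightarrow> R x + L y = 0"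
  shows "sum R (A - {Max A}) + sum L (A - {Min A}) = 0"
  using assms
proof (induction rule: finite_linorder_max_induct)
  case (insert b A)
  show ?case
  proof (cases "A = {}")
    case False
    have MA: "Max A \<in> A" "Min A \<in> A" using insert.hyps False by auto
    have "Max A < b" "Min A < b" using insert.hyps MA by blast+
    have M: "Max (insert b A) = b"
      using insert.hyps by (intro Max_eqI) (auto intro: less_imp_le)
    have "Min (insert b A) = Min A"
      using insert.hyps MA \<open>Min A < b\<close> by (intro Min_eqI) (auto intro: less_imp_le)
    note M = M this
    have "x \<le> Max A" if "x \<in> A" for x using insert.hyps that by simp
    then have "{Max A<..<b} \<inter> insert b A = {}" by (auto simp flip: not_less)
    then have Rb: "R (Max A) + L b = 0" using MA insert.hyps by (intro insert.prems) auto
    have "sum R (A - {Max A}) + sum L (A - {Min A}) = 0"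
    proof (rule insert.IH[OF False])
      fix x y assume "x \<in> A" "y \<in> A" "x < y" "{x<..<y} \<inter> A = {}"
      moreover from this have "b \<notin> {x<..<y}" using insert.hyps by auto
      ultimately show "R x + L y = 0" by (intro insert.prems) auto
    qed
    moreover have "sum R (insert b A - {b}) = R (Max A) + sum R (A - {Max A})"
      using insert.hyps MA by (simp add: insert_Diff_if sum.remove[of A "Max A"])
        (metis Diff_empty Diff_insert0 order_less_irrefl sum.remove)
    moreover have "sum L (insert b A - {Min A}) = L b + sum L (A - {Min A})"
    proof -
      have "insert b A - {Min A} = insert b (A - {Min A})" "b \<notin> A - {Min A}"
        using insert.hyps MA by auto
      then show ?thesis using insert.hyps by simp
    qed
    ultimately show ?thesis using Rb unfolding M by (simp add: algebra_simps)
  qed simp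
qed simp

section \<open>Rational functions and germs of slopes\<close>

text \<open>A relation instead of a value: \<open>outgoing_slope\<close> is a definite description
  and is meaningful only once such a \<open>k\<close> is known to exist.\<close>

definition has_slope :: "('p, 'e) graph_model \<Rightarrow> ('p \<Rightarrow> real) \<Rightarrow> 'e \<times> real \<times> real \<Rightarrow> int \<Rightarrow> bool" where
  "has_slope G f \<delta> k \<longleftrightarrow> (\<forall>\<^sub>F h in at_right 0. f (along G \<delta> h) = f (along G \<delta> 0) + of_int k * h)"

lemma has_slope_unique:
  assumes "has_slope G f \<delta> k" "has_slope G f \<delta> l"
  shows "k = l"
proof -
  have "\<forall>\<^sub>F h::real in at_right 0. k = l"
    using assms[unfolded has_slope_def] eventually_at_right_less[of 0] by eventually_elim auto
  then show ?thesis by simp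
qed

lemma outgoing_slope_eq:
  assumes "has_slope G f \<delta> k"
  shows "outgoing_slope G f \<delta> = k"
proof -
  obtain e t \<sigma> where \<delta>: "\<delta> = (e, t, \<sigma>)" by (cases \<delta>)
  have "outgoing_slope G f \<delta> = (THE k. has_slope G f \<delta> k)"
    by (simp add: outgoing_slope_def has_slope_def \<delta>)
  then show ?thesis using assms has_slope_unique by (metis the_equality)
qed

lemma has_slope_const: "has_slope G (\<lambda>_. c) \<delta> 0"
  by (simp add: has_slope_def)

lemma has_slope_add: "has_slope G f \<delta> k \<Longrightarrow> has_slope G g \<delta> l \<Longrightarrow> has_slope G (\<lambda>x. f x + g x) \<delta> (k + l)"
  unfolding has_slope_def by (rule eventually_elim2, assumption, assumption) (simp add: algebra_simps)

lemma has_slope_uminus: "has_slope G f \<delta> k \<Longrightarrow> has_slope G (\<lambda>x. - f x) \<delta> (- k)"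
  unfolding has_slope_def by (auto elim!: eventually_mono)

lemma has_slope_max_const:
  assumes "has_slope G f \<delta> k"
  shows "has_slope G (\<lambda>x. max c (f x)) \<delta> (if f (along G \<delta> 0) > c then k else if f (along G \<delta> 0) = c then max 0 k else 0)"
proof -
  let ?a = "f (along G \<delta> 0)"
  note s = assms[unfolded has_slope_def] and pos = eventually_at_right_less[of "0::real"]
  consider "?a > c" | "?a = c" | "?a < c" by linarith
  then show ?thesis
  proof cases
    case 1
    have "\<forall>\<^sub>F h in at_right 0. c + 0 * h < ?a + of_int k * h" using 1 by (rule eventually_affine_less)
    with s have "\<forall>\<^sub>F h in at_right 0. max c (f (along G \<delta> h)) = max c ?a + of_int k * h"
      by eventually_elim (use 1 in auto)
    then show ?thesis using 1 by (simp add: has_slope_def)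
  next
    case 2
    have "\<forall>\<^sub>F h in at_right 0. max c (f (along G \<delta> h)) = max c ?a + of_int (max 0 k) * h"
      using s pos
    proof eventually_elim
      case (elim h)
      have "max c (f (along G \<delta> h)) = c + max 0 (of_int k * h)" using elim 2 by (simp add: max_def)
      also have "max 0 (of_int k * h) = of_int (max 0 k) * h"
        using elim(2) by (auto simp: max_def mult_le_0_iff zero_le_mult_iff)
      finally show ?case using 2 by simp
    qed
    then show ?thesis using 2 by (simp add: has_slope_def)
  next
    case 3
    have "\<forall>\<^sub>F h in at_right 0. ?a + of_int k * h < c + 0 * h" using 3 by (rule eventually_affine_less)
    with s have "\<forall>\<^sub>F h in at_right 0. max c (f (along G \<delta> h)) = max c ?a + of_int 0 * h"
      by eventually_elim (use 3 in auto)
    then show ?thesis using 3 by (simp add: has_slope_def)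
  qed
qed

lemma directions_range:
  assumes "(e, t, \<sigma>) \<in> directions G v"
  obtains c where "0 < c" "\<And>h. h \<in> {0..c} \<Longrightarrow> t + \<sigma> * h \<in> {0..elen G e}"
proof (rule that[of "if \<sigma> = 1 then elen G e - t else t"])
qed (use assms in \<open>auto simp: directions_def split: if_splits\<close>)

lemma directions_range_ev:
  assumes "(e, t, \<sigma>) \<in> directions G v"
  shows "\<forall>\<^sub>F h in at_right 0. t + \<sigma> * h \<in> {0<..<elen G e}"
proof -
  obtain c where c: "0 < c" "\<And>h. h \<in> {0..c} \<Longrightarrow> t + \<sigma> * h \<in> {0..elen G e}"
    using directions_range[OF assms] by blast
  have "t + \<sigma> * h \<in> {0<..<elen G e}" if "h \<in> {0<..c / 2}" for h
    using c(2)[of "2 * h"] c(2)[of 0] that c(1) assms by (auto simp: directions_def)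
  then show ?thesis unfolding eventually_at_right_0 using c(1) by (intro exI[of _ "c / 2"]) auto
qed

context tropical_curve
begin

lemma has_slope_ord:
  assumes "\<And>\<delta>. \<delta> \<in> directions G v \<Longrightarrow> has_slope G f \<delta> (s \<delta>)"
  shows "ord_at G f v = (\<Sum>\<delta>\<in>directions G v. s \<delta>)"
  unfolding ord_at_def by (rule sum.cong[OF HOL.refl]) (intro outgoing_slope_eq assms)

lemma has_slope_linear:
  assumes "\<And>t. t \<in> {x..y} \<Longrightarrow> f (epar G e t) = f (epar G e x) + of_int k * (t - x)" "x < y"
  shows "has_slope G f (e, x, 1) k" "has_slope G f (e, y, -1) (- k)"
proof -
  have "\<forall>\<^sub>F h in at_right 0. 0 < h \<and> h \<le> y - x" using assms(2) by (intro eventually_at_right_0_le) simp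
  then show "has_slope G f (e, x, 1) k" unfolding has_slope_def
  proof eventually_elim
    case (elim h)
    then show ?case using assms(1)[of "x + h"] by simp
  qed
  have "\<forall>\<^sub>F h in at_right 0. 0 < h \<and> h \<le> y - x" using assms(2) by (intro eventually_at_right_0_le) simp
  then show "has_slope G f (e, y, -1) (- k)" unfolding has_slope_def
  proof eventually_elim
    case (elim h)
    then show ?case using assms(1)[of "y - h"] assms(1)[of y] assms(2) by (simp add: algebra_simps)
  qed
qed

text \<open>Linear germs in all directions are easier to combine, and to carry to another model,
  than sets of breakpoints; \<open>pl_pieces\<close> recovers finiteness.\<close>

lemma rational_iff:
  "rational_function \<Gamma> G f \<longleftrightarrow>
    continuous_on \<Gamma> f \<and> (\<forall>v\<in>\<Gamma>. \<forall>\<delta>\<in>directions G v. \<exists>k. has_slope G f \<delta> k)" (is "_ \<longleftrightarrow> _ \<and> ?pl")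
proof (intro iffI conjI)
  assume r: "rational_function \<Gamma> G f"
  then show "continuous_on \<Gamma> f" by (simp add: rational_function_def)
  show ?pl
  proof (intro ballI)
    fix v \<delta> assume "v \<in> \<Gamma>" "\<delta> \<in> directions G v"
    then obtain e t \<sigma> where \<delta>: "\<delta> = (e, t, \<sigma>)" "e \<in> edges G" "t \<in> {0..elen G e}"
      and dir: "\<sigma> = 1 \<and> t < elen G e \<or> \<sigma> = - 1 \<and> 0 < t" by (auto simp: directions_def)
    obtain S where S: "finite S" "\<And>a b. 0 \<le> a \<Longrightarrow> a < b \<Longrightarrow> b \<le> elen G e \<Longrightarrow> {a<..<b} \<inter> S = {} \<Longrightarrow>
      \<exists>k::int. \<forall>t\<in>{a..b}. f (epar G e t) = f (epar G e a) + of_int k * (t - a)"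
      using r \<delta>(2) unfolding rational_function_def by metis
    have "\<exists>c>0. \<forall>s\<in>S - {t}. c \<le> dist t s"
      using finite_set_avoid[OF S(1), of t] by (metis DiffE insertI1)
    then obtain c where c: "c > 0" "\<And>s. s \<in> S \<Longrightarrow> s \<noteq> t \<Longrightarrow> c \<le> dist t s" by blast
    from dir show "\<exists>k. has_slope G f \<delta> k"
    proof
      assume d: "\<sigma> = 1 \<and> t < elen G e"
      define b where "b = min (elen G e) (t + c)"
      have "t < b" "b \<le> elen G e" "0 \<le> t" using d c \<delta> by (auto simp: b_def)
      moreover have "{t<..<b} \<inter> S = {}"
      proof (intro equalityI subsetI)
        fix s assume "s \<in> {t<..<b} \<inter> S"
        then show "s \<in> {}" using c(2)[of s] by (simp add: b_def dist_real_def)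
      qed simp
      ultimately have "\<exists>k::int. \<forall>s\<in>{t..b}. f (epar G e s) = f (epar G e t) + of_int k * (s - t)"
        by (intro S(2))
      then obtain k :: int where "\<forall>s\<in>{t..b}. f (epar G e s) = f (epar G e t) + of_int k * (s - t)" ..
      then have "has_slope G f (e, t, 1) k" using \<open>t < b\<close> by (intro has_slope_linear(1)) (rule bspec)
      then show ?thesis using d \<delta>(1) by (intro exI[of _ k]) simp
    next
      assume d: "\<sigma> = -1 \<and> 0 < t"
      define b where "b = max 0 (t - c)"
      have "b < t" "0 \<le> b" "t \<le> elen G e" using d c \<delta> by (auto simp: b_def)
      moreover have "{b<..<t} \<inter> S = {}"
      proof (intro equalityI subsetI)
        fix s assume "s \<in> {b<..<t} \<inter> S"
        then show "s \<in> {}" using c(2)[of s] by (simp add: b_def dist_real_def)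
      qed simp
      ultimately have "\<exists>k::int. \<forall>s\<in>{b..t}. f (epar G e s) = f (epar G e b) + of_int k * (s - b)"
        by (intro S(2))
      then obtain k :: int where "\<forall>s\<in>{b..t}. f (epar G e s) = f (epar G e b) + of_int k * (s - b)" ..
      then have "has_slope G f (e, t, -1) (- k)" using \<open>b < t\<close> by (intro has_slope_linear(2)) (rule bspec)
      then show ?thesis using d \<delta>(1) by (intro exI[of _ "- k"]) simp
    qed
  qed
next
  assume c: "continuous_on \<Gamma> f \<and> ?pl"
  have "\<exists>S. finite S \<and> (\<forall>x y. 0 \<le> x \<and> x < y \<and> y \<le> elen G e \<and> {x<..<y} \<inter> S = {} \<longrightarrow>
    (\<exists>k::int. \<forall>t\<in>{x..y}. f (epar G e t) = f (epar G e x) + of_int k * (t - x)))" if e: "e \<in> edges G" for e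
  proof (rule pl_pieces)
    fix t assume t: "t \<in> {0..<elen G e}"
    then have "(e, t, 1) \<in> directions G (epar G e t)" "epar G e t \<in> \<Gamma>"
      using e by (auto simp: directions_def intro!: epar_in)
    then have "\<exists>k. has_slope G f (e, t, 1) k" using c by blast
    then show "\<exists>k::int. \<forall>\<^sub>F h in at_right 0. f (epar G e (t + h)) = f (epar G e t) + of_int k * h"
      by (simp add: has_slope_def)
  next
    fix t assume t: "t \<in> {0<..elen G e}"
    then have "(e, t, -1) \<in> directions G (epar G e t)" "epar G e t \<in> \<Gamma>"
      using e by (auto simp: directions_def intro!: epar_in)
    then have "\<exists>k. has_slope G f (e, t, -1) k" using c by blast
    then show "\<exists>k::int. \<forall>\<^sub>F h in at_right 0. f (epar G e (t - h)) = f (epar G e t) + of_int k * h"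
      by (simp add: has_slope_def)
  qed (use elen_pos[OF e] in simp)
  then show "rational_function \<Gamma> G f" using c by (simp add: rational_function_def)
qed

lemma rationalI:
  assumes "continuous_on \<Gamma> f"
    and "\<And>v \<delta>. v \<in> \<Gamma> \<Longrightarrow> \<delta> \<in> directions G v \<Longrightarrow> \<exists>k. has_slope G f \<delta> k"
  shows "rational_function \<Gamma> G f"
  using assms by (simp add: rational_iff)

lemma rational_continuous: "rational_function \<Gamma> G f \<Longrightarrow> continuous_on \<Gamma> f"
  by (simp add: rational_function_def)

lemma rational_slope:
  "rational_function \<Gamma> G f \<Longrightarrow> v \<in> \<Gamma> \<Longrightarrow> \<delta> \<in> directions G v \<Longrightarrow> has_slope G f \<delta> (outgoing_slope G f \<delta>)"
  using rational_iff outgoing_slope_eq by metis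

lemma rational_add:
  assumes "rational_function \<Gamma> G f" "rational_function \<Gamma> G g"
  shows "rational_function \<Gamma> G (\<lambda>x. f x + g x)"
    and "v \<in> \<Gamma> \<Longrightarrow> ord_at G (\<lambda>x. f x + g x) v = ord_at G f v + ord_at G g v"
proof -
  show "rational_function \<Gamma> G (\<lambda>x. f x + g x)"
    using assms rational_slope by (intro rationalI[OF continuous_on_add] rational_continuous) (blast intro: has_slope_add)+
  assume "v \<in> \<Gamma>"
  then have "ord_at G (\<lambda>x. f x + g x) v = (\<Sum>\<delta>\<in>directions G v. outgoing_slope G f \<delta> + outgoing_slope G g \<delta>)"
    using assms by (intro has_slope_ord has_slope_add rational_slope)
  then show "ord_at G (\<lambda>x. f x + g x) v = ord_at G f v + ord_at G g v"
    by (simp add: sum.distrib ord_at_def)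
qed

lemma rational_uminus:
  assumes "rational_function \<Gamma> G f"
  shows "rational_function \<Gamma> G (\<lambda>x. - f x)"
    and "v \<in> \<Gamma> \<Longrightarrow> ord_at G (\<lambda>x. - f x) v = - ord_at G f v"
proof -
  show "rational_function \<Gamma> G (\<lambda>x. - f x)"
    using assms rational_slope by (intro rationalI[OF continuous_on_minus] rational_continuous) (blast intro: has_slope_uminus)+
  assume "v \<in> \<Gamma>"
  then have "ord_at G (\<lambda>x. - f x) v = (\<Sum>\<delta>\<in>directions G v. - outgoing_slope G f \<delta>)"
    using assms by (intro has_slope_ord has_slope_uminus rational_slope)
  then show "ord_at G (\<lambda>x. - f x) v = - ord_at G f v"
    by (simp add: sum_negf ord_at_def)
qed

lemma rational_const: "rational_function \<Gamma> G (\<lambda>_. c)" "ord_at G (\<lambda>_. c) v = 0"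
  using has_slope_ord[of v "\<lambda>_. c" "\<lambda>_. 0"] has_slope_const
  by (auto intro!: rationalI intro: has_slope_const)

lemma rational_max_const:
  assumes "rational_function \<Gamma> G f"
  shows "rational_function \<Gamma> G (\<lambda>x. max c (f x))"
  using assms rational_slope
  by (intro rationalI[OF continuous_on_max[OF continuous_on_const]] rational_continuous) (blast intro: has_slope_max_const)+

text \<open>From a point slightly further on, the same linear piece is seen backwards. This turns
  upper bounds for all slopes into lower bounds.\<close>

lemma has_slope_reverse:
  assumes "has_slope G f (e, t, \<sigma>) k" "(e, t, \<sigma>) \<in> directions G v"
  shows "\<exists>x\<in>\<Gamma>. \<exists>\<delta>\<in>directions G x. has_slope G f \<delta> (- k)"
proof -
  from assms(1)[unfolded has_slope_def] directions_range_ev[OF assms(2)]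
  have "\<forall>\<^sub>F h in at_right 0. f (along G (e, t, \<sigma>) h) = f (along G (e, t, \<sigma>) 0) + of_int k * h \<and> t + \<sigma> * h \<in> {0<..<elen G e}"
    by eventually_elim blast
  then obtain c where c: "c > 0" "\<And>h. h \<in> {0<..c} \<Longrightarrow> f (along G (e, t, \<sigma>) h) = f (along G (e, t, \<sigma>) 0) + of_int k * h \<and>
      t + \<sigma> * h \<in> {0<..<elen G e}"
    unfolding eventually_at_right_0 by blast
  define \<delta> where "\<delta> = (e, t + \<sigma> * c, - \<sigma>)"
  have e: "e \<in> edges G" "\<sigma> = 1 \<or> \<sigma> = -1" using assms(2) by (auto simp: directions_def)
  have "t + \<sigma> * c \<in> {0<..<elen G e}" using c by simp
  then have \<delta>: "\<delta> \<in> directions G (epar G e (t + \<sigma> * c))" "epar G e (t + \<sigma> * c) \<in> \<Gamma>"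
    using e by (auto simp: directions_def \<delta>_def intro!: epar_in)
  have "\<forall>\<^sub>F h in at_right 0. 0 < h \<and> h \<le> c / 2" using c by (intro eventually_at_right_0_le) simp
  then have "has_slope G f \<delta> (- k)" unfolding has_slope_def
  proof eventually_elim
    case (elim h)
    have "along G \<delta> h = along G (e, t, \<sigma>) (c - h)" "along G \<delta> 0 = along G (e, t, \<sigma>) c"
      by (simp_all add: \<delta>_def algebra_simps)
    then show ?case using c(2)[of "c - h"] c(2)[of c] elim c(1) by (simp add: algebra_simps)
  qed
  then show ?thesis using \<delta> by blast
qed

lemma continuous_Lipschitz:
  assumes L: "\<And>e s t. e \<in> edges G \<Longrightarrow> s \<in> {0..elen G e} \<Longrightarrow> t \<in> {0..elen G e} \<Longrightarrow>
      \<bar>f (epar G e s) - f (epar G e t)\<bar> \<le> C * \<bar>s - t\<bar>"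
    and C: "0 \<le> C"
  shows "continuous_on \<Gamma> f"
  unfolding continuous_on_iff
proof (intro ballI allI impI)
  fix x and \<epsilon> :: real assume x: "x \<in> \<Gamma>" "0 < \<epsilon>"
  show "\<exists>\<delta>>0. \<forall>y\<in>\<Gamma>. dist y x < \<delta> \<longrightarrow> dist (f y) (f x) < \<epsilon>"
  proof (intro exI conjI ballI impI)
    show "0 < \<epsilon> / (C + 1)" using x C by simp
    fix y assume y: "y \<in> \<Gamma>" "dist y x < \<epsilon> / (C + 1)"
    have "\<bar>f y - f x\<bar> \<le> C * dist y x" using x y by (intro Lipschitz_dist L C)
    also have "\<dots> \<le> (C + 1) * dist y x" by (intro mult_right_mono) auto
    also have "\<dots> < \<epsilon>" using y(2) C by (simp add: field_simps)
    finally show "dist (f y) (f x) < \<epsilon>" by (simp add: dist_real_def)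
  qed
qed

text \<open>After regrouping the directions at the points of \<open>W\<close> by edges, every linear
  piece contributes its two outgoing end slopes, which cancel. So principal divisors have degree
  0.\<close>

lemma sum_ord_zero:
  assumes r: "rational_function \<Gamma> G f"
  shows "finite {v \<in> \<Gamma>. ord_at G f v \<noteq> 0}"
    and "finite W \<Longrightarrow> W \<subseteq> \<Gamma> \<Longrightarrow> {v \<in> \<Gamma>. ord_at G f v \<noteq> 0} \<subseteq> W \<Longrightarrow> (\<Sum>v\<in>W. ord_at G f v) = 0"
proof -
  let ?s = "outgoing_slope G f"
  have "\<forall>e\<in>edges G. \<exists>S. finite S \<and> (\<forall>a b. 0 \<le> a \<and> a < b \<and> b \<le> elen G e \<and> {a<..<b} \<inter> S = {} \<longrightarrow>
      (\<exists>k::int. \<forall>t\<in>{a..b}. f (epar G e t) = f (epar G e a) + of_int k * (t - a)))"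
    using r by (simp add: rational_function_def)
  then obtain S where S: "\<And>e. e \<in> edges G \<Longrightarrow> finite (S e)"
    "\<And>e a b. e \<in> edges G \<Longrightarrow> 0 \<le> a \<and> a < b \<and> b \<le> elen G e \<and> {a<..<b} \<inter> S e = {} \<Longrightarrow>
      \<exists>k::int. \<forall>t\<in>{a..b}. f (epar G e t) = f (epar G e a) + of_int k * (t - a)"
    by (metis (no_types, lifting))
  define W0 where "W0 = verts G \<union> (\<Union>e\<in>edges G. epar G e ` ({0..elen G e} \<inter> S e))"
  have W0: "finite W0" "W0 \<subseteq> \<Gamma>"
    using finite_verts finite_edges S(1) verts_subset epar_in by (auto simp: W0_def)
  have zero: "(\<Sum>v\<in>W. ord_at G f v) = 0" if W: "finite W" "W0 \<subseteq> W" "W \<subseteq> \<Gamma>" for W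
  proof -
    define T where "T e = {t \<in> {0..elen G e}. epar G e t \<in> W}" for e
    define U where "U e = (\<lambda>t. (e, t, 1::real)) ` (T e - {elen G e}) \<union> (\<lambda>t. (e, t, -1)) ` (T e - {0})" for e
    have finT: "finite (T e)" if "e \<in> edges G" for e
      unfolding T_def using that W(1) by (rule finite_params)
    have "(\<Sum>v\<in>W. ord_at G f v) = (\<Sum>v\<in>W. sum ?s (directions G v))"
      by (simp add: ord_at_def)
    also have "\<dots> = sum ?s (\<Union>v\<in>W. directions G v)"
      using W(1) finite_directions
      by (intro sum.UNION_disjoint[symmetric]) (auto simp: directions_def)
    also have "(\<Union>v\<in>W. directions G v) = (\<Union>e\<in>edges G. U e)"
      by (auto simp: directions_def U_def T_def image_iff)
    also have "sum ?s \<dots> = (\<Sum>e\<in>edges G. sum ?s (U e))"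
      using finite_edges finT
      by (intro sum.UNION_disjoint) (auto simp: U_def)
    also have "\<dots> = (\<Sum>e\<in>edges G. 0)"
    proof (rule sum.cong[OF HOL.refl])
      fix e assume e: "e \<in> edges G"
      have T0: "0 \<in> T e" "elen G e \<in> T e"
        using e W(2) epar_0[OF e] epar_elen[OF e] elen_pos[OF e] by (auto simp: T_def W0_def)
      have "Max (T e) = elen G e" "Min (T e) = 0"
        using T0 finT[OF e] by (auto intro!: Max_eqI Min_eqI simp: T_def)
      moreover have "(\<Sum>t\<in>T e - {Max (T e)}. ?s (e, t, 1)) + (\<Sum>t\<in>T e - {Min (T e)}. ?s (e, t, -1)) = 0"
      proof (rule sum_consecutive[OF finT[OF e]])
        fix x y assume xy: "x \<in> T e" "y \<in> T e" "x < y" "{x<..<y} \<inter> T e = {}"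
        have "z \<in> T e" if "z \<in> {x<..<y} \<inter> S e" for z
        proof -
          have "z \<in> {0..elen G e} \<inter> S e" using that xy by (auto simp: T_def)
          then have "epar G e z \<in> W0" unfolding W0_def using e by blast
          then show ?thesis using W(2) that xy by (auto simp: T_def)
        qed
        then have "{x<..<y} \<inter> S e = {}" using xy(4) by blast
        then obtain k :: int where k: "\<forall>t\<in>{x..y}. f (epar G e t) = f (epar G e x) + of_int k * (t - x)"
          using S(2)[OF e, of x y] xy by (auto simp: T_def)
        have "has_slope G f (e, x, 1) k" "has_slope G f (e, y, -1) (- k)"
          using k xy(3) by (auto intro!: has_slope_linear simp del: of_int_minus)
        then show "?s (e, x, 1) + ?s (e, y, -1) = 0" by (simp add: outgoing_slope_eq)
      qed (use T0 in auto)
      moreover have "sum ?s (U e) = (\<Sum>t\<in>T e - {elen G e}. ?s (e, t, 1)) + (\<Sum>t\<in>T e - {0}. ?s (e, t, -1))"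
        unfolding U_def using finT[OF e]
        by (subst sum.union_disjoint) (auto simp: sum.reindex inj_on_def)
      ultimately show "sum ?s (U e) = 0" by simp
    qed
    finally show ?thesis by simp
  qed
  \<comment> \<open>The sum vanishes over every admissible set containing \<open>W0\<close>; adding
    the single point \<open>x\<close> to \<open>W0\<close> isolates its order.\<close>
  have off: "ord_at G f x = 0" if "x \<in> \<Gamma>" "x \<notin> W0" for x
    using zero[of "insert x W0"] zero[of W0] W0 that by auto
  then have sub: "{v \<in> \<Gamma>. ord_at G f v \<noteq> 0} \<subseteq> W0" by blast
  then show "finite {v \<in> \<Gamma>. ord_at G f v \<noteq> 0}" using W0(1) finite_subset by blast
  assume W: "finite W" "W \<subseteq> \<Gamma>" "{v \<in> \<Gamma>. ord_at G f v \<noteq> 0} \<subseteq> W"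
  have "(\<Sum>v\<in>W. ord_at G f v) = (\<Sum>v\<in>W \<union> W0. ord_at G f v)"
    using W W0 by (intro sum.mono_neutral_left) auto
  also have "\<dots> = 0" using W W0 by (intro zero) auto
  finally show "(\<Sum>v\<in>W. ord_at G f v) = 0" .
qed

lemma div_degree_nonneg: "effective E \<Longrightarrow> 0 \<le> div_degree E"
  by (auto simp: div_degree_def effective_def intro: sum_nonneg)

lemma sum_le_div_degree:
  assumes "effective E" "finite W"
  shows "(\<Sum>x\<in>W. Poly_Mapping.lookup E x) \<le> div_degree E"
proof -
  have "(\<Sum>x\<in>W. Poly_Mapping.lookup E x) = (\<Sum>x\<in>W \<inter> Poly_Mapping.keys E. Poly_Mapping.lookup E x)"
    using assms by (intro sum.mono_neutral_right) (auto simp: in_keys_iff)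
  also have "\<dots> \<le> div_degree E" unfolding div_degree_def
    using assms by (intro sum_mono2) (auto simp: effective_def)
  finally show ?thesis .
qed

text \<open>The degree of \<open>div (max c f)\<close> bounds the slopes of \<open>f\<close> at the level \<open>c\<close>.\<close>

lemma slope_bound:
  assumes r: "rational_function \<Gamma> G f" and E: "divisor \<Gamma> E" "effective E"
    and nonneg: "\<And>x. x \<in> \<Gamma> \<Longrightarrow> 0 \<le> Poly_Mapping.lookup E x + ord_at G f x"
    and "v \<in> \<Gamma>" "\<delta> \<in> directions G v" "has_slope G f \<delta> k"
  shows "\<bar>k\<bar> \<le> div_degree E"
proof -
  have le: "k \<le> div_degree E" if v: "v \<in> \<Gamma>" "\<delta> \<in> directions G v" "has_slope G f \<delta> k" for v \<delta> k
  proof (cases "k \<le> 0")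
    case False
    \<comment> \<open>Truncation replaces the slopes at \<open>v\<close> by their positive parts, so
      that \<open>k\<close> cannot be cancelled by negative slopes, while the orders elsewhere stay
      at least \<open>- E\<close>.\<close>
    define g where "g x = max (f v) (f x)" for x
    let ?s = "outgoing_slope G f"
    have gr: "rational_function \<Gamma> G g" unfolding g_def using r by (rule rational_max_const)
    have og: "ord_at G g x = (\<Sum>\<delta>\<in>directions G x. if f x > f v then ?s \<delta> else if f x = f v then max 0 (?s \<delta>) else 0)"
      if "x \<in> \<Gamma>" for x
    proof (rule has_slope_ord)
      fix \<delta> assume \<delta>: "\<delta> \<in> directions G x"
      show "has_slope G g \<delta> (if f x > f v then ?s \<delta> else if f x = f v then max 0 (?s \<delta>) else 0)"
        using has_slope_max_const[OF rational_slope[OF r that \<delta>], of "f v"]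
        unfolding g_def along_0[OF \<delta>] .
    qed
    have lower: "- Poly_Mapping.lookup E x \<le> ord_at G g x" if x: "x \<in> \<Gamma>" for x
    proof -
      consider "f x > f v" | "f x = f v" | "f x < f v" by linarith
      then show ?thesis
      proof cases
        case 1
        then have "ord_at G g x = ord_at G f x" using og[OF x] by (simp add: ord_at_def)
        then show ?thesis using nonneg[OF x] by simp
      next
        case 2
        then have "0 \<le> ord_at G g x" using og[OF x] by (auto intro: sum_nonneg)
        moreover have "0 \<le> Poly_Mapping.lookup E x" using E(2) by (simp add: effective_def)
        ultimately show ?thesis by linarith
      next
        case 3
        then show ?thesis using og[OF x] E(2) by (simp add: effective_def)
      qed
    qed
    have "?s \<delta> = k" using v(3) by (rule outgoing_slope_eq)
    then have "k \<le> max 0 (?s \<delta>)" by simp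
    also have "\<dots> \<le> (\<Sum>\<delta>\<in>directions G v. max 0 (?s \<delta>))"
      using v(2) finite_directions by (intro member_le_sum) auto
    finally have kv: "k \<le> ord_at G g v" using og[OF v(1)] by simp
    define W where "W = insert v {x \<in> \<Gamma>. ord_at G g x \<noteq> 0}"
    have W: "finite W" "W \<subseteq> \<Gamma>" "v \<in> W" using sum_ord_zero(1)[OF gr] v by (auto simp: W_def)
    have "0 = (\<Sum>x\<in>W. ord_at G g x)" using W by (intro sum_ord_zero(2)[OF gr, symmetric]) (auto simp: W_def)
    also have "\<dots> = ord_at G g v + (\<Sum>x\<in>W - {v}. ord_at G g x)" using W by (simp add: sum.remove)
    also have "\<dots> \<ge> k + (\<Sum>x\<in>W - {v}. - Poly_Mapping.lookup E x)"
      using W by (intro add_mono kv sum_mono lower) auto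
    finally have "k \<le> (\<Sum>x\<in>W - {v}. Poly_Mapping.lookup E x)" by (simp add: sum_negf)
    also have "\<dots> \<le> div_degree E" using E W by (intro sum_le_div_degree) auto
    finally show ?thesis .
  qed (use div_degree_nonneg[OF E(2)] in auto)
  obtain e t \<sigma> where "\<delta> = (e, t, \<sigma>)" by (cases \<delta>)
  then obtain x \<delta>' where "x \<in> \<Gamma>" "\<delta>' \<in> directions G x" "has_slope G f \<delta>' (- k)"
    using has_slope_reverse assms(6,7) by blast
  then show ?thesis using le[of v \<delta> k] le[of x \<delta>' "- k"] assms(5-7) by (simp add: abs_le_iff)
qed

section \<open>The largest function in a linear system\<close>

text \<open>The inequality is required on the whole rest of the edge and not only for a germ:
  inequalities between values at fixed points survive suprema, germs do not.\<close>

definition supports :: "('p \<Rightarrow> real) \<Rightarrow> ('e \<times> real \<times> real \<Rightarrow> int) \<Rightarrow> 'p \<Rightarrow> bool" where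
  "supports f m x \<longleftrightarrow> (\<forall>(e, t, \<sigma>)\<in>directions G x. \<forall>s\<in>{0..elen G e}. 0 \<le> \<sigma> * (s - t) \<longrightarrow>
     f x + of_int (m (e, t, \<sigma>)) * \<bar>s - t\<bar> \<le> f (epar G e s))"

text \<open>For a divisor \<open>E\<close> supported on vertices, these are the rational functions \<open>f\<close> with
  \<open>E + div f\<close> effective. Unlike that condition, the present one is visibly preserved by suprema.\<close>

definition supported :: "('p \<Rightarrow>\<^sub>0 int) \<Rightarrow> ('p \<Rightarrow> real) \<Rightarrow> bool" where
  "supported E f \<longleftrightarrow> (\<forall>x\<in>\<Gamma>. \<exists>m. (\<forall>\<delta>\<in>directions G x. \<bar>m \<delta>\<bar> \<le> div_degree E) \<and>
     - Poly_Mapping.lookup E x \<le> (\<Sum>\<delta>\<in>directions G x. m \<delta>) \<and> supports f m x)"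

text \<open>As \<open>E\<close> vanishes inside the edges, nonnegativity of \<open>E + div f\<close>
  makes \<open>f\<close> convex on every edge, so its germ slopes support it on the whole rest of
  the edge.\<close>

lemma rational_supported:
  assumes r: "rational_function \<Gamma> G f" and E: "divisor \<Gamma> E" "effective E" "Poly_Mapping.keys E \<subseteq> verts G"
    and nonneg: "\<And>x. x \<in> \<Gamma> \<Longrightarrow> 0 \<le> Poly_Mapping.lookup E x + ord_at G f x"
  shows "supported E f"
  unfolding supported_def
proof (intro ballI exI conjI)
  let ?s = "outgoing_slope G f"
  fix x assume x: "x \<in> \<Gamma>"
  show "\<bar>?s \<delta>\<bar> \<le> div_degree E" if "\<delta> \<in> directions G x" for \<delta>
    by (rule slope_bound[OF r E(1,2) nonneg x that rational_slope[OF r x that]])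
  show "- Poly_Mapping.lookup E x \<le> sum ?s (directions G x)"
    using nonneg[OF x] by (simp add: ord_at_def)
  show "supports f ?s x" unfolding supports_def
  proof (intro ballI, clarify)
    fix e t \<sigma> s assume d: "(e, t, \<sigma>) \<in> directions G x" "s \<in> {0..elen G e}" "0 \<le> \<sigma> * (s - t)"
    then have e: "e \<in> edges G" "t \<in> {0..elen G e}" "epar G e t = x" "\<sigma> = 1 \<or> \<sigma> = -1"
      by (auto simp: directions_def)
    have right: "\<forall>\<^sub>F h in at_right 0. f (epar G e (t + h)) = f (epar G e t) + of_int (?s (e, t, 1)) * h"
      if "t \<in> {0..<elen G e}" for t
    proof -
      have "epar G e t \<in> \<Gamma>" using that e(1) by (intro epar_in) auto
      moreover have "(e, t, 1) \<in> directions G (epar G e t)" using that e(1) by (auto simp: directions_def)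
      ultimately show ?thesis using rational_slope[OF r, of "epar G e t" "(e, t, 1)"] by (simp add: has_slope_def)
    qed
    have left: "\<forall>\<^sub>F h in at_right 0. f (epar G e (t - h)) = f (epar G e t) + of_int (?s (e, t, -1)) * h"
      if "t \<in> {0<..elen G e}" for t
    proof -
      have "epar G e t \<in> \<Gamma>" using that e(1) by (intro epar_in) auto
      moreover have "(e, t, -1) \<in> directions G (epar G e t)" using that e(1) by (auto simp: directions_def)
      ultimately show ?thesis using rational_slope[OF r, of "epar G e t" "(e, t, -1)"] by (simp add: has_slope_def)
    qed
    have conv: "0 \<le> real_of_int (?s (e, t, 1)) + of_int (?s (e, t, -1))" if "t \<in> {0<..<elen G e}" for t
    proof -
      have "epar G e t \<in> \<Gamma>" using that e(1) by (intro epar_in) auto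
      moreover have "Poly_Mapping.lookup E (epar G e t) = 0"
        using epar_interior[OF e(1) that] E(3) by (auto simp: in_keys_iff)
      ultimately have "0 \<le> ?s (e, t, 1) + ?s (e, t, -1)"
        using nonneg[of "epar G e t"] directions_interior[OF e(1) that] by (simp add: ord_at_def)
      then show ?thesis by linarith
    qed
    note cp = convex_pl_support[of 0 "elen G e" "\<lambda>s. f (epar G e s)" "\<lambda>t. of_int (?s (e, t, 1))"
        "\<lambda>t. of_int (?s (e, t, -1))", OF right left conv]
    consider "s = t" | "\<sigma> = 1" "t < s" | "\<sigma> = -1" "s < t" using e(4) d(3) by fastforce
    then show "f x + of_int (?s (e, t, \<sigma>)) * \<bar>s - t\<bar> \<le> f (epar G e s)"
    proof cases
      case 2
      then show ?thesis using cp(1)[of t s] d(2) e by auto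
    next
      case 3
      then show ?thesis using cp(2)[of s t] d(2) e by auto
    qed (use e in auto)
  qed
qed

lemma supported_Lipschitz:
  assumes f: "supported E f" and e: "e \<in> edges G" and "s \<in> {0..elen G e}" "t \<in> {0..elen G e}"
  shows "\<bar>f (epar G e s) - f (epar G e t)\<bar> \<le> of_int (div_degree E) * \<bar>s - t\<bar>"
proof -
  have *: "f (epar G e t) - of_int (div_degree E) * \<bar>s - t\<bar> \<le> f (epar G e s)"
    if st: "s \<in> {0..elen G e}" "t \<in> {0..elen G e}" for s t
  proof (cases "s = t")
    case False
    define \<sigma> where "\<sigma> = (if t < s then 1 else -1::real)"
    have d: "(e, t, \<sigma>) \<in> directions G (epar G e t)" "0 \<le> \<sigma> * (s - t)"
      using st e False by (auto simp: directions_def \<sigma>_def)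
    obtain m where m: "\<And>\<delta>. \<delta> \<in> directions G (epar G e t) \<Longrightarrow> \<bar>m \<delta>\<bar> \<le> div_degree E"
      "supports f m (epar G e t)"
      using f epar_in[OF e st(2)] unfolding supported_def by metis
    have "f (epar G e t) + of_int (m (e, t, \<sigma>)) * \<bar>s - t\<bar> \<le> f (epar G e s)"
      using m(2) d st(1) unfolding supports_def by fast
    moreover have "- real_of_int (div_degree E) \<le> of_int (m (e, t, \<sigma>))" using m(1)[OF d(1)] by linarith
    then have "- real_of_int (div_degree E) * \<bar>s - t\<bar> \<le> of_int (m (e, t, \<sigma>)) * \<bar>s - t\<bar>"
      by (intro mult_right_mono) auto
    ultimately show ?thesis by linarith
  qed simp
  from *[OF assms(3,4)] *[OF assms(4,3)] show ?thesis by (simp add: abs_le_iff abs_minus_commute)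
qed

text \<open>At an interior point \<open>E\<close> vanishes and the two supporting slopes have
  nonnegative sum, so the line of the right one also lies below \<open>f\<close> on the left. At an
  end there is only one side.\<close>

lemma supported_edge:
  assumes f: "supported E f" and E: "Poly_Mapping.keys E \<subseteq> verts G"
    and e: "e \<in> edges G" and t: "t \<in> {0..elen G e}"
  obtains m :: int where "\<bar>m\<bar> \<le> div_degree E"
    "\<And>s. s \<in> {0..elen G e} \<Longrightarrow> f (epar G e t) + of_int m * (s - t) \<le> f (epar G e s)"
proof -
  obtain m where m: "\<And>\<delta>. \<delta> \<in> directions G (epar G e t) \<Longrightarrow> \<bar>m \<delta>\<bar> \<le> div_degree E"
    "- Poly_Mapping.lookup E (epar G e t) \<le> (\<Sum>\<delta>\<in>directions G (epar G e t). m \<delta>)"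
    "supports f m (epar G e t)"
    using f epar_in[OF e t] unfolding supported_def by metis
  have r: "f (epar G e t) + of_int (m (e, t, 1)) * (s - t) \<le> f (epar G e s)" "(e, t, 1) \<in> directions G (epar G e t)"
    if "t < elen G e" "s \<in> {0..elen G e}" "t \<le> s" for s
  proof -
    show d: "(e, t, 1) \<in> directions G (epar G e t)" using that e t by (auto simp: directions_def)
    then have "f (epar G e t) + of_int (m (e, t, 1)) * \<bar>s - t\<bar> \<le> f (epar G e s)"
      using m(3) that unfolding supports_def by force
    then show "f (epar G e t) + of_int (m (e, t, 1)) * (s - t) \<le> f (epar G e s)" using that by simp
  qed
  have l: "f (epar G e t) + of_int (m (e, t, -1)) * (t - s) \<le> f (epar G e s)" "(e, t, -1) \<in> directions G (epar G e t)"
    if "0 < t" "s \<in> {0..elen G e}" "s \<le> t" for s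
  proof -
    show d: "(e, t, -1) \<in> directions G (epar G e t)" using that e t by (auto simp: directions_def)
    then have "f (epar G e t) + of_int (m (e, t, -1)) * \<bar>s - t\<bar> \<le> f (epar G e s)"
      using m(3) that unfolding supports_def by force
    then show "f (epar G e t) + of_int (m (e, t, -1)) * (t - s) \<le> f (epar G e s)" using that by simp
  qed
  show ?thesis
  proof (cases "t < elen G e")
    case False
    then have t': "t = elen G e" "0 < t" using t elen_pos[OF e] by auto
    show ?thesis
    proof (rule that[of "- m (e, t, -1)"])
      show "\<bar>- m (e, t, -1)\<bar> \<le> div_degree E" using m(1)[OF l(2)[of t]] t t' by simp
      show "f (epar G e t) + of_int (- m (e, t, -1)) * (s - t) \<le> f (epar G e s)" if "s \<in> {0..elen G e}" for s
        using l(1)[of s] that t' by (simp add: algebra_simps)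
    qed
  next
    case True
    show ?thesis
    proof (rule that[of "m (e, t, 1)"])
      show "\<bar>m (e, t, 1)\<bar> \<le> div_degree E" using m(1)[OF r(2)[of t]] t True by simp
      fix s assume s: "s \<in> {0..elen G e}"
      show "f (epar G e t) + of_int (m (e, t, 1)) * (s - t) \<le> f (epar G e s)"
      proof (cases "t \<le> s")
        case False
        then have t': "t \<in> {0<..<elen G e}" "0 < t" using s True by auto
        have "Poly_Mapping.lookup E (epar G e t) = 0"
          using epar_interior[OF e t'(1)] E by (auto simp: in_keys_iff)
        then have "0 \<le> m (e, t, 1) + m (e, t, -1)"
          using m(2) directions_interior[OF e t'(1)] by simp
        then have "- real_of_int (m (e, t, 1)) \<le> of_int (m (e, t, -1))" by linarith
        then have "- real_of_int (m (e, t, 1)) * (t - s) \<le> of_int (m (e, t, -1)) * (t - s)"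
          using False by (intro mult_right_mono) auto
        then show ?thesis using l(1)[OF t'(2) s] False by (simp add: algebra_simps)
      qed (use r(1)[OF True s] in simp)
    qed
  qed
qed

text \<open>Supporting slopes are integers of absolute value at most \<open>div_degree E\<close>, so
  only finitely many occur and \<open>f\<close> is a maximum of finitely many lines on each edge.
  The germ slopes dominate the supporting ones, which gives nonnegativity.\<close>

lemma supported_rational:
  assumes f: "supported E f" and E: "effective E" "Poly_Mapping.keys E \<subseteq> verts G"
  shows "rational_function \<Gamma> G f" and "x \<in> \<Gamma> \<Longrightarrow> 0 \<le> Poly_Mapping.lookup E x + ord_at G f x"
proof -
  let ?d = "div_degree E"
  have d0: "0 \<le> ?d" using E(1) by (rule div_degree_nonneg)
  show r: "rational_function \<Gamma> G f"
  proof (rule rationalI)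
    show "continuous_on \<Gamma> f"
      using d0 supported_Lipschitz[OF f] by (intro continuous_Lipschitz[of f "of_int ?d"]) auto
  next
    fix v \<delta> assume v: "v \<in> \<Gamma>" "\<delta> \<in> directions G v"
    obtain e t \<sigma> where \<delta>: "\<delta> = (e, t, \<sigma>)" by (cases \<delta>)
    have e: "e \<in> edges G" "t \<in> {0..elen G e}" "\<sigma> = 1 \<or> \<sigma> = -1" using v \<delta> by (auto simp: directions_def)
    define \<phi> where "\<phi> s = f (epar G e s)" for s
    \<comment> \<open>Slopes are collected without their points of contact; one point
      \<open>\<tau> m\<close> is then chosen for each slope.\<close>
    define M where "M = {m \<in> {- ?d..?d}. \<exists>\<tau>\<in>{0..elen G e}. \<forall>s\<in>{0..elen G e}. \<phi> \<tau> + of_int m * (s - \<tau>) \<le> \<phi> s}"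
    have finM: "finite M" unfolding M_def by (rule finite_subset[of _ "{- ?d..?d}"]) auto
    have "\<forall>m\<in>M. \<exists>\<tau>\<in>{0..elen G e}. \<forall>s\<in>{0..elen G e}. \<phi> \<tau> + of_int m * (s - \<tau>) \<le> \<phi> s" by (simp add: M_def)
    then obtain \<tau> where \<tau>: "\<And>m. m \<in> M \<Longrightarrow> \<tau> m \<in> {0..elen G e}"
      "\<And>m s. m \<in> M \<Longrightarrow> s \<in> {0..elen G e} \<Longrightarrow> \<phi> (\<tau> m) + of_int m * (s - \<tau> m) \<le> \<phi> s" by metis
    define L where "L m p = \<phi> (\<tau> m) + of_int m * (p - \<tau> m)" for m p
    have L1: "L m p \<le> \<phi> p" if "m \<in> M" "p \<in> {0..elen G e}" for m p
      using \<tau>(2)[OF that] by (simp add: L_def)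
    have L2: "\<exists>m\<in>M. \<phi> p = L m p" if p: "p \<in> {0..elen G e}" for p
    proof -
      obtain m :: int where m: "\<bar>m\<bar> \<le> ?d" "\<And>s. s \<in> {0..elen G e} \<Longrightarrow> \<phi> p + of_int m * (s - p) \<le> \<phi> s"
        using supported_edge[OF f E(2) e(1) p] unfolding \<phi>_def by blast
      have "m \<in> {- ?d..?d}" using m(1) by (simp add: abs_le_iff)
      then have mM: "m \<in> M" using m(2) p unfolding M_def by blast
      \<comment> \<open>Parallel supporting lines coincide, so the line chosen for \<open>m\<close>
        also touches at \<open>p\<close>.\<close>
      have "\<phi> p \<le> L m p" using m(2)[OF \<tau>(1)[OF mM]] by (simp add: L_def algebra_simps)
      then show ?thesis using L1[OF mM p] mM by (intro bexI[of _ m]) auto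
    qed
    obtain j :: int where j: "\<sigma> = of_int j" using e(3) by (metis of_int_1 of_int_minus)
    have along_in: "\<forall>\<^sub>F h in at_right 0. t + \<sigma> * h \<in> {0..elen G e}"
      using directions_range_ev[OF v(2)[unfolded \<delta>]] by eventually_elim auto
    have L3: "L m t + of_int (j * m) * h = L m (t + \<sigma> * h)" for m h by (simp add: L_def j algebra_simps)
    have "\<forall>\<^sub>F h in at_right 0. (\<lambda>h. \<phi> (t + \<sigma> * h)) h = (\<lambda>h. \<phi> (t + \<sigma> * h)) 0 +
      of_int (Max ((\<lambda>m. j * m) ` {m \<in> M. L m t = (\<lambda>h. \<phi> (t + \<sigma> * h)) 0})) * h"
    proof (rule max_lines_slope[OF finM])
      show "L m t \<le> \<phi> (t + \<sigma> * 0)" if "m \<in> M" for m using L1[OF that e(2)] by simp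
      show "\<exists>m\<in>M. L m t = \<phi> (t + \<sigma> * 0)" using L2[OF e(2)] by auto
      show "\<forall>\<^sub>F h in at_right 0. (\<forall>m\<in>M. L m t + of_int (j * m) * h \<le> \<phi> (t + \<sigma> * h)) \<and>
          (\<exists>m\<in>M. \<phi> (t + \<sigma> * h) = L m t + of_int (j * m) * h)"
        using along_in unfolding L3 by eventually_elim (use L1 L2 in blast)
    qed
    then show "\<exists>k. has_slope G f \<delta> k"
      unfolding has_slope_def \<delta> \<phi>_def along_simp by blast
  qed
  assume x: "x \<in> \<Gamma>"
  obtain m where m: "- Poly_Mapping.lookup E x \<le> (\<Sum>\<delta>\<in>directions G x. m \<delta>)" "supports f m x"
    using f x unfolding supported_def by metis
  have "m \<delta> \<le> outgoing_slope G f \<delta>" if \<delta>: "\<delta> \<in> directions G x" for \<delta>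
  proof -
    obtain e t \<sigma> where \<delta>': "\<delta> = (e, t, \<sigma>)" by (cases \<delta>)
    have e: "\<sigma> = 1 \<or> \<sigma> = -1" "epar G e t = x" using \<delta> \<delta>' by (auto simp: directions_def)
    have "\<forall>\<^sub>F h::real in at_right 0. m \<delta> \<le> outgoing_slope G f \<delta>"
      using rational_slope[OF r x \<delta>, unfolded has_slope_def] directions_range_ev[OF \<delta>[unfolded \<delta>']] eventually_at_right_less[of 0]
    proof eventually_elim
      case (elim h)
      have "0 \<le> \<sigma> * ((t + \<sigma> * h) - t)" using e elim by auto
      then have "f x + of_int (m (e, t, \<sigma>)) * \<bar>(t + \<sigma> * h) - t\<bar> \<le> f (epar G e (t + \<sigma> * h))"
        using m(2) \<delta>[unfolded \<delta>'] elim(2) unfolding supports_def by fastforce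
      moreover have "\<bar>(t + \<sigma> * h) - t\<bar> = h" using e elim by auto
      ultimately have "of_int (m \<delta>) * h \<le> of_int (outgoing_slope G f \<delta>) * h" using elim(1) \<delta>' e by simp
      then show ?case using elim(3) by simp
    qed
    then show ?thesis by simp
  qed
  then have "(\<Sum>\<delta>\<in>directions G x. m \<delta>) \<le> ord_at G f x" unfolding ord_at_def by (intro sum_mono)
  then show "0 \<le> Poly_Mapping.lookup E x + ord_at G f x" using m(1) by linarith
qed

text \<open>Only finitely many assignments of slopes to the directions at \<open>x\<close> are
  possible. So a single assignment supports functions whose values at \<open>x\<close> come
  arbitrarily close to the supremum, and its inequalities pass to the limit.\<close>

lemma supported_SUP:
  assumes "\<F> \<noteq> {}" and f: "\<And>f. f \<in> \<F> \<Longrightarrow> supported E f"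
    and bdd: "\<And>x. x \<in> \<Gamma> \<Longrightarrow> bdd_above ((\<lambda>f. f x) ` \<F>)"
  shows "supported E (\<lambda>x. SUP f\<in>\<F>. f x)"
  unfolding supported_def
proof
  fix x assume x: "x \<in> \<Gamma>"
  define F where "F x = (SUP f\<in>\<F>. f x)" for x
  define \<M> where "\<M> = {m \<in> directions G x \<rightarrow>\<^sub>E {- div_degree E..div_degree E}.
    - Poly_Mapping.lookup E x \<le> (\<Sum>\<delta>\<in>directions G x. m \<delta>)}"
  have fin: "finite \<M>" unfolding \<M>_def
    by (rule finite_subset[of _ "directions G x \<rightarrow>\<^sub>E {- div_degree E..div_degree E}"])
      (auto intro!: finite_PiE finite_directions)
  have ex: "\<exists>m\<in>\<M>. supports f m x" if "f \<in> \<F>" for f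
  proof -
    obtain m where m: "\<And>\<delta>. \<delta> \<in> directions G x \<Longrightarrow> \<bar>m \<delta>\<bar> \<le> div_degree E"
      "- Poly_Mapping.lookup E x \<le> (\<Sum>\<delta>\<in>directions G x. m \<delta>)" "supports f m x"
      using f[OF \<open>f \<in> \<F>\<close>] x unfolding supported_def by metis
    have "restrict m (directions G x) \<in> \<M>"
    proof -
      have "m \<delta> \<in> {- div_degree E..div_degree E}" if "\<delta> \<in> directions G x" for \<delta>
        using m(1)[OF that] by (simp add: abs_le_iff)
      then show ?thesis using m(2) unfolding \<M>_def by (simp add: restrict_PiE_iff)
    qed
    moreover have "supports f (restrict m (directions G x)) x"
      using m(3) unfolding supports_def by auto
    ultimately show ?thesis by blast
  qed
  have "\<exists>m\<in>\<M>. \<forall>\<epsilon>>0. \<exists>f\<in>\<F>. F x - \<epsilon> < f x \<and> supports f m x"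
  proof (rule ccontr)
    assume "\<not> ?thesis"
    then have "\<forall>m\<in>\<M>. \<exists>\<epsilon>>0. \<forall>f\<in>\<F>. supports f m x \<longrightarrow> f x \<le> F x - \<epsilon>"
      by (meson not_less)
    then obtain \<epsilon> where \<epsilon>: "\<And>m. m \<in> \<M> \<Longrightarrow> 0 < \<epsilon> m"
      "\<And>m f. m \<in> \<M> \<Longrightarrow> f \<in> \<F> \<Longrightarrow> supports f m x \<Longrightarrow> f x \<le> F x - \<epsilon> m" by metis
    have ne: "\<M> \<noteq> {}" using ex assms(1) by blast
    have "f x \<le> F x - Min (\<epsilon> ` \<M>)" if "f \<in> \<F>" for f
    proof -
      obtain m where m: "m \<in> \<M>" "supports f m x" using ex[OF \<open>f \<in> \<F>\<close>] by blast
      have "Min (\<epsilon> ` \<M>) \<le> \<epsilon> m" using fin m by simp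
      then show ?thesis using \<epsilon>(2)[OF m(1) that m(2)] by linarith
    qed
    then have "F x \<le> F x - Min (\<epsilon> ` \<M>)" unfolding F_def using assms(1) by (intro cSUP_least) auto
    moreover have "0 < Min (\<epsilon> ` \<M>)" using fin ne \<epsilon>(1) by simp
    ultimately show False by simp
  qed
  then obtain m where m: "m \<in> \<M>" "\<And>\<epsilon>. 0 < \<epsilon> \<Longrightarrow> \<exists>f\<in>\<F>. F x - \<epsilon> < f x \<and> supports f m x" by blast
  have "supports F m x" unfolding supports_def
  proof (intro ballI, clarify)
    fix e t \<sigma> s assume d: "(e, t, \<sigma>) \<in> directions G x" "s \<in> {0..elen G e}" "0 \<le> \<sigma> * (s - t)"
    have y: "epar G e s \<in> \<Gamma>" using d by (intro epar_in) (auto simp: directions_def)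
    show "F x + of_int (m (e, t, \<sigma>)) * \<bar>s - t\<bar> \<le> F (epar G e s)"
    proof (rule field_le_epsilon)
      fix \<epsilon> :: real assume "0 < \<epsilon>"
      then obtain f where f: "f \<in> \<F>" "F x - \<epsilon> < f x" "supports f m x" using m(2) by blast
      have "f x + of_int (m (e, t, \<sigma>)) * \<bar>s - t\<bar> \<le> f (epar G e s)"
        using f(3) d unfolding supports_def by fast
      also have "\<dots> \<le> F (epar G e s)" unfolding F_def using f(1) bdd[OF y] by (intro cSUP_upper)
      finally show "F x + of_int (m (e, t, \<sigma>)) * \<bar>s - t\<bar> \<le> F (epar G e s) + \<epsilon>" using f(2) by linarith
    qed
  qed
  then show "\<exists>m. (\<forall>\<delta>\<in>directions G x. \<bar>m \<delta>\<bar> \<le> div_degree E) \<and>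
      - Poly_Mapping.lookup E x \<le> (\<Sum>\<delta>\<in>directions G x. m \<delta>) \<and> supports (\<lambda>x. SUP f\<in>\<F>. f x) m x"
    using m(1) unfolding F_def \<M>_def by (intro exI[of _ m]) (auto simp: abs_le_iff PiE_iff)
qed

text \<open>The zero function is a candidate because \<open>E\<close> is effective, and the common
  Lipschitz constant bounds all candidates in terms of the distance from \<open>w\<close>.\<close>

lemma ex_maximal:
  assumes E: "effective E" and w: "w \<in> \<Gamma>"
  obtains F where "supported E F" "F w = 0" "\<And>f x. supported E f \<Longrightarrow> f w = 0 \<Longrightarrow> x \<in> \<Gamma> \<Longrightarrow> f x \<le> F x"
proof -
  define \<F> where "\<F> = {f. supported E f \<and> f w = 0}"
  have d0: "0 \<le> div_degree E" using E by (rule div_degree_nonneg)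
  have "supported E (\<lambda>_. 0)" unfolding supported_def
    using E d0 by (intro ballI exI[of _ "\<lambda>_. 0"]) (auto simp: supports_def effective_def)
  then have ne: "\<F> \<noteq> {}" by (auto simp: \<F>_def)
  have bdd: "bdd_above ((\<lambda>f. f x) ` \<F>)" if x: "x \<in> \<Gamma>" for x
  proof (rule bdd_aboveI2)
    fix f assume f: "f \<in> \<F>"
    then have "\<bar>f x - f w\<bar> \<le> of_int (div_degree E) * dist x w"
      using d0 x w supported_Lipschitz by (intro Lipschitz_dist) (auto simp: \<F>_def)
    then show "f x \<le> of_int (div_degree E) * dist x w" using f by (simp add: \<F>_def)
  qed
  show ?thesis
  proof (rule that[of "\<lambda>x. SUP f\<in>\<F>. f x"])
    show "supported E (\<lambda>x. SUP f\<in>\<F>. f x)" using ne bdd by (intro supported_SUP) (auto simp: \<F>_def)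
    have "(\<lambda>f. f w) ` \<F> = {0}" using ne by (auto simp: \<F>_def)
    then show "(SUP f\<in>\<F>. f w) = 0" by simp
    show "f x \<le> (SUP f\<in>\<F>. f x)" if "supported E f" "f w = 0" "x \<in> \<Gamma>" for f x
      using that bdd by (intro cSUP_upper) (auto simp: \<F>_def)
  qed
qed

section \<open>Reduced divisors\<close>

lemma along_in_ev:
  assumes "\<delta> \<in> directions G v"
  shows "\<forall>\<^sub>F h in at_right 0. along G \<delta> h \<in> \<Gamma>"
proof -
  obtain e t \<sigma> where \<delta>: "\<delta> = (e, t, \<sigma>)" by (cases \<delta>)
  then have "e \<in> edges G" using assms by (auto simp: directions_def)
  with directions_range_ev[OF assms[unfolded \<delta>]] show ?thesis
    by (auto simp: \<delta> elim!: eventually_mono intro!: epar_in)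
qed

lemma continuous_along:
  assumes "(e, t, \<sigma>) \<in> directions G v" "\<And>h. h \<in> {0..c} \<Longrightarrow> t + \<sigma> * h \<in> {0..elen G e}"
  shows "continuous_on {0..c} (along G (e, t, \<sigma>))"
proof -
  have "continuous_on {0..c} (epar G e \<circ> (\<lambda>h. t + \<sigma> * h))"
    using assms by (intro continuous_on_compose continuous_intros continuous_on_subset[OF continuous_epar])
      (auto simp: directions_def)
  then show ?thesis by (simp add: comp_def along_def)
qed

text \<open>An arc from \<open>v\<close> has a point on some branch \<open>\<delta>\<close> of the
  star, and cannot get there without passing through all earlier points of that branch. The
  intermediate value theorem for \<open>\<xi>\<close> makes this precise.\<close>

lemma arc_germ:
  assumes g: "arc g" "pathstart g = v" "path_image g \<subseteq> \<Gamma>"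
  shows "\<exists>\<delta>\<in>directions G v. \<exists>c>0. \<forall>h\<in>{0<..<c}. along G \<delta> h \<in> g ` {0<..<1}"
proof -
  have v: "v \<in> \<Gamma>" using g pathstart_in_path_image by blast
  obtain \<epsilon> where \<epsilon>: "0 < \<epsilon>"
    and d: "\<And>\<delta> \<delta>' h h'. \<delta> \<in> directions G v \<Longrightarrow> \<delta>' \<in> directions G v \<Longrightarrow> h \<in> {0..\<epsilon>} \<Longrightarrow> h' \<in> {0..\<epsilon>} \<Longrightarrow>
      dist (along G \<delta> h) (along G \<delta>' h') = (if \<delta> = \<delta>' then \<bar>h - h'\<bar> else h + h')"
    and near: "\<And>y. y \<in> \<Gamma> \<Longrightarrow> dist v y < \<epsilon> \<Longrightarrow> y \<noteq> v \<Longrightarrow> \<exists>\<delta>\<in>directions G v. y = along G \<delta> (dist v y)"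
    using star[OF v] by metis
  have cont: "continuous_on {0..1} g" and inj: "inj_on g {0..1}" and g0: "g 0 = v"
    using g by (auto simp: arc_def path_def pathstart_def)
  have gin: "g \<tau> \<in> \<Gamma>" if "\<tau> \<in> {0..1}" for \<tau> using that g(3) by (auto simp: path_image_def)
  obtain \<eta> where \<eta>: "0 < \<eta>" "\<And>\<tau>. \<tau> \<in> {0..1} \<Longrightarrow> dist \<tau> 0 < \<eta> \<Longrightarrow> dist (g \<tau>) (g 0) < \<epsilon> / 2"
    using cont \<epsilon> unfolding continuous_on_iff by (metis atLeastAtMost_iff half_gt_zero order.refl zero_le_one)
  define \<tau>0 where "\<tau>0 = min (1 / 2) (\<eta> / 2)"
  have \<tau>0: "0 < \<tau>0" "\<tau>0 < 1" using \<eta>(1) by (auto simp: \<tau>0_def)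
  have close: "dist v (g \<tau>) < \<epsilon> / 2" if "\<tau> \<in> {0..\<tau>0}" for \<tau>
    using \<eta>(2)[of \<tau>] that \<tau>0 \<eta>(1) g0 by (auto simp: \<tau>0_def dist_commute)
  have ne: "g \<tau> \<noteq> v" if "\<tau> \<in> {0<..1}" for \<tau>
    using inj_onD[OF inj, of \<tau> 0] g0 that by auto
  define \<rho> where "\<rho> = dist v (g \<tau>0)"
  have \<rho>: "0 < \<rho>" "\<rho> < \<epsilon> / 2" using close[of \<tau>0] ne[of \<tau>0] \<tau>0 by (auto simp: \<rho>_def)
  have "\<exists>\<delta>\<in>directions G v. g \<tau>0 = along G \<delta> (dist v (g \<tau>0))"
    using \<rho> \<tau>0 \<epsilon> by (intro near gin ne) (auto simp: \<rho>_def)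
  then obtain \<delta> where \<delta>: "\<delta> \<in> directions G v" "g \<tau>0 = along G \<delta> \<rho>"
    unfolding \<rho>_def by blast
  \<comment> \<open>Within radius \<open>\<epsilon> / 2\<close> this is the distance from
    \<open>v\<close> on the branch \<open>\<delta>\<close> and minus the distance from
    \<open>v\<close> on all other branches.\<close>
  define \<xi> where "\<xi> \<tau> = \<epsilon> / 2 - dist (g \<tau>) (along G \<delta> (\<epsilon> / 2))" for \<tau>
  have \<xi>v: "\<xi> \<tau> = 0" if "g \<tau> = v" for \<tau>
    using d[OF \<delta>(1) \<delta>(1), of 0 "\<epsilon> / 2"] \<epsilon> along_0[OF \<delta>(1)] that by (simp add: \<xi>_def)
  have \<xi>\<tau>0: "\<xi> \<tau>0 = \<rho>" using d[OF \<delta>(1) \<delta>(1), of \<rho> "\<epsilon> / 2"] \<rho> \<delta>(2) by (simp add: \<xi>_def)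
  have "along G \<delta> h \<in> g ` {0<..<1}" if h: "h \<in> {0<..<\<rho>}" for h
  proof -
    have "continuous_on {0..\<tau>0} \<xi>" unfolding \<xi>_def
      using \<tau>0 by (intro continuous_intros continuous_on_subset[OF cont]) auto
    then obtain \<tau> where \<tau>: "0 \<le> \<tau>" "\<tau> \<le> \<tau>0" "\<xi> \<tau> = h"
      using IVT'[of \<xi> 0 h \<tau>0] h \<tau>0 \<xi>v[OF g0] \<xi>\<tau>0 by auto
    then have "g \<tau> \<noteq> v" using \<xi>v h by force
    then have \<tau>': "\<tau> \<in> {0<..<1}" using \<tau> \<tau>0 g0 by (cases "\<tau> = 0") auto
    define h' where "h' = dist v (g \<tau>)"
    have h': "0 \<le> h'" "h' < \<epsilon> / 2" using close[of \<tau>] \<tau> by (auto simp: h'_def)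
    have "\<exists>\<delta>\<in>directions G v. g \<tau> = along G \<delta> (dist v (g \<tau>))"
      using h' \<tau>' \<epsilon> \<open>g \<tau> \<noteq> v\<close> by (intro near gin) (auto simp: h'_def)
    then obtain \<delta>' where \<delta>': "\<delta>' \<in> directions G v" "g \<tau> = along G \<delta>' h'"
      unfolding h'_def by blast
    have "\<xi> \<tau> = (if \<delta>' = \<delta> then h' else - h')"
      using d[OF \<delta>'(1) \<delta>(1), of h' "\<epsilon> / 2"] h' \<delta>'(2) \<epsilon> by (auto simp: \<xi>_def)
    then have "\<delta>' = \<delta>" "h' = h" using \<tau>(3) h h' by (auto split: if_splits)
    then show ?thesis using \<delta>'(2) \<tau>' by force
  qed
  then show ?thesis using \<delta>(1) \<rho>(1) by blast
qed

text \<open>Two arcs of an admissible family cannot start along the same direction, since by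
  \<open>arc_germ\<close> both would cover an initial segment of it. Conversely, short straight
  segments along the directions that leave \<open>X\<close> form an admissible family. Reducedness
  thereby becomes a condition on slopes.\<close>

lemma deg_out_eq:
  assumes v: "v \<in> \<Gamma>"
  shows "deg_out \<Gamma> X v = card {\<delta> \<in> directions G v. \<forall>\<^sub>F h in at_right 0. along G \<delta> h \<notin> X}"
proof -
  define L where "L = {\<delta> \<in> directions G v. \<forall>\<^sub>F h in at_right 0. along G \<delta> h \<notin> X}"
  define good where "good A \<longleftrightarrow> finite A \<and>
     (\<forall>g\<in>A. arc g \<and> pathstart g = v \<and> path_image g \<subseteq> \<Gamma> - (X - {v})) \<and>
     (\<forall>g\<in>A. \<forall>h\<in>A. g \<noteq> h \<longrightarrow> g ` {0<..<1} \<inter> path_image h = {})" for A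
  have finL: "finite L" unfolding L_def using finite_directions by auto
  have upper: "card A \<le> card L" if A: "good A" for A
  proof -
    have "\<exists>\<delta>\<in>L. \<exists>c>0. \<forall>h\<in>{0<..<c}. along G \<delta> h \<in> g ` {0<..<1}" if "g \<in> A" for g
    proof -
      have g: "arc g" "pathstart g = v" "path_image g \<subseteq> \<Gamma> - (X - {v})" using A that by (auto simp: good_def)
      then obtain \<delta> c where \<delta>: "\<delta> \<in> directions G v" "0 < c" "\<forall>h\<in>{0<..<c}. along G \<delta> h \<in> g ` {0<..<1}"
        using arc_germ[of g v] by blast
      have "g \<tau> \<notin> X" if "\<tau> \<in> {0<..<1}" for \<tau>
      proof -
        have "g \<tau> \<noteq> g 0" using g(1) that inj_onD[of g "{0..1}" \<tau> 0] by (auto simp: arc_def)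
        then have "g \<tau> \<noteq> v" using g(2) by (simp add: pathstart_def)
        moreover have "g \<tau> \<in> path_image g" using that by (auto simp: path_image_def)
        ultimately show ?thesis using g(3) by blast
      qed
      then have notX: "along G \<delta> h \<notin> X" if "h \<in> {0<..<c}" for h
        using bspec[OF \<delta>(3) that] by force
      have "\<forall>\<^sub>F h in at_right 0. along G \<delta> h \<notin> X"
        unfolding eventually_at_right_0 using notX \<delta>(2) by (intro exI[of _ "c / 2"]) auto
      then have "\<delta> \<in> L" using \<delta>(1) by (simp add: L_def)
      then show ?thesis using \<delta> by blast
    qed
    then obtain \<Delta> c where \<Delta>: "\<And>g. g \<in> A \<Longrightarrow> \<Delta> g \<in> L" "\<And>g. g \<in> A \<Longrightarrow> 0 < c g"
      "\<And>g h. g \<in> A \<Longrightarrow> h \<in> {0<..<c g} \<Longrightarrow> along G (\<Delta> g) h \<in> g ` {0<..<1}" by metis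
    have "inj_on \<Delta> A"
    proof (rule inj_onI, rule ccontr)
      fix g g' assume *: "g \<in> A" "g' \<in> A" "\<Delta> g = \<Delta> g'" "g \<noteq> g'"
      define h where "h = min (c g) (c g') / 2"
      have "h \<in> {0<..<c g}" "h \<in> {0<..<c g'}" using \<Delta>(2)[OF *(1)] \<Delta>(2)[OF *(2)] by (auto simp: h_def min_def)
      then have "along G (\<Delta> g) h \<in> g ` {0<..<1}" "along G (\<Delta> g) h \<in> g' ` {0<..<1}"
        using \<Delta>(3)[OF *(1)] \<Delta>(3)[OF *(2)] *(3) by auto
      moreover have "g' ` {0<..<1} \<subseteq> path_image g'" by (auto simp: path_image_def)
      moreover have "g ` {0<..<1} \<inter> path_image g' = {}" using A * by (auto simp: good_def)
      ultimately show False by blast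
    qed
    then show ?thesis using \<Delta>(1) finL by (intro card_inj_on_le) auto
  qed
  obtain \<epsilon> where \<epsilon>: "0 < \<epsilon>"
    and range: "\<And>e t \<sigma> h. (e, t, \<sigma>) \<in> directions G v \<Longrightarrow> h \<in> {0..\<epsilon>} \<Longrightarrow> t + \<sigma> * h \<in> {0..elen G e}"
    and d: "\<And>\<delta> \<delta>' h h'. \<delta> \<in> directions G v \<Longrightarrow> \<delta>' \<in> directions G v \<Longrightarrow> h \<in> {0..\<epsilon>} \<Longrightarrow> h' \<in> {0..\<epsilon>} \<Longrightarrow>
      dist (along G \<delta> h) (along G \<delta>' h') = (if \<delta> = \<delta>' then \<bar>h - h'\<bar> else h + h')"
    using star[OF v] by metis
  have "\<forall>\<^sub>F h in at_right 0. \<forall>\<delta>\<in>L. along G \<delta> h \<notin> X"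
    using finL by (intro eventually_ball_finite) (auto simp: L_def)
  then obtain c0 where c0: "0 < c0" "\<And>h \<delta>. h \<in> {0<..c0} \<Longrightarrow> \<delta> \<in> L \<Longrightarrow> along G \<delta> h \<notin> X"
    unfolding eventually_at_right_0 by blast
  define c where "c = min c0 \<epsilon>"
  have c: "0 < c" "c \<le> c0" "c \<le> \<epsilon>" using c0 \<epsilon> by (auto simp: c_def)
  define \<gamma> where "\<gamma> \<delta> \<tau> = along G \<delta> (c * \<tau>)" for \<delta> and \<tau> :: real
  have c\<tau>: "c * \<tau> \<in> {0..\<epsilon>}" "c * \<tau> \<in> {0..c}" if "\<tau> \<in> {0..1}" for \<tau>
  proof -
    have "c * \<tau> \<le> c" using that c(1) by (intro mult_left_le) auto
    moreover have "0 \<le> c * \<tau>" using that c(1) by simp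
    ultimately show "c * \<tau> \<in> {0..\<epsilon>}" "c * \<tau> \<in> {0..c}" using c(3) unfolding atLeastAtMost_iff by linarith+
  qed
  have d\<gamma>: "dist (\<gamma> \<delta> \<tau>) (\<gamma> \<delta>' \<tau>') = (if \<delta> = \<delta>' then c * \<bar>\<tau> - \<tau>'\<bar> else c * (\<tau> + \<tau>'))"
    if "\<delta> \<in> L" "\<delta>' \<in> L" "\<tau> \<in> {0..1}" "\<tau>' \<in> {0..1}" for \<delta> \<delta>' \<tau> \<tau>'
    using d[of \<delta> \<delta>' "c * \<tau>" "c * \<tau>'"] c\<tau>[OF that(3)] c\<tau>[OF that(4)] that(1,2) c(1)
    by (auto simp: L_def \<gamma>_def abs_mult distrib_left simp flip: right_diff_distrib)
  have good: "good (\<gamma> ` L)" unfolding good_def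
  proof (intro conjI ballI impI)
    show "finite (\<gamma> ` L)" using finL by simp
  next
    fix g assume "g \<in> \<gamma> ` L"
    then obtain \<delta> where \<delta>: "\<delta> \<in> L" "g = \<gamma> \<delta>" by blast
    obtain e t \<sigma> where \<delta>': "\<delta> = (e, t, \<sigma>)" by (cases \<delta>)
    have \<delta>d: "\<delta> \<in> directions G v" using \<delta>(1) by (simp add: L_def)
    have "continuous_on {0..\<epsilon>} (along G \<delta>)" using \<delta>d range unfolding \<delta>' by (intro continuous_along)
    then have "continuous_on {0..1} (along G \<delta> \<circ> (\<lambda>\<tau>. c * \<tau>))"
      using c\<tau>(1) by (intro continuous_on_compose continuous_intros) (auto elim!: continuous_on_subset)
    moreover have "inj_on (\<gamma> \<delta>) {0..1}"
    proof (rule inj_onI)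
      fix \<tau> \<tau>' :: real assume *: "\<tau> \<in> {0..1}" "\<tau>' \<in> {0..1}" "\<gamma> \<delta> \<tau> = \<gamma> \<delta> \<tau>'"
      then show "\<tau> = \<tau>'" using d\<gamma>[OF \<delta>(1) \<delta>(1) *(1,2)] c by simp
    qed
    ultimately show "arc g" using \<delta>(2) by (simp add: arc_def path_def \<gamma>_def comp_def)
    show "pathstart g = v" using \<delta>(2) along_0[OF \<delta>d] by (simp add: pathstart_def \<gamma>_def)
    show "path_image g \<subseteq> \<Gamma> - (X - {v})"
    proof
      fix y assume "y \<in> path_image g"
      then obtain \<tau> where \<tau>: "\<tau> \<in> {0..1}" "y = \<gamma> \<delta> \<tau>" using \<delta>(2) by (auto simp: path_image_def)
      have e: "e \<in> edges G" using \<delta>d \<delta>' by (auto simp: directions_def)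
      have "y \<in> \<Gamma>" using \<tau> range[OF \<delta>d[unfolded \<delta>'] c\<tau>(1)[OF \<tau>(1)]] e \<delta>' by (auto simp: \<gamma>_def intro!: epar_in)
      moreover have "y \<notin> X" if "y \<noteq> v"
      proof -
        have "\<tau> \<noteq> 0" using that \<tau>(2) along_0[OF \<delta>d] by (auto simp: \<gamma>_def)
        then have "0 < c * \<tau>" using \<tau>(1) c(1) by simp
        then have "c * \<tau> \<in> {0<..c0}"
          using c\<tau>(2)[OF \<tau>(1)] c(2) unfolding greaterThanAtMost_iff atLeastAtMost_iff by linarith
        then show ?thesis using c0(2) \<delta>(1) \<tau>(2) by (auto simp: \<gamma>_def)
      qed
      ultimately show "y \<in> \<Gamma> - (X - {v})" by blast
    qed
  next
    fix g g' assume "g \<in> \<gamma> ` L" "g' \<in> \<gamma> ` L" "g \<noteq> g'"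
    then obtain \<delta> \<delta>' where \<delta>: "\<delta> \<in> L" "\<delta>' \<in> L" "g = \<gamma> \<delta>" "g' = \<gamma> \<delta>'" "\<delta> \<noteq> \<delta>'" by blast
    show "g ` {0<..<1} \<inter> path_image g' = {}"
    proof (rule ccontr)
      assume "g ` {0<..<1} \<inter> path_image g' \<noteq> {}"
      then obtain y where y: "y \<in> g ` {0<..<1}" "y \<in> path_image g'" by blast
      then obtain \<tau> \<tau>' where *: "\<tau> \<in> {0<..<1}" "\<tau>' \<in> {0..1}" "\<gamma> \<delta> \<tau> = \<gamma> \<delta>' \<tau>'"
        unfolding \<delta> path_image_def by (metis imageE)
      then have "c * (\<tau> + \<tau>') = 0" using d\<gamma>[OF \<delta>(1,2), of \<tau> \<tau>'] \<delta>(5) by auto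
      then show False using c * by auto
    qed
  qed
  have "inj_on \<gamma> L"
  proof (rule inj_onI, rule ccontr)
    fix \<delta> \<delta>' assume *: "\<delta> \<in> L" "\<delta>' \<in> L" "\<gamma> \<delta> = \<gamma> \<delta>'" "\<delta> \<noteq> \<delta>'"
    then show False using d\<gamma>[OF *(1,2), of 1 1] c by simp
  qed
  then have card: "card (\<gamma> ` L) = card L" by (rule card_image)
  have "deg_out \<Gamma> X v = Max {card A | A. good A}" unfolding deg_out_def good_def ..
  also have "\<dots> = card L"
  proof (rule Max_eqI)
    show "finite {card A | A. good A}" by (rule finite_subset[of _ "{..card L}"]) (use upper in auto)
    show "card L \<in> {card A | A. good A}" using good card by force
  qed (use upper in auto)
  finally show ?thesis by (simp add: L_def)
qed

lemma slope_nonpos_at_max: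
  assumes r: "rational_function \<Gamma> G f" and u: "u \<in> \<Gamma>" "\<delta> \<in> directions G u" and max: "\<And>x. x \<in> \<Gamma> \<Longrightarrow> f x \<le> f u"
  shows "outgoing_slope G f \<delta> \<le> 0"
proof -
  have "\<forall>\<^sub>F h::real in at_right 0. outgoing_slope G f \<delta> \<le> 0"
    using rational_slope[OF r u, unfolded has_slope_def] along_in_ev[OF u(2)] eventually_at_right_less[of 0]
  proof eventually_elim
    case (elim h)
    then have "of_int (outgoing_slope G f \<delta>) * h \<le> 0" using max[of "along G \<delta> h"] along_0[OF u(2)] by simp
    then show ?case using elim(3) by (simp add: mult_le_0_iff)
  qed
  then show ?thesis by simp
qed

lemma ord_nonpos_at_max:
  assumes "rational_function \<Gamma> G f" "u \<in> \<Gamma>" "\<And>x. x \<in> \<Gamma> \<Longrightarrow> f x \<le> f u"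
  shows "ord_at G f u \<le> 0"
  unfolding ord_at_def using slope_nonpos_at_max[OF assms(1,2) _ assms(3)] by (intro sum_nonpos)

text \<open>Otherwise a component of the set where \<open>f\<close> is maximal could be fired.\<close>

lemma reduced_imp_max:
  assumes red: "reduced \<Gamma> P D" and P: "P \<in> \<Gamma>" and r: "rational_function \<Gamma> G f"
    and nonneg: "\<And>x. x \<in> \<Gamma> - {P} \<Longrightarrow> 0 \<le> Poly_Mapping.lookup D x + ord_at G f x"
    and "x \<in> \<Gamma>"
  shows "f x \<le> f P"
proof -
  have cont: "continuous_on \<Gamma> f" using r by (rule rational_continuous)
  obtain x0 where x0: "x0 \<in> \<Gamma>" "\<And>x. x \<in> \<Gamma> \<Longrightarrow> f x \<le> f x0"
    using continuous_attains_sup[OF compact_\<Gamma> _ cont] P by blast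
  have "f x0 \<le> f P"
  proof (rule ccontr)
    assume "\<not> f x0 \<le> f P"
    define Y where "Y = {x \<in> \<Gamma>. f x = f x0}"
    define X where "X = connected_component_set Y x0"
    have "closed Y" unfolding Y_def
      using continuous_closedin_preimage_constant[OF cont] compact_imp_closed[OF compact_\<Gamma>] closedin_closed_trans by blast
    then have clX: "closed X" unfolding X_def by (rule closed_connected_component)
    have XY: "X \<subseteq> Y" "x0 \<in> X" using x0 by (auto simp: X_def Y_def connected_component_subset)
    have conX: "connected X" by (simp add: X_def connected_connected_component)
    have "P \<notin> X" using XY \<open>\<not> f x0 \<le> f P\<close> by (auto simp: Y_def)
    have X\<Gamma>: "closedin (top_of_set \<Gamma>) X" using clX XY by (intro closed_subset) (auto simp: Y_def)
    obtain u where u: "u \<in> top_of_set \<Gamma> frontier_of X" "Poly_Mapping.lookup D u < int (deg_out \<Gamma> X u)"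
      using red X\<Gamma> conX XY(2) \<open>P \<notin> X\<close> unfolding reduced_def by blast
    have uX: "u \<in> X" using u(1) frontier_of_subset_closedin[OF X\<Gamma>] by blast
    then have u\<Gamma>: "u \<in> \<Gamma>" "f u = f x0" "u \<noteq> P" using XY \<open>P \<notin> X\<close> by (auto simp: Y_def)
    define L where "L = {\<delta> \<in> directions G u. \<forall>\<^sub>F h in at_right 0. along G \<delta> h \<notin> X}"
    have max: "f x \<le> f u" if "x \<in> \<Gamma>" for x using x0(2) that u\<Gamma> by simp
    \<comment> \<open>Slope 0 keeps \<open>f\<close> maximal on an initial segment, which then
      belongs to the component \<open>X\<close>; so every direction that leaves \<open>X\<close> has
      slope at most -1.\<close>
    have sl: "outgoing_slope G f \<delta> \<le> (if \<delta> \<in> L then -1 else 0)" if \<delta>: "\<delta> \<in> directions G u" for \<delta>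
    proof (rule ccontr)
      assume n: "\<not> ?thesis"
      have "outgoing_slope G f \<delta> \<le> 0" using slope_nonpos_at_max[OF r u\<Gamma>(1) \<delta> max] .
      then have s0: "outgoing_slope G f \<delta> = 0" "\<delta> \<in> L" using n by (auto split: if_splits)
      obtain e t \<sigma> where \<delta>': "\<delta> = (e, t, \<sigma>)" by (cases \<delta>)
      obtain c1 where c1: "0 < c1" "\<And>h. h \<in> {0..c1} \<Longrightarrow> t + \<sigma> * h \<in> {0..elen G e}"
        using directions_range[OF \<delta>[unfolded \<delta>']] by blast
      have "\<forall>\<^sub>F h in at_right 0. f (along G \<delta> h) = f u"
        using rational_slope[OF r u\<Gamma>(1) \<delta>] s0 along_0[OF \<delta>] by (simp add: has_slope_def)
      then obtain c2 where c2: "0 < c2" "\<And>h. h \<in> {0<..c2} \<Longrightarrow> f (along G \<delta> h) = f u"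
        unfolding eventually_at_right_0 by blast
      define c where "c = min c1 c2"
      have c: "0 < c" "c \<le> c1" "c \<le> c2" using c1 c2 by (auto simp: c_def)
      have "connected (along G \<delta> ` {0..c})"
        using \<delta> c1 c unfolding \<delta>' by (intro connected_continuous_image continuous_along) auto
      moreover have "along G \<delta> h \<in> Y" if "h \<in> {0..c}" for h
      proof -
        have "along G \<delta> h \<in> \<Gamma>" using c1(2)[of h] that c \<delta> \<delta>' by (auto simp: directions_def intro!: epar_in)
        moreover have "f (along G \<delta> h) = f u" using c2(2)[of h] that c along_0[OF \<delta>] by (cases "h = 0") auto
        ultimately show ?thesis using u\<Gamma> by (simp add: Y_def)
      qed
      then have "along G \<delta> ` {0..c} \<subseteq> Y" by blast
      moreover have "u \<in> along G \<delta> ` {0..c}" using c along_0[OF \<delta>] by force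
      ultimately have "along G \<delta> ` {0..c} \<subseteq> connected_component_set Y u"
        by (intro connected_component_maximal)
      also have "connected_component_set Y u = X"
        using uX unfolding X_def by (metis connected_component_eq)
      finally have "\<forall>\<^sub>F h in at_right 0. along G \<delta> h \<in> X"
        unfolding eventually_at_right_0 using c(1) by (intro exI[of _ c]) auto
      moreover have "\<forall>\<^sub>F h in at_right 0. along G \<delta> h \<notin> X" using s0(2) by (simp add: L_def)
      ultimately have "\<forall>\<^sub>F h::real in at_right 0. False" by eventually_elim blast
      then show False by simp
    qed
    have "ord_at G f u \<le> (\<Sum>\<delta>\<in>directions G u. if \<delta> \<in> L then -1 else 0)"
      unfolding ord_at_def using sl by (intro sum_mono)
    also have "\<dots> = - int (card L)"
    proof -
      have "directions G u \<inter> L = L" by (auto simp: L_def)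
      then show ?thesis using finite_directions[of u] by (simp add: sum.If_cases)
    qed
    also have "card L = deg_out \<Gamma> X u" unfolding L_def using deg_out_eq[OF u\<Gamma>(1)] by simp
    finally show False using nonneg[of u] u\<Gamma> u(2) by simp
  qed
  then show ?thesis using x0(2)[OF assms(5)] by simp
qed

lemma openin_edge_segment:
  assumes e: "e \<in> edges G" and ab: "0 \<le> a" "b \<le> elen G e"
  shows "openin (top_of_set \<Gamma>) (epar G e ` {a<..<b})"
proof -
  define Z where "Z = verts G \<union> (\<Union>e'\<in>edges G - {e}. epar G e' ` ({0..elen G e'} \<inter> UNIV)) \<union>
    epar G e ` ({0..elen G e} \<inter> ({..a} \<union> {b..}))"
  have fin: "finite (edges G - {e})" using finite_edges by simp
  have "compact Z" unfolding Z_def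
    by (intro compact_Un compact_UN compact_epar e fin finite_imp_compact finite_verts closed_Un) auto
  then have "closed Z" by (rule compact_imp_closed)
  moreover have "\<Gamma> - epar G e ` {a<..<b} = \<Gamma> \<inter> Z"
  proof (intro equalityI subsetI)
    fix x assume x: "x \<in> \<Gamma> - epar G e ` {a<..<b}"
    then have x\<Gamma>: "x \<in> \<Gamma>" by simp
    then show "x \<in> \<Gamma> \<inter> Z"
    proof (cases rule: point_cases)
      case (2 e' t)
      show ?thesis
      proof (cases "e' = e")
        case True
        then have "t \<in> {0..elen G e} \<inter> ({..a} \<union> {b..})" using x 2 by force
        then show ?thesis using x\<Gamma> 2(3) True unfolding Z_def by blast
      next
        case False
        have "t \<in> {0..elen G e'} \<inter> UNIV" using 2(2) by simp
        then show ?thesis using x\<Gamma> 2 False unfolding Z_def by blast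
      qed
    qed (use x\<Gamma> in \<open>simp add: Z_def\<close>)
  next
    fix x assume x: "x \<in> \<Gamma> \<inter> Z"
    show "x \<in> \<Gamma> - epar G e ` {a<..<b}"
    proof (rule ccontr)
      assume "\<not> ?thesis"
      then obtain t where t: "t \<in> {a<..<b}" "x = epar G e t" using x by blast
      then have t': "t \<in> {0<..<elen G e}" using ab by auto
      have "x \<notin> verts G" using epar_interior[OF e t'] t by simp
      have "e' = e \<and> s = t" if "e' \<in> edges G" "s \<in> {0..elen G e'}" "x = epar G e' s" for e' s
        using interior_eq[OF e that(1) t' that(2)] t(2) that(3) by auto
      note * = this
      have "x \<in> Z" using x by blast
      then consider "x \<in> verts G" | e' s where "e' \<in> edges G - {e}" "s \<in> {0..elen G e'}" "x = epar G e' s"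
        | s where "s \<in> {0..elen G e}" "s \<in> {..a} \<union> {b..}" "x = epar G e s"
        unfolding Z_def by blast
      then show False
      proof cases
        case (2 e' s)
        then show False using *[of e' s] by auto
      next
        case (3 s)
        then show False using *[of e s] e t(1) by auto
      qed (use \<open>x \<notin> verts G\<close> in blast)
    qed
  qed
  moreover have "epar G e ` {a<..<b} = \<Gamma> - (\<Gamma> - epar G e ` {a<..<b})"
    using e ab epar_in[OF e] by auto
  ultimately show ?thesis
    by (metis closedin_closed_Int openin_diff openin_subtopology_self)
qed

text \<open>If points in and out of \<open>X\<close> alternated near \<open>x\<close>, an open
  segment of the edge with both ends outside \<open>X\<close> would cut off a nonempty clopen part
  of \<open>X\<close> that does not contain \<open>x\<close>.\<close>

lemma germ_dichotomy:
  assumes X: "connected X" "closed X" "X \<subseteq> \<Gamma>" and x: "x \<in> X" "\<delta> \<in> directions G x"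
  shows "(\<forall>\<^sub>F h in at_right 0. along G \<delta> h \<in> X) \<or> (\<forall>\<^sub>F h in at_right 0. along G \<delta> h \<notin> X)"
proof (rule ccontr)
  assume n: "\<not> ?thesis"
  obtain e t \<sigma> where \<delta>: "\<delta> = (e, t, \<sigma>)" by (cases \<delta>)
  have e: "e \<in> edges G" "epar G e t = x" "t \<in> {0..elen G e}" "\<sigma> = 1 \<or> \<sigma> = -1"
    using x(2) \<delta> by (auto simp: directions_def)
  obtain c where c: "0 < c" "\<And>h. h \<in> {0<..c} \<Longrightarrow> t + \<sigma> * h \<in> {0<..<elen G e}"
    using directions_range_ev[OF x(2)[unfolded \<delta>]] unfolding eventually_at_right_0 by blast
  obtain h1 where h1: "h1 \<in> {0<..c}" "along G \<delta> h1 \<notin> X"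
    using n c(1) unfolding eventually_at_right_0 by blast
  then have "0 < h1 / 2" by simp
  then obtain h2 where h2: "h2 \<in> {0<..h1 / 2}" "along G \<delta> h2 \<in> X"
    using n unfolding eventually_at_right_0 by blast
  then have "0 < h2 / 2" by simp
  then obtain h3 where h3: "h3 \<in> {0<..h2 / 2}" "along G \<delta> h3 \<notin> X"
    using n unfolding eventually_at_right_0 by blast
  have h: "0 < h3" "h3 < h2" "h2 < h1" "h1 \<le> c" using h1 h2 h3 by auto
  define a b where "a = min (t + \<sigma> * h3) (t + \<sigma> * h1)" and "b = max (t + \<sigma> * h3) (t + \<sigma> * h1)"
  have ab: "0 < a" "a < b" "b < elen G e" using c(2)[of h3] c(2)[of h1] h e(4) by (auto simp: a_def b_def)
  have notX: "epar G e a \<notin> X" "epar G e b \<notin> X" using h1(2) h3(2) \<delta> by (auto simp: a_def b_def min_def max_def)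
  define S where "S = epar G e ` {a<..<b}"
  have "openin (top_of_set \<Gamma>) S" unfolding S_def using e(1) ab by (intro openin_edge_segment) auto
  then obtain T where T: "open T" "S = \<Gamma> \<inter> T" by (auto simp: openin_open)
  have "X \<inter> S = X \<inter> T" using T X(3) by blast
  then have op: "openin (top_of_set X) (X \<inter> S)" using T by (metis openin_open_Int)
  have "compact (epar G e ` ({0..elen G e} \<inter> {a..b}))" using e(1) by (intro compact_epar) auto
  then have "closed (epar G e ` ({0..elen G e} \<inter> {a..b}))" by (rule compact_imp_closed)
  moreover have "X \<inter> S = X \<inter> epar G e ` ({0..elen G e} \<inter> {a..b})"
  proof -
    have "epar G e s \<in> S" if "s \<in> {a..b}" "epar G e s \<in> X" for s
      using that notX unfolding S_def by (cases "s = a \<or> s = b") auto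
    then show ?thesis using ab by (auto simp: S_def)
  qed
  ultimately have "closedin (top_of_set X) (X \<inter> S)" by (metis closedin_closed_Int)
  with op have "X \<inter> S = {} \<or> X \<inter> S = X" using X(1) unfolding connected_clopen by blast
  moreover have "along G \<delta> h2 \<in> X \<inter> S" using h2(2) h e(4) \<delta> by (auto simp: S_def a_def b_def)
  moreover have "x \<notin> S"
  proof
    assume "x \<in> S"
    then obtain s where s: "s \<in> {a<..<b}" "x = epar G e s" by (auto simp: S_def)
    then have "s = t" using interior_eq(2)[OF e(1,1) _ e(3), of s] ab e(2) by auto
    then show False using s(1) h e(4) by (auto simp: a_def b_def)
  qed
  ultimately show False using x(1) by blast
qed

end

section \<open>Distance to a closed set of parameters\<close>

lemma infdist_ge: "A \<noteq> {} \<Longrightarrow> (\<And>a. a \<in> A \<Longrightarrow> s \<le> dist x a) \<Longrightarrow> s \<le> infdist x A"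
  by (simp add: infdist_notempty cINF_greatest)

text \<open>\<open>p\<close> and \<open>q\<close> are the ends of the component of the complement of
  \<open>K\<close> that contains \<open>t\<close>.\<close>

lemma infdist_gap:
  fixes K :: "real set"
  assumes K: "closed K" "t \<notin> K" "p0 \<in> K" "q0 \<in> K" "p0 < t" "t < q0"
  obtains p q where "p < t" "t < q" "\<And>t'. t' \<in> {p..q} \<Longrightarrow> infdist t' K = min (t' - p) (q - t')"
proof -
  define p q where "p = Sup (K \<inter> {..t})" and "q = Inf (K \<inter> {t..})"
  have "p \<in> K \<inter> {..t}" unfolding p_def
    using K by (intro closed_contains_Sup) (auto intro!: bdd_aboveI[of _ t])
  moreover have "q \<in> K \<inter> {t..}" unfolding q_def
    using K by (intro closed_contains_Inf) (auto intro!: bdd_belowI[of _ t])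
  ultimately have pq: "p \<in> K" "q \<in> K" "p < t" "t < q" using K(2) by (auto simp: less_le)
  have out: "k \<le> p \<or> q \<le> k" if "k \<in> K" for k
    using that cSup_upper[of k "K \<inter> {..t}"] cInf_lower[of k "K \<inter> {t..}"]
    by (cases "k \<le> t") (auto simp: p_def q_def intro!: bdd_aboveI[of _ t] bdd_belowI[of _ t])
  have "infdist t' K = min (t' - p) (q - t')" if t': "t' \<in> {p..q}" for t'
  proof (rule antisym)
    show "infdist t' K \<le> min (t' - p) (q - t')"
      using infdist_le[OF pq(1), of t'] infdist_le[OF pq(2), of t'] t' by (auto simp: dist_real_def)
    show "min (t' - p) (q - t') \<le> infdist t' K"
    proof (rule infdist_ge)
      fix k assume "k \<in> K"
      then show "min (t' - p) (q - t') \<le> dist t' k" using out[of k] t' by (auto simp: dist_real_def)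
    qed (use pq in auto)
  qed
  then show ?thesis using that pq by blast
qed

text \<open>On the gap of \<open>K\<close> around \<open>t\<close> the function
  \<open>\<phi>\<close> is the maximum of 0, \<open>s + p - t\<close> and \<open>s - q + t\<close>,
  hence convex with integer slopes.\<close>

lemma tent_slopes:
  fixes K :: "real set" and s :: real
  assumes K: "closed K" "t \<notin> K" "p0 \<in> K" "q0 \<in> K" "p0 < t" "t < q0"
  defines "\<phi> \<equiv> \<lambda>t. max 0 (s - infdist t K)"
  obtains k l :: int where "0 \<le> k + l" "\<forall>\<^sub>F h in at_right 0. \<phi> (t + 1 * h) = \<phi> t + of_int k * h"
    "\<forall>\<^sub>F h in at_right 0. \<phi> (t + -1 * h) = \<phi> t + of_int l * h"
proof -
  obtain p q where pq: "p < t" "t < q" "\<And>t'. t' \<in> {p..q} \<Longrightarrow> infdist t' K = min (t' - p) (q - t')"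
    using infdist_gap[OF K] by blast
  define A :: "(real \<times> int) set" where "A = {(0, 0), (s + p, -1), (s - q, 1)}"
  define L where "L i x = fst i + of_int (snd i) * x" for i :: "real \<times> int" and x :: real
  have L: "(\<forall>i\<in>A. L i x \<le> \<phi> x) \<and> (\<exists>i\<in>A. \<phi> x = L i x)" if "x \<in> {p..q}" for x
    unfolding \<phi>_def pq(3)[OF that] A_def L_def by (auto simp: min_def max_def)
  define B where "B = {i \<in> A. L i t = \<phi> t}"
  have tin: "t \<in> {p..q}" using pq by simp
  have "\<exists>i. i \<in> B" using L[OF tin] unfolding B_def by (metis (mono_tags, lifting) mem_Collect_eq)
  then obtain i0 where i0: "i0 \<in> B" by blast
  have fin: "finite A" by (simp add: A_def)
  have sl: "\<forall>\<^sub>F h in at_right 0. \<phi> (t + of_int j * h) = \<phi> t + of_int (Max ((\<lambda>i. j * snd i) ` B)) * h"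
    if j: "j = 1 \<or> j = -1" for j :: int
  proof -
    have in_pq: "\<forall>\<^sub>F h in at_right 0. t + of_int j * h \<in> {p..q}"
      unfolding eventually_at_right_0 using pq j by (intro exI[of _ "min (t - p) (q - t)"]) auto
    have "\<forall>\<^sub>F h in at_right 0. (\<lambda>h. \<phi> (t + of_int j * h)) h = (\<lambda>h. \<phi> (t + of_int j * h)) 0 +
      of_int (Max ((\<lambda>i. j * snd i) ` {i \<in> A. L i t = (\<lambda>h. \<phi> (t + of_int j * h)) 0})) * h"
    proof (rule max_lines_slope[OF fin])
      show "L i t \<le> \<phi> (t + of_int j * 0)" if "i \<in> A" for i using L[OF tin] that by simp
      show "\<exists>i\<in>A. L i t = \<phi> (t + of_int j * 0)" using i0 by (auto simp: B_def)
      have L': "L i t + of_int (j * snd i) * h = L i (t + of_int j * h)" for i h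
        by (simp add: L_def algebra_simps)
      show "\<forall>\<^sub>F h in at_right 0. (\<forall>i\<in>A. L i t + of_int (j * snd i) * h \<le> \<phi> (t + of_int j * h)) \<and>
          (\<exists>i\<in>A. \<phi> (t + of_int j * h) = L i t + of_int (j * snd i) * h)"
        using in_pq unfolding L' by eventually_elim (rule L)
    qed
    then show ?thesis by (simp add: B_def)
  qed
  have finB: "finite B" using fin by (simp add: B_def)
  have "1 * snd i0 \<le> Max ((\<lambda>i. 1 * snd i) ` B)" "-1 * snd i0 \<le> Max ((\<lambda>i. -1 * snd i) ` B)"
    using finB i0 by (intro Max_ge; auto)+
  then have nonneg: "0 \<le> Max ((\<lambda>i. 1 * snd i) ` B) + Max ((\<lambda>i. -1 * snd i) ` B)" by linarith
  have sl': "\<forall>\<^sub>F h in at_right 0. \<phi> (t + 1 * h) = \<phi> t + of_int (Max ((\<lambda>i. 1 * snd i) ` B)) * h"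
    "\<forall>\<^sub>F h in at_right 0. \<phi> (t + -1 * h) = \<phi> t + of_int (Max ((\<lambda>i. -1 * snd i) ` B)) * h"
    using sl[of 1] sl[of "-1"] by (simp_all only: of_int_1 of_int_minus simp_thms)
  show ?thesis by (rule that[OF nonneg sl'])
qed

text \<open>On the side of \<open>\<sigma>\<close> there is no point of \<open>K\<close> up to
  \<open>c\<close>, so up to \<open>c / 2\<close> the nearest point of \<open>K\<close> is
  \<open>t\<close> itself.\<close>

lemma infdist_leave:
  fixes K :: "real set"
  assumes "t \<in> K" "\<And>h. h \<in> {0<..c} \<Longrightarrow> t + \<sigma> * h \<notin> K" "\<sigma> = 1 \<or> \<sigma> = -1" "h \<in> {0..c / 2}"
  shows "infdist (t + \<sigma> * h) K = h"
proof (rule antisym)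
  have "dist (t + \<sigma> * h) t = h" using assms by (auto simp: dist_real_def)
  then show "infdist (t + \<sigma> * h) K \<le> h" using infdist_le[OF assms(1), of "t + \<sigma> * h"] by simp
  show "h \<le> infdist (t + \<sigma> * h) K"
  proof (rule infdist_ge)
    fix k assume k: "k \<in> K"
    have "t + \<sigma> * (\<sigma> * (k - t)) = k" using assms(3) by auto
    then have "\<sigma> * (k - t) \<notin> {0<..c}" using assms(2)[of "\<sigma> * (k - t)"] k by auto
    then show "h \<le> dist (t + \<sigma> * h) k" using assms(3,4) by (auto simp: dist_real_def)
  qed (use assms in auto)
qed

context tropical_curve
begin

text \<open>Firing a closed connected set that violates reducedness would enlarge \<open>F\<close>.\<close>

lemma maximal_reduced:
  assumes E: "divisor \<Gamma> E" "effective E" "Poly_Mapping.keys E \<subseteq> verts G" and w: "w \<in> \<Gamma>"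
    and F: "supported E F" "F w = 0" "\<And>f x. supported E f \<Longrightarrow> f w = 0 \<Longrightarrow> x \<in> \<Gamma> \<Longrightarrow> f x \<le> F x"
    and D: "\<And>x. x \<in> \<Gamma> \<Longrightarrow> Poly_Mapping.lookup D x = Poly_Mapping.lookup E x + ord_at G F x"
  shows "reduced \<Gamma> w D"
  unfolding reduced_def
proof (intro conjI ballI allI impI)
  note Fr = supported_rational[OF F(1) E(2,3)]
  have D0: "0 \<le> Poly_Mapping.lookup D x" if "x \<in> \<Gamma>" for x using Fr(2)[OF that] D[OF that] by simp
  then show "0 \<le> Poly_Mapping.lookup D v" if "v \<in> \<Gamma> - {w}" for v using that by blast
  fix X assume X: "closedin (top_of_set \<Gamma>) X \<and> connected X \<and> X \<noteq> {} \<and> w \<notin> X"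
  then have conX: "connected X" "X \<noteq> {}" "w \<notin> X" "closedin (top_of_set \<Gamma>) X" by auto
  have clX: "closed X" using conX(4) compact_imp_closed[OF compact_\<Gamma>] closedin_closed_trans by blast
  have X\<Gamma>: "X \<subseteq> \<Gamma>" using closedin_subset[OF conX(4)] by simp
  show "\<exists>v\<in>top_of_set \<Gamma> frontier_of X. Poly_Mapping.lookup D v < int (deg_out \<Gamma> X v)"
  proof (rule ccontr)
    assume "\<not> ?thesis"
    then have legal: "int (deg_out \<Gamma> X v) \<le> Poly_Mapping.lookup D v" if "v \<in> top_of_set \<Gamma> frontier_of X" for v
      using that by (auto simp: not_less)
    \<comment> \<open>The firing distance \<open>s\<close> is small enough for the fired function to
      vanish at \<open>w\<close> and at all vertices outside \<open>X\<close>.\<close>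
    define Q where "Q = (\<lambda>y. infdist y X) ` ((insert w (verts G)) - X)"
    have finQ: "finite Q" unfolding Q_def using finite_verts by simp
    have Qne: "Q \<noteq> {}" unfolding Q_def using conX(3) by simp
    have "0 < q" if "q \<in> Q" for q
      using that clX conX(2) by (auto simp: Q_def intro: infdist_pos_not_in_closed)
    define s where "s = Min Q"
    have s: "0 < s" using \<open>\<And>q. q \<in> Q \<Longrightarrow> 0 < q\<close> Min_in[OF finQ Qne] by (simp add: s_def)
    have s_le: "s \<le> infdist y X" if "y \<in> insert w (verts G)" "y \<notin> X" for y
      unfolding s_def using finQ that by (intro Min_le) (auto simp: Q_def)
    \<comment> \<open>The two parameters at distance \<open>s\<close> beyond the ends leave the
      truncated distance on the edge unchanged. They ensure that every parameter outside
      \<open>X\<close> lies in a bounded gap, even on an edge that misses \<open>X\<close>.\<close>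
    define K where "K e = ({0..elen G e} \<inter> epar G e -` X) \<union> {-s, elen G e + s}" for e
    define \<phi> where "\<phi> e t = max 0 (s - infdist t (K e))" for e t
    have clK: "closed (K e)" if "e \<in> edges G" for e
      unfolding K_def using continuous_closed_preimage[OF continuous_epar[OF that] _ clX]
      by (intro closed_Un) auto
    have \<phi>_in: "\<phi> e t = s" if "e \<in> edges G" "t \<in> {0..elen G e}" "epar G e t \<in> X" for e t
      using that s by (simp add: \<phi>_def K_def)
    have \<phi>_out: "\<phi> e t = 0" if e: "e \<in> edges G" and t: "t \<in> {0..elen G e}" and "s \<le> infdist (epar G e t) X" for e t
    proof -
      have "s \<le> infdist t (K e)"
      proof (rule infdist_ge)
        fix k assume "k \<in> K e"
        then consider "k \<in> {0..elen G e}" "epar G e k \<in> X" | "k = -s" | "k = elen G e + s"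
          by (auto simp: K_def)
        then show "s \<le> dist t k"
        proof cases
          case 1
          then have "infdist (epar G e t) X \<le> dist (epar G e t) (epar G e k)" by (intro infdist_le)
          also have "\<dots> \<le> dist t k" using dist_epar_le[OF e t 1(1)] by (simp add: dist_real_def)
          finally show ?thesis using that(3) by simp
        qed (use t s in \<open>auto simp: dist_real_def\<close>)
      qed (simp add: K_def)
      then show ?thesis by (simp add: \<phi>_def)
    qed
    have end_val: "\<phi> e t = (if epar G e t \<in> X then s else 0)" if "e \<in> edges G" "t \<in> {0..elen G e}" "epar G e t \<in> insert w (verts G)" for e t
      using \<phi>_in[OF that(1,2)] \<phi>_out[OF that(1,2)] s_le[OF that(3)] by auto
    have "\<exists>g. (\<forall>u\<in>verts G. g u = (if u \<in> X then s else 0)) \<and> (\<forall>e\<in>edges G. \<forall>t\<in>{0..elen G e}. g (epar G e t) = \<phi> e t)"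
      using epar_0 epar_elen elen_pos by (intro glue end_val) (auto simp: less_imp_le)
    then obtain g where gv: "\<And>u. u \<in> verts G \<Longrightarrow> g u = (if u \<in> X then s else 0)"
      and ge: "\<And>e t. e \<in> edges G \<Longrightarrow> t \<in> {0..elen G e} \<Longrightarrow> g (epar G e t) = \<phi> e t" by blast
    have gX: "g x = s" if "x \<in> X" for x
    proof -
      have "x \<in> \<Gamma>" using that X\<Gamma> by blast
      then show ?thesis
      proof (cases rule: point_cases)
        case (2 e t)
        then show ?thesis using ge[of e t] \<phi>_in[of e t] that by auto
      qed (use gv that in simp)
    qed
    have g0: "0 \<le> g x" if "x \<in> \<Gamma>" for x
      using that
    proof (cases rule: point_cases)
      case (2 e t)
      then show ?thesis using ge[of e t] by (simp add: \<phi>_def)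
    qed (use gv s in simp)
    have gw: "g w = 0"
      using w
    proof (cases rule: point_cases)
      case (2 e t)
      then show ?thesis using ge[of e t] end_val[of e t] conX(3) by auto
    qed (use gv conX(3) in simp)
    have slope: "\<forall>\<^sub>F h in at_right 0. \<phi> e (t + \<sigma> * h) = \<phi> e t + of_int k * h \<Longrightarrow> has_slope G g (e, t, \<sigma>) k"
      if d: "(e, t, \<sigma>) \<in> directions G x" for e t \<sigma> k x
    proof -
      assume "\<forall>\<^sub>F h in at_right 0. \<phi> e (t + \<sigma> * h) = \<phi> e t + of_int k * h"
      with directions_range_ev[OF d]
      show "has_slope G g (e, t, \<sigma>) k" unfolding has_slope_def
      proof eventually_elim
        case (elim h)
        then show ?case using ge[of e "t + \<sigma> * h"] ge[of e t] d by (auto simp: directions_def)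
      qed
    qed
    \<comment> \<open>On \<open>X\<close> the function \<open>g\<close> equals \<open>s\<close> and
      descends with slope -1 exactly along the directions that leave \<open>X\<close>, so its order
      is minus their number, which is the outgoing degree.\<close>
    have slope_in: "has_slope G g \<delta> (if \<forall>\<^sub>F h in at_right 0. along G \<delta> h \<notin> X then -1 else 0)"
      if x: "x \<in> X" and \<delta>: "\<delta> \<in> directions G x" for x \<delta>
    proof (cases "\<forall>\<^sub>F h in at_right 0. along G \<delta> h \<notin> X")
      case False
      then have "\<forall>\<^sub>F h in at_right 0. along G \<delta> h \<in> X" using germ_dichotomy[OF conX(1) clX X\<Gamma> x \<delta>] by blast
      then have "has_slope G g \<delta> 0" unfolding has_slope_def
        by eventually_elim (use gX x along_0[OF \<delta>] in simp)
      then show ?thesis by (simp only: False if_False)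
    next
      case True
      obtain e t \<sigma> where \<delta>': "\<delta> = (e, t, \<sigma>)" by (cases \<delta>)
      have e: "e \<in> edges G" "t \<in> {0..elen G e}" "epar G e t = x" "\<sigma> = 1 \<or> \<sigma> = -1" using \<delta> \<delta>' by (auto simp: directions_def)
      from True directions_range_ev[OF \<delta>[unfolded \<delta>']]
      have "\<forall>\<^sub>F h in at_right 0. along G \<delta> h \<notin> X \<and> t + \<sigma> * h \<in> {0<..<elen G e}" by eventually_elim blast
      then obtain c where c: "0 < c" "\<And>h. h \<in> {0<..c} \<Longrightarrow> along G \<delta> h \<notin> X \<and> t + \<sigma> * h \<in> {0<..<elen G e}"
        unfolding eventually_at_right_0 by blast
      have tK: "t \<in> K e" using e x by (simp add: K_def)
      have nK: "t + \<sigma> * h \<notin> K e" if "h \<in> {0<..c}" for h using c(2)[OF that] s by (auto simp: K_def \<delta>')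
      have "\<forall>\<^sub>F h in at_right 0. \<phi> e (t + \<sigma> * h) = \<phi> e t + of_int (-1) * h"
        unfolding eventually_at_right_0
      proof (intro exI[of _ "min (c / 2) s"] conjI ballI)
        fix h assume h: "h \<in> {0<..min (c / 2) s}"
        then have "infdist (t + \<sigma> * h) (K e) = h" using tK nK e(4) by (intro infdist_leave[of _ _ c]) auto
        moreover have "infdist t (K e) = 0" using tK by simp
        ultimately show "\<phi> e (t + \<sigma> * h) = \<phi> e t + of_int (-1) * h" using h s by (simp add: \<phi>_def)
      qed (use c s in simp)
      then have "has_slope G g \<delta> (-1)" using slope[OF \<delta>[unfolded \<delta>']] \<delta>' by blast
      then show ?thesis by (simp only: True if_True)
    qed
    have slopes_out: "\<exists>k l. 0 \<le> k + l \<and> (t < elen G e \<longrightarrow> has_slope G g (e, t, 1) k) \<and> (0 < t \<longrightarrow> has_slope G g (e, t, -1) l)"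
      if e: "e \<in> edges G" "t \<in> {0..elen G e}" "epar G e t \<notin> X" for e t
    proof -
      have K: "t \<notin> K e" "-s \<in> K e" "elen G e + s \<in> K e" "-s < t" "t < elen G e + s" using e s by (auto simp: K_def)
      obtain k l :: int where kl: "0 \<le> k + l" "\<forall>\<^sub>F h in at_right 0. \<phi> e (t + 1 * h) = \<phi> e t + of_int k * h"
        "\<forall>\<^sub>F h in at_right 0. \<phi> e (t + -1 * h) = \<phi> e t + of_int l * h"
        using tent_slopes[OF clK[OF e(1)] K, of s] unfolding \<phi>_def by blast
      have "t < elen G e \<longrightarrow> (e, t, 1) \<in> directions G (epar G e t)" "0 < t \<longrightarrow> (e, t, -1) \<in> directions G (epar G e t)"
        using e by (auto simp: directions_def)
      then show ?thesis using kl slope by blast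
    qed
    have cont_g: "continuous_on \<Gamma> g"
    proof (rule continuous_Lipschitz[of g 1])
      fix e a b assume e: "e \<in> edges G" "a \<in> {0..elen G e}" "b \<in> {0..elen G e}"
      have "\<bar>infdist a (K e) - infdist b (K e)\<bar> \<le> dist a b" by (rule infdist_triangle_abs)
      then show "\<bar>g (epar G e a) - g (epar G e b)\<bar> \<le> 1 * \<bar>a - b\<bar>"
        using ge[OF e(1,2)] ge[OF e(1,3)] by (auto simp: \<phi>_def dist_real_def max_def abs_if split: if_splits)
    qed simp
    have gr: "rational_function \<Gamma> G g"
    proof (rule rationalI[OF cont_g])
      fix x \<delta> assume x: "x \<in> \<Gamma>" "\<delta> \<in> directions G x"
      obtain e t \<sigma> where \<delta>': "\<delta> = (e, t, \<sigma>)" by (cases \<delta>)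
      have e: "e \<in> edges G" "t \<in> {0..elen G e}" "epar G e t = x" "\<sigma> = 1 \<and> t < elen G e \<or> \<sigma> = -1 \<and> 0 < t"
        using x \<delta>' by (auto simp: directions_def)
      show "\<exists>k. has_slope G g \<delta> k"
      proof (cases "x \<in> X")
        case True
        then show ?thesis using slope_in x by blast
      next
        case False
        then obtain k l where "(t < elen G e \<longrightarrow> has_slope G g (e, t, 1) k)" "(0 < t \<longrightarrow> has_slope G g (e, t, -1) l)"
          using slopes_out[of e t] e by blast
        then show ?thesis using e(4) \<delta>' by blast
      qed
    qed
    have og: "0 \<le> Poly_Mapping.lookup D x + ord_at G g x" if x: "x \<in> \<Gamma>" for x
    proof (cases "x \<in> X")
      case True
      define L where "L = {\<delta> \<in> directions G x. \<forall>\<^sub>F h in at_right 0. along G \<delta> h \<notin> X}"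
      have "ord_at G g x = (\<Sum>\<delta>\<in>directions G x. if \<forall>\<^sub>F h in at_right 0. along G \<delta> h \<notin> X then -1 else 0)"
        using slope_in[OF True] by (intro has_slope_ord)
      also have "\<dots> = (\<Sum>\<delta>\<in>directions G x. if \<delta> \<in> L then -1 else 0)" by (intro sum.cong) (auto simp: L_def)
      also have "\<dots> = - int (card L)"
      proof -
        have "directions G x \<inter> L = L" by (auto simp: L_def)
        then show ?thesis using finite_directions[of x] by (simp add: sum.If_cases)
      qed
      finally have ord: "ord_at G g x = - int (card L)" .
      show ?thesis
      proof (cases "x \<in> top_of_set \<Gamma> frontier_of X")
        case True
        then show ?thesis using legal[OF True] ord deg_out_eq[OF x, of X] by (simp add: L_def)
      next
        case False
        have "x \<in> top_of_set \<Gamma> closure_of X" using \<open>x \<in> X\<close> conX(4) by (simp add: closure_of_closedin)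
        then have "x \<in> top_of_set \<Gamma> interior_of X" using False by (simp add: frontier_of_def)
        then obtain T where T: "openin (top_of_set \<Gamma>) T" "x \<in> T" "T \<subseteq> X" by (auto simp: interior_of_def)
        then obtain r where r: "0 < r" "ball x r \<inter> \<Gamma> \<subseteq> T" unfolding openin_contains_ball by blast
        \<comment> \<open>A point of \<open>X\<close> off the frontier has a neighbourhood inside
          \<open>X\<close>, so no direction leaves \<open>X\<close> there.\<close>
        have "L = {}"
        proof (rule ccontr)
          assume "L \<noteq> {}"
          then obtain \<delta> where \<delta>: "\<delta> \<in> directions G x" "\<forall>\<^sub>F h in at_right 0. along G \<delta> h \<notin> X" by (auto simp: L_def)
          obtain e t \<sigma> where \<delta>': "\<delta> = (e, t, \<sigma>)" by (cases \<delta>)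
          have e: "e \<in> edges G" "t \<in> {0..elen G e}" "epar G e t = x" "\<sigma> = 1 \<or> \<sigma> = -1" using \<delta> \<delta>' by (auto simp: directions_def)
          have "\<forall>\<^sub>F h in at_right 0. 0 < h \<and> h \<le> r / 2" using r by (intro eventually_at_right_0_le) simp
          with \<delta>(2) directions_range_ev[OF \<delta>(1)[unfolded \<delta>']] have "\<forall>\<^sub>F h::real in at_right 0. False"
          proof eventually_elim
            case (elim h)
            have "t + \<sigma> * h \<in> {0..elen G e}" using elim(2) by auto
            then have "dist x (along G \<delta> h) \<le> h" "along G \<delta> h \<in> \<Gamma>"
              using dist_epar_le[OF e(1,2), of "t + \<sigma> * h"] e elim(3) by (auto simp: \<delta>' intro!: epar_in)
            then have "along G \<delta> h \<in> ball x r \<inter> \<Gamma>" using elim(3) r by auto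
            then show False using elim(1) r(2) T(3) by blast
          qed
          then show False by simp
        qed
        then show ?thesis using ord D0[OF x] by simp
      qed
    next
      case False
      have "0 \<le> ord_at G g x"
        using x
      proof (cases rule: point_cases)
        case 1
        \<comment> \<open>A vertex outside \<open>X\<close> is a minimum of \<open>g\<close>, so
          none of its outgoing slopes is negative. At the other points outside \<open>X\<close> the
          tent is convex.\<close>
        then have "g x = 0" using gv False by simp
        then have "outgoing_slope G (\<lambda>x. - g x) \<delta> \<le> 0" if "\<delta> \<in> directions G x" for \<delta>
          using slope_nonpos_at_max[OF rational_uminus(1)[OF gr] x that] g0 by simp
        then have "ord_at G (\<lambda>x. - g x) x \<le> 0" unfolding ord_at_def by (intro sum_nonpos)
        then show ?thesis using rational_uminus(2)[OF gr x] by simp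
      next
        case (2 e t)
        then obtain k l where kl: "0 \<le> k + l" "has_slope G g (e, t, 1) k" "has_slope G g (e, t, -1) l"
          using slopes_out[of e t] False by auto
        then have "ord_at G g x = k + l" using directions_interior[OF 2(1,2)] 2(3)
          by (simp add: ord_at_def outgoing_slope_eq)
        then show ?thesis using kl by simp
      qed
      then show ?thesis using D0[OF x] by simp
    qed
    \<comment> \<open>The sum still vanishes at \<open>w\<close> but exceeds \<open>F\<close> by
      \<open>s\<close> on \<open>X\<close>, against the maximality of \<open>F\<close>.\<close>
    have "supported E (\<lambda>x. F x + g x)"
    proof (rule rational_supported[OF _ E])
      show "rational_function \<Gamma> G (\<lambda>x. F x + g x)" using Fr(1) gr by (rule rational_add)
      show "0 \<le> Poly_Mapping.lookup E x + ord_at G (\<lambda>x. F x + g x) x" if "x \<in> \<Gamma>" for x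
        using og[OF that] D[OF that] rational_add(2)[OF Fr(1) gr that] by simp
    qed
    moreover obtain x where x: "x \<in> X" using conX(2) by blast
    ultimately have "F x + g x \<le> F x" using F(2) gw X\<Gamma> by (intro F(3)) auto
    then show False using gX[OF x] s by simp
  qed
qed

end

section \<open>Linear equivalence and uniqueness of reduced divisors\<close>

lemma ex_poly_mapping:
  assumes "finite {x \<in> A. g x \<noteq> 0}"
  shows "\<exists>D. Poly_Mapping.keys D \<subseteq> A \<and> (\<forall>x\<in>A. Poly_Mapping.lookup D x = g x)"
proof -
  have "finite {x. (if x \<in> A then g x else 0) \<noteq> 0}" using assms by (rule rev_finite_subset) auto
  then have "Poly_Mapping.lookup (Abs_poly_mapping (\<lambda>x. if x \<in> A then g x else 0)) = (\<lambda>x. if x \<in> A then g x else 0)"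
    by (intro Abs_poly_mapping_inverse) simp
  then show ?thesis
    by (intro exI[of _ "Abs_poly_mapping (\<lambda>x. if x \<in> A then g x else 0)"]) (auto simp: in_keys_iff split: if_splits)
qed

context tropical_curve
begin

lemma lin_equiv_sym: "lin_equiv \<Gamma> G D D' \<Longrightarrow> lin_equiv \<Gamma> G D' D"
proof -
  assume "lin_equiv \<Gamma> G D D'"
  then obtain f where "rational_function \<Gamma> G f" "\<forall>v\<in>\<Gamma>. Poly_Mapping.lookup (D - D') v = ord_at G f v"
    unfolding lin_equiv_def by blast
  then show ?thesis unfolding lin_equiv_def
    by (intro exI[of _ "\<lambda>x. - f x"] conjI rational_uminus(1) ballI) (auto simp: rational_uminus(2) lookup_minus)
qed

lemma lin_equiv_trans:
  assumes "lin_equiv \<Gamma> G D D'" "lin_equiv \<Gamma> G D' D''"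
  shows "lin_equiv \<Gamma> G D D''"
proof -
  obtain f where "rational_function \<Gamma> G f" "\<forall>v\<in>\<Gamma>. Poly_Mapping.lookup (D - D') v = ord_at G f v"
    using assms unfolding lin_equiv_def by blast
  moreover obtain g where "rational_function \<Gamma> G g" "\<forall>v\<in>\<Gamma>. Poly_Mapping.lookup (D' - D'') v = ord_at G g v"
    using assms unfolding lin_equiv_def by blast
  ultimately show ?thesis unfolding lin_equiv_def
    by (intro exI[of _ "\<lambda>x. f x + g x"] conjI rational_add(1) ballI) (force simp: rational_add(2) lookup_minus)+
qed

lemma lin_equiv_degree:
  assumes "lin_equiv \<Gamma> G D D'" "divisor \<Gamma> D" "divisor \<Gamma> D'"
  shows "div_degree D = div_degree D'"
proof -
  obtain f where f: "rational_function \<Gamma> G f" "\<And>v. v \<in> \<Gamma> \<Longrightarrow> Poly_Mapping.lookup (D - D') v = ord_at G f v"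
    using assms(1) unfolding lin_equiv_def by blast
  define W where "W = Poly_Mapping.keys D \<union> Poly_Mapping.keys D'"
  have W: "finite W" "W \<subseteq> \<Gamma>" using assms by (auto simp: W_def divisor_def)
  have "(\<Sum>v\<in>W. Poly_Mapping.lookup D v - Poly_Mapping.lookup D' v) = (\<Sum>v\<in>W. ord_at G f v)"
    using W f(2) by (intro sum.cong) (auto simp: lookup_minus)
  also have "\<dots> = 0"
  proof (rule sum_ord_zero(2)[OF f(1) W])
    show "{v \<in> \<Gamma>. ord_at G f v \<noteq> 0} \<subseteq> W"
      using f(2)[symmetric] by (auto simp: W_def lookup_minus in_keys_iff)
  qed
  finally have "(\<Sum>v\<in>W. Poly_Mapping.lookup D v) = (\<Sum>v\<in>W. Poly_Mapping.lookup D' v)"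
    by (simp add: sum_subtractf)
  moreover have "(\<Sum>v\<in>W. Poly_Mapping.lookup D v) = div_degree D" unfolding div_degree_def
    using W by (intro sum.mono_neutral_right) (auto simp: W_def in_keys_iff)
  moreover have "(\<Sum>v\<in>W. Poly_Mapping.lookup D' v) = div_degree D'" unfolding div_degree_def
    using W by (intro sum.mono_neutral_right) (auto simp: W_def in_keys_iff)
  ultimately show ?thesis by simp
qed

lemma ord_zero_if_constant:
  assumes "\<And>x. x \<in> \<Gamma> \<Longrightarrow> f x = c" "v \<in> \<Gamma>"
  shows "ord_at G f v = 0"
proof -
  have "ord_at G f v = (\<Sum>\<delta>\<in>directions G v. 0)"
  proof (rule has_slope_ord)
    fix \<delta> assume \<delta>: "\<delta> \<in> directions G v"
    show "has_slope G f \<delta> 0" unfolding has_slope_def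
      using along_in_ev[OF \<delta>] by eventually_elim (use assms along_0[OF \<delta>] in simp)
  qed
  then show ?thesis by simp
qed

text \<open>If \<open>D - D' = div f\<close>, reducedness of \<open>D'\<close> makes
  \<open>f\<close> largest at \<open>P\<close> and reducedness of \<open>D\<close> makes
  \<open>- f\<close> largest there, so \<open>f\<close> is constant.\<close>

lemma reduced_unique:
  assumes P: "P \<in> \<Gamma>" and D: "divisor \<Gamma> D" "reduced \<Gamma> P D" and D': "divisor \<Gamma> D'" "reduced \<Gamma> P D'"
    and eq: "lin_equiv \<Gamma> G D D'"
  shows "D = D'"
proof -
  obtain f where f: "rational_function \<Gamma> G f" "\<And>v. v \<in> \<Gamma> \<Longrightarrow> Poly_Mapping.lookup (D - D') v = ord_at G f v"
    using eq unfolding lin_equiv_def by blast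
  have "f x \<le> f P" if "x \<in> \<Gamma>" for x
  proof (rule reduced_imp_max[OF D'(2) P f(1) _ that])
    show "0 \<le> Poly_Mapping.lookup D' x + ord_at G f x" if "x \<in> \<Gamma> - {P}" for x
    proof -
      have "0 \<le> Poly_Mapping.lookup D x" using D(2) that by (simp add: reduced_def)
      then show ?thesis using f(2)[of x, symmetric] that by (simp add: lookup_minus)
    qed
  qed
  moreover have "- f x \<le> - f P" if "x \<in> \<Gamma>" for x
  proof (rule reduced_imp_max[OF D(2) P rational_uminus(1)[OF f(1)] _ that])
    show "0 \<le> Poly_Mapping.lookup D x + ord_at G (\<lambda>x. - f x) x" if "x \<in> \<Gamma> - {P}" for x
    proof -
      have "0 \<le> Poly_Mapping.lookup D' x" using D'(2) that by (simp add: reduced_def)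
      then show ?thesis using f(2)[of x, symmetric] that rational_uminus(2)[OF f(1), of x] by (simp add: lookup_minus)
    qed
  qed
  ultimately have "f x = f P" if "x \<in> \<Gamma>" for x using that by (metis antisym neg_le_iff_le)
  then have "ord_at G f v = 0" if "v \<in> \<Gamma>" for v using that ord_zero_if_constant by blast
  then have *: "Poly_Mapping.lookup D v = Poly_Mapping.lookup D' v" if "v \<in> \<Gamma>" for v
    using f(2)[OF that] that by (simp add: lookup_minus)
  show "D = D'"
  proof (rule poly_mapping_eqI)
    fix v
    show "Poly_Mapping.lookup D v = Poly_Mapping.lookup D' v"
    proof (cases "v \<in> \<Gamma>")
      case False
      then have "v \<notin> Poly_Mapping.keys D" "v \<notin> Poly_Mapping.keys D'"
        using D(1) D'(1) by (auto simp: divisor_def)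
      then show ?thesis by (simp add: in_keys_iff)
    qed (rule *)
  qed
qed

text \<open>Only the coefficient at \<open>P\<close> is in question. If
  \<open>E - D = div f\<close>, then \<open>f\<close> is largest at \<open>P\<close>, so its order
  there is at most 0 and \<open>D\<close> has at least as many chips at \<open>P\<close> as
  \<open>E\<close>.\<close>

lemma reduced_effective:
  assumes P: "P \<in> \<Gamma>" and D: "divisor \<Gamma> D" "reduced \<Gamma> P D" and E: "effective E" and eq: "lin_equiv \<Gamma> G E D"
  shows "effective D"
  unfolding effective_def
proof
  fix v
  obtain f where f: "rational_function \<Gamma> G f" "\<And>v. v \<in> \<Gamma> \<Longrightarrow> Poly_Mapping.lookup (E - D) v = ord_at G f v"
    using eq unfolding lin_equiv_def by blast
  consider "v \<notin> \<Gamma>" | "v \<in> \<Gamma> - {P}" | "v = P" using P by blast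
  then show "0 \<le> Poly_Mapping.lookup D v"
  proof cases
    case 1
    then have "v \<notin> Poly_Mapping.keys D" using D(1) by (auto simp: divisor_def)
    then show ?thesis by (simp add: in_keys_iff)
  next
    case 2
    then show ?thesis using D(2) by (simp add: reduced_def)
  next
    case 3
    have "f x \<le> f P" if "x \<in> \<Gamma>" for x
    proof (rule reduced_imp_max[OF D(2) P f(1) _ that])
      show "0 \<le> Poly_Mapping.lookup D x + ord_at G f x" if "x \<in> \<Gamma> - {P}" for x
        using f(2)[of x, symmetric] that E by (simp add: lookup_minus effective_def)
    qed
    then have "ord_at G f P \<le> 0" using f(1) P by (intro ord_nonpos_at_max)
    then have "Poly_Mapping.lookup E P \<le> Poly_Mapping.lookup D P" using f(2)[OF P] by (simp add: lookup_minus)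
    moreover have "0 \<le> Poly_Mapping.lookup E P" using E by (simp add: effective_def)
    ultimately show ?thesis using 3 by simp
  qed
qed

lemma ex_reduced_maximal:
  assumes E: "divisor \<Gamma> E" "effective E" "Poly_Mapping.keys E \<subseteq> verts G" and w: "w \<in> \<Gamma>"
  obtains F D where "supported E F" "F w = 0"
    "\<And>f x. supported E f \<Longrightarrow> f w = 0 \<Longrightarrow> x \<in> \<Gamma> \<Longrightarrow> f x \<le> F x"
    "divisor \<Gamma> D" "\<And>x. x \<in> \<Gamma> \<Longrightarrow> Poly_Mapping.lookup D x = Poly_Mapping.lookup E x + ord_at G F x"
    "lin_equiv \<Gamma> G D E" "reduced \<Gamma> w D"
proof -
  obtain F where F: "supported E F" "F w = 0" "\<And>f x. supported E f \<Longrightarrow> f w = 0 \<Longrightarrow> x \<in> \<Gamma> \<Longrightarrow> f x \<le> F x"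
    using ex_maximal[OF E(2) w] by blast
  note Fr = supported_rational[OF F(1) E(2,3)]
  have "finite {x \<in> \<Gamma>. Poly_Mapping.lookup E x + ord_at G F x \<noteq> 0}"
    by (rule finite_subset[of _ "Poly_Mapping.keys E \<union> {x \<in> \<Gamma>. ord_at G F x \<noteq> 0}"])
      (use sum_ord_zero(1)[OF Fr(1)] in \<open>auto simp: in_keys_iff\<close>)
  then obtain D where D: "Poly_Mapping.keys D \<subseteq> \<Gamma>"
    "\<And>x. x \<in> \<Gamma> \<Longrightarrow> Poly_Mapping.lookup D x = Poly_Mapping.lookup E x + ord_at G F x"
    using ex_poly_mapping[of \<Gamma> "\<lambda>x. Poly_Mapping.lookup E x + ord_at G F x"] by blast
  have "lin_equiv \<Gamma> G D E" unfolding lin_equiv_def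
    using Fr(1) D(2) by (intro exI[of _ F]) (simp add: lookup_minus)
  moreover have "reduced \<Gamma> w D" using E w F D(2) by (rule maximal_reduced)
  ultimately show ?thesis using that F D by (auto simp: divisor_def)
qed

end

section \<open>Change of model\<close>

text \<open>Both stars at \<open>v\<close> describe the same metric, and in a star two points other
  than \<open>v\<close> lie on one branch exactly when their distance is the difference, not the
  sum, of their distances from \<open>v\<close>. So a branch of one model cannot switch branches of
  the other.\<close>

lemma directions_match:
  assumes "model_of \<Gamma> G" "model_of \<Gamma> M" and v: "v \<in> \<Gamma>"
  shows "\<exists>\<epsilon>>0. \<forall>\<delta>\<in>directions G v. \<exists>\<delta>'\<in>directions M v. \<forall>h\<in>{0..\<epsilon>}. along G \<delta> h = along M \<delta>' h"
proof -
  interpret G: tropical_curve \<Gamma> G using assms by unfold_locales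
  interpret M: tropical_curve \<Gamma> M using assms by unfold_locales
  obtain \<epsilon>1 where \<epsilon>1: "0 < \<epsilon>1"
    and r1: "\<And>e t \<sigma> h. (e, t, \<sigma>) \<in> directions G v \<Longrightarrow> h \<in> {0..\<epsilon>1} \<Longrightarrow> t + \<sigma> * h \<in> {0..elen G e}"
    and d1: "\<And>\<delta> \<delta>' h h'. \<delta> \<in> directions G v \<Longrightarrow> \<delta>' \<in> directions G v \<Longrightarrow> h \<in> {0..\<epsilon>1} \<Longrightarrow> h' \<in> {0..\<epsilon>1} \<Longrightarrow>
      dist (along G \<delta> h) (along G \<delta>' h') = (if \<delta> = \<delta>' then \<bar>h - h'\<bar> else h + h')"
    using G.star[OF v] by metis
  obtain \<epsilon>2 where \<epsilon>2: "0 < \<epsilon>2"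
    and d2: "\<And>\<delta> \<delta>' h h'. \<delta> \<in> directions M v \<Longrightarrow> \<delta>' \<in> directions M v \<Longrightarrow> h \<in> {0..\<epsilon>2} \<Longrightarrow> h' \<in> {0..\<epsilon>2} \<Longrightarrow>
      dist (along M \<delta> h) (along M \<delta>' h') = (if \<delta> = \<delta>' then \<bar>h - h'\<bar> else h + h')"
    and n2: "\<And>y. y \<in> \<Gamma> \<Longrightarrow> dist v y < \<epsilon>2 \<Longrightarrow> y \<noteq> v \<Longrightarrow> \<exists>\<delta>\<in>directions M v. y = along M \<delta> (dist v y)"
    using M.star[OF v] by metis
  define \<epsilon> where "\<epsilon> = min \<epsilon>1 \<epsilon>2 / 2"
  have \<epsilon>: "0 < \<epsilon>" "\<epsilon> \<le> \<epsilon>1" "\<epsilon> < \<epsilon>2" using \<epsilon>1 \<epsilon>2 by (auto simp: \<epsilon>_def)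
  show ?thesis
  proof (intro exI[of _ \<epsilon>] conjI ballI \<epsilon>(1))
    fix \<delta> assume \<delta>: "\<delta> \<in> directions G v"
    have on: "\<exists>\<delta>'\<in>directions M v. along G \<delta> h = along M \<delta>' h" if h: "h \<in> {0<..\<epsilon>}" for h
    proof -
      obtain e t \<sigma> where \<delta>': "\<delta> = (e, t, \<sigma>)" by (cases \<delta>)
      have "along G \<delta> h \<in> \<Gamma>"
        using r1[OF \<delta>[unfolded \<delta>'], of h] h \<epsilon> \<delta> by (auto simp: \<delta>' directions_def intro!: G.epar_in)
      moreover have "dist v (along G \<delta> h) = h"
        using d1[OF \<delta> \<delta>, of 0 h] h \<epsilon> along_0[OF \<delta>] by simp
      moreover from this have "along G \<delta> h \<noteq> v" using h by auto
      ultimately show ?thesis using n2[of "along G \<delta> h"] h \<epsilon> by simp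
    qed
    obtain \<delta>' where \<delta>': "\<delta>' \<in> directions M v" "along G \<delta> \<epsilon> = along M \<delta>' \<epsilon>" using on[of \<epsilon>] \<epsilon> by auto
    have "along G \<delta> h = along M \<delta>' h" if h: "h \<in> {0..\<epsilon>}" for h
    proof (cases "h = 0")
      case True
      then show ?thesis using along_0[OF \<delta>] along_0[OF \<delta>'(1)] by simp
    next
      case False
      then obtain \<delta>'' where \<delta>'': "\<delta>'' \<in> directions M v" "along G \<delta> h = along M \<delta>'' h" using on[of h] h by auto
      have "\<delta>'' = \<delta>'"
      proof (rule ccontr)
        assume "\<delta>'' \<noteq> \<delta>'"
        then have "dist (along G \<delta> h) (along G \<delta> \<epsilon>) = h + \<epsilon>"
          using d2[OF \<delta>''(1) \<delta>'(1), of h \<epsilon>] \<delta>''(2) \<delta>'(2) h \<epsilon> by simp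
        moreover have "dist (along G \<delta> h) (along G \<delta> \<epsilon>) = \<bar>h - \<epsilon>\<bar>" using d1[OF \<delta> \<delta>, of h \<epsilon>] h \<epsilon> by simp
        ultimately show False using False h by simp
      qed
      then show ?thesis using \<delta>'' by simp
    qed
    then show "\<exists>\<delta>'\<in>directions M v. \<forall>h\<in>{0..\<epsilon>}. along G \<delta> h = along M \<delta>' h" using \<delta>'(1) by blast
  qed
qed

lemma directions_match_inj:
  assumes "model_of \<Gamma> G" "model_of \<Gamma> M" and v: "v \<in> \<Gamma>"
  obtains \<beta> \<epsilon> where "0 < \<epsilon>" "inj_on \<beta> (directions G v)" "\<beta> ` directions G v \<subseteq> directions M v"
    "\<And>\<delta> h. \<delta> \<in> directions G v \<Longrightarrow> h \<in> {0..\<epsilon>} \<Longrightarrow> along G \<delta> h = along M (\<beta> \<delta>) h"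
proof -
  interpret G: tropical_curve \<Gamma> G using assms by unfold_locales
  obtain \<epsilon>1 where \<epsilon>1: "0 < \<epsilon>1"
    and d1: "\<And>\<delta> \<delta>' h h'. \<delta> \<in> directions G v \<Longrightarrow> \<delta>' \<in> directions G v \<Longrightarrow> h \<in> {0..\<epsilon>1} \<Longrightarrow> h' \<in> {0..\<epsilon>1} \<Longrightarrow>
      dist (along G \<delta> h) (along G \<delta>' h') = (if \<delta> = \<delta>' then \<bar>h - h'\<bar> else h + h')"
    using G.star[OF v] by metis
  obtain \<epsilon> \<beta> where \<epsilon>: "0 < \<epsilon>" and \<beta>: "\<And>\<delta>. \<delta> \<in> directions G v \<Longrightarrow> \<beta> \<delta> \<in> directions M v"
    "\<And>\<delta> h. \<delta> \<in> directions G v \<Longrightarrow> h \<in> {0..\<epsilon>} \<Longrightarrow> along G \<delta> h = along M (\<beta> \<delta>) h"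
    using directions_match[OF assms] by metis
  have "inj_on \<beta> (directions G v)"
  proof (rule inj_onI, rule ccontr)
    fix \<delta> \<delta>' assume *: "\<delta> \<in> directions G v" "\<delta>' \<in> directions G v" "\<beta> \<delta> = \<beta> \<delta>'" "\<delta> \<noteq> \<delta>'"
    define h where "h = min \<epsilon> \<epsilon>1"
    have "h \<in> {0..\<epsilon>}" "h \<in> {0..\<epsilon>1}" "0 < h" using \<epsilon> \<epsilon>1 by (auto simp: h_def)
    then show False using d1[OF *(1,2), of h h] \<beta>(2)[OF *(1), of h] \<beta>(2)[OF *(2), of h] * by simp
  qed
  then show ?thesis by (rule that[OF \<epsilon> _ _ \<beta>(2)]) (use \<beta>(1) in auto)
qed

text \<open>Matching in both directions gives injections both ways between finite sets.\<close>

lemma directions_bij: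
  assumes "model_of \<Gamma> G" "model_of \<Gamma> M" and v: "v \<in> \<Gamma>"
  obtains \<beta> \<epsilon> where "0 < \<epsilon>" "bij_betw \<beta> (directions G v) (directions M v)"
    "\<And>\<delta> h. \<delta> \<in> directions G v \<Longrightarrow> h \<in> {0..\<epsilon>} \<Longrightarrow> along G \<delta> h = along M (\<beta> \<delta>) h"
proof -
  interpret G: tropical_curve \<Gamma> G using assms by unfold_locales
  interpret M: tropical_curve \<Gamma> M using assms by unfold_locales
  obtain \<beta> \<epsilon> where \<beta>: "0 < \<epsilon>" "inj_on \<beta> (directions G v)" "\<beta> ` directions G v \<subseteq> directions M v"
    "\<And>\<delta> h. \<delta> \<in> directions G v \<Longrightarrow> h \<in> {0..\<epsilon>} \<Longrightarrow> along G \<delta> h = along M (\<beta> \<delta>) h"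
    by (rule directions_match_inj[OF assms], rule that)
  obtain \<alpha> \<epsilon>' where \<alpha>: "inj_on \<alpha> (directions M v)" "\<alpha> ` directions M v \<subseteq> directions G v"
    and "0 < \<epsilon>'" "\<And>\<delta> h. \<delta> \<in> directions M v \<Longrightarrow> h \<in> {0..\<epsilon>'} \<Longrightarrow> along M \<delta> h = along G (\<alpha> \<delta>) h"
    by (rule directions_match_inj[OF assms(2,1,3)], rule that)
  have "card (directions M v) \<le> card (directions G v)"
    using \<alpha> G.finite_directions by (intro card_inj_on_le) auto
  also have "\<dots> = card (\<beta> ` directions G v)" using \<beta>(2) by (simp add: card_image)
  finally have "\<beta> ` directions G v = directions M v"
    using \<beta>(3) M.finite_directions by (intro card_seteq) auto
  then have "bij_betw \<beta> (directions G v) (directions M v)" using \<beta>(2) by (simp add: bij_betw_def)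
  then show ?thesis by (rule that[OF \<beta>(1) _ \<beta>(4)])
qed

lemma outgoing_slope_THE: "outgoing_slope G f \<delta> = (THE k. has_slope G f \<delta> k)"
  by (cases \<delta>) (simp add: outgoing_slope_def has_slope_def)

lemma slopes_model:
  assumes "model_of \<Gamma> G" "model_of \<Gamma> M" and v: "v \<in> \<Gamma>"
  shows "ord_at G f v = ord_at M f v"
    and "(\<forall>\<delta>\<in>directions G v. \<exists>k. has_slope G f \<delta> k) \<longleftrightarrow> (\<forall>\<delta>\<in>directions M v. \<exists>k. has_slope M f \<delta> k)"
proof -
  obtain \<beta> \<epsilon> where \<beta>: "0 < \<epsilon>" "bij_betw \<beta> (directions G v) (directions M v)"
    "\<And>\<delta> h. \<delta> \<in> directions G v \<Longrightarrow> h \<in> {0..\<epsilon>} \<Longrightarrow> along G \<delta> h = along M (\<beta> \<delta>) h"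
    by (rule directions_bij[OF assms], rule that)
  have hs: "has_slope G f \<delta> k \<longleftrightarrow> has_slope M f (\<beta> \<delta>) k" if "\<delta> \<in> directions G v" for \<delta> k
  proof -
    have "\<forall>\<^sub>F h in at_right 0. along G \<delta> h = along M (\<beta> \<delta>) h"
      unfolding eventually_at_right_0 using \<beta>(1,3) that by (intro exI[of _ \<epsilon>]) auto
    moreover have "along G \<delta> 0 = along M (\<beta> \<delta>) 0" using \<beta>(1,3) that by auto
    ultimately show ?thesis unfolding has_slope_def
      by (intro eventually_cong) (auto elim: eventually_mono)
  qed
  have "outgoing_slope G f \<delta> = outgoing_slope M f (\<beta> \<delta>)" if "\<delta> \<in> directions G v" for \<delta>
  proof -
    have "has_slope G f \<delta> = has_slope M f (\<beta> \<delta>)" using hs[OF that] by blast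
    then show ?thesis by (simp add: outgoing_slope_THE)
  qed
  then show "ord_at G f v = ord_at M f v"
    unfolding ord_at_def using sum.reindex_bij_betw[OF \<beta>(2), of "outgoing_slope M f"] by simp
  show "(\<forall>\<delta>\<in>directions G v. \<exists>k. has_slope G f \<delta> k) \<longleftrightarrow> (\<forall>\<delta>\<in>directions M v. \<exists>k. has_slope M f \<delta> k)"
    unfolding bij_betw_imp_surj_on[OF \<beta>(2), symmetric] ball_simps using hs by blast
qed

text \<open>Three models meet in the proof: the one that defines reduced divisors, the simple one
  that carries the cells, and a subdivision whose vertices contain the support of a divisor. Orders
  and rational functions depend only on germs, which the models share.\<close>

lemma lin_equiv_model:
  assumes "model_of \<Gamma> G" "model_of \<Gamma> M"
  shows "lin_equiv \<Gamma> G = lin_equiv \<Gamma> M"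
proof -
  interpret G: tropical_curve \<Gamma> G using assms by unfold_locales
  interpret M: tropical_curve \<Gamma> M using assms by unfold_locales
  have "rational_function \<Gamma> G f = rational_function \<Gamma> M f" for f
    unfolding G.rational_iff M.rational_iff using slopes_model(2)[OF assms] by metis
  moreover have "ord_at G f v = ord_at M f v" if "v \<in> \<Gamma>" for f v
    using slopes_model(1)[OF assms that] .
  ultimately show ?thesis unfolding lin_equiv_def by (intro ext) auto
qed

section \<open>Subdivision of a model\<close>

definition subdivision_params :: "('p, 'e) graph_model \<Rightarrow> 'p set \<Rightarrow> 'e \<Rightarrow> real set" where
  "subdivision_params M W e = {t \<in> {0..elen M e}. epar M e t \<in> verts M \<union> W}"

definition subdivide :: "('p, 'e) graph_model \<Rightarrow> 'p set \<Rightarrow> ('p, 'e \<times> real \<times> real) graph_model" where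
  "subdivide M W = \<lparr>verts = verts M \<union> W,
     edges = {(e, a, b). e \<in> edges M \<and> a \<in> subdivision_params M W e \<and> b \<in> subdivision_params M W e \<and> a < b \<and>
       {a<..<b} \<inter> subdivision_params M W e = {}},
     elen = \<lambda>(e, a, b). b - a,
     epar = \<lambda>(e, a, b) t. epar M e (a + t)\<rparr>"

text \<open>The metric is the delicate point: one step of a chain in \<open>G\<close> may cross
  several edges of the subdivision and has to be broken into steps of the same total length.\<close>

lemma (in tropical_curve) model_of_subdivide:
  assumes W: "finite W" "W \<subseteq> \<Gamma>"
  shows "model_of \<Gamma> (subdivide G W)"
proof -
  define T where "T = subdivision_params G W"
  define R where "R = subdivide G W"
  have R: "verts R = verts G \<union> W" "elen R (e, a, b) = b - a" "epar R (e, a, b) t = epar G e (a + t)" for e a b t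
    by (simp_all add: R_def subdivide_def)
  have ER: "(e, a, b) \<in> edges R \<longleftrightarrow> e \<in> edges G \<and> a \<in> T e \<and> b \<in> T e \<and> a < b \<and> {a<..<b} \<inter> T e = {}" for e a b
    by (simp add: R_def subdivide_def T_def)
  have T: "T e = {t \<in> {0..elen G e}. epar G e t \<in> verts G \<union> W}" for e by (simp add: T_def subdivision_params_def)
  have finT: "finite (T e)" if "e \<in> edges G" for e
    unfolding T using that W finite_verts by (intro finite_params) auto
  have T0: "0 \<in> T e" "elen G e \<in> T e" if "e \<in> edges G" for e
    using epar_0[OF that] epar_elen[OF that] elen_pos[OF that] by (auto simp: T)
  have right: "\<exists>a b. (e, a, b) \<in> edges R \<and> a \<le> x \<and> x < b" if e: "e \<in> edges G" and x: "x \<in> {0..<elen G e}" for e x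
  proof -
    define a b where "a = Max (T e \<inter> {..x})" and "b = Min (T e \<inter> {x<..})"
    have "a \<in> T e \<inter> {..x}" unfolding a_def using finT[OF e] T0[OF e] x by (intro Max_in) auto
    moreover have "b \<in> T e \<inter> {x<..}" unfolding b_def using finT[OF e] T0[OF e] x by (intro Min_in) auto
    moreover have "z \<le> a \<or> b \<le> z" if "z \<in> T e" for z
      using that finT[OF e] by (cases "z \<le> x") (auto simp: a_def b_def intro!: Max_ge Min_le)
    then have "{a<..<b} \<inter> T e = {}" by fastforce
    ultimately show ?thesis using e by (intro exI[of _ a] exI[of _ b]) (auto simp: ER)
  qed
  have left: "\<exists>a b. (e, a, b) \<in> edges R \<and> a < x \<and> x \<le> b" if e: "e \<in> edges G" and x: "x \<in> {0<..elen G e}" for e x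
  proof -
    define a b where "a = Max (T e \<inter> {..<x})" and "b = Min (T e \<inter> {x..})"
    have "a \<in> T e \<inter> {..<x}" unfolding a_def using finT[OF e] T0[OF e] x by (intro Max_in) auto
    moreover have "b \<in> T e \<inter> {x..}" unfolding b_def using finT[OF e] T0[OF e] x by (intro Min_in) auto
    moreover have "z \<le> a \<or> b \<le> z" if "z \<in> T e" for z
      using that finT[OF e] by (cases "z < x") (auto simp: a_def b_def intro!: Max_ge Min_le)
    then have "{a<..<b} \<inter> T e = {}" by fastforce
    ultimately show ?thesis using e by (intro exI[of _ a] exI[of _ b]) (auto simp: ER)
  qed
  have bounds: "0 \<le> a" "a < b" "b \<le> elen G e" "e \<in> edges G" if "(e, a, b) \<in> edges R" for e a b
    using that by (auto simp: ER T)
  \<comment> \<open>\<open>P e s t\<close>: a step between \<open>s\<close> and \<open>t\<close>, in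
    either direction, can be prepended to every chain of the subdivision. This holds locally and
    composes, so \<open>Bolzano\<close> yields it for all pairs on an edge.\<close>
  define P where "P e s t \<longleftrightarrow> s \<in> {0..elen G e} \<and> t \<in> {0..elen G e} \<longrightarrow>
    (\<forall>c y. chain_length R (epar G e t) c y \<longrightarrow> chain_length R (epar G e s) (\<bar>s - t\<bar> + c) y) \<and>
    (\<forall>c y. chain_length R (epar G e s) c y \<longrightarrow> chain_length R (epar G e t) (\<bar>s - t\<bar> + c) y)" for e s t
  have P_piece: "P e s t" if "(e, a, b) \<in> edges R" "s \<in> {a..b}" "t \<in> {a..b}" for e a b s t
  proof -
    have *: "chain_length R (epar G e s) (\<bar>s - t\<bar> + c) y"
      if "chain_length R (epar G e t) c y" "s \<in> {a..b}" "t \<in> {a..b}" for c y s t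
    proof -
      have "chain_length R (epar R (e, a, b) (s - a)) (\<bar>(s - a) - (t - a)\<bar> + c) y"
        using that \<open>(e, a, b) \<in> edges R\<close> by (intro chain_length.step) (auto simp: R)
      then show ?thesis by (simp add: R)
    qed
    show ?thesis unfolding P_def using *[of t _ _ s] *[of s _ _ t] that(2,3) by (auto simp: abs_minus_commute)
  qed
  have P_trans: "P e x z" if "P e x y" "P e y z" "x \<le> y" "y \<le> z" for e x y z
  proof (cases "x \<in> {0..elen G e} \<and> z \<in> {0..elen G e}")
    case True
    then have "y \<in> {0..elen G e}" using that by auto
    moreover have "\<bar>x - y\<bar> + (\<bar>y - z\<bar> + c) = \<bar>x - z\<bar> + c" "\<bar>y - z\<bar> + (\<bar>x - y\<bar> + c) = \<bar>x - z\<bar> + c" for c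
      using that(3,4) by simp_all
    ultimately show ?thesis using True that(1,2) unfolding P_def by metis
  qed (auto simp: P_def)
  have P_all: "P e s t" if e: "e \<in> edges G" and st: "0 \<le> s" "s \<le> t" "t \<le> elen G e" for e s t
  proof (rule Bolzano[of s t "P e"])
    fix x assume x: "s \<le> x" "x \<le> t"
    have "\<exists>d>0. \<forall>y. x \<le> y \<and> y - x < d \<longrightarrow> P e x y"
    proof (cases "x < elen G e")
      case True
      then obtain a b where ab: "(e, a, b) \<in> edges R" "a \<le> x" "x < b" using right[OF e, of x] x st by auto
      then show ?thesis by (intro exI[of _ "b - x"]) (auto intro!: P_piece)
    next
      case False
      have "P e x x" by (simp add: P_def)
      moreover have "P e x y" if "x < y" for y using False that by (auto simp: P_def)
      ultimately show ?thesis by (intro exI[of _ 1]) (auto simp: less_eq_real_def)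
    qed
    then obtain d1 where d1: "d1 > 0" "\<And>y. x \<le> y \<Longrightarrow> y - x < d1 \<Longrightarrow> P e x y" by blast
    have "\<exists>d>0. \<forall>y. y \<le> x \<and> x - y < d \<longrightarrow> P e y x"
    proof (cases "0 < x")
      case True
      then obtain a b where ab: "(e, a, b) \<in> edges R" "a < x" "x \<le> b" using left[OF e, of x] x st by auto
      then show ?thesis by (intro exI[of _ "x - a"]) (auto intro!: P_piece)
    next
      case False
      have "P e x x" by (simp add: P_def)
      moreover have "P e y x" if "y < x" for y using False that by (auto simp: P_def)
      ultimately show ?thesis by (intro exI[of _ 1]) (auto simp: less_eq_real_def)
    qed
    then obtain d2 where d2: "d2 > 0" "\<And>y. y \<le> x \<Longrightarrow> x - y < d2 \<Longrightarrow> P e y x" by blast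
    show "\<exists>d>0. \<forall>a b. a \<le> x \<and> x \<le> b \<and> b - a < d \<longrightarrow> P e a b"
    proof (intro exI[of _ "min d1 d2"] conjI allI impI)
      fix a b assume ab: "a \<le> x \<and> x \<le> b \<and> b - a < min d1 d2"
      then have "P e a x" "P e x b" by (auto intro!: d1 d2)
      then show "P e a b" using P_trans ab by blast
    qed (use d1 d2 in simp)
  next
    fix a b c assume "P e a b" "P e b c" "a \<le> b" "b \<le> c"
    then show "P e a c" by (rule P_trans)
  qed (use st in simp)
  have GR: "chain_length R x c y" if "chain_length G x c y" for x c y
    using that
  proof (induction rule: chain_length.induct)
    case (refl x)
    show ?case by (rule chain_length.refl)
  next
    case (step e s t c y)
    then show ?case using P_all[of e "min s t" "max s t"]
      by (cases "s \<le> t") (auto simp: P_def min_def max_def abs_minus_commute)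
  qed
  have RG: "chain_length G x c y" if "chain_length R x c y" for x c y
    using that
  proof (induction rule: chain_length.induct)
    case (refl x)
    show ?case by (rule chain_length.refl)
  next
    case (step e' s t c y)
    obtain e a b where e': "e' = (e, a, b)" by (cases e')
    have "chain_length G (epar G e (a + s)) (\<bar>(a + s) - (a + t)\<bar> + c) y"
      using step bounds[of e a b] by (intro chain_length.step) (auto simp: e' R)
    then show ?case by (simp add: e' R)
  qed
  have chains: "chain_length R x c y \<longleftrightarrow> chain_length G x c y" for x c y using GR RG by blast
  have inner: "a + t \<in> {0<..<elen G e}" "epar G e (a + t) \<notin> verts G \<union> W"
    if "(e, a, b) \<in> edges R" "t \<in> {0<..<b - a}" for e a b t
  proof -
    show t: "a + t \<in> {0<..<elen G e}" using bounds[OF that(1)] that(2) by auto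
    have "a + t \<in> {a<..<b}" using that(2) by auto
    moreover have "{a<..<b} \<inter> T e = {}" using that(1) by (simp add: ER)
    ultimately have "a + t \<notin> T e" by blast
    then show "epar G e (a + t) \<notin> verts G \<union> W" using t by (simp add: T)
  qed
  show ?thesis unfolding R_def[symmetric] model_of_def
  proof (intro conjI ballI impI)
    show "finite (verts R)" "verts R \<noteq> {}" using W finite_verts verts_nonempty by (auto simp: R)
    have "edges R \<subseteq> (SIGMA e:edges G. T e \<times> T e)" by (auto simp: ER)
    then show "finite (edges R)" using finT finite_edges by (auto elim!: finite_subset)
  next
    fix e' assume "e' \<in> edges R"
    moreover obtain e a b where e': "e' = (e, a, b)" by (cases e')
    ultimately have E: "(e, a, b) \<in> edges R" by simp
    note bd = bounds[OF E]
    show "0 < elen R e'" using bd by (simp add: e' R)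
    show "epar R e' 0 \<in> verts R" "epar R e' (elen R e') \<in> verts R" using E by (auto simp: e' R ER T)
    show "inj_on (epar R e') {0<..<elen R e'}"
    proof (rule inj_onI)
      fix s t assume *: "s \<in> {0<..<elen R e'}" "t \<in> {0<..<elen R e'}" "epar R e' s = epar R e' t"
      then have "a + s \<in> {0<..<elen G e}" "a + t \<in> {0<..<elen G e}" "epar G e (a + s) = epar G e (a + t)"
        using inner(1)[OF E] by (auto simp: e' R)
      then have "a + s = a + t" using inj_onD[OF inj_epar[OF bd(4)]] by blast
      then show "s = t" by simp
    qed
    show "epar R e' ` {0<..<elen R e'} \<inter> verts R = {}" using inner(2)[OF E] by (auto simp: e' R)
    fix f' assume "f' \<in> edges R" "e' \<noteq> f'"
    moreover obtain f c d where f': "f' = (f, c, d)" by (cases f')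
    ultimately have Fe: "(f, c, d) \<in> edges R" "(e, a, b) \<noteq> (f, c, d)" using e' by auto
    show "epar R e' ` {0<..<elen R e'} \<inter> epar R f' ` {0<..<elen R f'} = {}"
    proof (rule ccontr)
      assume "\<not> ?thesis"
      then obtain y where y: "y \<in> epar R e' ` {0<..<b - a}" "y \<in> epar R f' ` {0<..<d - c}"
        by (auto simp: e' f' R(2))
      from y(1) obtain s where s: "s \<in> {0<..<b - a}" "y = epar G e (a + s)" by (auto simp: e' R)
      from y(2) obtain t where t: "t \<in> {0<..<d - c}" "y = epar G f (c + t)" by (auto simp: f' R)
      note st = s(1) t(1) s(2)[symmetric, unfolded t(2)] 
      have in2: "c + t \<in> {0..elen G f}" using inner(1)[OF Fe(1) st(2)] by auto
      have eq: "e = f" "a + s = c + t"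
        using interior_eq[OF bd(4) bounds(4)[OF Fe(1)] inner(1)[OF E st(1)] in2 st(3)] by auto
      have x: "c + t \<in> {a<..<b}" "c + t \<in> {c<..<d}" using eq(2) st by auto
      have TT: "c \<in> T e" "d \<in> T e" "a \<in> T e" "b \<in> T e" "{a<..<b} \<inter> T e = {}" "{c<..<d} \<inter> T e = {}"
        using E Fe(1) eq(1) by (auto simp: ER)
      \<comment> \<open>Pieces of one edge contain no subdivision parameter in their interior, in
        particular no end of another piece; two pieces with a common interior point therefore
        coincide.\<close>
      have "c \<notin> {a<..<b}" "d \<notin> {a<..<b}" "a \<notin> {c<..<d}" "b \<notin> {c<..<d}" using TT by blast+
      then have "a = c" "b = d" using x by auto
      then show False using Fe(2) eq(1) by simp
    qed
  next
    show "\<Gamma> = verts R \<union> (\<Union>e\<in>edges R. epar R e ` {0..elen R e})"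
    proof (intro equalityI subsetI)
      fix x assume "x \<in> \<Gamma>"
      then show "x \<in> verts R \<union> (\<Union>e\<in>edges R. epar R e ` {0..elen R e})"
      proof (cases rule: point_cases)
        case (2 e t)
        then obtain a b where ab: "(e, a, b) \<in> edges R" "a \<le> t" "t < b" using right[of e t] by auto
        then have "x \<in> epar R (e, a, b) ` {0..elen R (e, a, b)}"
          using 2(3) by (intro image_eqI[of _ _ "t - a"]) (auto simp: R)
        then show ?thesis using ab(1) by blast
      qed (simp add: R)
    next
      fix x assume "x \<in> verts R \<union> (\<Union>e\<in>edges R. epar R e ` {0..elen R e})"
      then consider "x \<in> verts R" | e a b t where "(e, a, b) \<in> edges R" "t \<in> {0..b - a}" "x = epar G e (a + t)"
        by (auto simp: R) 
      then show "x \<in> \<Gamma>"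
      proof cases
        case 1
        then show ?thesis using verts_subset W by (auto simp: R)
      next
        case (2 e a b t)
        then show ?thesis using bounds[OF 2(1)] by (auto intro!: epar_in)
      qed
    qed
  next
    fix x y assume "x \<in> \<Gamma>" "y \<in> \<Gamma>"
    then show "{c. chain_length R x c y} \<noteq> {}" "dist x y = Inf {c. chain_length R x c y}"
      unfolding chains using dist_Inf by blast+
  qed
qed

context tropical_curve
begin

text \<open>The maximal function is available only for a divisor supported on vertices, hence the
  passage to the subdivision at the support of \<open>E\<close>.\<close>

lemma ex_reduced:
  assumes E: "E \<in> linear_system \<Gamma> G D" and P: "P \<in> \<Gamma>"
  shows "\<exists>D'. divisor \<Gamma> D' \<and> lin_equiv \<Gamma> G D' D \<and> reduced \<Gamma> P D'"
proof -
  have E: "divisor \<Gamma> E" "effective E" "lin_equiv \<Gamma> G E D" using E by (auto simp: linear_system_def)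
  define R where "R = subdivide G (Poly_Mapping.keys E)"
  have R: "model_of \<Gamma> R" unfolding R_def using E(1) by (intro model_of_subdivide) (auto simp: divisor_def)
  interpret R: tropical_curve \<Gamma> R using R by unfold_locales
  have "Poly_Mapping.keys E \<subseteq> verts R" by (simp add: R_def subdivide_def)
  then obtain D' where D': "divisor \<Gamma> D'" "lin_equiv \<Gamma> R D' E" "reduced \<Gamma> P D'"
    using R.ex_reduced_maximal[OF E(1,2) _ P] by metis
  then have "lin_equiv \<Gamma> G D' E" using lin_equiv_model[OF model R] by simp
  then show ?thesis using D' E(3) lin_equiv_trans by blast
qed

lemma reduced_divisor_eqI:
  assumes "P \<in> \<Gamma>" "divisor \<Gamma> D'" "lin_equiv \<Gamma> G D' D" "reduced \<Gamma> P D'"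
  shows "reduced_divisor \<Gamma> G D P = D'"
  unfolding reduced_divisor_def
proof (rule the_equality)
  fix D'' assume "divisor \<Gamma> D'' \<and> lin_equiv \<Gamma> G D'' D \<and> reduced \<Gamma> P D''"
  then show "D'' = D'"
    using reduced_unique[OF assms(1), of D'' D'] assms lin_equiv_trans[OF _ lin_equiv_sym[OF assms(3)]] by blast
qed (use assms in blast)

lemma reduced_divisor_props:
  assumes "linear_system \<Gamma> G D \<noteq> {}" and P: "P \<in> \<Gamma>"
  shows "reduced \<Gamma> P (reduced_divisor \<Gamma> G D P)" "reduced_divisor \<Gamma> G D P \<in> linear_system \<Gamma> G D"
proof -
  obtain E where E: "E \<in> linear_system \<Gamma> G D" using assms by blast
  obtain D' where D': "divisor \<Gamma> D'" "lin_equiv \<Gamma> G D' D" "reduced \<Gamma> P D'" using ex_reduced[OF E P] by blast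
  have eq: "reduced_divisor \<Gamma> G D P = D'" using P D' by (rule reduced_divisor_eqI)
  have "lin_equiv \<Gamma> G E D'"
    using E lin_equiv_trans[OF _ lin_equiv_sym[OF D'(2)]] by (simp add: linear_system_def)
  then have "effective D'" using reduced_effective[OF P D'(1,3), of E] E by (simp add: linear_system_def)
  then show "reduced \<Gamma> P (reduced_divisor \<Gamma> G D P)" "reduced_divisor \<Gamma> G D P \<in> linear_system \<Gamma> G D"
    using D' eq by (simp_all add: linear_system_def)
qed

end

section \<open>Scale invariance near a vertex\<close>

text \<open>The upper envelope of lines of slopes \<open>0, - 1, ..., - d\<close> with integer
  heights, in coordinates divided by \<open>r\<close>: at distance \<open>h\<close> from the start
  of a half edge the function itself has the value \<open>r\<close> times the envelope at
  \<open>h / r\<close>.\<close>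

definition pencil :: "nat \<Rightarrow> (nat \<Rightarrow> nat) \<Rightarrow> real \<Rightarrow> real" where
  "pencil d c q = Max ((\<lambda>m. real (c m) - real m * q) ` {..d})"

definition pencil_args :: "nat \<Rightarrow> (nat \<Rightarrow> nat) \<Rightarrow> real \<Rightarrow> nat set" where
  "pencil_args d c q = {m \<in> {..d}. real (c m) - real m * q = pencil d c q}"

text \<open>The outgoing slope of \<open>pencil d c\<close> at \<open>q\<close> to the right for \<open>j = 1\<close>, to the left for \<open>j = - 1\<close>.\<close>

definition pencil_slope :: "nat \<Rightarrow> (nat \<Rightarrow> nat) \<Rightarrow> int \<Rightarrow> real \<Rightarrow> int" where
  "pencil_slope d c j q = Max ((\<lambda>m. - j * int m) ` pencil_args d c q)"

text \<open>The order of the envelope at \<open>q\<close>, that is, the number of chips that it puts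
  there.\<close>

definition pencil_bend :: "nat \<Rightarrow> (nat \<Rightarrow> nat) \<Rightarrow> real \<Rightarrow> int" where
  "pencil_bend d c q = pencil_slope d c 1 q + pencil_slope d c (- 1) q"

lemma pencil_ge: "m \<le> d \<Longrightarrow> real (c m) - real m * q \<le> pencil d c q"
  by (simp add: pencil_def)

lemma pencil_attained: "\<exists>m\<le>d. pencil d c q = real (c m) - real m * q"
proof -
  have "pencil d c q \<in> (\<lambda>m. real (c m) - real m * q) ` {..d}" unfolding pencil_def by (rule Max_in) auto
  then show ?thesis by auto
qed

lemma pencil_args: "finite (pencil_args d c q)" "pencil_args d c q \<noteq> {}"
  using pencil_attained[of d c q] by (auto simp: pencil_args_def)

lemma pencil_slope_ge: "m \<in> pencil_args d c q \<Longrightarrow> - j * int m \<le> pencil_slope d c j q"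
  unfolding pencil_slope_def using pencil_args[of d c q] by (intro Max_ge) auto

lemma pencil_has_slope:
  "\<forall>\<^sub>F h in at_right 0. pencil d c (q + of_int j * h) = pencil d c q + of_int (pencil_slope d c j q) * h"
proof -
  have *: "real (c m) - real m * q + of_int (- j * int m) * h = real (c m) - real m * (q + of_int j * h)" for m h
    by (simp add: algebra_simps)
  have "\<forall>\<^sub>F h in at_right 0. (\<lambda>h. pencil d c (q + of_int j * h)) h = (\<lambda>h. pencil d c (q + of_int j * h)) 0 +
    of_int (Max ((\<lambda>m. - j * int m) ` {m \<in> {..d}. real (c m) - real m * q = (\<lambda>h. pencil d c (q + of_int j * h)) 0})) * h"
  proof (rule max_lines_slope)
    show "\<exists>m\<in>{..d}. real (c m) - real m * q = pencil d c (q + of_int j * 0)"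
      using pencil_attained[of d c q] by auto
    show "\<forall>\<^sub>F h in at_right 0. (\<forall>m\<in>{..d}. real (c m) - real m * q + of_int (- j * int m) * h \<le> pencil d c (q + of_int j * h)) \<and>
        (\<exists>m\<in>{..d}. pencil d c (q + of_int j * h) = real (c m) - real m * q + of_int (- j * int m) * h)"
      unfolding * using pencil_ge pencil_attained by (intro always_eventually) blast
  qed (auto intro: pencil_ge)
  then show ?thesis by (simp add: pencil_slope_def pencil_args_def)
qed

lemma pencil_bend_nonneg: "0 \<le> pencil_bend d c q"
proof -
  obtain m where "m \<in> pencil_args d c q" using pencil_args by blast
  from pencil_slope_ge[OF this, of 1] pencil_slope_ge[OF this, of "-1"] show ?thesis
    by (simp add: pencil_bend_def)
qed

lemma pencil_Lipschitz: "\<bar>pencil d c q - pencil d c q'\<bar> \<le> real d * \<bar>q - q'\<bar>"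
proof -
  have *: "pencil d c q \<le> pencil d c q' + real d * \<bar>q - q'\<bar>" for q q'
  proof -
    obtain m where m: "m \<le> d" "pencil d c q = real (c m) - real m * q" using pencil_attained by blast
    have "real m * (q' - q) \<le> real m * \<bar>q - q'\<bar>" by (intro mult_left_mono) auto
    also have "\<dots> \<le> real d * \<bar>q - q'\<bar>" using m by (intro mult_right_mono) auto
    finally show ?thesis using m pencil_ge[OF m(1), of c q'] by (simp add: algebra_simps)
  qed
  from *[of q q'] *[of q' q] show ?thesis by (simp add: abs_le_iff abs_minus_commute)
qed

text \<open>As the heights are at most \<open>d\<close>, every line of slope at most -1 is
  nonpositive from \<open>d\<close> on, where the constant line takes over. All bending thus happens
  within distance \<open>d * r\<close> of the vertex.\<close>

lemma pencil_large:
  assumes "\<And>m. m \<le> d \<Longrightarrow> c m \<le> d" "real d \<le> q"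
  shows "pencil d c q = real (c 0)"
proof (rule antisym)
  obtain m where m: "m \<le> d" "pencil d c q = real (c m) - real m * q" using pencil_attained by blast
  show "pencil d c q \<le> real (c 0)"
  proof (cases "m = 0")
    case False
    then have "1 * q \<le> real m * q" using assms(2) by (intro mult_right_mono) auto
    moreover have "real (c m) \<le> real d" using assms(1)[OF m(1)] by simp
    ultimately have "real (c m) - real m * q \<le> 0" using assms(2) by linarith
    then show ?thesis using m(2) by linarith
  qed (use m in simp)
  show "real (c 0) \<le> pencil d c q" using pencil_ge[of 0 d c q] by simp
qed

lemma pencil_slope_large:
  assumes "\<And>m. m \<le> d \<Longrightarrow> c m \<le> d" "real d < q"
  shows "pencil_slope d c j q = 0"
proof -
  have pencil: "pencil d c q = real (c 0)" using assms by (intro pencil_large) auto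
  have "m = 0" if m: "m \<in> pencil_args d c q" for m
  proof (rule ccontr)
    assume "m \<noteq> 0"
    then have "1 * q \<le> real m * q" using assms(2) by (intro mult_right_mono) auto
    moreover have "real (c m) \<le> real d" using assms(1)[of m] m by (simp add: pencil_args_def)
    ultimately have "real (c m) - real m * q < 0" using assms(2) by linarith
    then show False using m pencil by (simp add: pencil_args_def)
  qed
  then have "pencil_args d c q = {0}" using pencil_args(2)[of d c q] by blast
  then show ?thesis by (simp add: pencil_slope_def)
qed

text \<open>At a bend two lines with different integer slopes and integer heights meet. Rationality
  of the speeds and finiteness of the set of bends both come from this.\<close>

lemma pencil_bendE:
  assumes "pencil_bend d c q \<noteq> 0"
  obtains m m' where "m \<le> d" "m' \<le> d" "m \<noteq> m'" "q = (real (c m') - real (c m)) / (real m' - real m)"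
proof -
  obtain m where m: "m \<in> pencil_args d c q" using pencil_args(2) by blast
  have "\<exists>m'\<in>pencil_args d c q. m' \<noteq> m"
  proof (rule ccontr)
    assume "\<not> ?thesis"
    then have "pencil_args d c q = {m}" using m by blast
    then show False using assms by (simp add: pencil_bend_def pencil_slope_def)
  qed
  then obtain m' where m': "m' \<in> pencil_args d c q" "m' \<noteq> m" by blast
  then have "real (c m) - real m * q = real (c m') - real m' * q" using m by (simp add: pencil_args_def)
  then have "q * (real m' - real m) = real (c m') - real (c m)" by (simp add: algebra_simps)
  then have "q = (real (c m') - real (c m)) / (real m' - real m)" using m' by (simp add: field_simps)
  then show ?thesis using that[of m m'] m m' by (auto simp: pencil_args_def)
qed

lemma pencil_bend_rational: "pencil_bend d c q \<noteq> 0 \<Longrightarrow> q \<in> \<rat>"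
  by (elim pencil_bendE) auto

lemma finite_pencil_bends: "finite {q. pencil_bend d c q \<noteq> 0}"
proof (rule finite_subset)
  show "{q. pencil_bend d c q \<noteq> 0} \<subseteq> (\<lambda>(m, m'). (real (c m') - real (c m)) / (real m' - real m)) ` ({..d} \<times> {..d})"
  proof
    fix q assume "q \<in> {q. pencil_bend d c q \<noteq> 0}"
    then obtain m m' where "m \<le> d" "m' \<le> d" "q = (real (c m') - real (c m)) / (real m' - real m)"
      using pencil_bendE[of d c q] by blast
    then show "q \<in> (\<lambda>(m, m'). (real (c m') - real (c m)) / (real m' - real m)) ` ({..d} \<times> {..d})" by force
  qed
qed simp

lemma germ_slope_unique:
  fixes \<phi> :: "real \<Rightarrow> real"
  assumes "\<forall>\<^sub>F h in at_right 0. \<phi> (q + j * h) = \<phi> q + of_int k * h"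
    "\<forall>\<^sub>F h in at_right 0. \<phi> (q + j * h) = \<phi> q + of_int l * h"
  shows "k = l"
proof -
  have "\<forall>\<^sub>F h::real in at_right 0. k = l"
    using assms eventually_at_right_less[of 0] by eventually_elim auto
  then show ?thesis by simp
qed

text \<open>The slope changes from its initial value to 0 and the bends account for the change: the
  chips sent out along a half edge are those that its starting vertex loses.\<close>

lemma sum_pencil_bend:
  assumes c: "\<And>m. m \<le> d \<Longrightarrow> c m \<le> d"
  shows "(\<Sum>q\<in>{q. 0 < q \<and> pencil_bend d c q \<noteq> 0}. pencil_bend d c q) = - pencil_slope d c 1 0"
proof -
  \<comment> \<open>Strictly beyond \<open>d\<close>, so that there is neither a bend nor a nonzero
    slope at the right end.\<close>
  define b where "b = real d + 1"
  have s: "\<forall>\<^sub>F h in at_right 0. pencil d c (t + h) = pencil d c t + of_int (pencil_slope d c 1 t) * h"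
    "\<forall>\<^sub>F h in at_right 0. pencil d c (t - h) = pencil d c t + of_int (pencil_slope d c (-1) t) * h" for t
    using pencil_has_slope[of d c t 1] pencil_has_slope[of d c t "-1"] by simp_all
  have "\<exists>S. finite S \<and> (\<forall>x y. 0 \<le> x \<and> x < y \<and> y \<le> b \<and> {x<..<y} \<inter> S = {} \<longrightarrow>
    (\<exists>k::int. \<forall>t\<in>{x..y}. pencil d c t = pencil d c x + of_int k * (t - x)))"
    using s by (intro pl_pieces exI) (auto simp: b_def)
  then obtain S where S: "finite S" "\<And>x y. 0 \<le> x \<Longrightarrow> x < y \<Longrightarrow> y \<le> b \<Longrightarrow> {x<..<y} \<inter> S = {} \<Longrightarrow>
    \<exists>k::int. \<forall>t\<in>{x..y}. pencil d c t = pencil d c x + of_int k * (t - x)" by blast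
  define Q where "Q = {q. 0 < q \<and> pencil_bend d c q \<noteq> 0}"
  have Q: "finite Q" "Q \<subseteq> {0<..<b}"
  proof -
    show "finite Q" unfolding Q_def by (rule finite_subset[OF _ finite_pencil_bends[of d c]]) auto
    have "q \<le> real d" if "q \<in> Q" for q
    proof (rule ccontr)
      assume "\<not> q \<le> real d"
      then have "pencil_bend d c q = 0" using pencil_slope_large[of d c q] c by (simp add: pencil_bend_def)
      then show False using that by (simp add: Q_def)
    qed
    then show "Q \<subseteq> {0<..<b}" by (force simp: Q_def b_def)
  qed
  define A where "A = insert 0 (insert b (Q \<union> (S \<inter> {0..b})))"
  have A: "finite A" "A \<subseteq> {0..b}" "0 \<in> A" "b \<in> A" "A \<noteq> {}" using Q S(1) by (auto simp: A_def b_def)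
  have M: "Max A = b" "Min A = 0" using A by (auto intro!: Max_eqI Min_eqI)
  have b0: "0 < b" by (simp add: b_def)
  have "sum (pencil_slope d c 1) (A - {Max A}) + sum (pencil_slope d c (-1)) (A - {Min A}) = 0"
  proof (rule sum_consecutive[OF A(1,5)])
    fix x y assume xy: "x \<in> A" "y \<in> A" "x < y" "{x<..<y} \<inter> A = {}"
    then have r: "0 \<le> x" "y \<le> b" using A(2) by auto
    have "{x<..<y} \<inter> S = {}"
    proof (intro equalityI subsetI)
      fix z assume "z \<in> {x<..<y} \<inter> S"
      then have "z \<in> {x<..<y} \<inter> A" using r by (auto simp: A_def)
      then show "z \<in> {}" using xy(4) by simp
    qed simp
    then obtain k :: int where k: "\<forall>t\<in>{x..y}. pencil d c t = pencil d c x + of_int k * (t - x)"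
      using S(2) r xy(3) by blast
    have near: "\<forall>\<^sub>F h in at_right 0. 0 < h \<and> h \<le> y - x" using xy(3) by (intro eventually_at_right_0_le) simp
    then have "\<forall>\<^sub>F h in at_right 0. pencil d c (x + 1 * h) = pencil d c x + of_int k * h"
    proof eventually_elim
      case (elim h)
      then show ?case using bspec[OF k, of "x + h"] by simp
    qed
    then have 1: "pencil_slope d c 1 x = k" using germ_slope_unique[of "pencil d c" x 1 "pencil_slope d c 1 x" k] s(1)[of x] by simp
    from near have "\<forall>\<^sub>F h in at_right 0. pencil d c (y + -1 * h) = pencil d c y + of_int (- k) * h"
    proof eventually_elim
      case (elim h)
      have "pencil d c (y - h) = pencil d c x + of_int k * (y - h - x)" "pencil d c y = pencil d c x + of_int k * (y - x)"
        using bspec[OF k, of "y - h"] bspec[OF k, of y] elim xy(3) by auto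
      then show ?case by (simp add: algebra_simps)
    qed
    then have "pencil_slope d c (-1) y = - k"
      using germ_slope_unique[of "pencil d c" y "-1" "pencil_slope d c (-1) y" "-k"] s(2)[of y] by simp
    then show "pencil_slope d c 1 x + pencil_slope d c (-1) y = 0" using 1 by simp
  qed
  moreover have "pencil_slope d c (-1) b = 0" using c by (intro pencil_slope_large) (auto simp: b_def)
  moreover have "sum (pencil_slope d c 1) (A - {b}) = pencil_slope d c 1 0 + sum (pencil_slope d c 1) (A - {0, b})"
  proof -
    have eq: "A - {b} = insert 0 (A - {0, b})" using A(3) b0 by auto
    show ?thesis unfolding eq by (rule sum.insert) (use A(1) in auto)
  qed
  moreover have "sum (pencil_slope d c (-1)) (A - {0}) = pencil_slope d c (-1) b + sum (pencil_slope d c (-1)) (A - {0, b})"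
  proof -
    have eq: "A - {0} = insert b (A - {0, b})" using A(4) b0 by auto
    show ?thesis unfolding eq by (rule sum.insert) (use A(1) in auto)
  qed
  ultimately have "pencil_slope d c 1 0 + (\<Sum>q\<in>A - {0, b}. pencil_bend d c q) = 0"
    unfolding M by (simp add: pencil_bend_def sum.distrib)
  moreover have "(\<Sum>q\<in>A - {0, b}. pencil_bend d c q) = (\<Sum>q\<in>Q. pencil_bend d c q)"
    using A Q by (intro sum.mono_neutral_right) (auto simp: A_def Q_def)
  ultimately show ?thesis by (simp add: Q_def)
qed

text \<open>The infimum is the intercept of the supporting line of slope \<open>- m\<close> of \<open>\<phi>\<close>; it is rounded up to a
  multiple of \<open>r\<close>.\<close>

definition heights :: "real \<Rightarrow> real \<Rightarrow> (real \<Rightarrow> real) \<Rightarrow> nat \<Rightarrow> nat" where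
  "heights r l \<phi> m = nat \<lceil>(INF s\<in>{0..l}. \<phi> s + real m * s) / r\<rceil>"

text \<open>All claims compare the intercepts \<open>I m\<close> with multiples of \<open>r\<close>
  or with \<open>\<phi> 0\<close>, and rounding up is monotone and fixes multiples of
  \<open>r\<close>. Lines of slopes \<open>0, - 1, ..., - d\<close> suffice on the first half of the
  edge because there no supporting slope is positive.\<close>

lemma heights:
  fixes \<phi> :: "real \<Rightarrow> real"
  assumes r: "0 < r" and l: "0 < l"
    and conv: "\<And>t. t \<in> {0..l} \<Longrightarrow> \<exists>m::int. \<bar>m\<bar> \<le> int d \<and> (\<forall>s\<in>{0..l}. \<phi> t + of_int m * (s - t) \<le> \<phi> s)"
    and bounds: "\<And>t. t \<in> {0..l} \<Longrightarrow> 0 \<le> \<phi> t \<and> \<phi> t \<le> real d * r"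
    and small: "2 * (real d * r) < l"
  shows "heights r l \<phi> m \<le> d"
    and "real (heights r l \<phi> m) \<le> of_int \<lceil>\<phi> 0 / r\<rceil>"
    and "(\<And>s. s \<in> {0..l} \<Longrightarrow> \<phi> 0 - real k * s \<le> \<phi> s) \<Longrightarrow> real (heights r l \<phi> k) = of_int \<lceil>\<phi> 0 / r\<rceil>"
    and "h \<in> {0..l / 2} \<Longrightarrow> \<exists>m\<le>d. \<phi> h \<le> r * real (heights r l \<phi> m) - real m * h"
    and "\<phi> r = 0 \<Longrightarrow> r \<le> l / 2 \<Longrightarrow> heights r l \<phi> m \<le> m \<and> (\<exists>m\<le>d. heights r l \<phi> m = m)"
    and "heights r l (\<lambda>s. \<phi> (l - s)) 0 = heights r l \<phi> 0"
proof -
  define I where "I m = (INF s\<in>{0..l}. \<phi> s + real m * s)" for m :: nat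
  have bdd: "bdd_below ((\<lambda>s. \<phi> s + real m * s) ` {0..l})" for m :: nat
    using bounds by (intro bdd_belowI2[of _ 0]) auto
  have I_le: "I m \<le> \<phi> s + real m * s" if "s \<in> {0..l}" for m s
    unfolding I_def using that bdd by (intro cINF_lower)
  have I_ge: "x \<le> I m" if "\<And>s. s \<in> {0..l} \<Longrightarrow> x \<le> \<phi> s + real m * s" for m x
    unfolding I_def using that l by (intro cINF_greatest) auto
  have I0: "0 \<le> I m" for m using bounds by (intro I_ge) auto
  have H: "real (heights r l \<phi> m) = of_int \<lceil>I m / r\<rceil>" for m
    using I0[of m] r by (simp add: heights_def I_def)
  have mono: "\<lceil>x / r\<rceil> \<le> \<lceil>y / r\<rceil>" if "x \<le> y" for x y
    using that r by (intro ceiling_mono divide_right_mono) auto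
  have \<phi>0: "I m \<le> \<phi> 0" for m using I_le[of 0 m] l by simp
  have "I m \<le> real d * r" using \<phi>0[of m] bounds[of 0] l by simp
  then have "I m / r \<le> real d" using r by (simp add: field_simps)
  then show "heights r l \<phi> m \<le> d" by (simp add: heights_def flip: I_def)
  show "real (heights r l \<phi> m) \<le> of_int \<lceil>\<phi> 0 / r\<rceil>" unfolding H using mono[OF \<phi>0] by simp
  show "real (heights r l \<phi> k) = of_int \<lceil>\<phi> 0 / r\<rceil>" if "\<And>s. s \<in> {0..l} \<Longrightarrow> \<phi> 0 - real k * s \<le> \<phi> s" for k
  proof -
    have "\<phi> 0 \<le> I k" using that by (intro I_ge) (simp add: algebra_simps)
    then have "I k = \<phi> 0" using \<phi>0[of k] by simp
    then show ?thesis unfolding H by simp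
  qed
  have touch: "\<exists>m\<le>d. I m = \<phi> h + real m * h" if h: "h \<in> {0..l / 2}" for h
  proof -
    have h': "h \<in> {0..l}" using h l by auto
    obtain m :: int where m: "\<bar>m\<bar> \<le> int d" "\<And>s. s \<in> {0..l} \<Longrightarrow> \<phi> h + of_int m * (s - h) \<le> \<phi> s"
      using conv[OF h'] by blast
    \<comment> \<open>A positive integer slope would lift \<open>\<phi>\<close> to at least
      \<open>l / 2\<close> at the far end, above its upper bound \<open>d * r\<close>.\<close>
    have "m \<le> 0"
    proof (rule ccontr)
      assume "\<not> m \<le> 0"
      then have 1: "1 * (l - h) \<le> of_int m * (l - h)" using h l by (intro mult_right_mono) auto
      have "\<phi> h + of_int m * (l - h) \<le> \<phi> l" using m(2)[of l] l by simp
      with 1 have "\<phi> h + 1 * (l - h) \<le> \<phi> l" by (meson add_left_mono order.trans)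
      moreover have "0 \<le> \<phi> h" "h \<le> l / 2" using bounds[OF h'] h by auto
      moreover have "l / 2 \<le> y" if "x + 1 * (l - h) \<le> y" "0 \<le> x" "h \<le> l / 2" for x y
        using that by simp
      ultimately have "l / 2 \<le> \<phi> l" by blast
      then show False using bounds[of l] small l by simp
    qed
    then have k: "real (nat (- m)) = - of_int m" "nat (- m) \<le> d" using m(1) by auto
    have "\<phi> h + real (nat (- m)) * h \<le> I (nat (- m))"
      using m(2) unfolding k(1) by (intro I_ge) (force simp: k algebra_simps)
    then show ?thesis using I_le[OF h', of "nat (- m)"] k(2) by (intro exI[of _ "nat (- m)"]) auto
  qed
  have rH: "I m \<le> r * real (heights r l \<phi> m)" for m
  proof -
    have "I m \<le> of_int \<lceil>I m / r\<rceil> * r" unfolding pos_divide_le_eq[OF r, symmetric] by simp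
    then show ?thesis unfolding H by (simp add: mult.commute)
  qed
  show "\<exists>m\<le>d. \<phi> h \<le> r * real (heights r l \<phi> m) - real m * h" if "h \<in> {0..l / 2}"
  proof -
    obtain m where "m \<le> d" "I m = \<phi> h + real m * h" using touch[OF \<open>h \<in> {0..l / 2}\<close>] by blast
    then show ?thesis using rH[of m] by (intro exI[of _ m]) auto
  qed
  show "heights r l \<phi> m \<le> m \<and> (\<exists>m\<le>d. heights r l \<phi> m = m)" if "\<phi> r = 0" "r \<le> l / 2"
  proof
    have rl: "r \<in> {0..l}" "r \<in> {0..l / 2}" using that r l by auto
    \<comment> \<open>The value 0 at \<open>r\<close> bounds the intercept of slope
      \<open>- m\<close> by \<open>m * r\<close>, and the line that touches at \<open>r\<close>
      attains this bound; both facts concern multiples of \<open>r\<close>.\<close>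
    have "I m / r \<le> real m" using I_le[OF rl(1), of m] that r by (simp add: field_simps)
    then show "heights r l \<phi> m \<le> m" by (simp add: heights_def flip: I_def)
    obtain m' where m': "m' \<le> d" "I m' = \<phi> r + real m' * r" using touch[OF rl(2)] by blast
    then have "I m' / r = real m'" using that r by (simp add: field_simps)
    then have "heights r l \<phi> m' = m'" by (simp add: heights_def flip: I_def)
    then show "\<exists>m\<le>d. heights r l \<phi> m = m" using m'(1) by blast
  qed
  \<comment> \<open>The intercept of the constant line is the infimum of \<open>\<phi>\<close>,
    which is the same seen from either end of the edge.\<close>
  have "(\<lambda>s. \<phi> (l - s) + real 0 * s) ` {0..l} = (\<lambda>s. \<phi> s + real 0 * s) ` {0..l}"
  proof (intro equalityI subsetI)
    fix y assume "y \<in> (\<lambda>s. \<phi> (l - s) + real 0 * s) ` {0..l}"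
    then obtain s where "s \<in> {0..l}" "y = \<phi> (l - s)" by auto
    then show "y \<in> (\<lambda>s. \<phi> s + real 0 * s) ` {0..l}" by (intro image_eqI[of _ _ "l - s"]) auto
  next
    fix y assume "y \<in> (\<lambda>s. \<phi> s + real 0 * s) ` {0..l}"
    then obtain s where "s \<in> {0..l}" "y = \<phi> s" by auto
    then show "y \<in> (\<lambda>s. \<phi> (l - s) + real 0 * s) ` {0..l}" by (intro image_eqI[of _ _ "l - s"]) auto
  qed
  then show "heights r l (\<lambda>s. \<phi> (l - s)) 0 = heights r l \<phi> 0" unfolding heights_def by simp
qed

text \<open>A half edge is an edge together with the end to start from, so the two ends of a loop
  stay distinct.\<close>

definition half_point :: "('p, 'e) graph_model \<Rightarrow> 'e \<times> bool \<Rightarrow> real \<Rightarrow> 'p" where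
  "half_point G \<eta> h = epar G (fst \<eta>) (if snd \<eta> then h else elen G (fst \<eta>) - h)"

definition half_dir :: "('p, 'e) graph_model \<Rightarrow> 'e \<times> bool \<Rightarrow> 'e \<times> real \<times> real" where
  "half_dir G \<eta> = (if snd \<eta> then (fst \<eta>, 0, 1) else (fst \<eta>, elen G (fst \<eta>), - 1))"

definition half_edges :: "('p, 'e) graph_model \<Rightarrow> ('e \<times> bool) set" where
  "half_edges G = edges G \<times> UNIV"

definition half_edges_at :: "('p, 'e) graph_model \<Rightarrow> 'p \<Rightarrow> ('e \<times> bool) set" where
  "half_edges_at G u = {\<eta> \<in> half_edges G. half_point G \<eta> 0 = u}"

lemma along_half_dir: "along G (half_dir G \<eta>) h = half_point G \<eta> h"
  by (simp add: half_dir_def half_point_def along_def)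

text \<open>Here \<open>n (\<eta>, m)\<close> is the height, in units of \<open>r\<close>, of the supporting line of slope \<open>- m\<close> at the
  start of the half edge \<open>\<eta>\<close>. For small \<open>r\<close> the two maxima bend only near their own end of the edge and
  equal \<open>n (\<eta>, 0)\<close> elsewhere, so they are glued by subtracting that common value once.\<close>

definition bend_fun :: "('p, 'e) graph_model \<Rightarrow> nat \<Rightarrow> (('e \<times> bool) \<times> nat \<Rightarrow> nat) \<Rightarrow> real \<Rightarrow> 'e \<Rightarrow> real \<Rightarrow> real" where
  "bend_fun G d n r e s = r * (pencil d (\<lambda>m. n ((e, True), m)) (s / r) +
     pencil d (\<lambda>m. n ((e, False), m)) ((elen G e - s) / r) - real (n ((e, True), 0)))"

lemma eventually_scale:
  fixes P :: "real \<Rightarrow> bool"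
  assumes "\<forall>\<^sub>F h in at_right 0. P h" "0 < r"
  shows "\<forall>\<^sub>F h in at_right 0. P (h / r)"
proof -
  obtain \<epsilon> where "0 < \<epsilon>" "\<And>h. h \<in> {0<..\<epsilon>} \<Longrightarrow> P h" using assms(1) unfolding eventually_at_right_0 by blast
  then show ?thesis unfolding eventually_at_right_0 using assms(2)
    by (intro exI[of _ "r * \<epsilon>"]) (auto simp: field_simps)
qed

lemma pencil_mono:
  assumes "\<And>m. m \<le> d \<Longrightarrow> c m \<le> c' m"
  shows "pencil d c q \<le> pencil d c' q"
proof -
  obtain m where m: "m \<le> d" "pencil d c q = real (c m) - real m * q" using pencil_attained by blast
  have "real (c m) \<le> real (c' m)" using assms[OF m(1)] by simp
  then show ?thesis using m pencil_ge[OF m(1), of c' q] by linarith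
qed

text \<open>Values and arguments are scaled by the same \<open>r\<close>, so slopes do not change;
  the second pencil is run through backwards, hence the sign \<open>- j\<close>.\<close>

lemma bend_fun_slope:
  assumes r: "0 < r" and j: "j = 1 \<or> j = -1"
  shows "\<forall>\<^sub>F h in at_right 0. bend_fun G d n r e (s + of_int j * h) = bend_fun G d n r e s +
    of_int (pencil_slope d (\<lambda>m. n ((e, True), m)) j (s / r) + pencil_slope d (\<lambda>m. n ((e, False), m)) (- j) ((elen G e - s) / r)) * h"
proof -
  let ?c = "\<lambda>b m. n ((e, b), m)"
  have "\<forall>\<^sub>F h in at_right 0. pencil d (?c True) (s / r + of_int j * (h / r)) = pencil d (?c True) (s / r) +
      of_int (pencil_slope d (?c True) j (s / r)) * (h / r)"
    using pencil_has_slope r by (rule eventually_scale)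
  moreover have "\<forall>\<^sub>F h in at_right 0. pencil d (?c False) ((elen G e - s) / r + of_int (- j) * (h / r)) =
      pencil d (?c False) ((elen G e - s) / r) + of_int (pencil_slope d (?c False) (- j) ((elen G e - s) / r)) * (h / r)"
    using pencil_has_slope r by (rule eventually_scale)
  ultimately show ?thesis
  proof eventually_elim
    case (elim h)
    have 1: "(s + of_int j * h) / r = s / r + of_int j * (h / r)"
      "(elen G e - (s + of_int j * h)) / r = (elen G e - s) / r + of_int (- j) * (h / r)"
      using r by (simp_all add: field_simps)
    show ?case unfolding bend_fun_def 1 elim using r by (simp add: field_simps)
  qed
qed

lemma count_mset_of_divisor: "count (mset_of_divisor D) x = nat (Poly_Mapping.lookup D x)"
proof -
  have "count (mset_of_divisor D) x = (\<Sum>v\<in>Poly_Mapping.keys D. if x = v then nat (Poly_Mapping.lookup D v) else 0)"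
    unfolding mset_of_divisor_def count_sum by (intro sum.cong) auto
  also have "\<dots> = nat (Poly_Mapping.lookup D x)" by (simp add: in_keys_iff)
  finally show ?thesis .
qed

context tropical_curve
begin

lemma finite_half_edges: "finite (half_edges G)" "finite (half_edges_at G u)"
  using finite_edges by (auto simp: half_edges_def half_edges_at_def)

lemma half_point_in: "\<eta> \<in> half_edges G \<Longrightarrow> h \<in> {0..elen G (fst \<eta>)} \<Longrightarrow> half_point G \<eta> h \<in> \<Gamma>"
  by (auto simp: half_point_def half_edges_def intro!: epar_in)

lemma half_point_0_vertex: "\<eta> \<in> half_edges G \<Longrightarrow> half_point G \<eta> 0 \<in> verts G"
  using epar_0 epar_elen by (auto simp: half_point_def half_edges_def)

lemma inj_half_dir: "inj_on (half_dir G) (half_edges G)"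
  by (rule inj_onI) (auto simp: half_dir_def half_edges_def prod_eq_iff split: if_splits)

lemma directions_half_edges:
  assumes "u \<in> verts G"
  shows "directions G u = half_dir G ` half_edges_at G u"
proof (intro equalityI subsetI)
  fix \<delta> assume "\<delta> \<in> directions G u"
  then consider e where "\<delta> = (e, 0, 1)" "e \<in> edges G" "epar G e 0 = u"
    | e where "\<delta> = (e, elen G e, -1)" "e \<in> edges G" "epar G e (elen G e) = u"
    using directions_vertex[OF assms] by auto
  then show "\<delta> \<in> half_dir G ` half_edges_at G u"
  proof cases
    case (1 e)
    then show ?thesis by (intro image_eqI[of _ _ "(e, True)"]) (auto simp: half_dir_def half_edges_at_def half_edges_def half_point_def)
  next
    case (2 e)
    then show ?thesis by (intro image_eqI[of _ _ "(e, False)"]) (auto simp: half_dir_def half_edges_at_def half_edges_def half_point_def)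
  qed
next
  fix \<delta> assume "\<delta> \<in> half_dir G ` half_edges_at G u"
  then show "\<delta> \<in> directions G u"
    using directions_vertex[OF assms] by (auto simp: half_dir_def half_edges_at_def half_edges_def half_point_def)
qed

lemma sum_directions_vertex:
  assumes "u \<in> verts G"
  shows "(\<Sum>\<delta>\<in>directions G u. g \<delta>) = (\<Sum>\<eta>\<in>half_edges_at G u. g (half_dir G \<eta>))"
proof -
  have "inj_on (half_dir G) (half_edges_at G u)" by (rule inj_on_subset[OF inj_half_dir]) (auto simp: half_edges_at_def)
  then show ?thesis unfolding directions_half_edges[OF assms] by (simp add: sum.reindex)
qed

text \<open>A chain from \<open>u\<close> to the middle of \<open>e0\<close> starts with a step on
  some edge, so a connected curve with an edge has no isolated vertex.\<close>

lemma vertex_on_edge: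
  assumes "e0 \<in> edges G" "u \<in> \<Gamma>"
  shows "\<exists>e\<in>edges G. \<exists>s\<in>{0..elen G e}. u = epar G e s"
proof (rule ccontr)
  assume n: "\<not> ?thesis"
  define y where "y = epar G e0 (elen G e0 / 2)"
  have y: "y \<in> \<Gamma>" "u \<noteq> y" using assms(1) n elen_pos[OF assms(1)] by (auto simp: y_def intro!: epar_in)
  obtain c where "chain_length G u c y" using dist_Inf(1)[OF assms(2) y(1)] by blast
  then show False
  proof cases
    case refl
    then show False using y by simp
  next
    case (step e s t c)
    then show False using n by blast
  qed
qed

text \<open>The combinatorial condition for \<open>bend_fun\<close> to define, for every small \<open>r\<close>, a supported function that
  vanishes at distance \<open>r\<close> along \<open>\<eta>0\<close>: \<open>N u\<close> is the value at the vertex \<open>u\<close>, in units of \<open>r\<close>, and \<open>- k \<eta>\<close>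
  a slope of a line attaining it. It does not involve \<open>r\<close>, and pointwise suprema preserve it.\<close>

definition valid_heights :: "('p \<Rightarrow>\<^sub>0 int) \<Rightarrow> 'e \<times> bool \<Rightarrow> (('e \<times> bool) \<times> nat \<Rightarrow> nat) \<Rightarrow> bool" where
  "valid_heights E \<eta>0 n \<longleftrightarrow> (\<forall>p. n p \<le> nat (div_degree E)) \<and> (\<forall>p. p \<notin> half_edges G \<times> {..nat (div_degree E)} \<longrightarrow> n p = 0) \<and>
    (\<exists>N k. (\<forall>u\<in>verts G. (\<Sum>\<eta>\<in>half_edges_at G u. int (k \<eta>)) \<le> Poly_Mapping.lookup E u) \<and>
      (\<forall>\<eta>\<in>half_edges G. k \<eta> \<le> nat (div_degree E) \<and> n (\<eta>, k \<eta>) = N (half_point G \<eta> 0) \<and>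
        (\<forall>m\<le>nat (div_degree E). n (\<eta>, m) \<le> N (half_point G \<eta> 0)))) \<and>
    (\<forall>e\<in>edges G. n ((e, True), 0) = n ((e, False), 0)) \<and>
    (\<forall>m\<le>nat (div_degree E). n (\<eta>0, m) \<le> m) \<and> (\<exists>m\<le>nat (div_degree E). n (\<eta>0, m) = m)"

lemma valid_heightsD:
  assumes "valid_heights E \<eta>0 n"
  shows "n p \<le> nat (div_degree E)" "p \<notin> half_edges G \<times> {..nat (div_degree E)} \<Longrightarrow> n p = 0"
    "e \<in> edges G \<Longrightarrow> n ((e, True), 0) = n ((e, False), 0)" "m \<le> nat (div_degree E) \<Longrightarrow> n (\<eta>0, m) \<le> m"
    "\<exists>m\<le>nat (div_degree E). n (\<eta>0, m) = m"
proof -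
  note * = assms[unfolded valid_heights_def]
  have 1: "\<forall>p. n p \<le> nat (div_degree E)" using * by (elim conjE)
  have 2: "\<forall>p. p \<notin> half_edges G \<times> {..nat (div_degree E)} \<longrightarrow> n p = 0" using * by (elim conjE)
  have 3: "\<forall>e\<in>edges G. n ((e, True), 0) = n ((e, False), 0)" using * by (elim conjE)
  have 4: "\<forall>m\<le>nat (div_degree E). n (\<eta>0, m) \<le> m" using * by (elim conjE)
  show "n p \<le> nat (div_degree E)" using 1 by blast
  show "p \<notin> half_edges G \<times> {..nat (div_degree E)} \<Longrightarrow> n p = 0" using 2 by blast
  show "e \<in> edges G \<Longrightarrow> n ((e, True), 0) = n ((e, False), 0)" using 3 by blast
  show "m \<le> nat (div_degree E) \<Longrightarrow> n (\<eta>0, m) \<le> m" using 4 by blast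
  show "\<exists>m\<le>nat (div_degree E). n (\<eta>0, m) = m" using * by (elim conjE)
qed

lemma valid_heightsE:
  assumes "valid_heights E \<eta>0 n"
  obtains N k where "\<And>u. u \<in> verts G \<Longrightarrow> (\<Sum>\<eta>\<in>half_edges_at G u. int (k \<eta>)) \<le> Poly_Mapping.lookup E u"
    "\<And>\<eta>. \<eta> \<in> half_edges G \<Longrightarrow> k \<eta> \<le> nat (div_degree E)" "\<And>\<eta>. \<eta> \<in> half_edges G \<Longrightarrow> n (\<eta>, k \<eta>) = N (half_point G \<eta> 0)"
    "\<And>\<eta> m. \<eta> \<in> half_edges G \<Longrightarrow> m \<le> nat (div_degree E) \<Longrightarrow> n (\<eta>, m) \<le> N (half_point G \<eta> 0)"
proof -
  have "\<exists>N k. (\<forall>u\<in>verts G. (\<Sum>\<eta>\<in>half_edges_at G u. int (k \<eta>)) \<le> Poly_Mapping.lookup E u) \<and>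
      (\<forall>\<eta>\<in>half_edges G. k \<eta> \<le> nat (div_degree E) \<and> n (\<eta>, k \<eta>) = N (half_point G \<eta> 0) \<and>
        (\<forall>m\<le>nat (div_degree E). n (\<eta>, m) \<le> N (half_point G \<eta> 0)))"
    using assms[unfolded valid_heights_def] by (elim conjE)
  then obtain N k where 1: "\<forall>u\<in>verts G. (\<Sum>\<eta>\<in>half_edges_at G u. int (k \<eta>)) \<le> Poly_Mapping.lookup E u"
    and 2: "\<forall>\<eta>\<in>half_edges G. k \<eta> \<le> nat (div_degree E) \<and> n (\<eta>, k \<eta>) = N (half_point G \<eta> 0) \<and>
        (\<forall>m\<le>nat (div_degree E). n (\<eta>, m) \<le> N (half_point G \<eta> 0))" by (elim exE conjE)
  show ?thesis by (rule that[of k N]) (use 1 2 in blast)+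
qed

text \<open>The heights are bounded, and their default value 0 outside the finite index set leaves
  only finitely many functions.\<close>

lemma finite_valid_heights: "finite {n. valid_heights E \<eta>0 n}"
proof (rule finite_subset)
  let ?A = "half_edges G \<times> {..nat (div_degree E)}"
  show "{n. valid_heights E \<eta>0 n} \<subseteq> {n. \<forall>p. (p \<in> ?A \<longrightarrow> n p \<in> {..nat (div_degree E)}) \<and> (p \<notin> ?A \<longrightarrow> n p = 0)}"
    by (auto simp: valid_heights_def)
  show "finite {n :: ('e \<times> bool) \<times> nat \<Rightarrow> nat. \<forall>p. (p \<in> ?A \<longrightarrow> n p \<in> {..nat (div_degree E)}) \<and> (p \<notin> ?A \<longrightarrow> n p = 0)}"
    using finite_half_edges(1) by (intro finite_set_of_finite_funs) auto
qed

text \<open>At each vertex the slopes \<open>k\<close> are taken from whichever of the two has the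
  larger vertex value there. The choice depends on the vertex only, so the bound on the sum over its
  half edges is inherited.\<close>

lemma valid_heights_sup:
  assumes n: "valid_heights E \<eta>0 n" and n': "valid_heights E \<eta>0 n'"
  shows "valid_heights E \<eta>0 (sup n n')"
proof -
  let ?d = "nat (div_degree E)"
  obtain N k where k: "\<And>u. u \<in> verts G \<Longrightarrow> (\<Sum>\<eta>\<in>half_edges_at G u. int (k \<eta>)) \<le> Poly_Mapping.lookup E u"
    "\<And>\<eta>. \<eta> \<in> half_edges G \<Longrightarrow> k \<eta> \<le> ?d" "\<And>\<eta>. \<eta> \<in> half_edges G \<Longrightarrow> n (\<eta>, k \<eta>) = N (half_point G \<eta> 0)"
    "\<And>\<eta> m. \<eta> \<in> half_edges G \<Longrightarrow> m \<le> ?d \<Longrightarrow> n (\<eta>, m) \<le> N (half_point G \<eta> 0)"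
    by (rule valid_heightsE[OF n], rule that)
  obtain N' k' where k': "\<And>u. u \<in> verts G \<Longrightarrow> (\<Sum>\<eta>\<in>half_edges_at G u. int (k' \<eta>)) \<le> Poly_Mapping.lookup E u"
    "\<And>\<eta>. \<eta> \<in> half_edges G \<Longrightarrow> k' \<eta> \<le> ?d" "\<And>\<eta>. \<eta> \<in> half_edges G \<Longrightarrow> n' (\<eta>, k' \<eta>) = N' (half_point G \<eta> 0)"
    "\<And>\<eta> m. \<eta> \<in> half_edges G \<Longrightarrow> m \<le> ?d \<Longrightarrow> n' (\<eta>, m) \<le> N' (half_point G \<eta> 0)"
    by (rule valid_heightsE[OF n'], rule that)
  define K where "K \<eta> = (if N' (half_point G \<eta> 0) \<le> N (half_point G \<eta> 0) then k \<eta> else k' \<eta>)" for \<eta>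
  have sup: "sup n n' p = max (n p) (n' p)" for p by (simp add: sup_max)
  have K1: "(\<Sum>\<eta>\<in>half_edges_at G u. int (K \<eta>)) \<le> Poly_Mapping.lookup E u" if "u \<in> verts G" for u
  proof -
    have "(\<Sum>\<eta>\<in>half_edges_at G u. int (K \<eta>)) = (if N' u \<le> N u then (\<Sum>\<eta>\<in>half_edges_at G u. int (k \<eta>)) else (\<Sum>\<eta>\<in>half_edges_at G u. int (k' \<eta>)))"
      by (auto simp: K_def half_edges_at_def intro!: sum.cong)
    then show ?thesis using k(1)[OF that] k'(1)[OF that] by simp
  qed
  have K2: "K \<eta> \<le> ?d \<and> sup n n' (\<eta>, K \<eta>) = max (N (half_point G \<eta> 0)) (N' (half_point G \<eta> 0)) \<and>
      (\<forall>m\<le>?d. sup n n' (\<eta>, m) \<le> max (N (half_point G \<eta> 0)) (N' (half_point G \<eta> 0)))" if \<eta>: "\<eta> \<in> half_edges G" for \<eta>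
  proof (intro conjI allI impI)
    show "K \<eta> \<le> ?d" using k(2)[OF \<eta>] k'(2)[OF \<eta>] by (simp add: K_def)
    show "sup n n' (\<eta>, K \<eta>) = max (N (half_point G \<eta> 0)) (N' (half_point G \<eta> 0))"
    proof (cases "N' (half_point G \<eta> 0) \<le> N (half_point G \<eta> 0)")
      case True
      then show ?thesis using k(3)[OF \<eta>] k'(4)[OF \<eta> k(2)[OF \<eta>]] unfolding sup K_def by simp
    next
      case False
      then show ?thesis using k'(3)[OF \<eta>] k(4)[OF \<eta> k'(2)[OF \<eta>]] unfolding sup K_def by simp
    qed
    show "sup n n' (\<eta>, m) \<le> max (N (half_point G \<eta> 0)) (N' (half_point G \<eta> 0))" if "m \<le> ?d" for m
      unfolding sup using k(4)[OF \<eta> that] k'(4)[OF \<eta> that] by (rule max.mono)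
  qed
  have basic: "n p \<le> ?d" "n' p \<le> ?d" "p \<notin> half_edges G \<times> {..?d} \<Longrightarrow> n p = 0" "p \<notin> half_edges G \<times> {..?d} \<Longrightarrow> n' p = 0"
    "e \<in> edges G \<Longrightarrow> n ((e, True), 0) = n ((e, False), 0)" "e \<in> edges G \<Longrightarrow> n' ((e, True), 0) = n' ((e, False), 0)"
    "m \<le> ?d \<Longrightarrow> n (\<eta>0, m) \<le> m" "m \<le> ?d \<Longrightarrow> n' (\<eta>0, m) \<le> m" for p e m
    using valid_heightsD[OF n] valid_heightsD[OF n'] by blast+
  obtain m where m: "m \<le> ?d" "n (\<eta>0, m) = m" using valid_heightsD(5)[OF n] by blast
  show ?thesis unfolding valid_heights_def
  proof (intro conjI allI impI ballI)
    show "sup n n' p \<le> ?d" for p unfolding sup using basic(1,2) by simp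
    show "sup n n' p = 0" if "p \<notin> half_edges G \<times> {..?d}" for p unfolding sup using basic(3,4)[OF that] by simp
    show "\<exists>N k. (\<forall>u\<in>verts G. (\<Sum>\<eta>\<in>half_edges_at G u. int (k \<eta>)) \<le> Poly_Mapping.lookup E u) \<and>
      (\<forall>\<eta>\<in>half_edges G. k \<eta> \<le> ?d \<and> sup n n' (\<eta>, k \<eta>) = N (half_point G \<eta> 0) \<and> (\<forall>m\<le>?d. sup n n' (\<eta>, m) \<le> N (half_point G \<eta> 0)))"
      using K1 K2 by (intro exI[of _ "\<lambda>u. max (N u) (N' u)"] exI[of _ K]) blast
    show "sup n n' ((e, True), 0) = sup n n' ((e, False), 0)" if "e \<in> edges G" for e
      unfolding sup using basic(5,6)[OF that] by simp
    show "sup n n' (\<eta>0, m) \<le> m" if "m \<le> ?d" for m unfolding sup using basic(7,8)[OF that] by simp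
    show "\<exists>m\<le>?d. sup n n' (\<eta>0, m) = m"
      unfolding sup using m basic(8)[OF m(1)] by (intro exI[of _ m]) simp
  qed
qed

lemma valid_heights_greatest:
  assumes "valid_heights E \<eta>0 n0"
  obtains n where "valid_heights E \<eta>0 n" "\<And>n'. valid_heights E \<eta>0 n' \<Longrightarrow> n' \<le> n"
proof -
  obtain n where n: "valid_heights E \<eta>0 n" "\<And>n'. valid_heights E \<eta>0 n' \<Longrightarrow> n \<le> n' \<Longrightarrow> n = n'"
    using finite_has_maximal[OF finite_valid_heights[of E \<eta>0]] assms by blast
  have "n' \<le> n" if "valid_heights E \<eta>0 n'" for n'
    using n(2)[OF valid_heights_sup[OF n(1) that]] by (metis sup.cobounded1 sup.cobounded2)
  then show ?thesis using that n(1) by blast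
qed

text \<open>Beyond the middle of the edge each pencil has become constant, and by validity its
  constant is the term subtracted in \<open>bend_fun\<close>, so only the pencil of the near end is
  left.\<close>

lemma bend_fun_half:
  assumes n: "valid_heights E \<eta>0 n" and e: "e \<in> edges G" and r: "0 < r" "2 * real (nat (div_degree E)) * r \<le> elen G e"
    and s: "s \<in> {0..elen G e}"
  shows "s \<le> elen G e / 2 \<Longrightarrow> bend_fun G (nat (div_degree E)) n r e s = r * pencil (nat (div_degree E)) (\<lambda>m. n ((e, True), m)) (s / r)"
    and "elen G e / 2 \<le> s \<Longrightarrow> bend_fun G (nat (div_degree E)) n r e s =
      r * pencil (nat (div_degree E)) (\<lambda>m. n ((e, False), m)) ((elen G e - s) / r)"
proof -
  let ?d = "nat (div_degree E)"
  have n0: "n p \<le> ?d" "n ((e, True), 0) = n ((e, False), 0)" for p using valid_heightsD(1,3)[OF n] e by blast+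
  have large: "pencil ?d (\<lambda>m. n ((e, b), m)) (t / r) = real (n ((e, b), 0))" if "elen G e / 2 \<le> t" for b t
  proof -
    have "real ?d * r \<le> t" using r(2) that by linarith
    then have "real ?d \<le> t / r" using r(1) by (simp add: pos_le_divide_eq)
    then show ?thesis using n0(1) by (intro pencil_large) auto
  qed
  show "bend_fun G ?d n r e s = r * pencil ?d (\<lambda>m. n ((e, True), m)) (s / r)" if "s \<le> elen G e / 2"
    using large[of "elen G e - s" False] that n0(2) by (simp add: bend_fun_def)
  show "bend_fun G ?d n r e s = r * pencil ?d (\<lambda>m. n ((e, False), m)) ((elen G e - s) / r)" if "elen G e / 2 \<le> s"
    using large[of s True] that by (simp add: bend_fun_def)
qed

text \<open>The subtracted term in \<open>bend_fun\<close> grows with the heights as well, so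
  monotonicity is read off on the two halves, where a single pencil remains.\<close>

lemma bend_fun_mono:
  assumes n: "valid_heights E \<eta>0 n" "valid_heights E \<eta>0 n'" "n \<le> n'" and e: "e \<in> edges G"
    and r: "0 < r" "2 * real (nat (div_degree E)) * r \<le> elen G e" and s: "s \<in> {0..elen G e}"
  shows "bend_fun G (nat (div_degree E)) n r e s \<le> bend_fun G (nat (div_degree E)) n' r e s"
proof -
  have "n p \<le> n' p" for p using n(3) by (rule le_funD)
  then have mono: "r * pencil (nat (div_degree E)) (\<lambda>m. n (\<eta>, m)) q \<le> r * pencil (nat (div_degree E)) (\<lambda>m. n' (\<eta>, m)) q" for \<eta> q
    using r(1) by (intro mult_left_mono pencil_mono) auto
  show ?thesis
    using bend_fun_half[OF n(1) e r s] bend_fun_half[OF n(2) e r s] mono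
    by (cases "s \<le> elen G e / 2") auto
qed

text \<open>At a vertex \<open>u\<close> every pencil starts at \<open>N u\<close> with slope at
  least \<open>- k\<close>, so the bound on the sum of \<open>k\<close> keeps
  \<open>E + div f\<close> nonnegative there; inside the edges bends are nonnegative by
  convexity.\<close>

lemma valid_heights_competitor:
  assumes E: "divisor \<Gamma> E" "effective E" "Poly_Mapping.keys E \<subseteq> verts G"
    and \<eta>0: "\<eta>0 \<in> half_edges G" and n: "valid_heights E \<eta>0 n"
    and r: "0 < r" "\<And>e. e \<in> edges G \<Longrightarrow> r * (real (nat (div_degree E)) + 1) < elen G e"
  obtains f where "supported E f" "f (half_point G \<eta>0 r) = 0"
    "\<And>e s. e \<in> edges G \<Longrightarrow> s \<in> {0..elen G e} \<Longrightarrow> f (epar G e s) = bend_fun G (nat (div_degree E)) n r e s"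
    "\<And>u. u \<in> verts G \<Longrightarrow> ord_at G f u = (\<Sum>\<eta>\<in>half_edges_at G u. pencil_slope (nat (div_degree E)) (\<lambda>m. n (\<eta>, m)) 1 0)"
    "\<And>e s. e \<in> edges G \<Longrightarrow> s \<in> {0<..<elen G e} \<Longrightarrow> ord_at G f (epar G e s) =
      pencil_bend (nat (div_degree E)) (\<lambda>m. n ((e, True), m)) (s / r) +
      pencil_bend (nat (div_degree E)) (\<lambda>m. n ((e, False), m)) ((elen G e - s) / r)"
proof -
  define d where "d = nat (div_degree E)"
  define c where "c \<eta> m = n (\<eta>, m)" for \<eta> m
  have n0: "n p \<le> d" "e \<in> edges G \<Longrightarrow> n ((e, True), 0) = n ((e, False), 0)" for p e
    using valid_heightsD(1,3)[OF n] unfolding d_def by blast+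
  obtain N k where k: "\<And>u. u \<in> verts G \<Longrightarrow> (\<Sum>\<eta>\<in>half_edges_at G u. int (k \<eta>)) \<le> Poly_Mapping.lookup E u"
    "\<And>\<eta>. \<eta> \<in> half_edges G \<Longrightarrow> k \<eta> \<le> d" "\<And>\<eta>. \<eta> \<in> half_edges G \<Longrightarrow> n (\<eta>, k \<eta>) = N (half_point G \<eta> 0)"
    "\<And>\<eta> m. \<eta> \<in> half_edges G \<Longrightarrow> m \<le> d \<Longrightarrow> n (\<eta>, m) \<le> N (half_point G \<eta> 0)"
    by (rule valid_heightsE[OF n, folded d_def], rule that)
  have large: "real d + 1 < elen G e / r" if "e \<in> edges G" for e
    using r(2)[OF that] r(1) by (simp add: d_def pos_less_divide_eq mult.commute)
  have cd: "c \<eta> m \<le> d" for \<eta> m by (simp add: c_def n0)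
  have c0: "c (e, True) 0 = c (e, False) 0" if "e \<in> edges G" for e using n0(2)[OF that] by (simp add: c_def)
  have om0: "pencil d (c \<eta>) 0 = real (N (half_point G \<eta> 0))" if \<eta>: "\<eta> \<in> half_edges G" for \<eta>
  proof (rule antisym)
    obtain m where "m \<le> d" "pencil d (c \<eta>) 0 = real (c \<eta> m) - real m * 0" using pencil_attained by blast
    then show "pencil d (c \<eta>) 0 \<le> real (N (half_point G \<eta> 0))" using k(4)[OF \<eta>, of m] by (simp add: c_def)
    show "real (N (half_point G \<eta> 0)) \<le> pencil d (c \<eta>) 0"
      using pencil_ge[OF k(2)[OF \<eta>], of "c \<eta>" 0] k(3)[OF \<eta>] by (simp add: c_def)
  qed
  have slope0: "- int (k \<eta>) \<le> pencil_slope d (c \<eta>) 1 0" if \<eta>: "\<eta> \<in> half_edges G" for \<eta>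
  proof -
    have "k \<eta> \<in> pencil_args d (c \<eta>) 0" using k(2,3)[OF \<eta>] om0[OF \<eta>] by (simp add: pencil_args_def c_def)
    from pencil_slope_ge[OF this, of 1] show ?thesis by simp
  qed
  define B where "B e s = bend_fun G d n r e s" for e s
  have B: "B e s = r * (pencil d (c (e, True)) (s / r) + pencil d (c (e, False)) ((elen G e - s) / r) - real (c (e, True) 0))" for e s
    by (simp add: B_def bend_fun_def c_def[abs_def])
  have omL: "pencil d (c \<eta>) q = real (c \<eta> 0)" if "real d \<le> q" for \<eta> q
    using cd that by (intro pencil_large)
  have B0: "B e 0 = r * real (N (epar G e 0))" "B e (elen G e) = r * real (N (epar G e (elen G e)))" if e: "e \<in> edges G" for e
    using om0[of "(e, True)"] om0[of "(e, False)"] e omL[of "elen G e / r"] large[OF e] c0[OF e]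
    by (auto simp: B half_edges_def half_point_def)
  have "\<exists>f. (\<forall>u\<in>verts G. f u = r * real (N u)) \<and> (\<forall>e\<in>edges G. \<forall>s\<in>{0..elen G e}. f (epar G e s) = B e s)"
    using B0 by (rule glue)
  then obtain f where f: "\<And>e s. e \<in> edges G \<Longrightarrow> s \<in> {0..elen G e} \<Longrightarrow> f (epar G e s) = B e s" by blast
  define sl where "sl = (\<lambda>(e, t, \<sigma>::real). if \<sigma> = 1
    then pencil_slope d (c (e, True)) 1 (t / r) + pencil_slope d (c (e, False)) (-1) ((elen G e - t) / r)
    else pencil_slope d (c (e, True)) (-1) (t / r) + pencil_slope d (c (e, False)) 1 ((elen G e - t) / r))"
  have sl: "has_slope G f \<delta> (sl \<delta>)" if \<delta>: "\<delta> \<in> directions G x" for \<delta> x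
  proof -
    obtain e t \<sigma> where \<delta>': "\<delta> = (e, t, \<sigma>)" by (cases \<delta>)
    have e: "e \<in> edges G" "t \<in> {0..elen G e}" "\<sigma> = 1 \<or> \<sigma> = -1" using \<delta> \<delta>' by (auto simp: directions_def)
    have *: "\<forall>\<^sub>F h in at_right 0. B e (t + \<sigma> * h) = B e t + of_int (sl \<delta>) * h"
      using e(3)
    proof
      assume "\<sigma> = 1"
      then show ?thesis using bend_fun_slope[OF r(1), of 1 G d n e t] by (simp add: \<delta>' sl_def B_def c_def[abs_def])
    next
      assume "\<sigma> = -1"
      then show ?thesis using bend_fun_slope[OF r(1), of "-1" G d n e t] by (simp add: \<delta>' sl_def B_def c_def[abs_def])
    qed
    with directions_range_ev[OF \<delta>[unfolded \<delta>']] show ?thesis unfolding has_slope_def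
    proof eventually_elim
      case (elim h)
      then show ?case using f[OF e(1,2)] f[OF e(1), of "t + \<sigma> * h"] by (auto simp: \<delta>')
    qed
  qed
  have slL: "pencil_slope d (c \<eta>) j q = 0" if "real d < q" for \<eta> j q using cd that by (intro pencil_slope_large)
  have ordv: "ord_at G f u = (\<Sum>\<eta>\<in>half_edges_at G u. pencil_slope d (c \<eta>) 1 0)" if u: "u \<in> verts G" for u
  proof -
    have "ord_at G f u = (\<Sum>\<delta>\<in>directions G u. sl \<delta>)" using sl by (intro has_slope_ord)
    also have "\<dots> = (\<Sum>\<eta>\<in>half_edges_at G u. sl (half_dir G \<eta>))" using u by (rule sum_directions_vertex)
    also have "\<dots> = (\<Sum>\<eta>\<in>half_edges_at G u. pencil_slope d (c \<eta>) 1 0)"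
    proof (rule sum.cong[OF HOL.refl])
      fix \<eta> assume \<eta>: "\<eta> \<in> half_edges_at G u"
      obtain e b where \<eta>': "\<eta> = (e, b)" by (cases \<eta>)
      have "e \<in> edges G" using \<eta> \<eta>' by (auto simp: half_edges_at_def half_edges_def)
      then have "real d < elen G e / r" using large[of e] by simp
      then show "sl (half_dir G \<eta>) = pencil_slope d (c \<eta>) 1 0" using slL by (cases b) (auto simp: \<eta>' half_dir_def sl_def)
    qed
    finally show ?thesis .
  qed
  have ordi: "ord_at G f (epar G e s) = pencil_bend d (c (e, True)) (s / r) + pencil_bend d (c (e, False)) ((elen G e - s) / r)"
    if "e \<in> edges G" "s \<in> {0<..<elen G e}" for e s
  proof -
    have "ord_at G f (epar G e s) = (\<Sum>\<delta>\<in>directions G (epar G e s). sl \<delta>)" using sl by (intro has_slope_ord)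
    then show ?thesis unfolding directions_interior[OF that] by (simp add: sl_def pencil_bend_def)
  qed
  have cont: "continuous_on \<Gamma> f"
  proof (rule continuous_Lipschitz[of f "2 * real d"])
    fix e s t assume e: "e \<in> edges G" "s \<in> {0..elen G e}" "t \<in> {0..elen G e}"
    have 1: "\<bar>pencil d (c (e, True)) (s / r) - pencil d (c (e, True)) (t / r)\<bar> \<le> real d * (\<bar>s - t\<bar> / r)"
      using pencil_Lipschitz[of d "c (e, True)" "s / r" "t / r"] r(1) by (simp add: abs_divide flip: diff_divide_distrib)
    have 2: "\<bar>pencil d (c (e, False)) ((elen G e - s) / r) - pencil d (c (e, False)) ((elen G e - t) / r)\<bar> \<le> real d * (\<bar>s - t\<bar> / r)"
      using pencil_Lipschitz[of d "c (e, False)" "(elen G e - s) / r" "(elen G e - t) / r"] r(1)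
      by (simp add: abs_divide abs_minus_commute flip: diff_divide_distrib)
    have "B e s - B e t = r * ((pencil d (c (e, True)) (s / r) - pencil d (c (e, True)) (t / r)) +
        (pencil d (c (e, False)) ((elen G e - s) / r) - pencil d (c (e, False)) ((elen G e - t) / r)))"
      unfolding B by (simp add: algebra_simps)
    then have "\<bar>B e s - B e t\<bar> = r * \<bar>(pencil d (c (e, True)) (s / r) - pencil d (c (e, True)) (t / r)) +
        (pencil d (c (e, False)) ((elen G e - s) / r) - pencil d (c (e, False)) ((elen G e - t) / r))\<bar>"
      using r(1) by (simp only: abs_mult abs_of_pos)
    also have "\<dots> \<le> r * (real d * (\<bar>s - t\<bar> / r) + real d * (\<bar>s - t\<bar> / r))"
      using r(1) by (intro mult_left_mono order.trans[OF abs_triangle_ineq] add_mono 1 2) simp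
    also have "\<dots> = 2 * real d * \<bar>s - t\<bar>" using r(1) by simp
    finally show "\<bar>f (epar G e s) - f (epar G e t)\<bar> \<le> 2 * real d * \<bar>s - t\<bar>" using f e by simp
  qed simp
  have rat: "rational_function \<Gamma> G f" using cont sl by (intro rationalI) blast+
  have nonneg: "0 \<le> Poly_Mapping.lookup E x + ord_at G f x" if "x \<in> \<Gamma>" for x
    using that
  proof (cases rule: point_cases)
    case 1
    have "(\<Sum>\<eta>\<in>half_edges_at G x. - int (k \<eta>)) \<le> ord_at G f x"
      unfolding ordv[OF 1] by (intro sum_mono slope0) (auto simp: half_edges_at_def)
    then show ?thesis using k(1)[OF 1] by (simp add: sum_negf)
  next
    case (2 e t)
    then have "0 \<le> ord_at G f x" using ordi pencil_bend_nonneg by (simp add: add_nonneg_nonneg)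
    then show ?thesis using E(2) by (simp add: effective_def add_nonneg_nonneg)
  qed
  \<comment> \<open>The point at distance \<open>r\<close> has rescaled coordinate 1, where the
    lines take the values \<open>c \<eta>0 m - m\<close>: none is positive and one is 0.\<close>
  have "pencil d (c \<eta>0) 1 = 0"
  proof (rule antisym)
    obtain m where "m \<le> d" "pencil d (c \<eta>0) 1 = real (c \<eta>0 m) - real m * 1" using pencil_attained by blast
    moreover have "c \<eta>0 m \<le> m" if "m \<le> d" for m using valid_heightsD(4)[OF n] that unfolding d_def c_def by blast
    ultimately show "pencil d (c \<eta>0) 1 \<le> 0" by simp
    obtain m where "m \<le> d" "c \<eta>0 m = m" using valid_heightsD(5)[OF n] unfolding d_def c_def by blast
    then show "0 \<le> pencil d (c \<eta>0) 1" using pencil_ge[of m d "c \<eta>0" 1] by simp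
  qed
  moreover obtain e b where \<eta>0': "\<eta>0 = (e, b)" by (cases \<eta>0)
  moreover have e: "e \<in> edges G" using \<eta>0 \<eta>0' by (simp add: half_edges_def)
  \<comment> \<open>Seen from the far end this point is at rescaled distance at least
    \<open>d\<close>, so the other pencil contributes just the constant that \<open>bend_fun\<close>
    subtracts.\<close>
  moreover have "real d \<le> (elen G e - r) / r" "r \<le> elen G e"
  proof -
    have "r * (real d + 1) < elen G e" using r(2)[OF e] by (simp add: d_def)
    then have "r * real d + r < elen G e" by (simp add: distrib_left)
    moreover have "0 \<le> r * real d" using r(1) by simp
    ultimately have "r \<le> elen G e" "real d * r \<le> elen G e - r" by (linarith, simp add: mult.commute)
    then show "r \<le> elen G e" "real d \<le> (elen G e - r) / r" using r(1) by (simp_all add: pos_le_divide_eq)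
  qed
  ultimately have "f (half_point G \<eta>0 r) = 0"
    using r(1) f[OF e, of r] f[OF e, of "elen G e - r"] omL[of "(elen G e - r) / r"] c0[OF e]
    by (cases b) (auto simp: half_point_def B)
  moreover have "supported E f" using rat E nonneg by (rule rational_supported)
  ultimately show ?thesis
    using f ordv ordi by (intro that[of f]) (simp_all add: B_def d_def c_def[abs_def])
qed

lemma supports_half:
  assumes "supports F m u" "\<eta> \<in> half_edges_at G u" "h \<in> {0..elen G (fst \<eta>)}"
  shows "F u + of_int (m (half_dir G \<eta>)) * h \<le> F (half_point G \<eta> h)"
proof -
  obtain e b where \<eta>: "\<eta> = (e, b)" by (cases \<eta>)
  have e: "e \<in> edges G" "half_point G \<eta> 0 = u" using assms(2) \<eta> by (auto simp: half_edges_at_def half_edges_def)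
  then have "u \<in> verts G" using half_point_0_vertex[of \<eta>] assms(2) by (simp add: half_edges_at_def)
  then have "half_dir G \<eta> \<in> directions G u" using assms(2) directions_half_edges by blast
  moreover have "F u + of_int (m (e, t, \<sigma>)) * \<bar>s - t\<bar> \<le> F (epar G e s)"
    if "(e, t, \<sigma>) \<in> directions G u" "s \<in> {0..elen G e}" "0 \<le> \<sigma> * (s - t)" for t \<sigma> s
    using assms(1) that unfolding supports_def by blast
  note this[of 0 1 h] this[of "elen G e" "-1" "elen G e - h"]
  ultimately show ?thesis using assms(3) by (cases b) (simp_all add: half_dir_def half_point_def \<eta>)
qed

text \<open>A supporting line of \<open>F\<close> at a vertex has intercept \<open>F u\<close> on
  its half edge, the largest possible one. After rounding it still attains the largest value, so the
  supporting slopes of \<open>F\<close> witness validity of the rounded heights.\<close>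

lemma valid_heights_rounding:
  assumes E: "effective E" "Poly_Mapping.keys E \<subseteq> verts G"
    and \<eta>0: "\<eta>0 \<in> half_edges G" and F: "supported E F" "F (half_point G \<eta>0 r) = 0"
    and r: "0 < r" "\<And>e. e \<in> edges G \<Longrightarrow> r * (2 * real (nat (div_degree E)) + 2) < elen G e"
    and bounds: "\<And>x. x \<in> \<Gamma> \<Longrightarrow> 0 \<le> F x \<and> F x \<le> real (nat (div_degree E)) * r"
  obtains n where "valid_heights E \<eta>0 n"
    "\<And>e s. e \<in> edges G \<Longrightarrow> s \<in> {0..elen G e} \<Longrightarrow> F (epar G e s) \<le> bend_fun G (nat (div_degree E)) n r e s"
proof -
  define d where "d = nat (div_degree E)"
  have d: "int d = div_degree E" using div_degree_nonneg[OF E(1)] by (simp add: d_def)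
  define \<phi> where "\<phi> \<eta> h = F (half_point G \<eta> h)" for \<eta> h
  define L where "L \<eta> = elen G (fst \<eta>)" for \<eta> :: "'e \<times> bool"
  define n where "n p = (if p \<in> half_edges G \<times> {..d} then heights r (L (fst p)) (\<phi> (fst p)) (snd p) else 0)" for p
  \<comment> \<open>The bound with \<open>2 * d + 2\<close> covers two demands: bends, at distance
    at most \<open>d * r\<close>, and the point at distance \<open>r\<close> all lie in the first
    half of the edge.\<close>
  have L: "0 < L \<eta>" "2 * (real d * r) < L \<eta>" "r \<le> L \<eta> / 2" if "\<eta> \<in> half_edges G" for \<eta>
  proof -
    have e: "fst \<eta> \<in> edges G" using that by (auto simp: half_edges_def)
    show "0 < L \<eta>" using elen_pos[OF e] by (simp add: L_def)
    have "r * (2 * real d + 2) < L \<eta>" using r(2)[OF e] by (simp add: d_def L_def)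
    moreover have "r * (2 * real d + 2) = 2 * (real d * r) + 2 * r" by (simp add: algebra_simps)
    moreover have "0 \<le> real d * r" using r(1) by simp
    ultimately show "2 * (real d * r) < L \<eta>" "r \<le> L \<eta> / 2" using r(1) by linarith+
  qed
  have conv: "\<exists>m::int. \<bar>m\<bar> \<le> int d \<and> (\<forall>s\<in>{0..L \<eta>}. \<phi> \<eta> t + of_int m * (s - t) \<le> \<phi> \<eta> s)"
    if \<eta>: "\<eta> \<in> half_edges G" and t: "t \<in> {0..L \<eta>}" for \<eta> t
  proof -
    obtain e b where \<eta>': "\<eta> = (e, b)" by (cases \<eta>)
    have e: "e \<in> edges G" using \<eta> \<eta>' by (simp add: half_edges_def)
    show ?thesis
    proof (cases b)
      case True
      obtain m :: int where "\<bar>m\<bar> \<le> div_degree E"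
        "\<And>s. s \<in> {0..elen G e} \<Longrightarrow> F (epar G e t) + of_int m * (s - t) \<le> F (epar G e s)"
        using supported_edge[OF F(1) E(2) e, of t] t by (auto simp: L_def \<eta>')
      then show ?thesis using True d by (intro exI[of _ m]) (simp add: \<phi>_def half_point_def L_def \<eta>')
    next
      case False
      obtain m :: int where m: "\<bar>m\<bar> \<le> div_degree E"
        "\<And>s. s \<in> {0..elen G e} \<Longrightarrow> F (epar G e (elen G e - t)) + of_int m * (s - (elen G e - t)) \<le> F (epar G e s)"
        using supported_edge[OF F(1) E(2) e, of "elen G e - t"] t by (auto simp: L_def \<eta>')
      have "\<phi> \<eta> t + of_int (- m) * (s - t) \<le> \<phi> \<eta> s" if "s \<in> {0..L \<eta>}" for s
        using m(2)[of "elen G e - s"] that False by (auto simp: \<phi>_def half_point_def L_def \<eta>' algebra_simps)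
      then show ?thesis using m(1) d by (intro exI[of _ "- m"]) simp
    qed
  qed
  have bd: "0 \<le> \<phi> \<eta> t \<and> \<phi> \<eta> t \<le> real d * r" if "\<eta> \<in> half_edges G" "t \<in> {0..L \<eta>}" for \<eta> t
    using that bounds[OF half_point_in[of \<eta> t]] by (simp add: \<phi>_def L_def d_def)
  note hs = heights[OF r(1) L(1) conv bd L(2)]
  have "\<forall>u\<in>verts G. \<exists>m. (\<forall>\<delta>\<in>directions G u. \<bar>m \<delta>\<bar> \<le> div_degree E) \<and>
      - Poly_Mapping.lookup E u \<le> (\<Sum>\<delta>\<in>directions G u. m \<delta>) \<and> supports F m u"
    using F(1) verts_subset unfolding supported_def by blast
  then obtain m where m: "\<And>u \<delta>. u \<in> verts G \<Longrightarrow> \<delta> \<in> directions G u \<Longrightarrow> \<bar>m u \<delta>\<bar> \<le> div_degree E"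
    "\<And>u. u \<in> verts G \<Longrightarrow> - Poly_Mapping.lookup E u \<le> (\<Sum>\<delta>\<in>directions G u. m u \<delta>)"
    "\<And>u. u \<in> verts G \<Longrightarrow> supports F (m u) u" by metis
  \<comment> \<open>The negated supporting slope at the start of \<open>\<eta>\<close>. Nothing is
    lost by \<open>nat\<close>: a positive slope would raise \<open>F\<close> above
    \<open>d * r\<close> at the other end of the edge.\<close>
  define k where "k \<eta> = nat (- m (half_point G \<eta> 0) (half_dir G \<eta>))" for \<eta>
  have k: "int (k \<eta>) = - m (half_point G \<eta> 0) (half_dir G \<eta>)" "k \<eta> \<le> d"
    "\<And>s. s \<in> {0..L \<eta>} \<Longrightarrow> \<phi> \<eta> 0 - real (k \<eta>) * s \<le> \<phi> \<eta> s" if \<eta>: "\<eta> \<in> half_edges G" for \<eta>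
  proof -
    let ?u = "half_point G \<eta> 0"
    have u: "?u \<in> verts G" using \<eta> by (rule half_point_0_vertex)
    have \<eta>u: "\<eta> \<in> half_edges_at G ?u" using \<eta> by (simp add: half_edges_at_def)
    then have dir: "half_dir G \<eta> \<in> directions G ?u" using directions_half_edges[OF u] by blast
    have sup: "\<phi> \<eta> 0 + of_int (m ?u (half_dir G \<eta>)) * s \<le> \<phi> \<eta> s" if "s \<in> {0..L \<eta>}" for s
      using supports_half[OF m(3)[OF u] \<eta>u, of s] that by (simp add: \<phi>_def L_def)
    have "m ?u (half_dir G \<eta>) \<le> 0"
    proof (rule ccontr)
      assume "\<not> ?thesis"
      then have "1 * L \<eta> \<le> of_int (m ?u (half_dir G \<eta>)) * L \<eta>" using L(1)[OF \<eta>] by (intro mult_right_mono) auto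
      moreover have "\<phi> \<eta> 0 + of_int (m ?u (half_dir G \<eta>)) * L \<eta> \<le> \<phi> \<eta> (L \<eta>)" using sup[of "L \<eta>"] L(1)[OF \<eta>] by simp
      moreover have "0 \<le> \<phi> \<eta> 0" "\<phi> \<eta> (L \<eta>) \<le> real d * r" "0 \<le> real d * r"
        using bd[OF \<eta>, of 0] bd[OF \<eta>, of "L \<eta>"] L(1)[OF \<eta>] r(1) by auto
      ultimately have "L \<eta> \<le> real d * r" by (smt (verit))
      then show False using L(2)[OF \<eta>] \<open>0 \<le> real d * r\<close> by linarith
    qed
    then show k1: "int (k \<eta>) = - m ?u (half_dir G \<eta>)" by (simp add: k_def)
    show "k \<eta> \<le> d" using m(1)[OF u dir] d k1 by linarith
    have "real (k \<eta>) = - of_int (m ?u (half_dir G \<eta>))" using k1 by (metis of_int_minus of_int_of_nat_eq)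
    then show "\<phi> \<eta> 0 - real (k \<eta>) * s \<le> \<phi> \<eta> s" if "s \<in> {0..L \<eta>}" for s using sup[OF that] by simp
  qed
  have n_in: "n (\<eta>, j) = heights r (L \<eta>) (\<phi> \<eta>) j" if "\<eta> \<in> half_edges G" "j \<le> d" for \<eta> j
    using that by (simp add: n_def)
  have sym: "n ((e, True), 0) = n ((e, False), 0)" if "e \<in> edges G" for e
  proof -
    have H: "(e, True) \<in> half_edges G" "(e, False) \<in> half_edges G" using that by (auto simp: half_edges_def)
    have "heights r (L (e, True)) (\<lambda>s. \<phi> (e, True) (L (e, True) - s)) 0 = heights r (L (e, True)) (\<phi> (e, True)) 0"
      using hs(6)[OF H(1) H(1) _ H(1) _ H(1)] by simp
    moreover have "(\<lambda>s. \<phi> (e, True) (L (e, True) - s)) = \<phi> (e, False)" "L (e, True) = L (e, False)"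
      by (auto simp: \<phi>_def half_point_def L_def)
    ultimately show ?thesis using n_in[OF H(1), of 0] n_in[OF H(2), of 0] by simp
  qed
  have valid_heights: "valid_heights E \<eta>0 n" unfolding valid_heights_def d_def[symmetric]
  proof (intro conjI allI impI ballI)
    fix p
    show "n p \<le> d"
    proof (cases "p \<in> half_edges G \<times> {..d}")
      case True
      then have H: "fst p \<in> half_edges G" by auto
      show ?thesis using True hs(1)[OF H H _ H _ H, of "snd p"] by (auto simp: n_def)
    qed (simp add: n_def)
    show "n p = 0" if "p \<notin> half_edges G \<times> {..d}" using that by (simp add: n_def)
  next
    show "\<exists>N k. (\<forall>u\<in>verts G. (\<Sum>\<eta>\<in>half_edges_at G u. int (k \<eta>)) \<le> Poly_Mapping.lookup E u) \<and>
      (\<forall>\<eta>\<in>half_edges G. k \<eta> \<le> d \<and> n (\<eta>, k \<eta>) = N (half_point G \<eta> 0) \<and> (\<forall>m\<le>d. n (\<eta>, m) \<le> N (half_point G \<eta> 0)))"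
    proof (intro exI[of _ "\<lambda>u. nat \<lceil>F u / r\<rceil>"] exI[of _ k] conjI ballI allI impI)
      fix u assume u: "u \<in> verts G"
      have "(\<Sum>\<eta>\<in>half_edges_at G u. int (k \<eta>)) = (\<Sum>\<eta>\<in>half_edges_at G u. - m u (half_dir G \<eta>))"
        using k(1) by (intro sum.cong) (auto simp: half_edges_at_def)
      also have "\<dots> = - (\<Sum>\<delta>\<in>directions G u. m u \<delta>)" by (simp add: sum_negf sum_directions_vertex[OF u])
      finally show "(\<Sum>\<eta>\<in>half_edges_at G u. int (k \<eta>)) \<le> Poly_Mapping.lookup E u" using m(2)[OF u] by simp
    next
      fix \<eta> assume \<eta>: "\<eta> \<in> half_edges G"
      show "k \<eta> \<le> d" using k(2)[OF \<eta>] .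
      have "real (heights r (L \<eta>) (\<phi> \<eta>) (k \<eta>)) = of_int \<lceil>\<phi> \<eta> 0 / r\<rceil>"
        using hs(3)[OF \<eta> \<eta> _ \<eta> _ \<eta>, of "k \<eta>"] k(3)[OF \<eta>] by simp
      then show "n (\<eta>, k \<eta>) = nat \<lceil>F (half_point G \<eta> 0) / r\<rceil>"
        using n_in[OF \<eta> k(2)[OF \<eta>]] unfolding \<phi>_def by linarith
      fix j assume "j \<le> d"
      then show "n (\<eta>, j) \<le> nat \<lceil>F (half_point G \<eta> 0) / r\<rceil>"
        using hs(2)[OF \<eta> \<eta> _ \<eta> _ \<eta>, of j] n_in[OF \<eta>, of j] unfolding \<phi>_def by linarith
    qed
  next
    show "n ((e, True), 0) = n ((e, False), 0)" if "e \<in> edges G" for e using sym[OF that] .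
    have "\<phi> \<eta>0 r = 0" using F(2) by (simp add: \<phi>_def)
    from hs(5)[OF \<eta>0 \<eta>0 _ \<eta>0 _ \<eta>0 this L(3)[OF \<eta>0]]
    have h5: "heights r (L \<eta>0) (\<phi> \<eta>0) j \<le> j" "\<exists>j\<le>d. heights r (L \<eta>0) (\<phi> \<eta>0) j = j" for j by auto
    show "n (\<eta>0, j) \<le> j" if "j \<le> d" for j using h5(1)[of j] n_in[OF \<eta>0 that] by simp
    show "\<exists>j\<le>d. n (\<eta>0, j) = j" using h5(2) n_in[OF \<eta>0] by metis
  qed
  have upper: "\<phi> \<eta> h \<le> r * pencil d (\<lambda>j. n (\<eta>, j)) (h / r)" if \<eta>: "\<eta> \<in> half_edges G" and h: "h \<in> {0..L \<eta> / 2}" for \<eta> h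
  proof -
    obtain j where j: "j \<le> d" "\<phi> \<eta> h \<le> r * real (heights r (L \<eta>) (\<phi> \<eta>) j) - real j * h"
      using hs(4)[OF \<eta> \<eta> _ \<eta> _ \<eta> h] by auto
    have "r * real (n (\<eta>, j)) - real j * h = r * (real (n (\<eta>, j)) - real j * (h / r))"
      using r(1) by (simp add: right_diff_distrib)
    also have "\<dots> \<le> r * pencil d (\<lambda>j. n (\<eta>, j)) (h / r)"
      using r(1) pencil_ge[OF j(1), of "\<lambda>j. n (\<eta>, j)" "h / r"] by (intro mult_left_mono) auto
    finally show ?thesis using j(2) n_in[OF \<eta> j(1)] by simp
  qed
  have "F (epar G e s) \<le> bend_fun G d n r e s" if e: "e \<in> edges G" and s: "s \<in> {0..elen G e}" for e s
  proof -
    have H: "(e, b) \<in> half_edges G" for b using e by (simp add: half_edges_def)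
    have "2 * real d * r \<le> elen G e" using L(2)[OF H] by (simp add: L_def)
    note half = bend_fun_half[OF valid_heights e r(1) this[unfolded d_def] s, folded d_def]
    show ?thesis
    proof (cases "s \<le> elen G e / 2")
      case True
      then show ?thesis using upper[OF H, of s True] half(1) s by (simp add: \<phi>_def half_point_def L_def)
    next
      case False
      then show ?thesis using upper[OF H, of "elen G e - s" False] half(2) s by (simp add: \<phi>_def half_point_def L_def)
    qed
  qed
  then show ?thesis using that valid_heights by (simp add: d_def)
qed

end

lemma image_mset_sum: "image_mset f (\<Sum>x\<in>A. g x) = (\<Sum>x\<in>A. image_mset f (g x))"
  by (induction A rule: infinite_finite_induct) auto

text \<open>A chip consists of an edge, an initial parameter and a speed, with \<open>r\<close> as
  time.\<close>

definition chip_pos :: "('p, 'e) graph_model \<Rightarrow> real \<Rightarrow> 'e \<times> real \<times> real \<Rightarrow> 'p" where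
  "chip_pos G r = (\<lambda>(e, a, q). epar G e (a + q * r))"

context tropical_curve
begin

lemma supported_zero: "effective E \<Longrightarrow> supported E (\<lambda>_. 0)"
  unfolding supported_def using div_degree_nonneg[of E]
  by (intro ballI exI[of _ "\<lambda>_. 0"]) (auto simp: supports_def effective_def)

lemma supported_diff_const: "supported E f \<Longrightarrow> supported E (\<lambda>x. f x - c)"
  unfolding supported_def supports_def by (simp add: diff_right_mono algebra_simps)

lemma half_point_Lipschitz:
  assumes "supported E f" "\<eta> \<in> half_edges G" "h \<in> {0..elen G (fst \<eta>)}"
  shows "\<bar>f (half_point G \<eta> 0) - f (half_point G \<eta> h)\<bar> \<le> of_int (div_degree E) * h"
proof -
  have e: "fst \<eta> \<in> edges G" using assms(2) by (auto simp: half_edges_def)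
  show ?thesis
    using supported_Lipschitz[OF assms(1) e, of "if snd \<eta> then 0 else elen G (fst \<eta>)" "if snd \<eta> then h else elen G (fst \<eta>) - h"]
      assms(3) elen_pos[OF e] by (auto simp: half_point_def split: if_splits)
qed

text \<open>Near a point where \<open>E\<close> is reduced, the function defining the reduced divisor is the same
  combinatorial object at all scales \<open>r\<close>.\<close>

lemma local_divisor:
  assumes E: "divisor \<Gamma> E" "effective E" "Poly_Mapping.keys E \<subseteq> verts G" and \<eta>0: "\<eta>0 \<in> half_edges G"
    and max: "\<And>f x. supported E f \<Longrightarrow> f (half_point G \<eta>0 0) = 0 \<Longrightarrow> x \<in> \<Gamma> \<Longrightarrow> f x \<le> 0"
  obtains \<epsilon> n where "0 < \<epsilon>" "valid_heights E \<eta>0 n" "\<And>e. e \<in> edges G \<Longrightarrow> \<epsilon> * (2 * real (nat (div_degree E)) + 2) < elen G e"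
    "\<And>u. u \<in> verts G \<Longrightarrow> 0 \<le> Poly_Mapping.lookup E u + (\<Sum>\<eta>\<in>half_edges_at G u. pencil_slope (nat (div_degree E)) (\<lambda>m. n (\<eta>, m)) 1 0)"
    "\<And>r D u. 0 < r \<Longrightarrow> r \<le> \<epsilon> \<Longrightarrow> divisor \<Gamma> D \<Longrightarrow> lin_equiv \<Gamma> G D E \<Longrightarrow> reduced \<Gamma> (half_point G \<eta>0 r) D \<Longrightarrow> u \<in> verts G \<Longrightarrow>
      Poly_Mapping.lookup D u = Poly_Mapping.lookup E u + (\<Sum>\<eta>\<in>half_edges_at G u. pencil_slope (nat (div_degree E)) (\<lambda>m. n (\<eta>, m)) 1 0)"
    "\<And>r D e s. 0 < r \<Longrightarrow> r \<le> \<epsilon> \<Longrightarrow> divisor \<Gamma> D \<Longrightarrow> lin_equiv \<Gamma> G D E \<Longrightarrow> reduced \<Gamma> (half_point G \<eta>0 r) D \<Longrightarrow>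
      e \<in> edges G \<Longrightarrow> s \<in> {0<..<elen G e} \<Longrightarrow>
      Poly_Mapping.lookup D (epar G e s) = pencil_bend (nat (div_degree E)) (\<lambda>m. n ((e, True), m)) (s / r) +
        pencil_bend (nat (div_degree E)) (\<lambda>m. n ((e, False), m)) ((elen G e - s) / r)"
proof -
  define d where "d = nat (div_degree E)"
  have d: "real d = of_int (div_degree E)" using div_degree_nonneg[OF E(2)] by (simp add: d_def)
  have e0: "fst \<eta>0 \<in> edges G" using \<eta>0 by (auto simp: half_edges_def)
  \<comment> \<open>The 3 in place of 2 makes the inequality with \<open>2 * d + 2\<close>
    strict.\<close>
  define \<epsilon> where "\<epsilon> = Min ((\<lambda>e. elen G e / (2 * real d + 3)) ` edges G)"
  have ne: "finite ((\<lambda>e. elen G e / (2 * real d + 3)) ` edges G)" "(\<lambda>e. elen G e / (2 * real d + 3)) ` edges G \<noteq> {}"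
    using finite_edges e0 by auto
  have \<epsilon>_pos: "0 < \<epsilon>" unfolding \<epsilon>_def using ne elen_pos by (simp add: Min_gr_iff)
  have \<epsilon>_small: "r * (2 * real d + 2) < elen G e" if "e \<in> edges G" "0 < r" "r \<le> \<epsilon>" for e r
  proof -
    have "\<epsilon> \<le> elen G e / (2 * real d + 3)" using that(1) ne(1) unfolding \<epsilon>_def by (intro Min_le) auto
    then have "r \<le> elen G e / (2 * real d + 3)" using that(3) by simp
    then have "r * (2 * real d + 3) \<le> elen G e" by (simp add: pos_le_divide_eq)
    then show ?thesis using that(2) by (simp add: distrib_left)
  qed
  let ?w = "\<lambda>r. half_point G \<eta>0 r"
  have w_len: "r \<in> {0..elen G (fst \<eta>0)}" if "0 < r" "r \<le> \<epsilon>" for r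
  proof -
    have "r * (2 * real d + 2) < elen G (fst \<eta>0)" using \<epsilon>_small[OF e0 that] .
    moreover have "r * (2 * real d + 2) = 2 * (real d * r) + 2 * r" by (simp add: algebra_simps)
    moreover have "0 \<le> real d * r" using that by simp
    ultimately have "r \<le> elen G (fst \<eta>0)" using that(1) by linarith
    then show ?thesis using that(1) by simp
  qed
  have key: "\<exists>n. valid_heights E \<eta>0 n \<and> (\<forall>f e s. supported E f \<longrightarrow> f (?w r) = 0 \<longrightarrow> e \<in> edges G \<longrightarrow> s \<in> {0..elen G e} \<longrightarrow>
      f (epar G e s) \<le> bend_fun G d n r e s)" if r: "0 < r" "r \<le> \<epsilon>" for r
  proof -
    have w: "?w r \<in> \<Gamma>" using \<eta>0 w_len[OF r] by (rule half_point_in)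
    obtain F where F: "supported E F" "F (?w r) = 0" "\<And>f x. supported E f \<Longrightarrow> f (?w r) = 0 \<Longrightarrow> x \<in> \<Gamma> \<Longrightarrow> f x \<le> F x"
      using ex_maximal[OF E(2) w] by blast
    have "0 \<le> F x \<and> F x \<le> real (nat (div_degree E)) * r" if x: "x \<in> \<Gamma>" for x
    proof
      show "0 \<le> F x" using F(3)[OF supported_zero[OF E(2)] HOL.refl x] .
      \<comment> \<open>\<open>F - F v\<close> vanishes at \<open>v\<close>, so by hypothesis it is
        at most 0: \<open>F\<close> is largest at \<open>v\<close>, and there the Lipschitz bound
        along the half edge gives at most \<open>d * r\<close>.\<close>
      have "F x - F (?w 0) \<le> 0"
        using max[OF supported_diff_const[OF F(1), of "F (?w 0)"] _ x] by simp
      moreover have "F (?w 0) \<le> real d * r"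
        using half_point_Lipschitz[OF F(1) \<eta>0 w_len[OF r]] F(2) d by simp
      ultimately show "F x \<le> real (nat (div_degree E)) * r" by (simp add: d_def)
    qed
    then obtain n where n: "valid_heights E \<eta>0 n"
      "\<And>e s. e \<in> edges G \<Longrightarrow> s \<in> {0..elen G e} \<Longrightarrow> F (epar G e s) \<le> bend_fun G (nat (div_degree E)) n r e s"
      using valid_heights_rounding[OF E(2,3) \<eta>0 F(1,2) r(1) \<epsilon>_small[unfolded d_def, OF _ r]] by blast
    have "f (epar G e s) \<le> bend_fun G d n r e s"
      if f: "supported E f" "f (?w r) = 0" and e: "e \<in> edges G" "s \<in> {0..elen G e}" for f e s
    proof -
      have "f (epar G e s) \<le> F (epar G e s)" using F(3)[OF f epar_in[OF e]] .
      also have "\<dots> \<le> bend_fun G d n r e s" using n(2)[OF e] by (simp add: d_def)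
      finally show ?thesis .
    qed
    then show ?thesis using n(1) by blast
  qed
  \<comment> \<open>Validity does not mention \<open>r\<close>, so the greatest valid heights are
    fixed once for all scales up to \<open>\<epsilon>\<close>.\<close>
  obtain n0 where n0: "valid_heights E \<eta>0 n0" using key[of \<epsilon>] \<epsilon>_pos by blast
  obtain n where n: "valid_heights E \<eta>0 n" "\<And>n'. valid_heights E \<eta>0 n' \<Longrightarrow> n' \<le> n"
    using valid_heights_greatest[OF n0] by blast
  have main: "\<exists>f. supported E f \<and> f (?w r) = 0 \<and> (\<forall>g x. supported E g \<longrightarrow> g (?w r) = 0 \<longrightarrow> x \<in> \<Gamma> \<longrightarrow> g x \<le> f x) \<and>
      (\<forall>u\<in>verts G. ord_at G f u = (\<Sum>\<eta>\<in>half_edges_at G u. pencil_slope d (\<lambda>m. n (\<eta>, m)) 1 0)) \<and>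
      (\<forall>e\<in>edges G. \<forall>s\<in>{0<..<elen G e}. ord_at G f (epar G e s) =
        pencil_bend d (\<lambda>m. n ((e, True), m)) (s / r) + pencil_bend d (\<lambda>m. n ((e, False), m)) ((elen G e - s) / r))"
    if r: "0 < r" "r \<le> \<epsilon>" for r
  proof -
    have small: "r * (real (nat (div_degree E)) + 1) < elen G e" if "e \<in> edges G" for e
    proof -
      have "r * (real d + 1) \<le> r * (2 * real d + 2)" using r by (intro mult_left_mono) auto
      then show ?thesis using \<epsilon>_small[OF that r] by (simp add: d_def)
    qed
    obtain f where f: "supported E f" "f (?w r) = 0"
      "\<And>e s. e \<in> edges G \<Longrightarrow> s \<in> {0..elen G e} \<Longrightarrow> f (epar G e s) = bend_fun G (nat (div_degree E)) n r e s"
      "\<And>u. u \<in> verts G \<Longrightarrow> ord_at G f u = (\<Sum>\<eta>\<in>half_edges_at G u. pencil_slope (nat (div_degree E)) (\<lambda>m. n (\<eta>, m)) 1 0)"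
      "\<And>e s. e \<in> edges G \<Longrightarrow> s \<in> {0<..<elen G e} \<Longrightarrow> ord_at G f (epar G e s) =
        pencil_bend (nat (div_degree E)) (\<lambda>m. n ((e, True), m)) (s / r) +
        pencil_bend (nat (div_degree E)) (\<lambda>m. n ((e, False), m)) ((elen G e - s) / r)"
      by (rule valid_heights_competitor[OF E \<eta>0 n(1) r(1) small], assumption, rule that)
    \<comment> \<open>Every competitor lies below the function of some valid heights depending on
      \<open>r\<close>, and these lie below the greatest ones. So \<open>f\<close> is the largest
      function at every scale.\<close>
    have "g x \<le> f x" if g: "supported E g" "g (?w r) = 0" and x: "x \<in> \<Gamma>" for g x
    proof -
      obtain e s where e: "e \<in> edges G" "s \<in> {0..elen G e}" "x = epar G e s"
        using vertex_on_edge[OF e0 x] by blast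
      obtain n' where n': "valid_heights E \<eta>0 n'" "g (epar G e s) \<le> bend_fun G d n' r e s"
        using key[OF r] g e(1,2) by blast
      have "2 * real (nat (div_degree E)) * r \<le> elen G e"
      proof -
        have "r * (2 * real d) \<le> r * (2 * real d + 2)" using r by (intro mult_left_mono) auto
        then show ?thesis using \<epsilon>_small[OF e(1) r] by (simp add: d_def mult.commute)
      qed
      then have "bend_fun G d n' r e s \<le> bend_fun G d n r e s"
        using bend_fun_mono[OF n'(1) n(1) n(2)[OF n'(1)] e(1) r(1) _ e(2)] by (simp add: d_def)
      then show ?thesis using n'(2) f(3)[OF e(1,2)] e(3) by (simp add: d_def)
    qed
    then show ?thesis using f(1,2,4,5) unfolding d_def by blast
  qed
  have D: "(\<forall>u\<in>verts G. Poly_Mapping.lookup D u = Poly_Mapping.lookup E u + (\<Sum>\<eta>\<in>half_edges_at G u. pencil_slope d (\<lambda>m. n (\<eta>, m)) 1 0)) \<and>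
      (\<forall>e\<in>edges G. \<forall>s\<in>{0<..<elen G e}. Poly_Mapping.lookup D (epar G e s) =
        pencil_bend d (\<lambda>m. n ((e, True), m)) (s / r) + pencil_bend d (\<lambda>m. n ((e, False), m)) ((elen G e - s) / r))"
    if r: "0 < r" "r \<le> \<epsilon>" and D: "divisor \<Gamma> D" "lin_equiv \<Gamma> G D E" "reduced \<Gamma> (?w r) D" for r D
  proof -
    have w: "?w r \<in> \<Gamma>" using \<eta>0 w_len[OF r] by (rule half_point_in)
    obtain f where f: "supported E f" "f (?w r) = 0" "\<And>g x. supported E g \<Longrightarrow> g (?w r) = 0 \<Longrightarrow> x \<in> \<Gamma> \<Longrightarrow> g x \<le> f x"
      "\<forall>u\<in>verts G. ord_at G f u = (\<Sum>\<eta>\<in>half_edges_at G u. pencil_slope d (\<lambda>m. n (\<eta>, m)) 1 0)"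
      "\<forall>e\<in>edges G. \<forall>s\<in>{0<..<elen G e}. ord_at G f (epar G e s) =
        pencil_bend d (\<lambda>m. n ((e, True), m)) (s / r) + pencil_bend d (\<lambda>m. n ((e, False), m)) ((elen G e - s) / r)"
      using main[OF r] by (elim exE conjE) blast
    have rat: "rational_function \<Gamma> G f" using supported_rational(1)[OF f(1) E(2,3)] .
    have "finite {x \<in> \<Gamma>. Poly_Mapping.lookup E x + ord_at G f x \<noteq> 0}"
      by (rule finite_subset[of _ "Poly_Mapping.keys E \<union> {x \<in> \<Gamma>. ord_at G f x \<noteq> 0}"])
        (use sum_ord_zero(1)[OF rat] in \<open>auto simp: in_keys_iff\<close>)
    then obtain D0 where D0: "Poly_Mapping.keys D0 \<subseteq> \<Gamma>"
      "\<And>x. x \<in> \<Gamma> \<Longrightarrow> Poly_Mapping.lookup D0 x = Poly_Mapping.lookup E x + ord_at G f x"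
      using ex_poly_mapping[of \<Gamma> "\<lambda>x. Poly_Mapping.lookup E x + ord_at G f x"] by blast
    have D0E: "lin_equiv \<Gamma> G D0 E" unfolding lin_equiv_def
      using rat D0(2) by (intro exI[of _ f]) (simp add: lookup_minus)
    have D0r: "reduced \<Gamma> (?w r) D0" using E w f(1-3) D0(2) by (rule maximal_reduced)
    have "divisor \<Gamma> D0" using D0(1) by (simp add: divisor_def)
    then have "D = D0"
      using reduced_unique[OF w D(1,3) _ D0r lin_equiv_trans[OF D(2) lin_equiv_sym[OF D0E]]] by blast
    then have DE: "Poly_Mapping.lookup D x = Poly_Mapping.lookup E x + ord_at G f x" if "x \<in> \<Gamma>" for x
      using D0(2)[OF that] by simp
    show ?thesis
    proof (intro conjI ballI)
      fix u assume u: "u \<in> verts G"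
      then show "Poly_Mapping.lookup D u = Poly_Mapping.lookup E u + (\<Sum>\<eta>\<in>half_edges_at G u. pencil_slope d (\<lambda>m. n (\<eta>, m)) 1 0)"
        using DE[of u] f(4) verts_subset by auto
    next
      fix e s assume e: "e \<in> edges G" "s \<in> {0<..<elen G e}"
      have "epar G e s \<in> \<Gamma>" using e by (intro epar_in) auto
      moreover have "Poly_Mapping.lookup E (epar G e s) = 0"
        using epar_interior[OF e] E(3) by (auto simp: in_keys_iff)
      ultimately show "Poly_Mapping.lookup D (epar G e s) = pencil_bend d (\<lambda>m. n ((e, True), m)) (s / r) +
          pencil_bend d (\<lambda>m. n ((e, False), m)) ((elen G e - s) / r)"
        using DE[of "epar G e s"] f(5) e by simp
    qed
  qed
  have nonneg: "0 \<le> Poly_Mapping.lookup E u + (\<Sum>\<eta>\<in>half_edges_at G u. pencil_slope d (\<lambda>m. n (\<eta>, m)) 1 0)" if u: "u \<in> verts G" for u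
  proof -
    obtain f where f: "supported E f" "\<forall>u\<in>verts G. ord_at G f u = (\<Sum>\<eta>\<in>half_edges_at G u. pencil_slope d (\<lambda>m. n (\<eta>, m)) 1 0)"
      using main[OF \<epsilon>_pos order.refl] by (elim exE conjE) (rule that)
    have "u \<in> \<Gamma>" using u verts_subset by blast
    then show ?thesis using supported_rational(2)[OF f(1) E(2,3), of u] f(2) u by auto
  qed
  show ?thesis
  proof (rule that[of \<epsilon> n])
    show "\<epsilon> * (2 * real (nat (div_degree E)) + 2) < elen G e" if "e \<in> edges G" for e
      using \<epsilon>_small[OF that \<epsilon>_pos] by (simp add: d_def)
  qed (use \<epsilon>_pos n(1) nonneg[unfolded d_def] D[unfolded d_def] in blast)+
qed

text \<open>Some chips stand at the vertices; each bend \<open>q\<close> of a half edge contributes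
  chips that leave its start with speed \<open>q\<close>. Multiplicities are compared point by
  point. At \<open>r = 0\<close> the moving chips are back at the vertices, and by
  \<open>sum_pencil_bend\<close> they supply exactly what the standing chips lack of
  \<open>E\<close>.\<close>

lemma local_chips:
  assumes E: "divisor \<Gamma> E" "effective E" "Poly_Mapping.keys E \<subseteq> verts G" and \<eta>0: "\<eta>0 \<in> half_edges G"
    and max: "\<And>f x. supported E f \<Longrightarrow> f (half_point G \<eta>0 0) = 0 \<Longrightarrow> x \<in> \<Gamma> \<Longrightarrow> f x \<le> 0"
  obtains \<epsilon> C where "0 < \<epsilon>"
    "\<And>e a q. (e, a, q) \<in># C \<Longrightarrow> e \<in> edges G \<and> q \<in> \<rat> \<and> (\<forall>r\<in>{0..\<epsilon>}. a + q * r \<in> {0..elen G e})"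
    "mset_of_divisor E = image_mset (chip_pos G 0) C"
    "\<And>r D. 0 < r \<Longrightarrow> r \<le> \<epsilon> \<Longrightarrow> divisor \<Gamma> D \<Longrightarrow> lin_equiv \<Gamma> G D E \<Longrightarrow> reduced \<Gamma> (half_point G \<eta>0 r) D \<Longrightarrow>
      mset_of_divisor D = image_mset (chip_pos G r) C"
proof -
  define d where "d = nat (div_degree E)"
  obtain \<epsilon> n where \<epsilon>: "0 < \<epsilon>" and n: "valid_heights E \<eta>0 n"
    and \<epsilon>_small: "\<And>e. e \<in> edges G \<Longrightarrow> \<epsilon> * (2 * real d + 2) < elen G e"
    and nonneg: "\<And>u. u \<in> verts G \<Longrightarrow> 0 \<le> Poly_Mapping.lookup E u + (\<Sum>\<eta>\<in>half_edges_at G u. pencil_slope d (\<lambda>m. n (\<eta>, m)) 1 0)"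
    and Dv: "\<And>r D u. 0 < r \<Longrightarrow> r \<le> \<epsilon> \<Longrightarrow> divisor \<Gamma> D \<Longrightarrow> lin_equiv \<Gamma> G D E \<Longrightarrow> reduced \<Gamma> (half_point G \<eta>0 r) D \<Longrightarrow> u \<in> verts G \<Longrightarrow>
      Poly_Mapping.lookup D u = Poly_Mapping.lookup E u + (\<Sum>\<eta>\<in>half_edges_at G u. pencil_slope d (\<lambda>m. n (\<eta>, m)) 1 0)"
    and De: "\<And>r D e s. 0 < r \<Longrightarrow> r \<le> \<epsilon> \<Longrightarrow> divisor \<Gamma> D \<Longrightarrow> lin_equiv \<Gamma> G D E \<Longrightarrow> reduced \<Gamma> (half_point G \<eta>0 r) D \<Longrightarrow>
      e \<in> edges G \<Longrightarrow> s \<in> {0<..<elen G e} \<Longrightarrow>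
      Poly_Mapping.lookup D (epar G e s) = pencil_bend d (\<lambda>m. n ((e, True), m)) (s / r) +
        pencil_bend d (\<lambda>m. n ((e, False), m)) ((elen G e - s) / r)"
    by (rule local_divisor[OF E \<eta>0, folded d_def]) (rule max, assumption+, rule that)
  define bd where "bd p = nat (pencil_bend d (\<lambda>m. n (fst p, m)) (snd p))" for p
  define Q where "Q \<eta> = {q. 0 < q \<and> pencil_bend d (\<lambda>m. n (\<eta>, m)) q \<noteq> 0}" for \<eta>
  have cd: "n (\<eta>, m) \<le> d" for \<eta> m using valid_heightsD(1)[OF n] by (simp add: d_def)
  have finQ: "finite (Q \<eta>)" for \<eta>
    unfolding Q_def by (rule finite_subset[OF _ finite_pencil_bends[of d "\<lambda>m. n (\<eta>, m)"]]) auto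
  have Qd: "0 < q" "q \<le> real d" "q \<in> \<rat>" if "q \<in> Q \<eta>" for q \<eta>
  proof -
    show "0 < q" "q \<in> \<rat>" using that pencil_bend_rational by (auto simp: Q_def)
    show "q \<le> real d"
    proof (rule ccontr)
      assume "\<not> q \<le> real d"
      then have "pencil_bend d (\<lambda>m. n (\<eta>, m)) q = 0"
        using pencil_slope_large[of d "\<lambda>m. n (\<eta>, m)" q] cd by (simp add: pencil_bend_def)
      then show False using that by (simp add: Q_def)
    qed
  qed
  have small: "q * r < elen G e" "0 \<le> q * r" if "q \<in> Q \<eta>" "r \<in> {0..\<epsilon>}" "e \<in> edges G" for q r \<eta> e
  proof -
    have "q * r \<le> real d * \<epsilon>" using Qd[OF that(1)] that(2) by (intro mult_mono) auto
    also have "\<dots> < \<epsilon> * (2 * real d + 2)"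
    proof -
      have "\<epsilon> * (2 * real d + 2) = 2 * (real d * \<epsilon>) + 2 * \<epsilon>" by (simp add: algebra_simps)
      moreover have "0 \<le> real d * \<epsilon>" using \<epsilon> by simp
      ultimately show ?thesis using \<epsilon> by linarith
    qed
    also have "\<dots> < elen G e" using \<epsilon>_small[OF that(3)] .
    finally show "q * r < elen G e" .
    show "0 \<le> q * r" using Qd[OF that(1)] that(2) by simp
  qed
  define P where "P = Sigma (half_edges G) Q"
  have finP: "finite P" unfolding P_def using finite_half_edges(1) finQ by (rule finite_SigmaI)
  \<comment> \<open>A half edge that starts at the far end of its edge runs against the
    parametrization, hence the negative speed.\<close>
  define mv where "mv p = (fst (fst p), if snd (fst p) then 0 else elen G (fst (fst p)), if snd (fst p) then snd p else - snd p)"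
    for p :: "('e \<times> bool) \<times> real"
  have mv_pos: "chip_pos G r (mv p) = half_point G (fst p) (snd p * r)" for r p
    by (simp add: chip_pos_def mv_def half_point_def)
  have e0: "fst \<eta>0 \<in> edges G" using \<eta>0 by (auto simp: half_edges_def)
  have "\<forall>u\<in>verts G. \<exists>c. fst c \<in> edges G \<and> snd c \<in> {0..elen G (fst c)} \<and> u = epar G (fst c) (snd c)"
    using vertex_on_edge[OF e0] verts_subset by fastforce
  then obtain loc where loc: "\<And>u. u \<in> verts G \<Longrightarrow> fst (loc u) \<in> edges G \<and> snd (loc u) \<in> {0..elen G (fst (loc u))} \<and>
      u = epar G (fst (loc u)) (snd (loc u))" by metis
  \<comment> \<open>Chips live on edges, so a chip standing at a vertex is given some edge through
    it and speed 0.\<close>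
  define st where "st u = (fst (loc u), snd (loc u), 0::real)" for u
  have st_pos: "chip_pos G r (st u) = u" if "u \<in> verts G" for r u
    using loc[OF that] by (simp add: chip_pos_def st_def)
  define cv where "cv u = nat (Poly_Mapping.lookup E u + (\<Sum>\<eta>\<in>half_edges_at G u. pencil_slope d (\<lambda>m. n (\<eta>, m)) 1 0))" for u
  define C where "C = (\<Sum>u\<in>verts G. replicate_mset (cv u) (st u)) + (\<Sum>p\<in>P. replicate_mset (bd p) (mv p))"
  have cnt: "count (image_mset (chip_pos G r) C) x = (if x \<in> verts G then cv x else 0) +
      (\<Sum>p\<in>P. if half_point G (fst p) (snd p * r) = x then bd p else 0)" for r x
  proof -
    have "(\<Sum>u\<in>verts G. count (replicate_mset (cv u) (chip_pos G r (st u))) x) = (\<Sum>u\<in>verts G. if x = u then cv u else 0)"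
      using st_pos by (intro sum.cong) auto
    also have "\<dots> = (if x \<in> verts G then cv x else 0)" using finite_verts by simp
    finally show ?thesis unfolding C_def
      by (simp add: image_mset_sum count_sum mv_pos eq_commute[of x])
  qed
  have half_point_int: "half_point G \<eta> (q * r) \<notin> verts G" "half_point G \<eta> (q * r) \<in> \<Gamma>" if "\<eta> \<in> half_edges G" "q \<in> Q \<eta>" "0 < r" "r \<le> \<epsilon>" for \<eta> q r
  proof -
    have e: "fst \<eta> \<in> edges G" using that by (auto simp: half_edges_def)
    have qr: "q * r < elen G (fst \<eta>)" "0 < q * r" using small[OF that(2) _ e, of r] Qd(1)[OF that(2)] that by auto
    then have "(if snd \<eta> then q * r else elen G (fst \<eta>) - q * r) \<in> {0<..<elen G (fst \<eta>)}" by auto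
    from epar_interior[OF e this] show "half_point G \<eta> (q * r) \<notin> verts G" by (simp add: half_point_def)
    show "half_point G \<eta> (q * r) \<in> \<Gamma>" using qr by (intro half_point_in[OF that(1)]) auto
  qed
  have C_ok: "e \<in> edges G \<and> q \<in> \<rat> \<and> (\<forall>r\<in>{0..\<epsilon>}. a + q * r \<in> {0..elen G e})" if "(e, a, q) \<in># C" for e a q
  proof -
    have "(\<exists>u\<in>verts G. (e, a, q) = st u) \<or> (\<exists>p\<in>P. (e, a, q) = mv p)"
    proof -
      have "(e, a, q) \<in> (\<Union>u\<in>verts G. set_mset (replicate_mset (cv u) (st u))) \<union>
          (\<Union>p\<in>P. set_mset (replicate_mset (bd p) (mv p)))"
        using that finite_verts finP by (simp add: C_def set_mset_sum del: set_mset_replicate_mset_subset)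
      then show ?thesis by (auto split: if_splits)
    qed
    then show ?thesis
    proof (elim disjE bexE)
      fix u assume "u \<in> verts G" "(e, a, q) = st u"
      then show ?thesis using loc[of u] by (simp add: st_def)
    next
      fix p assume p: "p \<in> P" "(e, a, q) = mv p"
      obtain \<eta> q' where p': "p = (\<eta>, q')" by (cases p)
      have \<eta>: "\<eta> \<in> half_edges G" "q' \<in> Q \<eta>" using p(1) p' by (auto simp: P_def)
      have e: "e \<in> edges G" using p(2) p' \<eta>(1) by (auto simp: mv_def half_edges_def)
      show ?thesis using p(2) p' e Qd(3)[OF \<eta>(2)] small[OF \<eta>(2) _ e] elen_pos[OF e]
        by (auto simp: mv_def less_imp_le split: if_splits)
    qed
  qed
  have count0: "count (mset_of_divisor E) x = count (image_mset (chip_pos G 0) C) x" for x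
  proof -
    have "(\<Sum>p\<in>P. if half_point G (fst p) (snd p * 0) = x then bd p else 0) =
        (\<Sum>\<eta>\<in>half_edges G. \<Sum>q\<in>Q \<eta>. if half_point G \<eta> 0 = x then bd (\<eta>, q) else 0)"
      unfolding P_def using finite_half_edges(1) finQ by (simp add: sum.Sigma split_def cong: if_cong)
    also have "\<dots> = (\<Sum>\<eta>\<in>half_edges G. if half_point G \<eta> 0 = x then (\<Sum>q\<in>Q \<eta>. bd (\<eta>, q)) else 0)"
      by (intro sum.cong) auto
    also have "\<dots> = (\<Sum>\<eta>\<in>half_edges_at G x. \<Sum>q\<in>Q \<eta>. bd (\<eta>, q))"
      unfolding half_edges_at_def using finite_half_edges(1) by (simp add: sum.inter_filter)
    finally have S: "(\<Sum>p\<in>P. if half_point G (fst p) (snd p * 0) = x then bd p else 0) = (\<Sum>\<eta>\<in>half_edges_at G x. \<Sum>q\<in>Q \<eta>. bd (\<eta>, q))" .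
    have bdS: "int (\<Sum>q\<in>Q \<eta>. bd (\<eta>, q)) = - pencil_slope d (\<lambda>m. n (\<eta>, m)) 1 0" for \<eta>
    proof -
      have "int (\<Sum>q\<in>Q \<eta>. bd (\<eta>, q)) = (\<Sum>q\<in>Q \<eta>. pencil_bend d (\<lambda>m. n (\<eta>, m)) q)"
        by (simp add: bd_def pencil_bend_nonneg)
      also have "\<dots> = - pencil_slope d (\<lambda>m. n (\<eta>, m)) 1 0" unfolding Q_def by (rule sum_pencil_bend) (rule cd)
      finally show ?thesis .
    qed
    show ?thesis
    proof (cases "x \<in> verts G")
      case True
      have "int (count (image_mset (chip_pos G 0) C) x) = int (cv x) + (\<Sum>\<eta>\<in>half_edges_at G x. int (\<Sum>q\<in>Q \<eta>. bd (\<eta>, q)))"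
        unfolding cnt S using True by simp
      also have "\<dots> = int (cv x) - (\<Sum>\<eta>\<in>half_edges_at G x. pencil_slope d (\<lambda>m. n (\<eta>, m)) 1 0)"
        unfolding bdS by (simp add: sum_negf)
      also have "\<dots> = Poly_Mapping.lookup E x" using nonneg[OF True] by (simp add: cv_def)
      finally show ?thesis unfolding count_mset_of_divisor by linarith
    next
      case False
      have "half_edges_at G x = {}" using False half_point_0_vertex by (auto simp: half_edges_at_def)
      moreover have "Poly_Mapping.lookup E x = 0" using False E(3) by (auto simp: in_keys_iff)
      ultimately show ?thesis unfolding cnt S count_mset_of_divisor using False by simp
    qed
  qed
  have countr: "count (mset_of_divisor D) x = count (image_mset (chip_pos G r) C) x"
    if r: "0 < r" "r \<le> \<epsilon>" and D: "divisor \<Gamma> D" "lin_equiv \<Gamma> G D E" "reduced \<Gamma> (half_point G \<eta>0 r) D" for r D x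
  proof -
    consider "x \<notin> \<Gamma>" | "x \<in> verts G" | e s where "e \<in> edges G" "s \<in> {0<..<elen G e}" "x = epar G e s"
      using point_cases by metis
    then show ?thesis
    proof cases
      case 1
      have "(\<Sum>p\<in>P. if half_point G (fst p) (snd p * r) = x then bd p else 0) = 0"
        using half_point_int(2) r 1 by (intro sum.neutral) (auto simp: P_def)
      moreover have "x \<notin> verts G" using 1 verts_subset by blast
      moreover have "Poly_Mapping.lookup D x = 0" using 1 D(1) by (auto simp: divisor_def in_keys_iff)
      ultimately show ?thesis unfolding cnt count_mset_of_divisor by simp
    next
      case 2
      have "(\<Sum>p\<in>P. if half_point G (fst p) (snd p * r) = x then bd p else 0) = 0"
        using half_point_int(1) r 2 by (intro sum.neutral) (auto simp: P_def)
      then show ?thesis unfolding cnt count_mset_of_divisor using 2 Dv[OF r D 2] by (simp add: cv_def)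
    next
      case (3 e s)
      \<comment> \<open>An interior point of an edge can be reached at time \<open>r\<close> only
        from the two ends of that edge, with the two speeds listed here.\<close>
      define B where "B = {((e, True), s / r), ((e, False), (elen G e - s) / r)}"
      have "(\<Sum>p\<in>P. if half_point G (fst p) (snd p * r) = x then bd p else 0) = (\<Sum>p\<in>B. bd p)"
      proof (rule sum.mono_neutral_cong[OF _ finP])
        show "finite B" by (simp add: B_def)
        fix p assume p: "p \<in> B - P"
        have "fst p \<in> half_edges G" "0 < snd p" using p 3 r by (auto simp: B_def half_edges_def)
        then have "pencil_bend d (\<lambda>m. n (fst p, m)) (snd p) = 0" using p by (cases p) (auto simp: P_def Q_def)
        then show "bd p = 0" by (simp add: bd_def)
      next
        fix p assume p: "p \<in> P - B"
        obtain \<eta> q where p': "p = (\<eta>, q)" by (cases p)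
        have \<eta>: "\<eta> \<in> half_edges G" "q \<in> Q \<eta>" using p p' by (auto simp: P_def)
        obtain e' b where \<eta>': "\<eta> = (e', b)" by (cases \<eta>)
        have e': "e' \<in> edges G" using \<eta> \<eta>' by (simp add: half_edges_def)
        have "half_point G \<eta> (q * r) \<noteq> x"
        proof
          assume eq: "half_point G \<eta> (q * r) = x"
          have "(if b then q * r else elen G e' - q * r) \<in> {0..elen G e'}" using small[OF \<eta>(2) _ e', of r] r by auto
          moreover have "epar G e s = epar G e' (if b then q * r else elen G e' - q * r)"
            using eq 3(3) by (cases b) (simp_all add: half_point_def \<eta>')
          ultimately have "e = e'" "s = (if b then q * r else elen G e' - q * r)"
            using interior_eq[OF 3(1) e' 3(2)] by blast+
          then have "p \<in> B" using r(1) by (cases b) (auto simp: B_def p' \<eta>')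
          then show False using p by simp
        qed
        then show "(if half_point G (fst p) (snd p * r) = x then bd p else 0) = 0" by (simp add: p')
      next
        fix p assume "p \<in> P \<inter> B"
        then have "half_point G (fst p) (snd p * r) = x" using r(1) 3(3) by (auto simp: B_def half_point_def)
        then show "(if half_point G (fst p) (snd p * r) = x then bd p else 0) = bd p" by simp
      qed
      also have "\<dots> = bd ((e, True), s / r) + bd ((e, False), (elen G e - s) / r)" by (simp add: B_def)
      also have "\<dots> = nat (Poly_Mapping.lookup D x)"
        unfolding 3(3) De[OF r D 3(1,2)] bd_def by (simp add: nat_add_distrib pencil_bend_nonneg)
      finally show ?thesis unfolding cnt count_mset_of_divisor using epar_interior[OF 3(1,2)] 3(3) by simp
    qed
  qed
  show ?thesis
  proof (rule that[OF \<epsilon> C_ok])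
    show "mset_of_divisor E = image_mset (chip_pos G 0) C" by (rule multiset_eqI) (rule count0)
    show "mset_of_divisor D = image_mset (chip_pos G r) C"
      if "0 < r" "r \<le> \<epsilon>" "divisor \<Gamma> D" "lin_equiv \<Gamma> G D E" "reduced \<Gamma> (half_point G \<eta>0 r) D" for r D
      using that by (intro multiset_eqI countr)
  qed
qed

end

section \<open>Cells of the symmetric product\<close>

lemma lookup_scaleR: "Poly_Mapping.lookup (r *\<^sub>R x) k = r *\<^sub>R Poly_Mapping.lookup x k"
proof -
  have "finite {k. r *\<^sub>R Poly_Mapping.lookup x k \<noteq> 0}"
    by (rule finite_subset[of _ "Poly_Mapping.keys x"]) (auto simp: in_keys_iff)
  then show ?thesis by (simp add: scaleR_poly_mapping_def)
qed

definition chip_ok :: "('p, 'e) graph_model \<Rightarrow> real \<Rightarrow> 'e \<times> real \<times> real \<Rightarrow> bool" where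
  "chip_ok G \<epsilon> = (\<lambda>(e, a, q). e \<in> edges G \<and> q \<in> \<rat> \<and> (\<forall>r\<in>{0..\<epsilon>}. a + q * r \<in> {0..elen G e}))"

text \<open>In the subdivision at \<open>v\<close> and the support of the \<open>v\<close>-reduced
  divisor \<open>E\<close>, the direction \<open>\<delta>\<close> becomes a half edge at
  \<open>v\<close>. Reducedness of \<open>E\<close> supplies the hypothesis of
  \<open>local_chips\<close> through \<open>reduced_imp_max\<close>.\<close>

lemma (in tropical_curve) Red_chips:
  assumes ls: "linear_system \<Gamma> G D \<noteq> {}" and v: "v \<in> \<Gamma>" and \<delta>: "\<delta> \<in> directions G v"
  obtains \<epsilon> C where "0 < \<epsilon>" "\<And>c. c \<in># C \<Longrightarrow> chip_ok G \<epsilon> c"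
    "\<And>r. r \<in> {0..\<epsilon>} \<Longrightarrow> along G \<delta> r \<in> \<Gamma>"
    "\<And>r. r \<in> {0..\<epsilon>} \<Longrightarrow> Red \<Gamma> G D (along G \<delta> r) = image_mset (chip_pos G r) C"
proof -
  define E where "E = reduced_divisor \<Gamma> G D v"
  have Er: "reduced \<Gamma> v E" and "E \<in> linear_system \<Gamma> G D"
    unfolding E_def using reduced_divisor_props[OF ls v] by blast+
  then have E: "divisor \<Gamma> E" "effective E" "lin_equiv \<Gamma> G E D" by (auto simp: linear_system_def)
  define W where "W = Poly_Mapping.keys E \<union> {v}"
  define R where "R = subdivide G W"
  have R: "model_of \<Gamma> R" unfolding R_def
    using E(1) v by (intro model_of_subdivide) (auto simp: W_def divisor_def)
  interpret R: tropical_curve \<Gamma> R using R by unfold_locales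
  have vR: "v \<in> verts R" "Poly_Mapping.keys E \<subseteq> verts R" by (auto simp: R_def subdivide_def W_def)
  obtain \<epsilon>1 \<delta>' where \<epsilon>1: "0 < \<epsilon>1" "\<delta>' \<in> directions R v" "\<And>h. h \<in> {0..\<epsilon>1} \<Longrightarrow> along G \<delta> h = along R \<delta>' h"
    using directions_match[OF model R v] \<delta> by blast
  then obtain \<eta>0 where \<eta>0: "\<eta>0 \<in> half_edges_at R v" "\<delta>' = half_dir R \<eta>0" using R.directions_half_edges[OF vR(1)] by blast
  then have \<eta>0h: "\<eta>0 \<in> half_edges R" "half_point R \<eta>0 0 = v" by (auto simp: half_edges_at_def)
  have along: "along G \<delta> h = half_point R \<eta>0 h" if "h \<in> {0..\<epsilon>1}" for h
    using \<epsilon>1(3)[OF that] along_half_dir[of R \<eta>0 h] \<eta>0(2) by simp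
  have max: "f x \<le> 0" if f: "R.supported E f" "f (half_point R \<eta>0 0) = 0" and x: "x \<in> \<Gamma>" for f x
  proof -
    note fr = R.supported_rational[OF f(1) E(2) vR(2)]
    have "f x \<le> f v" using fr(2) by (intro R.reduced_imp_max[OF Er v fr(1) _ x]) auto
    then show ?thesis using f(2) \<eta>0h(2) by simp
  qed
  obtain \<epsilon>2 C where \<epsilon>2: "0 < \<epsilon>2"
    and C: "\<And>e a q. (e, a, q) \<in># C \<Longrightarrow> e \<in> edges R \<and> q \<in> \<rat> \<and> (\<forall>r\<in>{0..\<epsilon>2}. a + q * r \<in> {0..elen R e})"
    and C0: "mset_of_divisor E = image_mset (chip_pos R 0) C"
    and Cr: "\<And>r D. 0 < r \<Longrightarrow> r \<le> \<epsilon>2 \<Longrightarrow> divisor \<Gamma> D \<Longrightarrow> lin_equiv \<Gamma> R D E \<Longrightarrow> reduced \<Gamma> (half_point R \<eta>0 r) D \<Longrightarrow>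
      mset_of_divisor D = image_mset (chip_pos R r) C"
    by (rule R.local_chips[OF E(1,2) vR(2) \<eta>0h(1)]) (rule max, assumption+, rule that)
  obtain e t \<sigma> where \<delta>e: "\<delta> = (e, t, \<sigma>)" by (cases \<delta>)
  obtain \<epsilon>3 where \<epsilon>3: "0 < \<epsilon>3" "\<And>h. h \<in> {0..\<epsilon>3} \<Longrightarrow> t + \<sigma> * h \<in> {0..elen G e}"
    using directions_range[OF \<delta>[unfolded \<delta>e]] by blast
  define \<epsilon> where "\<epsilon> = min \<epsilon>1 (min \<epsilon>2 \<epsilon>3)"
  have \<epsilon>: "0 < \<epsilon>" "\<epsilon> \<le> \<epsilon>1" "\<epsilon> \<le> \<epsilon>2" "\<epsilon> \<le> \<epsilon>3" using \<epsilon>1(1) \<epsilon>2 \<epsilon>3(1) by (auto simp: \<epsilon>_def)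
  \<comment> \<open>A chip on the piece from \<open>a\<close> to \<open>b\<close> of an edge of
    \<open>R\<close> becomes a chip on the original edge; only its initial parameter is shifted by
    \<open>a\<close>.\<close>
  define up where "up = (\<lambda>((e, a, b :: real), s, q :: real). (e :: 'e, a + s :: real, q))"
  have up: "chip_pos G r (up c) = chip_pos R r c" for r c
    by (cases c) (auto simp: up_def chip_pos_def R_def subdivide_def algebra_simps)
  have img: "image_mset (chip_pos G r) (image_mset up C) = image_mset (chip_pos R r) C" for r
    by (simp add: up image_mset.compositionality comp_def)
  show ?thesis
  proof (rule that[of \<epsilon> "image_mset up C"])
    show "0 < \<epsilon>" by (rule \<epsilon>)
  next
    fix c assume "c \<in># image_mset up C"
    then obtain e a b s q where c: "((e, a, b), s, q) \<in># C" "c = (e, a + s, q)" by (auto simp: up_def)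
    note Cc = C[OF c(1)]
    have e: "e \<in> edges G" "0 \<le> a" "b \<le> elen G e" "elen R (e, a, b) = b - a"
      using Cc by (auto simp: R_def subdivide_def subdivision_params_def)
    have "a + s + q * r \<in> {0..elen G e}" if "r \<in> {0..\<epsilon>}" for r
    proof -
      have "s + q * r \<in> {0..b - a}" using Cc e(4) that \<epsilon>(3) by auto
      then show ?thesis using e(2,3) by auto
    qed
    then show "chip_ok G \<epsilon> c" using e(1) Cc c(2) by (simp add: chip_ok_def)
  next
    fix r assume r: "r \<in> {0..\<epsilon>}"
    show P: "along G \<delta> r \<in> \<Gamma>"
      using \<epsilon>3(2)[of r] r \<epsilon>(4) \<delta> by (auto simp: \<delta>e directions_def intro!: epar_in)
    show "Red \<Gamma> G D (along G \<delta> r) = image_mset (chip_pos G r) (image_mset up C)"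
    proof (cases "r = 0")
      case True
      then show ?thesis using C0 along_0[OF \<delta>] unfolding img by (simp add: Red_def E_def)
    next
      case False
      define P where "P = along G \<delta> r"
      have PR: "P = half_point R \<eta>0 r" using along r \<epsilon>(2) by (simp add: P_def)
      have P\<Gamma>: "P \<in> \<Gamma>" using P by (simp add: P_def)
      define D' where "D' = reduced_divisor \<Gamma> G D P"
      have D': "reduced \<Gamma> P D'" "D' \<in> linear_system \<Gamma> G D"
        unfolding D'_def using reduced_divisor_props[OF ls P\<Gamma>] by blast+
      then have D'': "divisor \<Gamma> D'" "lin_equiv \<Gamma> G D' D" by (auto simp: linear_system_def)
      have "lin_equiv \<Gamma> R D' E"
        using lin_equiv_trans[OF D''(2) lin_equiv_sym[OF E(3)]] lin_equiv_model[OF model R] by simp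
      then have "mset_of_divisor D' = image_mset (chip_pos R r) C"
        using Cr[of r D'] False r \<epsilon>(3) D''(1) D'(1) PR by auto
      then show ?thesis unfolding img by (simp add: Red_def D'_def P_def)
    qed
  qed
qed

text \<open>Different starting values decide the order for a short time and equal ones leave it to
  the speeds. The right-hand side is free of \<open>r\<close>, so the order at one small positive
  time is the order at all of them.\<close>

lemma order_constant:
  fixes S :: "(real \<times> real) set"
  assumes "finite S"
  obtains \<epsilon> where "0 < \<epsilon>" "\<And>a q a' q' r. (a, q) \<in> S \<Longrightarrow> (a', q') \<in> S \<Longrightarrow> 0 < r \<Longrightarrow> r \<le> \<epsilon> \<Longrightarrow>
    a + q * r \<le> a' + q' * r \<longleftrightarrow> a < a' \<or> a = a' \<and> q \<le> q'"
proof -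
  have "\<forall>\<^sub>F r in at_right 0. a + q * r \<le> a' + q' * r \<longleftrightarrow> a < a' \<or> a = a' \<and> q \<le> q'" for a q a' q' :: real
  proof -
    consider "a < a'" | "a' < a" | "a = a'" by linarith
    then show ?thesis
    proof cases
      case 1
      from eventually_affine_less[OF this, of q q'] show ?thesis by eventually_elim (use 1 in auto)
    next
      case 2
      from eventually_affine_less[OF this, of q' q] show ?thesis by eventually_elim (use 2 in auto)
    next
      case 3
      have "\<forall>\<^sub>F r::real in at_right 0. 0 < r" by (rule eventually_at_right_less)
      then show ?thesis by eventually_elim (use 3 in auto)
    qed
  qed
  then have "\<forall>\<^sub>F r in at_right 0. \<forall>x\<in>S \<times> S. case x of ((a, q), (a', q')) \<Rightarrow>
      a + q * r \<le> a' + q' * r \<longleftrightarrow> a < a' \<or> a = a' \<and> q \<le> q'"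
    using assms by (intro eventually_ball_finite) auto
  then obtain \<epsilon> where \<epsilon>: "0 < \<epsilon>" "\<And>r. r \<in> {0<..\<epsilon>} \<Longrightarrow> \<forall>x\<in>S \<times> S. case x of ((a, q), (a', q')) \<Rightarrow>
      a + q * r \<le> a' + q' * r \<longleftrightarrow> a < a' \<or> a = a' \<and> q \<le> q'"
    unfolding eventually_at_right_0 by blast
  show ?thesis
  proof (rule that[OF \<epsilon>(1)])
    fix a q a' q' r assume "(a, q) \<in> S" "(a', q') \<in> S" "0 < r" "r \<le> \<epsilon>"
    then show "a + q * r \<le> a' + q' * r \<longleftrightarrow> a < a' \<or> a = a' \<and> q \<le> q'"
      using \<epsilon>(2)[of r] by fastforce
  qed
qed

lemma common_denominator:
  assumes "finite A" "A \<subseteq> (\<rat> :: real set)"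
  shows "\<exists>n::nat. 0 < n \<and> (\<forall>q\<in>A. real n * q \<in> \<int>)"
  using assms
proof (induction A rule: finite_induct)
  case empty
  then show ?case by (intro exI[of _ 1]) simp
next
  case (insert x A)
  then obtain n :: nat where n: "0 < n" "\<forall>q\<in>A. real n * q \<in> \<int>" by auto
  obtain a b :: int where ab: "0 < b" "x = of_int a / of_int b"
    using insert.prems Rats_cases'[of x] by (metis insert_subset)
  have nb: "real (nat b) = of_int b" using ab by simp
  have "real (n * nat b) * x = of_int (int n * a)" using ab nb by simp
  then have "real (n * nat b) * x \<in> \<int>" by (metis Ints_of_int)
  moreover have "real (n * nat b) * q \<in> \<int>" if "q \<in> A" for q
  proof -
    have "real (n * nat b) * q = (real n * q) * of_int b" using nb by simp
    then show ?thesis using n(2) that by (metis Ints_mult Ints_of_int)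
  qed
  ultimately show ?case using n(1) ab(1) by (intro exI[of _ "n * nat b"]) auto
qed

lemma convex_cell_polytope: "convex (cell_polytope M s)"
proof (rule convexI)
  fix x y and u v :: real
  assume x: "x \<in> cell_polytope M s" and y: "y \<in> cell_polytope M s" and uv: "0 \<le> u" "0 \<le> v" "u + v = 1"
  have l: "Poly_Mapping.lookup (u *\<^sub>R x + v *\<^sub>R y) k = u * Poly_Mapping.lookup x k + v * Poly_Mapping.lookup y k" for k
    by (simp add: lookup_add lookup_scaleR)
  show "u *\<^sub>R x + v *\<^sub>R y \<in> cell_polytope M s"
    unfolding cell_polytope_def
  proof (intro CollectI conjI ballI allI impI)
    show "Poly_Mapping.keys (u *\<^sub>R x + v *\<^sub>R y) \<subseteq> {(e, i). e \<in> edges M \<and> i < s e}"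
    proof
      fix k assume "k \<in> Poly_Mapping.keys (u *\<^sub>R x + v *\<^sub>R y)"
      then have "k \<in> Poly_Mapping.keys x \<or> k \<in> Poly_Mapping.keys y" by (auto simp: in_keys_iff l)
      then show "k \<in> {(e, i). e \<in> edges M \<and> i < s e}" using x y by (auto simp: cell_polytope_def)
    qed
    fix e assume e: "e \<in> edges M"
    show "Poly_Mapping.lookup (u *\<^sub>R x + v *\<^sub>R y) (e, i) \<in> {0..elen M e}" if i: "i < s e" for i
    proof -
      have "Poly_Mapping.lookup x (e, i) \<in> {0..elen M e}" "Poly_Mapping.lookup y (e, i) \<in> {0..elen M e}"
        using x y e i by (auto simp: cell_polytope_def)
      then show ?thesis unfolding l using uv convexD[OF convex_real_interval(5), of _ 0 "elen M e" _ u v] by simp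
    qed
    show "Poly_Mapping.lookup (u *\<^sub>R x + v *\<^sub>R y) (e, i) \<le> Poly_Mapping.lookup (u *\<^sub>R x + v *\<^sub>R y) (e, j)"
      if "j < s e" "i \<le> j" for i j
      unfolding l using x y e that uv by (intro add_mono mult_left_mono) (auto simp: cell_polytope_def)
  qed
qed

lemma image_mset_nth: "image_mset (\<lambda>i. f (L ! i)) (mset_set {..<length L}) = image_mset f (mset L)"
proof -
  have "mset L = mset (map ((!) L) [0..<length L])" by (simp add: map_nth)
  also have "\<dots> = image_mset ((!) L) (mset_set {..<length L})" by (simp add: lessThan_atLeast0)
  finally show ?thesis by (simp add: image_mset.compositionality comp_def)
qed

lemma sum_filter_mset:
  assumes "finite A" "\<And>c. c \<in># C \<Longrightarrow> g c \<in> A"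
  shows "(\<Sum>e\<in>A. filter_mset (\<lambda>c. g c = e) C) = C"
proof (rule multiset_eqI)
  fix c
  have "count (\<Sum>e\<in>A. filter_mset (\<lambda>c. g c = e) C) c = (\<Sum>e\<in>A. if g c = e then count C c else 0)"
    unfolding count_sum by (intro sum.cong) auto
  also have "\<dots> = (if g c \<in> A then count C c else 0)" using assms(1) by simp
  also have "\<dots> = count C c" using assms(2)[of c] by (cases "c \<in># C") (auto simp: not_in_iff)
  finally show "count (\<Sum>e\<in>A. filter_mset (\<lambda>c. g c = e) C) c = count C c" .
qed

lemma size_sum_mset:
  fixes f :: "'a \<Rightarrow> 'b multiset"
  shows "size (\<Sum>e\<in>A. f e) = (\<Sum>e\<in>A. size (f e))"
  by (induction A rule: infinite_finite_induct) auto

context tropical_curve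
begin

text \<open>\<open>s\<close> counts the chips on each edge, and the whole polytope of
  \<open>s\<close> serves as the cell. Only images are compared here, so the chips may be sorted
  separately at each time.\<close>

lemma chips_in_cell:
  assumes C: "\<And>c. c \<in># C \<Longrightarrow> chip_ok G \<epsilon> c" and "0 \<le> \<epsilon>"
  shows "\<exists>(s, F)\<in>cells G (size C). (\<lambda>r. image_mset (chip_pos G r) C) ` {0..\<epsilon>} \<subseteq> cell_point G s ` F"
proof -
  define B where "B e = filter_mset (\<lambda>c. fst c = e) C" for e
  define s where "s e = size (B e)" for e
  define val where "val r c = fst (snd c) + snd (snd c) * r" for r and c :: "'e \<times> real \<times> real"
  have Ce: "fst c \<in> edges G" if "c \<in># C" for c using C[OF that] by (auto simp: chip_ok_def)
  have CB: "(\<Sum>e\<in>edges G. B e) = C" unfolding B_def using finite_edges Ce by (rule sum_filter_mset)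
  have point: "\<exists>x\<in>cell_polytope G s. cell_point G s x = image_mset (chip_pos G r) C" if r: "r \<in> {0..\<epsilon>}" for r
  proof -
    define L where "L e = sorted_list_of_multiset (image_mset (val r) (B e))" for e
    have len: "length (L e) = s e" for e
      by (simp add: L_def s_def size_mset[symmetric] del: size_mset)
    have mL: "mset (L e) = image_mset (val r) (B e)" for e by (simp add: L_def)
    have Lrange: "L e ! i \<in> {0..elen G e}" if "i < s e" for e i
    proof -
      have "L e ! i \<in># mset (L e)" using that len[of e] by simp
      then obtain c where c: "c \<in># B e" "L e ! i = val r c" unfolding mL by auto
      then have "chip_ok G \<epsilon> c" "fst c = e" using C by (auto simp: B_def)
      then show ?thesis using c(2) r by (cases c) (auto simp: chip_ok_def val_def)
    qed
    define K where "K = (SIGMA e:edges G. {..<s e})"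
    have "finite K" unfolding K_def using finite_edges by auto
    then have "finite {k \<in> K. L (fst k) ! snd k \<noteq> 0}" by simp
    then obtain x where x: "Poly_Mapping.keys x \<subseteq> K" "\<And>k. k \<in> K \<Longrightarrow> Poly_Mapping.lookup x k = L (fst k) ! snd k"
      using ex_poly_mapping[of K "\<lambda>k. L (fst k) ! snd k"] by blast
    have xe: "Poly_Mapping.lookup x (e, i) = L e ! i" if "e \<in> edges G" "i < s e" for e i
      using x(2)[of "(e, i)"] that by (simp add: K_def)
    have "x \<in> cell_polytope G s" unfolding cell_polytope_def
    proof (intro CollectI conjI ballI allI impI)
      show "Poly_Mapping.keys x \<subseteq> {(e, i). e \<in> edges G \<and> i < s e}" using x(1) by (auto simp: K_def)
      fix e assume e: "e \<in> edges G"
      show "Poly_Mapping.lookup x (e, i) \<in> {0..elen G e}" if "i < s e" for i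
        using Lrange[OF that] xe[OF e that] by simp
      show "Poly_Mapping.lookup x (e, i) \<le> Poly_Mapping.lookup x (e, j)" if "j < s e" "i \<le> j" for i j
        using xe[OF e that(1)] xe[OF e, of i] that len[of e] by (simp add: L_def sorted_nth_mono)
    qed
    moreover have "cell_point G s x = image_mset (chip_pos G r) C"
    proof -
      have "cell_point G s x = (\<Sum>e\<in>edges G. image_mset (chip_pos G r) (B e))"
        unfolding cell_point_def
      proof (rule sum.cong[OF HOL.refl])
        fix e assume e: "e \<in> edges G"
        have "image_mset (\<lambda>i. epar G e (Poly_Mapping.lookup x (e, i))) (mset_set {..<s e}) =
            image_mset (\<lambda>i. epar G e (L e ! i)) (mset_set {..<length (L e)})"
          unfolding len using xe[OF e] by (intro image_mset_cong) auto
        also have "\<dots> = image_mset (epar G e) (image_mset (val r) (B e))" unfolding image_mset_nth mL ..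
        also have "\<dots> = image_mset (chip_pos G r) (B e)"
          unfolding image_mset.compositionality
          by (intro image_mset_cong) (auto simp: B_def val_def chip_pos_def)
        finally show "image_mset (\<lambda>i. epar G e (Poly_Mapping.lookup x (e, i))) (mset_set {..<s e}) =
            image_mset (chip_pos G r) (B e)" .
      qed
      also have "\<dots> = image_mset (chip_pos G r) C" unfolding image_mset_sum[symmetric] CB ..
      finally show ?thesis .
    qed
    ultimately show ?thesis by blast
  qed
  have "s e = 0" if "e \<notin> edges G" for e
  proof -
    have "B e = filter_mset (\<lambda>c. False) C" unfolding B_def using Ce that by (intro filter_mset_cong) auto
    then show ?thesis by (simp add: s_def)
  qed
  moreover have "(\<Sum>e\<in>edges G. s e) = size C"
    unfolding s_def size_sum_mset[symmetric] CB ..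
  moreover have "cell_polytope G s \<noteq> {}" using point[of 0] assms(2) by auto
  ultimately have "(s, cell_polytope G s) \<in> cells G (size C)"
    unfolding cells_def using face_of_refl[OF convex_cell_polytope] by auto
  moreover have "(\<lambda>r. image_mset (chip_pos G r) C) ` {0..\<epsilon>} \<subseteq> cell_point G s ` cell_polytope G s"
  proof
    fix y assume "y \<in> (\<lambda>r. image_mset (chip_pos G r) C) ` {0..\<epsilon>}"
    then obtain r where r: "r \<in> {0..\<epsilon>}" "y = image_mset (chip_pos G r) C" by blast
    from point[OF r(1)] r(2) show "y \<in> cell_point G s ` cell_polytope G s" by (metis imageI)
  qed
  ultimately show ?thesis by (intro bexI[of _ "(s, cell_polytope G s)"]) auto
qed

text \<open>A lift at a single time \<open>h\<close> determines the lift at all times, because every chip in the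
  interior of an edge moves along and no other chip moves. As the straight segment extends
  beyond \<open>h\<close>, every face containing the lift at time \<open>h\<close> contains all of it.\<close>

lemma chips_straight:
  assumes C: "\<And>c. c \<in># C \<Longrightarrow> chip_ok G \<epsilon> c" and \<epsilon>: "0 < \<epsilon>"
  obtains \<epsilon>' where "0 < \<epsilon>'" "\<epsilon>' \<le> \<epsilon>"
    "\<And>h s F. 0 < h \<Longrightarrow> h < \<epsilon>' \<Longrightarrow> (s, F) \<in> cells G N \<Longrightarrow> image_mset (chip_pos G h) C \<in> cell_point G s ` F \<Longrightarrow>
      straight_in_cell G s F h (\<lambda>r. image_mset (chip_pos G r) C)"
proof -
  \<comment> \<open>Stationary chips at both ends of all edges are added because a coordinate of the
    lift at an end of its edge may represent a chip of \<open>C\<close> that reaches the same vertex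
    on another edge.\<close>
  define Cs where "Cs = set_mset C \<union> (\<lambda>e. (e, 0, 0)) ` edges G \<union> (\<lambda>e. (e, elen G e, 0)) ` edges G"
  have finCs: "finite Cs" unfolding Cs_def using finite_edges by simp
  obtain \<epsilon>0 where \<epsilon>0: "0 < \<epsilon>0" and ord: "\<And>a q a' q' r. (a, q) \<in> snd ` Cs \<Longrightarrow> (a', q') \<in> snd ` Cs \<Longrightarrow> 0 < r \<Longrightarrow> r \<le> \<epsilon>0 \<Longrightarrow>
    a + q * r \<le> a' + q' * r \<longleftrightarrow> a < a' \<or> a = a' \<and> q \<le> q'"
    using order_constant[of "snd ` Cs"] finCs by (metis finite_imageI)
  define \<epsilon>' where "\<epsilon>' = min \<epsilon> \<epsilon>0"
  have \<epsilon>': "0 < \<epsilon>'" "\<epsilon>' \<le> \<epsilon>" "\<epsilon>' \<le> \<epsilon>0" using \<epsilon> \<epsilon>0 by (auto simp: \<epsilon>'_def)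
  have ok: "e \<in> edges G \<and> q \<in> \<rat> \<and> (\<forall>r\<in>{0..\<epsilon>'}. a + q * r \<in> {0..elen G e})" if "(e, a, q) \<in> Cs" for e a q
    using that C[of "(e, a, q)"] \<epsilon>'(2) elen_pos unfolding Cs_def by (auto simp: chip_ok_def less_imp_le)
  have move: "a + q * r \<le> a' + q' * r"
    if "(e, a, q) \<in> Cs" "(e', a', q') \<in> Cs" "a + q * h \<le> a' + q' * h" "0 < h" "h \<le> \<epsilon>'" "r \<in> {0..\<epsilon>'}" for e a q e' a' q' h r
  proof -
    have in_S: "(a, q) \<in> snd ` Cs" "(a', q') \<in> snd ` Cs" using that(1,2) by force+
    have T: "a < a' \<or> a = a' \<and> q \<le> q'" using ord[OF in_S, of h] that(3-5) \<epsilon>'(3) by simp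
    show ?thesis
    proof (cases "r = 0")
      case False
      then show ?thesis using ord[OF in_S, of r] T that(6) \<epsilon>'(3) by simp
    qed (use T in auto)
  qed
  \<comment> \<open>Comparison with the stationary chip at that end, both ways: a chip found at an
    end at a small positive time stands still.\<close>
  have stat: "a + q * r = p" if "(e, a, q) \<in> Cs" "a + q * h = p" "p = 0 \<or> p = elen G e" "0 < h" "h \<le> \<epsilon>'" "r \<in> {0..\<epsilon>'}" for e a q h r p
  proof -
    have "(e, p, 0) \<in> Cs" using that(3) ok[OF that(1)] by (auto simp: Cs_def)
    then show ?thesis using move[OF that(1) _ _ that(4-6), of e p 0] move[OF _ that(1) _ that(4-6), of e p 0] that(2) by simp
  qed
  \<comment> \<open>Chips that meet at one small positive time stay together. Inside an edge their
    order in both senses is constant, and at a vertex both stand still. Hence the multiset at time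
    \<open>h\<close> determines the multisets at all times.\<close>
  have same: "chip_pos G r c = chip_pos G r c'"
    if c: "c \<in> Cs" "c' \<in> Cs" "chip_pos G h c = chip_pos G h c'" and h: "0 < h" "h \<le> \<epsilon>'" and r: "r \<in> {0..\<epsilon>'}" for c c' h r
  proof -
    obtain e a q where c1: "c = (e, a, q)" by (cases c)
    obtain e' a' q' where c2: "c' = (e', a', q')" by (cases c')
    note o1 = ok[OF c(1)[unfolded c1]] and o2 = ok[OF c(2)[unfolded c2]]
    have p: "a + q * h \<in> {0..elen G e}" "a' + q' * h \<in> {0..elen G e'}" using o1 o2 h by auto
    have eq: "epar G e (a + q * h) = epar G e' (a' + q' * h)" using c(3) by (simp add: c1 c2 chip_pos_def)
    show ?thesis
    proof (cases "a + q * h \<in> {0<..<elen G e}")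
      case True
      then have e: "e = e'" "a + q * h = a' + q' * h" using interior_eq[OF _ _ True p(2) eq] o1 o2 by auto
      then have "a + q * r = a' + q' * r"
        using move[OF c(1)[unfolded c1] c(2)[unfolded c2] _ h r] move[OF c(2)[unfolded c2] c(1)[unfolded c1] _ h r] by simp
      then show ?thesis using e by (simp add: c1 c2 chip_pos_def)
    next
      case False
      then have v1: "a + q * h = 0 \<or> a + q * h = elen G e" using p(1) by auto
      then have "epar G e (a + q * h) \<in> verts G" using epar_0 epar_elen o1 by auto
      then have v2: "a' + q' * h = 0 \<or> a' + q' * h = elen G e'" using vertex_param[OF _ p(2)] eq o2 by simp
      have 1: "a + q * r = a + q * h" using stat[OF c(1)[unfolded c1] HOL.refl v1 h r] .
      have 2: "a' + q' * r = a' + q' * h" using stat[OF c(2)[unfolded c2] HOL.refl v2 h r] .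
      show ?thesis unfolding c1 c2 chip_pos_def prod.case 1 2 by (rule eq)
    qed
  qed
  have main: "straight_in_cell G s F h (\<lambda>r. image_mset (chip_pos G r) C)"
    if h: "0 < h" "h < \<epsilon>'" and sF: "(s, F) \<in> cells G N" and lift: "image_mset (chip_pos G h) C \<in> cell_point G s ` F" for h s F
  proof -
    have F: "F face_of cell_polytope G s" using sF by (simp add: cells_def)
    obtain x where x: "x \<in> F" "cell_point G s x = image_mset (chip_pos G h) C" using lift by auto
    have xP: "x \<in> cell_polytope G s" using F x(1) face_of_imp_subset by blast
    define K where "K = (SIGMA e:edges G. {..<s e})"
    have finK: "finite K" unfolding K_def using finite_edges by auto
    \<comment> \<open>A coordinate strictly inside its edge is the position of a chip of
      \<open>C\<close> on that edge; a coordinate at an end is represented by a stationary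
      chip.\<close>
    have "\<exists>a q. (fst k, a, q) \<in> Cs \<and> a + q * h = Poly_Mapping.lookup x k" if k: "k \<in> K" for k
    proof -
      obtain e i where k': "k = (e, i)" by (cases k)
      have e: "e \<in> edges G" "i < s e" using k k' by (auto simp: K_def)
      let ?p = "Poly_Mapping.lookup x (e, i)"
      have p: "?p \<in> {0..elen G e}" using xP e by (simp add: cell_polytope_def)
      show ?thesis
      proof (cases "?p = 0 \<or> ?p = elen G e")
        case True
        then show ?thesis using e by (intro exI[of _ ?p] exI[of _ 0]) (auto simp: k' Cs_def)
      next
        case False
        then have pi: "?p \<in> {0<..<elen G e}" using p by auto
        have "epar G e ?p \<in># cell_point G s x"
          unfolding cell_point_def using e finite_edges by (auto simp: set_mset_sum)
        then obtain c where c: "c \<in># C" "epar G e ?p = chip_pos G h c" unfolding x(2) by auto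
        obtain e' a q where c': "c = (e', a, q)" by (cases c)
        have cs: "(e', a, q) \<in> Cs" using c(1) c' by (simp add: Cs_def)
        have "a + q * h \<in> {0..elen G e'}" using ok[OF cs] h by auto
        moreover have "epar G e ?p = epar G e' (a + q * h)" using c(2) c' by (simp add: chip_pos_def)
        ultimately have "e = e'" "?p = a + q * h" using interior_eq[OF e(1) _ pi] ok[OF cs] by blast+
        then show ?thesis using cs k' by (intro exI[of _ a] exI[of _ q]) simp
      qed
    qed
    then obtain A Q where AQ: "\<And>k. k \<in> K \<Longrightarrow> (fst k, A k, Q k) \<in> Cs" "\<And>k. k \<in> K \<Longrightarrow> A k + Q k * h = Poly_Mapping.lookup x k"
      by metis
    obtain x0 where x0: "Poly_Mapping.keys x0 \<subseteq> K" "\<And>k. k \<in> K \<Longrightarrow> Poly_Mapping.lookup x0 k = A k"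
      using ex_poly_mapping[of K A] finK by auto
    obtain w where w: "Poly_Mapping.keys w \<subseteq> K" "\<And>k. k \<in> K \<Longrightarrow> Poly_Mapping.lookup w k = Q k"
      using ex_poly_mapping[of K Q] finK by auto
    define y where "y r = x0 + r *\<^sub>R w" for r
    have y: "Poly_Mapping.lookup (y r) k = (if k \<in> K then A k + Q k * r else 0)" for r k
    proof (cases "k \<in> K")
      case False
      then have "Poly_Mapping.lookup x0 k = 0" "Poly_Mapping.lookup w k = 0"
        using x0(1) w(1) by (meson in_keys_iff subsetD)+
      then show ?thesis using False by (simp add: y_def lookup_add lookup_scaleR)
    qed (use x0(2) w(2) in \<open>simp add: y_def lookup_add lookup_scaleR\<close>)
    have yK: "Poly_Mapping.keys (y r) \<subseteq> K" for r
    proof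
      fix k assume "k \<in> Poly_Mapping.keys (y r)"
      then show "k \<in> K" using y[of r k] by (metis in_keys_iff)
    qed
    have xK: "Poly_Mapping.keys x \<subseteq> K" using xP by (auto simp: cell_polytope_def K_def)
    have yh: "y h = x"
    proof (rule poly_mapping_eqI)
      fix k
      show "Poly_Mapping.lookup (y h) k = Poly_Mapping.lookup x k"
      proof (cases "k \<in> K")
        case False
        then have "Poly_Mapping.lookup x k = 0" using xK by (meson in_keys_iff subsetD)
        then show ?thesis using False by (simp add: y)
      qed (use AQ(2) in \<open>simp add: y\<close>)
    qed
    have yP: "y r \<in> cell_polytope G s" if r: "r \<in> {0..\<epsilon>'}" for r
      unfolding cell_polytope_def
    proof (intro CollectI conjI ballI allI impI)
      show "Poly_Mapping.keys (y r) \<subseteq> {(e, i). e \<in> edges G \<and> i < s e}" using yK by (auto simp: K_def)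
      fix e assume e: "e \<in> edges G"
      show "Poly_Mapping.lookup (y r) (e, i) \<in> {0..elen G e}" if "i < s e" for i
      proof -
        have k: "(e, i) \<in> K" using e that by (simp add: K_def)
        show ?thesis using ok[OF AQ(1)[OF k]] r k by (simp add: y)
      qed
      show "Poly_Mapping.lookup (y r) (e, i) \<le> Poly_Mapping.lookup (y r) (e, j)" if ij: "j < s e" "i \<le> j" for i j
      proof -
        have k: "(e, i) \<in> K" "(e, j) \<in> K" using e ij by (auto simp: K_def)
        have "Poly_Mapping.lookup x (e, i) \<le> Poly_Mapping.lookup x (e, j)"
          using xP e ij by (simp add: cell_polytope_def)
        then have "A (e, i) + Q (e, i) * h \<le> A (e, j) + Q (e, j) * h" using AQ(2)[OF k(1)] AQ(2)[OF k(2)] by simp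
        from move[OF AQ(1)[OF k(1)] AQ(1)[OF k(2)] this h(1) less_imp_le[OF h(2)] r] show ?thesis using k by (simp add: y)
      qed
    qed
    have yF: "y r \<in> F" if r: "r \<in> {0..h}" for r
    proof (cases "y r = y \<epsilon>' \<or> r = h")
      case True
      then show ?thesis
      proof
        assume eq: "y r = y \<epsilon>'"
        then have "(\<epsilon>' - r) *\<^sub>R w = 0" by (auto simp: y_def)
        then have "w = 0" using r h by simp
        then show ?thesis using yh x(1) by (simp add: y_def)
      qed (use yh x(1) in simp)
    next
      case False
      \<comment> \<open>\<open>h\<close> is the convex combination of \<open>r\<close> and
        \<open>\<epsilon>'\<close> with weight \<open>u\<close>. As \<open>h < \<epsilon>'\<close>
        is strict, the lift at time \<open>h\<close> is an inner point of the segment from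
        \<open>y r\<close> to \<open>y \<epsilon>'\<close>, and the face property yields
        \<open>y r\<close>.\<close>
      define u where "u = (h - r) / (\<epsilon>' - r)"
      have u: "0 < u" "u < 1" using r h False by (auto simp: u_def)
      have "u * (\<epsilon>' - r) = h - r" using r h by (simp add: u_def)
      then have hu: "h = (1 - u) * r + u * \<epsilon>'" by (simp add: algebra_simps)
      have "x = (1 - u) *\<^sub>R y r + u *\<^sub>R y \<epsilon>'"
      proof -
        have "(1 - u) *\<^sub>R y r + u *\<^sub>R y \<epsilon>' = ((1 - u) + u) *\<^sub>R x0 + ((1 - u) * r + u * \<epsilon>') *\<^sub>R w"
          unfolding y_def by (simp only: scaleR_add_right scaleR_add_left scaleR_scaleR ac_simps)
        then show ?thesis using hu yh by (simp add: y_def)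
      qed
      then have "x \<in> open_segment (y r) (y \<epsilon>')" unfolding in_segment using False u by blast
      moreover have "y r \<in> cell_polytope G s" "y \<epsilon>' \<in> cell_polytope G s" using r h \<epsilon>' by (auto intro!: yP)
      ultimately show ?thesis using face_ofD[OF F] x(1) by blast
    qed
    \<comment> \<open>The map that takes positions at time \<open>h\<close> to positions at time
      \<open>r\<close>. By \<open>same\<close> it does not depend on the choice of the chip, so it
      transports the equality of multisets at time \<open>h\<close> to time
      \<open>r\<close>.\<close>
    define \<theta> where "\<theta> r z = chip_pos G r (SOME c. c \<in> Cs \<and> chip_pos G h c = z)" for r z
    have \<theta>: "\<theta> r (chip_pos G h c) = chip_pos G r c" if "c \<in> Cs" "r \<in> {0..\<epsilon>'}" for r c
    proof -
      have "\<exists>c'. c' \<in> Cs \<and> chip_pos G h c' = chip_pos G h c" using that(1) by blast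
      from someI_ex[OF this] show ?thesis unfolding \<theta>_def using same[OF _ that(1) _ h(1) less_imp_le[OF h(2)] that(2)] by blast
    qed
    have yC: "cell_point G s (y r) = image_mset (chip_pos G r) C" if r: "r \<in> {0..\<epsilon>'}" for r
    proof -
      have "cell_point G s (y r) = (\<Sum>e\<in>edges G. image_mset (\<theta> r) (image_mset (\<lambda>i. epar G e (Poly_Mapping.lookup x (e, i))) (mset_set {..<s e})))"
        unfolding cell_point_def
      proof (rule sum.cong[OF HOL.refl])
        fix e assume e: "e \<in> edges G"
        have "epar G e (Poly_Mapping.lookup (y r) (e, i)) = \<theta> r (epar G e (Poly_Mapping.lookup x (e, i)))" if "i < s e" for i
        proof -
          have k: "(e, i) \<in> K" using e that by (simp add: K_def)
          have cs: "(e, A (e, i), Q (e, i)) \<in> Cs" using AQ(1)[OF k] by simp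
          show ?thesis using \<theta>[OF cs r] AQ(2)[OF k] k by (simp add: chip_pos_def y)
        qed
        then show "image_mset (\<lambda>i. epar G e (Poly_Mapping.lookup (y r) (e, i))) (mset_set {..<s e}) =
            image_mset (\<theta> r) (image_mset (\<lambda>i. epar G e (Poly_Mapping.lookup x (e, i))) (mset_set {..<s e}))"
          unfolding image_mset.compositionality comp_def by (intro image_mset_cong) auto
      qed
      also have "\<dots> = image_mset (\<theta> r) (cell_point G s x)" by (simp add: cell_point_def image_mset_sum)
      also have "\<dots> = image_mset (chip_pos G r) C"
        unfolding x(2) image_mset.compositionality comp_def using \<theta>[OF _ r] by (intro image_mset_cong) (auto simp: Cs_def)
      finally show ?thesis .
    qed
    have "Q ` K \<subseteq> \<rat>" using ok[OF AQ(1)] by auto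
    then obtain n :: nat where n: "0 < n" "\<And>k. k \<in> K \<Longrightarrow> real n * Q k \<in> \<int>"
      using common_denominator[of "Q ` K"] finK by auto
    have "real n *\<^sub>R w \<in> cell_lattice F" unfolding cell_lattice_def
    proof (intro CollectI conjI allI)
      \<comment> \<open>\<open>w\<close> is the difference quotient of two points of
        \<open>F\<close>, so it lies in the linear space parallel to \<open>F\<close>.\<close>
      have "y h - y 0 \<in> {x - y |x y. x \<in> F \<and> y \<in> F}" using yF[of h] yF[of 0] h by auto
      then have "(real n / h) *\<^sub>R (y h - y 0) \<in> span {x - y |x y. x \<in> F \<and> y \<in> F}"
        by (rule span_scale[OF span_base])
      moreover have "(real n / h) *\<^sub>R (y h - y 0) = real n *\<^sub>R w"
      proof -
        have "y h - y 0 = h *\<^sub>R w" by (simp add: y_def)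
        then have "(real n / h) *\<^sub>R (y h - y 0) = ((real n / h) * h) *\<^sub>R w" by simp
        also have "(real n / h) * h = real n" using h by simp
        finally show ?thesis .
      qed
      ultimately show "real n *\<^sub>R w \<in> span {x - y |x y. x \<in> F \<and> y \<in> F}" by (rule back_subst[of "\<lambda>z. z \<in> span {x - y |x y. x \<in> F \<and> y \<in> F}"])
      fix k
      show "Poly_Mapping.lookup (real n *\<^sub>R w) k \<in> \<int>"
      proof (cases "k \<in> K")
        case False
        then have "Poly_Mapping.lookup w k = 0" using w(1) by (meson in_keys_iff subsetD)
        then show ?thesis by (simp add: lookup_scaleR)
      qed (use n(2) w(2) in \<open>simp add: lookup_scaleR\<close>)
    qed
    then have "w \<in> rational_slopes F" unfolding rational_slopes_def using n(1) by blast
    moreover have "\<forall>r\<in>{0..h}. x0 + r *\<^sub>R w \<in> F \<and> image_mset (chip_pos G r) C = cell_point G s (x0 + r *\<^sub>R w)"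
      using yF yC h(2) unfolding y_def by auto
    ultimately show ?thesis unfolding straight_in_cell_def by blast
  qed
  show ?thesis by (rule that[OF \<epsilon>'(1,2) main])
qed

end

section \<open>The map \<open>Red\<close> to the symmetric product\<close>

lemma topspace_sym_product: "topspace (sym_product_topology \<Gamma> N) = sym_product \<Gamma> N"
proof (rule antisym)
  show "topspace (sym_product_topology \<Gamma> N) \<subseteq> sym_product \<Gamma> N"
    using openin_topspace[of "sym_product_topology \<Gamma> N"] unfolding openin_sym_product_topology by blast
  have "{x \<in> {..<N} \<rightarrow>\<^sub>E \<Gamma>. unordered_tuple N x \<in> sym_product \<Gamma> N} = {..<N} \<rightarrow>\<^sub>E \<Gamma>"
    by (auto simp: unordered_tuple_def sym_product_def PiE_def Pi_def)
  then have "openin (sym_product_topology \<Gamma> N) (sym_product \<Gamma> N)"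
    unfolding openin_sym_product_topology using openin_topspace[of "product_topology (\<lambda>_. top_of_set \<Gamma>) {..<N}"]
    by simp
  then show "sym_product \<Gamma> N \<subseteq> topspace (sym_product_topology \<Gamma> N)" by (rule openin_subset)
qed

context tropical_curve
begin

lemma Red_in_sym_product:
  assumes ls: "linear_system \<Gamma> G D \<noteq> {}" and D: "divisor \<Gamma> D" and P: "P \<in> \<Gamma>"
  shows "Red \<Gamma> G D P \<in> sym_product \<Gamma> (nat (div_degree D))"
proof -
  define E where "E = reduced_divisor \<Gamma> G D P"
  have E: "divisor \<Gamma> E" "effective E" "lin_equiv \<Gamma> G E D"
    using reduced_divisor_props(2)[OF ls P] by (auto simp: linear_system_def E_def)
  have "set_mset (mset_of_divisor E) \<subseteq> \<Gamma>"
  proof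
    fix x assume "x \<in># mset_of_divisor E"
    then have "0 < count (mset_of_divisor E) x" by simp
    then have "x \<in> Poly_Mapping.keys E" by (simp add: count_mset_of_divisor in_keys_iff)
    then show "x \<in> \<Gamma>" using E(1) by (auto simp: divisor_def)
  qed
  moreover have "int (size (mset_of_divisor E)) = div_degree E"
    unfolding mset_of_divisor_def size_sum_mset div_degree_def using E(2) by (simp add: effective_def)
  moreover have "div_degree E = div_degree D" using lin_equiv_degree[OF E(3,1) D] .
  ultimately show ?thesis by (auto simp: sym_product_def Red_def E_def)
qed

lemma integral_affine_Red:
  assumes ls: "linear_system \<Gamma> G D \<noteq> {}" and D: "divisor \<Gamma> D"
  shows "integral_affine \<Gamma> G (nat (div_degree D)) (Red \<Gamma> G D)"
  unfolding integral_affine_def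
proof (intro conjI ballI)
  let ?N = "nat (div_degree D)"
  show "Red \<Gamma> G D \<in> \<Gamma> \<rightarrow> sym_product \<Gamma> ?N" using Red_in_sym_product[OF ls D] by blast
  fix v \<delta> assume v: "v \<in> \<Gamma>" and \<delta>: "\<delta> \<in> directions G v"
  obtain e t \<sigma> where \<delta>': "\<delta> = (e, t, \<sigma>)" by (cases \<delta>)
  obtain \<epsilon>1 C where \<epsilon>1: "0 < \<epsilon>1" and C: "\<And>c. c \<in># C \<Longrightarrow> chip_ok G \<epsilon>1 c"
    and "\<And>r. r \<in> {0..\<epsilon>1} \<Longrightarrow> along G \<delta> r \<in> \<Gamma>"
    and R: "\<And>r. r \<in> {0..\<epsilon>1} \<Longrightarrow> Red \<Gamma> G D (along G \<delta> r) = image_mset (chip_pos G r) C"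
    using Red_chips[OF ls v \<delta>] by blast
  have "Red \<Gamma> G D v = image_mset (chip_pos G 0) C" using R[of 0] \<epsilon>1 along_0[OF \<delta>] by simp
  then have N: "size C = ?N" using Red_in_sym_product[OF ls D v] by (simp add: sym_product_def)
  obtain \<epsilon>2 where \<epsilon>2: "0 < \<epsilon>2" "\<epsilon>2 \<le> \<epsilon>1"
    and S: "\<And>h s F. 0 < h \<Longrightarrow> h < \<epsilon>2 \<Longrightarrow> (s, F) \<in> cells G ?N \<Longrightarrow> image_mset (chip_pos G h) C \<in> cell_point G s ` F \<Longrightarrow>
      straight_in_cell G s F h (\<lambda>r. image_mset (chip_pos G r) C)"
    using chips_straight[OF C \<epsilon>1] by blast
  obtain \<epsilon>3 where \<epsilon>3: "0 < \<epsilon>3" "\<And>h. h \<in> {0..\<epsilon>3} \<Longrightarrow> t + \<sigma> * h \<in> {0..elen G e}"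
    using directions_range[OF \<delta>[unfolded \<delta>']] by blast
  \<comment> \<open>\<open>S\<close> requires \<open>h\<close> strictly below
    \<open>\<epsilon>2\<close>, so that the segment extends beyond \<open>h\<close>; hence the
    half.\<close>
  define \<epsilon> where "\<epsilon> = min (\<epsilon>2 / 2) \<epsilon>3"
  have \<epsilon>: "0 < \<epsilon>" "\<epsilon> < \<epsilon>2" "\<epsilon> \<le> \<epsilon>1" "\<epsilon> \<le> \<epsilon>3" using \<epsilon>2 \<epsilon>3(1) by (auto simp: \<epsilon>_def)
  define \<gamma> where "\<gamma> r = Red \<Gamma> G D (epar G e (t + \<sigma> * r))" for r
  have \<gamma>: "\<gamma> r = image_mset (chip_pos G r) C" if "r \<in> {0..\<epsilon>}" for r
    using R[of r] that \<epsilon>(3) by (simp add: \<gamma>_def \<delta>')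
  have cell: "\<exists>(s, F)\<in>cells G ?N. \<gamma> ` {0..\<epsilon>} \<subseteq> cell_point G s ` F"
  proof -
    have "\<exists>(s, F)\<in>cells G (size C). (\<lambda>r. image_mset (chip_pos G r) C) ` {0..\<epsilon>1} \<subseteq> cell_point G s ` F"
      using C \<epsilon>1 by (intro chips_in_cell) auto
    then obtain s F where sF: "(s, F) \<in> cells G ?N"
      "(\<lambda>r. image_mset (chip_pos G r) C) ` {0..\<epsilon>1} \<subseteq> cell_point G s ` F" unfolding N by blast
    have "\<gamma> ` {0..\<epsilon>} \<subseteq> (\<lambda>r. image_mset (chip_pos G r) C) ` {0..\<epsilon>1}"
    proof
      fix y assume "y \<in> \<gamma> ` {0..\<epsilon>}"
      then obtain r where r: "r \<in> {0..\<epsilon>}" "y = \<gamma> r" by blast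
      then show "y \<in> (\<lambda>r. image_mset (chip_pos G r) C) ` {0..\<epsilon>1}"
        using \<gamma>[OF r(1)] \<epsilon>(3) by (intro image_eqI[of _ _ r]) auto
    qed
    then show ?thesis using sF by (intro bexI[of _ "(s, F)"]) auto
  qed
  have straight: "straight_in_cell G s F h \<gamma>"
    if h: "h \<in> {0<..\<epsilon>}" and sF: "(s, F) \<in> cells G ?N" "\<gamma> ` {0..h} \<subseteq> cell_point G s ` F" for h s F
  proof -
    have "\<gamma> h \<in> cell_point G s ` F" using sF(2) h by auto
    then have "image_mset (chip_pos G h) C \<in> cell_point G s ` F" using \<gamma>[of h] h by simp
    then have "straight_in_cell G s F h (\<lambda>r. image_mset (chip_pos G r) C)"
      using S[of h s F] sF(1) h \<epsilon>(2) by simp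
    then show ?thesis unfolding straight_in_cell_def using \<gamma> h by (metis (no_types, lifting) atLeastAtMost_iff greaterThanAtMost_iff order.trans)
  qed
  have "\<exists>\<epsilon>>0. t + \<sigma> * \<epsilon> \<in> {0..elen G e} \<and>
        (let \<gamma> = (\<lambda>r. Red \<Gamma> G D (epar G e (t + \<sigma> * r))) in
          (\<exists>(s, F)\<in>cells G ?N. \<gamma> ` {0..\<epsilon>} \<subseteq> cell_point G s ` F) \<and>
          (\<forall>h\<in>{0<..\<epsilon>}. \<forall>(s, F)\<in>cells G ?N. \<gamma> ` {0..h} \<subseteq> cell_point G s ` F \<longrightarrow> straight_in_cell G s F h \<gamma>))"
    unfolding Let_def \<gamma>_def[abs_def, symmetric]
  proof (intro exI[of _ \<epsilon>] conjI)
    show "0 < \<epsilon>" "t + \<sigma> * \<epsilon> \<in> {0..elen G e}" using \<epsilon> \<epsilon>3(2)[of \<epsilon>] by auto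
    show "\<exists>(s, F)\<in>cells G ?N. \<gamma> ` {0..\<epsilon>} \<subseteq> cell_point G s ` F" by (rule cell)
    show "\<forall>h\<in>{0<..\<epsilon>}. \<forall>(s, F)\<in>cells G ?N. \<gamma> ` {0..h} \<subseteq> cell_point G s ` F \<longrightarrow> straight_in_cell G s F h \<gamma>"
      using straight by blast
  qed
  then show "case \<delta> of (e, t, \<sigma>) \<Rightarrow> \<exists>\<epsilon>>0. t + \<sigma> * \<epsilon> \<in> {0..elen G e} \<and>
        (let \<gamma> = (\<lambda>r. Red \<Gamma> G D (epar G e (t + \<sigma> * r))) in
          (\<exists>(s, F)\<in>cells G ?N. \<gamma> ` {0..\<epsilon>} \<subseteq> cell_point G s ` F) \<and>
          (\<forall>h\<in>{0<..\<epsilon>}. \<forall>(s, F)\<in>cells G ?N. \<gamma> ` {0..h} \<subseteq> cell_point G s ` F \<longrightarrow> straight_in_cell G s F h \<gamma>))"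
    by (simp only: \<delta>' prod.case)
qed

text \<open>Listing the chips once in a fixed order lifts the path to the product, where continuity
  is checked in each coordinate. Open sets of the symmetric product are those with open preimage in
  the product.\<close>

lemma Red_near:
  assumes ls: "linear_system \<Gamma> G D \<noteq> {}" and D: "divisor \<Gamma> D" and v: "v \<in> \<Gamma>" and \<delta>: "\<delta> \<in> directions G v"
    and U: "openin (sym_product_topology \<Gamma> (nat (div_degree D))) U" "Red \<Gamma> G D v \<in> U"
  shows "\<exists>\<epsilon>>0. \<forall>r\<in>{0..<\<epsilon>}. Red \<Gamma> G D (along G \<delta> r) \<in> U"
proof -
  let ?N = "nat (div_degree D)"
  obtain \<epsilon> C where \<epsilon>: "0 < \<epsilon>" and C: "\<And>c. c \<in># C \<Longrightarrow> chip_ok G \<epsilon> c"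
    and "\<And>r. r \<in> {0..\<epsilon>} \<Longrightarrow> along G \<delta> r \<in> \<Gamma>"
    and R: "\<And>r. r \<in> {0..\<epsilon>} \<Longrightarrow> Red \<Gamma> G D (along G \<delta> r) = image_mset (chip_pos G r) C"
    using Red_chips[OF ls v \<delta>] by blast
  have R0: "Red \<Gamma> G D v = image_mset (chip_pos G 0) C" using R[of 0] \<epsilon> along_0[OF \<delta>] by simp
  then have N: "size C = ?N" using Red_in_sym_product[OF ls D v] by (simp add: sym_product_def)
  obtain L where L: "mset L = C" using ex_mset by blast
  then have len: "length L = ?N" using N by (metis size_mset)
  define x where "x r = (\<lambda>i\<in>{..<?N}. chip_pos G r (L ! i))" for r
  have tuple: "unordered_tuple ?N (x r) = image_mset (chip_pos G r) C" for r
  proof -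
    have "unordered_tuple ?N (x r) = image_mset (\<lambda>i. chip_pos G r (L ! i)) (mset_set {..<length L})"
      unfolding unordered_tuple_def len x_def by (intro image_mset_cong) auto
    then show ?thesis unfolding image_mset_nth L .
  qed
  have ok: "chip_ok G \<epsilon> (L ! i)" if "i < ?N" for i
    using C[of "L ! i"] that len unfolding L[symmetric] by simp
  have pos_in: "chip_pos G r (L ! i) \<in> \<Gamma>" if "i < ?N" "r \<in> {0..\<epsilon>}" for i r
    using ok[OF that(1)] that(2) by (cases "L ! i") (auto simp: chip_ok_def chip_pos_def intro!: epar_in)
  have "continuous_map (top_of_set {0..\<epsilon>}) (product_topology (\<lambda>_. top_of_set \<Gamma>) {..<?N}) x"
    unfolding continuous_map_componentwise
  proof (intro conjI ballI)
    show "x ` topspace (top_of_set {0..\<epsilon>}) \<subseteq> extensional {..<?N}" by (auto simp: x_def)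
    fix i assume i: "i \<in> {..<?N}"
    obtain e a q where c: "L ! i = (e, a, q)" by (cases "L ! i")
    have e: "e \<in> edges G" "\<And>r. r \<in> {0..\<epsilon>} \<Longrightarrow> a + q * r \<in> {0..elen G e}"
      using ok[of i] i c by (auto simp: chip_ok_def)
    have "continuous_on {0..\<epsilon>} (epar G e \<circ> (\<lambda>r. a + q * r))"
      using e by (intro continuous_on_compose continuous_intros continuous_on_subset[OF continuous_epar]) auto
    then have "continuous_on {0..\<epsilon>} (\<lambda>r. x r i)"
      using i by (simp add: x_def c chip_pos_def comp_def)
    moreover have "(\<lambda>r. x r i) \<in> {0..\<epsilon>} \<rightarrow> \<Gamma>" using i pos_in by (auto simp: x_def)
    ultimately show "continuous_map (top_of_set {0..\<epsilon>}) (top_of_set \<Gamma>) (\<lambda>r. x r i)"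
      by (simp add: continuous_map_subtopology_eu)
  qed
  moreover have "openin (product_topology (\<lambda>_. top_of_set \<Gamma>) {..<?N}) {y \<in> {..<?N} \<rightarrow>\<^sub>E \<Gamma>. unordered_tuple ?N y \<in> U}"
    using U(1) unfolding openin_sym_product_topology by blast
  ultimately have "openin (top_of_set {0..\<epsilon>}) {r \<in> topspace (top_of_set {0..\<epsilon>}). x r \<in> {y \<in> {..<?N} \<rightarrow>\<^sub>E \<Gamma>. unordered_tuple ?N y \<in> U}}"
    by (rule openin_continuous_map_preimage)
  moreover have "0 \<in> {r \<in> topspace (top_of_set {0..\<epsilon>}). x r \<in> {y \<in> {..<?N} \<rightarrow>\<^sub>E \<Gamma>. unordered_tuple ?N y \<in> U}}"
    using \<epsilon> U(2) pos_in unfolding tuple[of 0] R0 by (auto simp: x_def tuple[of 0, unfolded x_def])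
  ultimately obtain \<rho> where \<rho>: "0 < \<rho>"
    "ball 0 \<rho> \<inter> {0..\<epsilon>} \<subseteq> {r \<in> topspace (top_of_set {0..\<epsilon>}). x r \<in> {y \<in> {..<?N} \<rightarrow>\<^sub>E \<Gamma>. unordered_tuple ?N y \<in> U}}"
    unfolding openin_contains_ball by blast
  show ?thesis
  proof (intro exI[of _ "min \<rho> \<epsilon>"] conjI ballI)
    show "0 < min \<rho> \<epsilon>" using \<rho> \<epsilon> by simp
    fix r assume r: "r \<in> {0..<min \<rho> \<epsilon>}"
    then have "r \<in> ball 0 \<rho> \<inter> {0..\<epsilon>}" by (auto simp: dist_real_def)
    then have "unordered_tuple ?N (x r) \<in> U" using \<rho>(2) by blast
    then show "Red \<Gamma> G D (along G \<delta> r) \<in> U" using R[of r] r unfolding tuple by simp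
  qed
qed

text \<open>A small ball around \<open>v\<close> consists of initial segments along the finitely
  many directions at \<open>v\<close>, so the least of their radii works.\<close>

lemma continuous_Red:
  assumes ls: "linear_system \<Gamma> G D \<noteq> {}" and D: "divisor \<Gamma> D"
  shows "continuous_map (top_of_set \<Gamma>) (sym_product_topology \<Gamma> (nat (div_degree D))) (Red \<Gamma> G D)"
  unfolding continuous_map_def
proof (intro conjI allI impI)
  let ?N = "nat (div_degree D)"
  show "Red \<Gamma> G D \<in> topspace (top_of_set \<Gamma>) \<rightarrow> topspace (sym_product_topology \<Gamma> ?N)"
    using Red_in_sym_product[OF ls D] by (simp add: topspace_sym_product)
  fix U assume U: "openin (sym_product_topology \<Gamma> ?N) U"
  show "openin (top_of_set \<Gamma>) {x \<in> topspace (top_of_set \<Gamma>). Red \<Gamma> G D x \<in> U}"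
    unfolding openin_contains_ball
  proof (intro conjI ballI)
    show "{x \<in> topspace (top_of_set \<Gamma>). Red \<Gamma> G D x \<in> U} \<subseteq> \<Gamma>" by auto
    fix v assume "v \<in> {x \<in> topspace (top_of_set \<Gamma>). Red \<Gamma> G D x \<in> U}"
    then have v: "v \<in> \<Gamma>" "Red \<Gamma> G D v \<in> U" by auto
    obtain \<epsilon>0 where \<epsilon>0: "0 < \<epsilon>0"
      and near: "\<And>y. y \<in> \<Gamma> \<Longrightarrow> dist v y < \<epsilon>0 \<Longrightarrow> y \<noteq> v \<Longrightarrow> \<exists>\<delta>\<in>directions G v. y = along G \<delta> (dist v y)"
      using star[OF v(1)] by metis
    have "\<forall>\<delta>\<in>directions G v. \<exists>\<epsilon>>0. \<forall>r\<in>{0..<\<epsilon>}. Red \<Gamma> G D (along G \<delta> r) \<in> U"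
      using Red_near[OF ls D v(1) _ U v(2)] by blast
    then obtain \<rho> where \<rho>: "\<And>\<delta>. \<delta> \<in> directions G v \<Longrightarrow> 0 < \<rho> \<delta>"
      "\<And>\<delta> r. \<delta> \<in> directions G v \<Longrightarrow> r \<in> {0..<\<rho> \<delta>} \<Longrightarrow> Red \<Gamma> G D (along G \<delta> r) \<in> U" by metis
    define \<epsilon> where "\<epsilon> = Min (insert \<epsilon>0 (\<rho> ` directions G v))"
    have fin: "finite (insert \<epsilon>0 (\<rho> ` directions G v))" using finite_directions by simp
    have \<epsilon>: "0 < \<epsilon>" "\<epsilon> \<le> \<epsilon>0" "\<And>\<delta>. \<delta> \<in> directions G v \<Longrightarrow> \<epsilon> \<le> \<rho> \<delta>"
      unfolding \<epsilon>_def using fin \<epsilon>0 \<rho>(1) by (auto simp: Min_gr_iff)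
    have "Red \<Gamma> G D y \<in> U" if y: "y \<in> \<Gamma>" "dist v y < \<epsilon>" for y
    proof (cases "y = v")
      case False
      then obtain \<delta> where \<delta>: "\<delta> \<in> directions G v" "y = along G \<delta> (dist v y)" using near[of y] y \<epsilon>(2) by auto
      have "dist v y \<in> {0..<\<rho> \<delta>}" using \<epsilon>(3)[OF \<delta>(1)] y(2) by simp
      then have "Red \<Gamma> G D (along G \<delta> (dist v y)) \<in> U" by (rule \<rho>(2)[OF \<delta>(1)])
      then show ?thesis using \<delta>(2) by metis
    qed (use v in simp)
    then have "ball v \<epsilon> \<inter> \<Gamma> \<subseteq> {x \<in> topspace (top_of_set \<Gamma>). Red \<Gamma> G D x \<in> U}" by auto
    then show "\<exists>\<epsilon>>0. ball v \<epsilon> \<inter> \<Gamma> \<subseteq> {x \<in> topspace (top_of_set \<Gamma>). Red \<Gamma> G D x \<in> U}" using \<epsilon>(1) by blast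
  qed
qed

end

text \<open>If the linear system were empty, the zero divisor would already realise the minimum and
  the rank would be -1.\<close>

lemma linear_system_nonempty:
  assumes "0 \<le> div_rank \<Gamma> G D"
  shows "linear_system \<Gamma> G D \<noteq> {}"
proof
  assume e: "linear_system \<Gamma> G D = {}"
  have "(LEAST n. \<exists>E. divisor \<Gamma> E \<and> effective E \<and> div_degree E = int n \<and> linear_system \<Gamma> G (D - E) = {}) = 0"
    using e by (intro Least_eq_0 exI[of _ 0]) (simp add: divisor_def effective_def div_degree_def)
  then show False using assms by (simp add: div_rank_def)
qed

theorem theorem3:
  fixes \<Gamma> :: "'p::metric_space set"
    and G :: "('p, 'e) graph_model"
    and M :: "('p, 'f) graph_model"
    and D :: "'p \<Rightarrow>\<^sub>0 int"
  assumes "model_of \<Gamma> G"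
    and "model_of \<Gamma> M" and "simple_model M"
    and "divisor \<Gamma> D" and "div_rank \<Gamma> G D \<ge> 0"
  shows "reduced_divisor \<Gamma> G D \<in> \<Gamma> \<rightarrow> linear_system \<Gamma> G D
    \<and> integral_affine \<Gamma> M (nat (div_degree D)) (Red \<Gamma> G D)
    \<and> continuous_map (top_of_set \<Gamma>) (sym_product_topology \<Gamma> (nat (div_degree D))) (Red \<Gamma> G D)"
proof -
  interpret G: tropical_curve \<Gamma> G using assms(1) by unfold_locales
  interpret M: tropical_curve \<Gamma> M using assms(2) by unfold_locales
  \<comment> \<open>Reducedness refers to the metric only, so once linear equivalence is the same
    for both models, so are the reduced divisors, and the results for \<open>M\<close>
    apply.\<close>
  have eq: "lin_equiv \<Gamma> G = lin_equiv \<Gamma> M" using assms(1,2) by (rule lin_equiv_model)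
  have ls: "linear_system \<Gamma> G D \<noteq> {}" using assms(5) by (rule linear_system_nonempty)
  have lsM: "linear_system \<Gamma> M D \<noteq> {}" using ls by (simp add: linear_system_def eq)
  have Red: "Red \<Gamma> G D = Red \<Gamma> M D" by (intro ext) (simp add: Red_def reduced_divisor_def eq)
  show ?thesis unfolding Red
    using G.reduced_divisor_props(2)[OF ls] M.integral_affine_Red[OF lsM assms(4)] M.continuous_Red[OF lsM assms(4)]
    by blast
qed

end
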